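(* Let $k$ be a finite field and let $(\mathscr C,\mathbb E,\mathfrak s)$ be an extriangulated category, where $\mathscr C$ is an essentially small Krull–Schmidt additive $k$-linear category and $\mathbb E$ is $k$-bilinear, such that for all $X,Y\in\mathscr C$ one has $\dim_k\mathbb E^i(X,Y)<\infty$ for every $i\ge 0$ and $\sum_{i\ge 0}\dim_k\mathbb E^i(X,Y)<\infty$. Let $\mathcal H(\mathscr C)$ be the $\mathbb Q$-vector space with basis $\{u_{[X]}\mid X\in\mathscr C\}$ indexed by the isomorphism classes of objects of $\mathscr C$, with the bilinear multiplication $$u_{[X]}\ast u_{[Y]}=\sum_{[L]}F_{XY}^L\,u_{[L]},\qquad F_{XY}^L:=\frac{|{}_X(L,Y)|}{|\mathrm{Aut}\,Y|}\frac{[L,Y]}{[Y,Y]}=\frac{|(X,L)_Y|}{|\mathrm{Aut}\,X|}\frac{[X,L]}{[X,X]}$$ (the two expressions for $F_{XY}^L$ agree). Then $\mathcal H(\mathscr C)$ is an associative algebra.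
   Context: An extriangulated category (Nakaoka–Palu) is a triple $(\mathscr C,\mathbb E,\mathfrak s)$ as follows. (ET1) $\mathscr C$ is additive and $\mathbb E:\mathscr C^{op}\times\mathscr C\to Ab$ is a biadditive functor; elements $\delta\in\mathbb E(C,A)$ are called extensions; for $a:A\to A'$, $c:C'\to C$ put $a_*\delta=\mathbb E(C,a)(\delta)$, $c^*\delta=\mathbb E(c,A)(\delta)$; a morphism from $\delta\in\mathbb E(C,A)$ to $\delta'\in\mathbb E(C',A')$ is a pair $(a:A\to A',c:C\to C')$ with $a_*\delta=c^*\delta'$. (ET2) $\mathfrak s$ assigns to each $\delta\in\mathbb E(C,A)$ an equivalence class $[A\to B\to C]$ of sequences (two sequences $A\to B\to C$ and $A\to B'\to C$ are equivalent if there is an isomorphism $B\cong B'$ compatible with the identities of $A$ and $C$), such that every morphism $(a,c):\delta\to\delta'$ is realized by some $(a,b,c)$ making both squares between representing sequences commute, $\mathfrak s(0)$ is the class of the split sequence $A\to A\oplus C\to C$, and $\mathfrak s(\delta\oplus\delta')=\mathfrak s(\delta)\oplus\mathfrak s(\delta')$. (ET3) If $\mathfrak s(\delta)=[A\xrightarrow{x}B\xrightarrow{y}C]$, $\mathfrak s(\delta')=[A'\xrightarrow{x'}B'\xrightarrow{y'}C']$ and $bx=x'a$, there is $c$ with $cy=y'b$ and $a_*\delta=c^*\delta'$. (ET4) If $\delta\in\mathbb E(D,A)$, $\delta'\in\mathbb E(F,B)$ are realized by $A\xrightarrow{f}B\xrightarrow{f'}D$ and $B\xrightarrow{g}C\xrightarrow{g'}F$,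 there are an object $E$, an extension $\delta''\in\mathbb E(E,A)$ realized by $A\xrightarrow{h}C\xrightarrow{h'}E$ with $h=gf$, and a sequence $D\xrightarrow{d}E\xrightarrow{e}F$ realizing $f'_*\delta'$, with $h'g=df'$, $eh'=g'$, $d^*\delta''=\delta$, $f_*\delta''=e^*\delta'$. The duals of (ET3) and (ET4) also hold. If $\mathfrak s(\delta)=[A\xrightarrow{x}B\xrightarrow{y}C]$, then $A\xrightarrow{x}B\xrightarrow{y}C\overset{\delta}{\dashrightarrow}$ is called an $\mathbb E$-triangle, $x$ an inflation, $y$ a deflation, $C=\mathrm{cone}(x)$ and $A=\mathrm{cocone}(y)$ (well defined up to isomorphism). Higher extensions: $\mathbb E^0=\mathrm{Hom}$, $\mathbb E^1=\mathbb E$, and $\mathbb E^n(C,A)=\int^{M\in\mathscr C}\mathbb E^{n-1}(M,A)\otimes_k\mathbb E(C,M)$ for $n\ge2$ (Yoneda-type coend). Notation: $(X,L)_Y$ is the set of inflations $f:X\to L$ with $\mathrm{cone}(f)\cong Y$; ${}_X(L,Y)$ is the set of deflations $g:L\to Y$ with $\mathrm{cocone}(g)\cong X$. Further $\{X,Y\}':=\prod_{i>0}|\mathbb E^i(X,Y)|^{(-1)^i}$ and $[X,Y]:=\dfrac{1}{\{X,Y\}'\,|\mathrm{Hom}(X,Y)|}$. $[X]$ (single argument) denotes the isomorphism class of $X$. *)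

theory Defs
  imports Complex_Main "HOL-Algebra.Module" "Jordan_Normal_Form.Missing_VectorSpace"
begin

section \<open>Linear categories\<close>

text \<open>
  Morphism spaces are \<open>K\<close>-modules in the sense of \<open>HOL-Algebra\<close>; only their additive structure
  and scalar multiplication are used, the ring multiplication and unit carried by the record type
  \<open>module\<close> are ignored. \<open>g \<cdot> f\<close> is ``first \<open>f\<close>, then \<open>g\<close>''. The operations on morphisms take no
  object arguments; this is no restriction, since morphisms may be tagged with source and target
  (likewise for the actions \<open>push\<close> and \<open>pull\<close> on extensions below). The objects form a set \<open>Ob\<close>;
  essential smallness needs no separate hypothesis, as an essentially small category is equivalent
  to one of this form.
\<close>

record ('k, 'o, 'm) lin_cat =
  Ob :: "'o set"
  Hom :: "'o \<Rightarrow> 'o \<Rightarrow> ('k, 'm) module"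
  Id :: "'o \<Rightarrow> 'm"
  cmp :: "'m \<Rightarrow> 'm \<Rightarrow> 'm" (infixl \<open>\<cdot>\<index>\<close> 75)

abbreviation Homset :: "('k, 'o, 'm, 'z) lin_cat_scheme \<Rightarrow> 'o \<Rightarrow> 'o \<Rightarrow> 'm set"
  where "Homset \<C> X Y \<equiv> carrier (Hom \<C> X Y)"

locale linear_category = field K
  for K :: "'k ring" and \<C> :: "('k, 'o, 'm, 'z) lin_cat_scheme" (structure) +
  assumes Hom_vectorspace:
      "\<lbrakk>X \<in> Ob \<C>; Y \<in> Ob \<C>\<rbrakk> \<Longrightarrow> vectorspace K (Hom \<C> X Y)"
    and Id_closed: "X \<in> Ob \<C> \<Longrightarrow> Id \<C> X \<in> Homset \<C> X X"
    and Id_right: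
      "\<lbrakk>X \<in> Ob \<C>; Y \<in> Ob \<C>; f \<in> Homset \<C> X Y\<rbrakk> \<Longrightarrow> f \<cdot> Id \<C> X = f"
    and Id_left:
      "\<lbrakk>X \<in> Ob \<C>; Y \<in> Ob \<C>; f \<in> Homset \<C> X Y\<rbrakk> \<Longrightarrow> Id \<C> Y \<cdot> f = f"
    and cmp_assoc:
      "\<lbrakk>W \<in> Ob \<C>; X \<in> Ob \<C>; Y \<in> Ob \<C>; Z \<in> Ob \<C>;
        f \<in> Homset \<C> W X; g \<in> Homset \<C> X Y; h \<in> Homset \<C> Y Z\<rbrakk>
       \<Longrightarrow> h \<cdot> (g \<cdot> f) = (h \<cdot> g) \<cdot> f"
    and cmp_linear_right:
      "\<lbrakk>X \<in> Ob \<C>; Y \<in> Ob \<C>; Z \<in> Ob \<C>; g \<in> Homset \<C> Y Z\<rbrakk>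
       \<Longrightarrow> linear_map K (Hom \<C> X Y) (Hom \<C> X Z) (\<lambda>f. g \<cdot> f)"
    and cmp_linear_left:
      "\<lbrakk>X \<in> Ob \<C>; Y \<in> Ob \<C>; Z \<in> Ob \<C>; f \<in> Homset \<C> X Y\<rbrakk>
       \<Longrightarrow> linear_map K (Hom \<C> Y Z) (Hom \<C> X Z) (\<lambda>g. g \<cdot> f)"

context
  fixes \<C> :: "('k, 'o, 'm, 'z) lin_cat_scheme" (structure)
begin

definition isos :: "'o \<Rightarrow> 'o \<Rightarrow> 'm set"
  where "isos X Y = {f \<in> Homset \<C> X Y. \<exists>g \<in> Homset \<C> Y X. g \<cdot> f = Id \<C> X \<and> f \<cdot> g = Id \<C> Y}"

definition isomorphic :: "'o \<Rightarrow> 'o \<Rightarrow> bool"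
  where "isomorphic X Y \<longleftrightarrow> X \<in> Ob \<C> \<and> Y \<in> Ob \<C> \<and> isos X Y \<noteq> {}"

definition Aut :: "'o \<Rightarrow> 'm set"
  where "Aut X = isos X X"

definition zero_object :: "'o \<Rightarrow> bool"
  where "zero_object Z \<longleftrightarrow> Z \<in> Ob \<C> \<and>
    (\<forall>X \<in> Ob \<C>. (\<exists>!f. f \<in> Homset \<C> Z X) \<and> (\<exists>!f. f \<in> Homset \<C> X Z))"

definition biproduct :: "'o \<Rightarrow> 'o \<Rightarrow> 'o \<Rightarrow> 'm \<Rightarrow> 'm \<Rightarrow> 'm \<Rightarrow> 'm \<Rightarrow> bool"
  where "biproduct A B P i j p q \<longleftrightarrow>
    A \<in> Ob \<C> \<and> B \<in> Ob \<C> \<and> P \<in> Ob \<C> \<and>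
    i \<in> Homset \<C> A P \<and> j \<in> Homset \<C> B P \<and> p \<in> Homset \<C> P A \<and> q \<in> Homset \<C> P B \<and>
    p \<cdot> i = Id \<C> A \<and> q \<cdot> j = Id \<C> B \<and>
    q \<cdot> i = \<zero>\<^bsub>Hom \<C> A B\<^esub> \<and> p \<cdot> j = \<zero>\<^bsub>Hom \<C> B A\<^esub> \<and>
    (i \<cdot> p) \<oplus>\<^bsub>Hom \<C> P P\<^esub> (j \<cdot> q) = Id \<C> P"

text \<open>An object has local endomorphism ring if that ring is nonzero and the sum of two
  non-units is a non-unit.\<close>

definition local_object :: "'o \<Rightarrow> bool"
  where "local_object X \<longleftrightarrow> X \<in> Ob \<C> \<and> Id \<C> X \<noteq> \<zero>\<^bsub>Hom \<C> X X\<^esub> \<and>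
    (\<forall>f \<in> Homset \<C> X X. \<forall>g \<in> Homset \<C> X X.
      f \<notin> Aut X \<and> g \<notin> Aut X \<longrightarrow> f \<oplus>\<^bsub>Hom \<C> X X\<^esub> g \<notin> Aut X)"

definition finite_direct_sum :: "'o \<Rightarrow> nat \<Rightarrow> (nat \<Rightarrow> 'o) \<Rightarrow> bool"
  where "finite_direct_sum X n S \<longleftrightarrow> X \<in> Ob \<C> \<and> (\<forall>r<n. S r \<in> Ob \<C>) \<and>
    (\<exists>i p. (\<forall>r<n. i r \<in> Homset \<C> (S r) X \<and> p r \<in> Homset \<C> X (S r)) \<and>
      (\<forall>r<n. \<forall>t<n. p t \<cdot> i r = (if r = t then Id \<C> (S r) else \<zero>\<^bsub>Hom \<C> (S r) (S t)\<^esub>)) \<and>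
      (\<Oplus>\<^bsub>Hom \<C> X X\<^esub>r\<in>{..<n}. i r \<cdot> p r) = Id \<C> X)"

definition krull_schmidt :: bool
  where "krull_schmidt \<longleftrightarrow>
    (\<forall>X \<in> Ob \<C>. \<exists>n S. (\<forall>r<n. local_object (S r)) \<and> finite_direct_sum X n S)"

text \<open>Sequences \<open>A \<rightarrow> B \<rightarrow> C\<close> as triples \<open>(x, B, y)\<close>, and their equivalence.\<close>

definition sequences :: "'o \<Rightarrow> 'o \<Rightarrow> ('m \<times> 'o \<times> 'm) set"
  where "sequences C A = {(x, B, y). B \<in> Ob \<C> \<and> x \<in> Homset \<C> A B \<and> y \<in> Homset \<C> B C}"

definition seq_equiv :: "'o \<Rightarrow> 'o \<Rightarrow> (('m \<times> 'o \<times> 'm) \<times> ('m \<times> 'o \<times> 'm)) set"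
  where "seq_equiv C A = {((x, B, y), (x', B', y')).
    (x, B, y) \<in> sequences C A \<and> (x', B', y') \<in> sequences C A \<and>
    (\<exists>b \<in> isos B B'. b \<cdot> x = x' \<and> y' \<cdot> b = y)}"

end

locale additive_category = linear_category +
  assumes zero_object_exists: "\<exists>Z. zero_object \<C> Z"
    and biproduct_exists:
      "\<lbrakk>A \<in> Ob \<C>; B \<in> Ob \<C>\<rbrakk> \<Longrightarrow> \<exists>P i j p q. biproduct \<C> A B P i j p q"


section \<open>Extriangulated categories\<close>

text \<open>
  \<open>Ext \<C> C A\<close> is the space of extensions \<open>\<E>(C,A)\<close>, \<open>push \<C> a \<delta>\<close> is \<open>a\<^sub>*\<delta>\<close>, \<open>pull \<C> c \<delta>\<close> is
  \<open>c\<^sup>*\<delta>\<close>, and \<open>realn \<C> C A \<delta>\<close> is the equivalence class of sequences assigned to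
  \<open>\<delta> \<in> \<E>(C,A)\<close>.
\<close>

record ('k, 'o, 'm, 'e) extri_cat = "('k, 'o, 'm) lin_cat" +
  Ext :: "'o \<Rightarrow> 'o \<Rightarrow> ('k, 'e) module"
  push :: "'m \<Rightarrow> 'e \<Rightarrow> 'e"
  pull :: "'m \<Rightarrow> 'e \<Rightarrow> 'e"
  realn :: "'o \<Rightarrow> 'o \<Rightarrow> 'e \<Rightarrow> ('m \<times> 'o \<times> 'm) set"

abbreviation Extset :: "('k, 'o, 'm, 'e, 'z) extri_cat_scheme \<Rightarrow> 'o \<Rightarrow> 'o \<Rightarrow> 'e set"
  where "Extset \<C> C A \<equiv> carrier (Ext \<C> C A)"

text \<open>\<open>triangle \<C> A x B y C \<delta>\<close>: \<open>A \<rightarrow> B \<rightarrow> C\<close> together with \<open>\<delta>\<close> is an \<open>\<E>\<close>-triangle.\<close>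

definition triangle ::
    "('k, 'o, 'm, 'e, 'z) extri_cat_scheme \<Rightarrow> 'o \<Rightarrow> 'm \<Rightarrow> 'o \<Rightarrow> 'm \<Rightarrow> 'o \<Rightarrow> 'e \<Rightarrow> bool"
  where "triangle \<C> A x B y C \<delta> \<longleftrightarrow> A \<in> Ob \<C> \<and> B \<in> Ob \<C> \<and> C \<in> Ob \<C> \<and>
    \<delta> \<in> Extset \<C> C A \<and> (x, B, y) \<in> realn \<C> C A \<delta>"

locale extriangulated = additive_category K \<C>
  for K :: "'k ring" and \<C> :: "('k, 'o, 'm, 'e) extri_cat" (structure) +
    \<comment> \<open>(ET1): \<open>\<E>\<close> is a \<open>K\<close>-bilinear bifunctor\<close>
  assumes Ext_vectorspace:
      "\<lbrakk>C \<in> Ob \<C>; A \<in> Ob \<C>\<rbrakk> \<Longrightarrow> vectorspace K (Ext \<C> C A)"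
    and push_linear:
      "\<lbrakk>C \<in> Ob \<C>; A \<in> Ob \<C>; A' \<in> Ob \<C>; a \<in> Homset \<C> A A'\<rbrakk>
       \<Longrightarrow> linear_map K (Ext \<C> C A) (Ext \<C> C A') (\<lambda>\<delta>. push \<C> a \<delta>)"
    and push_linear_mor:
      "\<lbrakk>C \<in> Ob \<C>; A \<in> Ob \<C>; A' \<in> Ob \<C>; \<delta> \<in> Extset \<C> C A\<rbrakk>
       \<Longrightarrow> linear_map K (Hom \<C> A A') (Ext \<C> C A') (\<lambda>a. push \<C> a \<delta>)"
    and push_Id:
      "\<lbrakk>C \<in> Ob \<C>; A \<in> Ob \<C>; \<delta> \<in> Extset \<C> C A\<rbrakk> \<Longrightarrow> push \<C> (Id \<C> A) \<delta> = \<delta>"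
    and push_cmp:
      "\<lbrakk>C \<in> Ob \<C>; A \<in> Ob \<C>; A' \<in> Ob \<C>; A'' \<in> Ob \<C>;
        a \<in> Homset \<C> A A'; a' \<in> Homset \<C> A' A''; \<delta> \<in> Extset \<C> C A\<rbrakk>
       \<Longrightarrow> push \<C> (a' \<cdot> a) \<delta> = push \<C> a' (push \<C> a \<delta>)"
    and pull_linear:
      "\<lbrakk>C \<in> Ob \<C>; C' \<in> Ob \<C>; A \<in> Ob \<C>; c \<in> Homset \<C> C' C\<rbrakk>
       \<Longrightarrow> linear_map K (Ext \<C> C A) (Ext \<C> C' A) (\<lambda>\<delta>. pull \<C> c \<delta>)"
    and pull_linear_mor:
      "\<lbrakk>C \<in> Ob \<C>; C' \<in> Ob \<C>; A \<in> Ob \<C>; \<delta> \<in> Extset \<C> C A\<rbrakk>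
       \<Longrightarrow> linear_map K (Hom \<C> C' C) (Ext \<C> C' A) (\<lambda>c. pull \<C> c \<delta>)"
    and pull_Id:
      "\<lbrakk>C \<in> Ob \<C>; A \<in> Ob \<C>; \<delta> \<in> Extset \<C> C A\<rbrakk> \<Longrightarrow> pull \<C> (Id \<C> C) \<delta> = \<delta>"
    and pull_cmp:
      "\<lbrakk>C \<in> Ob \<C>; C' \<in> Ob \<C>; C'' \<in> Ob \<C>; A \<in> Ob \<C>;
        c \<in> Homset \<C> C' C; c' \<in> Homset \<C> C'' C'; \<delta> \<in> Extset \<C> C A\<rbrakk>
       \<Longrightarrow> pull \<C> (c \<cdot> c') \<delta> = pull \<C> c' (pull \<C> c \<delta>)"
    and push_pull:
      "\<lbrakk>C \<in> Ob \<C>; C' \<in> Ob \<C>; A \<in> Ob \<C>; A' \<in> Ob \<C>;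
        a \<in> Homset \<C> A A'; c \<in> Homset \<C> C' C; \<delta> \<in> Extset \<C> C A\<rbrakk>
       \<Longrightarrow> push \<C> a (pull \<C> c \<delta>) = pull \<C> c (push \<C> a \<delta>)"
    \<comment> \<open>(ET2): \<open>\<s>\<close> is an additive realization\<close>
    and realn_class:
      "\<lbrakk>C \<in> Ob \<C>; A \<in> Ob \<C>; \<delta> \<in> Extset \<C> C A\<rbrakk>
       \<Longrightarrow> realn \<C> C A \<delta> \<in> sequences \<C> C A // seq_equiv \<C> C A"
    and realn_morphism:
      "\<lbrakk>triangle \<C> A x B y C \<delta>; triangle \<C> A' x' B' y' C' \<delta>';
        a \<in> Homset \<C> A A'; c \<in> Homset \<C> C C'; push \<C> a \<delta> = pull \<C> c \<delta>'\<rbrakk>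
       \<Longrightarrow> \<exists>b \<in> Homset \<C> B B'. b \<cdot> x = x' \<cdot> a \<and> y' \<cdot> b = c \<cdot> y"
    and realn_zero:
      "biproduct \<C> A C P i j p q \<Longrightarrow> (i, P, q) \<in> realn \<C> C A \<zero>\<^bsub>Ext \<C> C A\<^esub>"
    and realn_sum:
      "\<lbrakk>triangle \<C> A x B y C \<delta>; triangle \<C> A' x' B' y' C' \<delta>';
        biproduct \<C> A A' A\<^sub>s iA jA pA qA; biproduct \<C> B B' B\<^sub>s iB jB pB qB;
        biproduct \<C> C C' C\<^sub>s iC jC pC qC\<rbrakk>
       \<Longrightarrow> ((iB \<cdot> x \<cdot> pA) \<oplus>\<^bsub>Hom \<C> A\<^sub>s B\<^sub>s\<^esub> (jB \<cdot> x' \<cdot> qA), B\<^sub>s,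
            (iC \<cdot> y \<cdot> pB) \<oplus>\<^bsub>Hom \<C> B\<^sub>s C\<^sub>s\<^esub> (jC \<cdot> y' \<cdot> qB))
           \<in> realn \<C> C\<^sub>s A\<^sub>s
               (push \<C> iA (pull \<C> pC \<delta>) \<oplus>\<^bsub>Ext \<C> C\<^sub>s A\<^sub>s\<^esub> push \<C> jA (pull \<C> qC \<delta>'))"
    \<comment> \<open>(ET3) and its dual\<close>
    and ET3:
      "\<lbrakk>triangle \<C> A x B y C \<delta>; triangle \<C> A' x' B' y' C' \<delta>';
        a \<in> Homset \<C> A A'; b \<in> Homset \<C> B B'; b \<cdot> x = x' \<cdot> a\<rbrakk>
       \<Longrightarrow> \<exists>c \<in> Homset \<C> C C'. c \<cdot> y = y' \<cdot> b \<and> push \<C> a \<delta> = pull \<C> c \<delta>'"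
    and ET3_op:
      "\<lbrakk>triangle \<C> A x B y C \<delta>; triangle \<C> A' x' B' y' C' \<delta>';
        b \<in> Homset \<C> B B'; c \<in> Homset \<C> C C'; c \<cdot> y = y' \<cdot> b\<rbrakk>
       \<Longrightarrow> \<exists>a \<in> Homset \<C> A A'. b \<cdot> x = x' \<cdot> a \<and> push \<C> a \<delta> = pull \<C> c \<delta>'"
    \<comment> \<open>(ET4) and its dual\<close>
    and ET4:
      "\<lbrakk>triangle \<C> A f B f' D \<delta>; triangle \<C> B g C g' F \<delta>'\<rbrakk>
       \<Longrightarrow> \<exists>E h h' d e \<delta>''.
         triangle \<C> A h C h' E \<delta>'' \<and> h = g \<cdot> f \<and>
         triangle \<C> D d E e F (push \<C> f' \<delta>') \<and>
         h' \<cdot> g = d \<cdot> f' \<and> e \<cdot> h' = g' \<and>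
         pull \<C> d \<delta>'' = \<delta> \<and> push \<C> f \<delta>'' = pull \<C> e \<delta>'"
    and ET4_op:
      "\<lbrakk>triangle \<C> D f' B f A \<delta>; triangle \<C> F g' C g B \<delta>'\<rbrakk>
       \<Longrightarrow> \<exists>E h h' d e \<delta>''.
         triangle \<C> E h' C h A \<delta>'' \<and> h = f \<cdot> g \<and>
         triangle \<C> F e E d D (pull \<C> f' \<delta>') \<and>
         g \<cdot> h' = f' \<cdot> d \<and> h' \<cdot> e = g' \<and>
         push \<C> d \<delta>'' = \<delta> \<and> pull \<C> f \<delta>'' = push \<C> e \<delta>'"


section \<open>Higher extensions\<close>

text \<open>
  For \<open>n \<ge> 2\<close>, \<open>\<E>\<^sup>n(C,A)\<close> is the coend \<open>\<integral>\<^sup>M \<E>\<^sup>n\<^sup>-\<^sup>1(M,A) \<otimes> \<E>(C,M)\<close>, that is, the quotient of the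
  direct sum of all \<open>\<E>\<^sup>n\<^sup>-\<^sup>1(M,A) \<otimes> \<E>(C,M)\<close> by the relations \<open>f\<^sup>*t \<otimes> \<epsilon> = t \<otimes> f\<^sub>*\<epsilon>\<close> for \<open>f : M \<rightarrow> N\<close>.
  To have one type for all \<open>n\<close>, its elements are presented as classes of formal linear
  combinations of tensors: \<open>Tensor M t \<epsilon>\<close> is \<open>t \<otimes> \<epsilon>\<close> in the summand of \<open>M\<close>, where \<open>t\<close> is itself
  such a combination representing an element of \<open>\<E>\<^sup>n\<^sup>-\<^sup>1(M,A)\<close>. At level 1 the terms represent
  elements of \<open>\<E>(C,A)\<close>. The congruence \<open>yeq\<close> is generated by the vector space axioms, linearity of
  the embedding \<open>Emb\<close> of \<open>\<E>(C,A)\<close> in level 1, bilinearity of the tensor, and the coend relation.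
\<close>

datatype ('k, 'o, 'e) yterm =
    Emb 'e
  | Zero
  | Plus "('k, 'o, 'e) yterm" "('k, 'o, 'e) yterm"
  | Scale 'k "('k, 'o, 'e) yterm"
  | Tensor 'o "('k, 'o, 'e) yterm" 'e

text \<open>The contravariant action on \<open>\<E>\<^sup>n(-,A)\<close>.\<close>

primrec ypull ::
    "('k, 'o, 'm, 'e, 'z) extri_cat_scheme \<Rightarrow> 'm \<Rightarrow> ('k, 'o, 'e) yterm \<Rightarrow> ('k, 'o, 'e) yterm"
  where
    "ypull \<C> c (Emb \<epsilon>) = Emb (pull \<C> c \<epsilon>)"
  | "ypull \<C> c Zero = Zero"
  | "ypull \<C> c (Plus s t) = Plus (ypull \<C> c s) (ypull \<C> c t)"
  | "ypull \<C> c (Scale k t) = Scale k (ypull \<C> c t)"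
  | "ypull \<C> c (Tensor M t \<epsilon>) = Tensor M t (pull \<C> c \<epsilon>)"

context
  fixes K :: "'k ring" and \<C> :: "('k, 'o, 'm, 'e) extri_cat"
begin

inductive ywf :: "nat \<Rightarrow> 'o \<Rightarrow> 'o \<Rightarrow> ('k, 'o, 'e) yterm \<Rightarrow> bool"
  where
    ywf_Emb: "\<lbrakk>C \<in> Ob \<C>; A \<in> Ob \<C>; \<epsilon> \<in> Extset \<C> C A\<rbrakk> \<Longrightarrow> ywf 1 C A (Emb \<epsilon>)"
  | ywf_Zero: "\<lbrakk>n \<ge> 1; C \<in> Ob \<C>; A \<in> Ob \<C>\<rbrakk> \<Longrightarrow> ywf n C A Zero"
  | ywf_Plus: "\<lbrakk>ywf n C A s; ywf n C A t\<rbrakk> \<Longrightarrow> ywf n C A (Plus s t)"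
  | ywf_Scale: "\<lbrakk>k \<in> carrier K; ywf n C A t\<rbrakk> \<Longrightarrow> ywf n C A (Scale k t)"
  | ywf_Tensor:
      "\<lbrakk>C \<in> Ob \<C>; M \<in> Ob \<C>; ywf n M A t; \<epsilon> \<in> Extset \<C> C M\<rbrakk>
       \<Longrightarrow> ywf (Suc n) C A (Tensor M t \<epsilon>)"

inductive yeq ::
    "nat \<Rightarrow> 'o \<Rightarrow> 'o \<Rightarrow> ('k, 'o, 'e) yterm \<Rightarrow> ('k, 'o, 'e) yterm \<Rightarrow> bool"
  where
    yeq_refl: "ywf n C A t \<Longrightarrow> yeq n C A t t"
  | yeq_sym: "yeq n C A s t \<Longrightarrow> yeq n C A t s"
  | yeq_trans: "\<lbrakk>yeq n C A s t; yeq n C A t u\<rbrakk> \<Longrightarrow> yeq n C A s u"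
  | yeq_Plus: "\<lbrakk>yeq n C A s s'; yeq n C A t t'\<rbrakk> \<Longrightarrow> yeq n C A (Plus s t) (Plus s' t')"
  | yeq_Scale: "\<lbrakk>k \<in> carrier K; yeq n C A t t'\<rbrakk> \<Longrightarrow> yeq n C A (Scale k t) (Scale k t')"
  | yeq_Tensor:
      "\<lbrakk>C \<in> Ob \<C>; M \<in> Ob \<C>; yeq n M A t t'; \<epsilon> \<in> Extset \<C> C M\<rbrakk>
       \<Longrightarrow> yeq (Suc n) C A (Tensor M t \<epsilon>) (Tensor M t' \<epsilon>)"
  | yeq_assoc:
      "\<lbrakk>ywf n C A s; ywf n C A t; ywf n C A u\<rbrakk>
       \<Longrightarrow> yeq n C A (Plus (Plus s t) u) (Plus s (Plus t u))"
  | yeq_comm: "\<lbrakk>ywf n C A s; ywf n C A t\<rbrakk> \<Longrightarrow> yeq n C A (Plus s t) (Plus t s)"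
  | yeq_Zero: "ywf n C A t \<Longrightarrow> yeq n C A (Plus Zero t) t"
  | yeq_Scale_zero: "ywf n C A t \<Longrightarrow> yeq n C A (Scale \<zero>\<^bsub>K\<^esub> t) Zero"
  | yeq_Scale_one: "ywf n C A t \<Longrightarrow> yeq n C A (Scale \<one>\<^bsub>K\<^esub> t) t"
  | yeq_Scale_mult:
      "\<lbrakk>k \<in> carrier K; l \<in> carrier K; ywf n C A t\<rbrakk>
       \<Longrightarrow> yeq n C A (Scale (k \<otimes>\<^bsub>K\<^esub> l) t) (Scale k (Scale l t))"
  | yeq_Scale_add:
      "\<lbrakk>k \<in> carrier K; l \<in> carrier K; ywf n C A t\<rbrakk>
       \<Longrightarrow> yeq n C A (Scale (k \<oplus>\<^bsub>K\<^esub> l) t) (Plus (Scale k t) (Scale l t))"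
  | yeq_Scale_Plus:
      "\<lbrakk>k \<in> carrier K; ywf n C A s; ywf n C A t\<rbrakk>
       \<Longrightarrow> yeq n C A (Scale k (Plus s t)) (Plus (Scale k s) (Scale k t))"
  | yeq_Emb_add:
      "\<lbrakk>C \<in> Ob \<C>; A \<in> Ob \<C>; \<epsilon> \<in> Extset \<C> C A; \<epsilon>' \<in> Extset \<C> C A\<rbrakk>
       \<Longrightarrow> yeq 1 C A (Emb (\<epsilon> \<oplus>\<^bsub>Ext \<C> C A\<^esub> \<epsilon>')) (Plus (Emb \<epsilon>) (Emb \<epsilon>'))"
  | yeq_Emb_smult:
      "\<lbrakk>C \<in> Ob \<C>; A \<in> Ob \<C>; k \<in> carrier K; \<epsilon> \<in> Extset \<C> C A\<rbrakk>
       \<Longrightarrow> yeq 1 C A (Emb (k \<odot>\<^bsub>Ext \<C> C A\<^esub> \<epsilon>)) (Scale k (Emb \<epsilon>))"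
  | yeq_Tensor_add_left:
      "\<lbrakk>C \<in> Ob \<C>; M \<in> Ob \<C>; ywf n M A s; ywf n M A t; \<epsilon> \<in> Extset \<C> C M\<rbrakk>
       \<Longrightarrow> yeq (Suc n) C A (Tensor M (Plus s t) \<epsilon>) (Plus (Tensor M s \<epsilon>) (Tensor M t \<epsilon>))"
  | yeq_Tensor_smult_left:
      "\<lbrakk>C \<in> Ob \<C>; M \<in> Ob \<C>; k \<in> carrier K; ywf n M A t; \<epsilon> \<in> Extset \<C> C M\<rbrakk>
       \<Longrightarrow> yeq (Suc n) C A (Tensor M (Scale k t) \<epsilon>) (Scale k (Tensor M t \<epsilon>))"
  | yeq_Tensor_add_right:
      "\<lbrakk>C \<in> Ob \<C>; M \<in> Ob \<C>; ywf n M A t; \<epsilon> \<in> Extset \<C> C M; \<epsilon>' \<in> Extset \<C> C M\<rbrakk>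
       \<Longrightarrow> yeq (Suc n) C A (Tensor M t (\<epsilon> \<oplus>\<^bsub>Ext \<C> C M\<^esub> \<epsilon>'))
             (Plus (Tensor M t \<epsilon>) (Tensor M t \<epsilon>'))"
  | yeq_Tensor_smult_right:
      "\<lbrakk>C \<in> Ob \<C>; M \<in> Ob \<C>; k \<in> carrier K; ywf n M A t; \<epsilon> \<in> Extset \<C> C M\<rbrakk>
       \<Longrightarrow> yeq (Suc n) C A (Tensor M t (k \<odot>\<^bsub>Ext \<C> C M\<^esub> \<epsilon>)) (Scale k (Tensor M t \<epsilon>))"
  | yeq_coend:
      "\<lbrakk>C \<in> Ob \<C>; M \<in> Ob \<C>; N \<in> Ob \<C>; f \<in> Homset \<C> M N; ywf n N A t; \<epsilon> \<in> Extset \<C> C M\<rbrakk>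
       \<Longrightarrow> yeq (Suc n) C A (Tensor M (ypull \<C> f t) \<epsilon>) (Tensor N t (push \<C> f \<epsilon>))"

definition ycls :: "nat \<Rightarrow> 'o \<Rightarrow> 'o \<Rightarrow> ('k, 'o, 'e) yterm \<Rightarrow> ('k, 'o, 'e) yterm set"
  where "ycls n C A t = {s. yeq n C A t s}"

definition higher_Ext :: "nat \<Rightarrow> 'o \<Rightarrow> 'o \<Rightarrow> ('k, ('k, 'o, 'e) yterm set) module"
  where "higher_Ext n C A =
    \<lparr>carrier = ycls n C A ` {t. ywf n C A t},
     mult = undefined,
     one = undefined,
     zero = ycls n C A Zero,
     add = (\<lambda>a b. \<Union>s\<in>a. \<Union>t\<in>b. ycls n C A (Plus s t)),
     smult = (\<lambda>k a. \<Union>t\<in>a. ycls n C A (Scale k t))\<rparr>"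

text \<open>\<open>\<E>\<^sup>0 = Hom\<close> and \<open>\<E>\<^sup>1 = \<E>\<close> live on types different from that of \<open>\<E>\<^sup>n\<close> for \<open>n \<ge> 2\<close>, hence
  the case distinctions. \<open>vectorspace.dim\<close> is only meaningful in the finite-dimensional case.\<close>

fun ext_fin_dim :: "nat \<Rightarrow> 'o \<Rightarrow> 'o \<Rightarrow> bool"
  where
    "ext_fin_dim 0 X Y = vectorspace.fin_dim K (Hom \<C> X Y)"
  | "ext_fin_dim (Suc 0) X Y = vectorspace.fin_dim K (Ext \<C> X Y)"
  | "ext_fin_dim (Suc (Suc n)) X Y = vectorspace.fin_dim K (higher_Ext (Suc (Suc n)) X Y)"

fun ext_dim :: "nat \<Rightarrow> 'o \<Rightarrow> 'o \<Rightarrow> nat"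
  where
    "ext_dim 0 X Y = vectorspace.dim K (Hom \<C> X Y)"
  | "ext_dim (Suc 0) X Y = vectorspace.dim K (Ext \<C> X Y)"
  | "ext_dim (Suc (Suc n)) X Y = vectorspace.dim K (higher_Ext (Suc (Suc n)) X Y)"

fun ext_card :: "nat \<Rightarrow> 'o \<Rightarrow> 'o \<Rightarrow> nat"
  where
    "ext_card 0 X Y = card (Homset \<C> X Y)"
  | "ext_card (Suc 0) X Y = card (Extset \<C> X Y)"
  | "ext_card (Suc (Suc n)) X Y = card (carrier (higher_Ext (Suc (Suc n)) X Y))"

definition ext_finite :: bool
  where "ext_finite \<longleftrightarrow> (\<forall>X \<in> Ob \<C>. \<forall>Y \<in> Ob \<C>.
    (\<forall>i. ext_fin_dim i X Y) \<and> summable (\<lambda>i. real (ext_dim i X Y)))"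


section \<open>The Hall algebra\<close>

text \<open>\<open>curly X Y\<close> is \<open>{X,Y}'\<close>; the infinite product is taken over its factors different from 1,
  of which \<open>ext_finite\<close> leaves only finitely many. \<open>square X Y\<close> is \<open>[X,Y]\<close>.\<close>

definition curly :: "'o \<Rightarrow> 'o \<Rightarrow> rat"
  where "curly X Y =
    (\<Prod>i \<in> {i. i > 0 \<and> ext_card i X Y \<noteq> 1}. of_nat (ext_card i X Y) powi ((-1) ^ i))"

definition square :: "'o \<Rightarrow> 'o \<Rightarrow> rat"
  where "square X Y = 1 / (curly X Y * of_nat (card (Homset \<C> X Y)))"

text \<open>\<open>inflations X L Y\<close> is \<open>(X,L)\<^sub>Y\<close>, and \<open>deflations X L Y\<close> is \<open>\<^sub>X(L,Y)\<close>.\<close>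

definition inflations :: "'o \<Rightarrow> 'o \<Rightarrow> 'o \<Rightarrow> 'm set"
  where "inflations X L Y = {f. \<exists>y Y' \<delta>. triangle \<C> X f L y Y' \<delta> \<and> isomorphic \<C> Y' Y}"

definition deflations :: "'o \<Rightarrow> 'o \<Rightarrow> 'o \<Rightarrow> 'm set"
  where "deflations X L Y = {g. \<exists>x X' \<delta>. triangle \<C> X' x L g Y \<delta> \<and> isomorphic \<C> X' X}"

definition hall_number :: "'o \<Rightarrow> 'o \<Rightarrow> 'o \<Rightarrow> rat"
  where "hall_number X Y L =
    of_nat (card (deflations X L Y)) / of_nat (card (Aut \<C> Y)) * (square L Y / square Y Y)"

definition hall_number_inflations :: "'o \<Rightarrow> 'o \<Rightarrow> 'o \<Rightarrow> rat"
  where "hall_number_inflations X Y L =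
    of_nat (card (inflations X L Y)) / of_nat (card (Aut \<C> X)) * (square X L / square X X)"

definition iso_class :: "'o \<Rightarrow> 'o set"
  where "iso_class X = {Y. isomorphic \<C> X Y}"

definition hall_basis :: "'o \<Rightarrow> 'o set \<Rightarrow> rat"
  where "hall_basis X = (\<lambda>c. if c = iso_class X then 1 else 0)"

text \<open>The structure constant for isomorphism classes, computed on chosen representatives.\<close>

definition hall_coeff :: "'o set \<Rightarrow> 'o set \<Rightarrow> 'o set \<Rightarrow> rat"
  where "hall_coeff a b c = hall_number (SOME X. X \<in> a) (SOME Y. Y \<in> b) (SOME L. L \<in> c)"

text \<open>Elements are finitely supported rational functions on the set of isomorphism classes
  (extended by 0 to all sets of objects), with basis vectors \<open>u\<^sub>[\<^sub>X\<^sub>]\<close> given by \<open>hall_basis X\<close>. The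
  unit is the basis vector of the class of zero objects.\<close>

definition hall_algebra :: "(rat, 'o set \<Rightarrow> rat) module"
  where "hall_algebra =
    \<lparr>carrier = {\<phi>. finite {c. \<phi> c \<noteq> 0} \<and> {c. \<phi> c \<noteq> 0} \<subseteq> iso_class ` Ob \<C>},
     mult = (\<lambda>\<phi> \<psi> c. if c \<in> iso_class ` Ob \<C>
       then \<Sum>a | \<phi> a \<noteq> 0. \<Sum>b | \<psi> b \<noteq> 0. \<phi> a * \<psi> b * hall_coeff a b c else 0),
     one = (\<lambda>c. if c = {Z. zero_object \<C> Z} then 1 else 0),
     zero = (\<lambda>c. 0),
     add = (\<lambda>\<phi> \<psi> c. \<phi> c + \<psi> c),
     smult = (\<lambda>r \<phi> c. r * \<phi> c)\<rparr>"

end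

definition rat_ring :: "rat ring"
  where "rat_ring = \<lparr>carrier = UNIV, mult = (*), one = 1, zero = 0, add = (+)\<rparr>"

text \<open>As \<open>algebra\<close>, but without commutativity of the multiplication.\<close>

locale assoc_algebra = module + ring M +
  assumes smult_assoc_left:
      "\<lbrakk>a \<in> carrier R; x \<in> carrier M; y \<in> carrier M\<rbrakk>
       \<Longrightarrow> (a \<odot>\<^bsub>M\<^esub> x) \<otimes>\<^bsub>M\<^esub> y = a \<odot>\<^bsub>M\<^esub> (x \<otimes>\<^bsub>M\<^esub> y)"
    and smult_assoc_right:
      "\<lbrakk>a \<in> carrier R; x \<in> carrier M; y \<in> carrier M\<rbrakk>
       \<Longrightarrow> x \<otimes>\<^bsub>M\<^esub> (a \<odot>\<^bsub>M\<^esub> y) = a \<odot>\<^bsub>M\<^esub> (x \<otimes>\<^bsub>M\<^esub> y)"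

end

theory Submission
  imports Defs
begin

text \<open>
  Let \<open>\<langle>X,Y\<rangle>\<close> be the alternating product of the orders of all \<open>\<E>\<^sup>i(X,Y)\<close>, \<open>i \<ge> 0\<close>, so that \<open>[X,Y] = 1/\<langle>X,Y\<rangle>\<close>.
  The long exact sequences of higher extensions express its failure to be multiplicative on a triangle
  \<open>A \<rightarrow> B \<rightarrow> C\<close> by the order of the kernel of \<open>Hom(Z,A) \<rightarrow> Hom(Z,B)\<close>, respectively of
  \<open>Hom(C,Z) \<rightarrow> Hom(B,Z)\<close>. These sequences rest on the fact that a sum of tensors in the coend can be moved along
  morphisms \<open>M \<rightarrow> N\<close> to a single tensor, and that two sums are equal iff they can be moved to the same tensor.

  The two expressions for \<open>F\<close> agree because both \<open>Aut Y\<close> acting on the cone and \<open>Aut X\<close> acting on the cocone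
  of the triangles \<open>X \<rightarrow> L \<rightarrow> Y\<close> have as stabilizers morphisms \<open>1 + u\<close> with \<open>u\<close> killed by the deflation (inflation)
  and by the extension, and the extensions \<open>u\<^sub>*\<delta>\<close> with \<open>f u = 0\<close> are the extensions \<open>u\<^sup>*\<delta>\<close> with \<open>u g = 0\<close>.

  For associativity fix an inflation \<open>h : X \<rightarrow> M\<close> with cone \<open>L'\<close> and a deflation \<open>g : M \<rightarrow> Z\<close> with cocone \<open>l : L \<rightarrow> M\<close>.
  A morphism \<open>f : X \<rightarrow> L\<close> with \<open>l f = h\<close> and a morphism \<open>e : L' \<rightarrow> Z\<close> with \<open>e h' = g\<close> are related if \<open>(f, 1, e)\<close> is a
  morphism of triangles. Octahedra show that related \<open>f\<close> and \<open>e\<close> are simultaneously an inflation with cone \<open>Y\<close> and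
  a deflation with cocone \<open>Y\<close>; counting related pairs in two ways compares both sides of the associativity law.
\<close>

section \<open>Linear categories\<close>

text \<open>Higher extensions are given by generators and relations, so the first obstacle is to
  decide when a tensor vanishes. The coend relation may be used in both directions, and a chain of
  such uses zigzags between objects; half exactness of the level below supplies the weak pushouts
  that shorten every zigzag to a cospan. The two variables play unequal roles, since a tensor splits
  off its factor on the side of the contravariant variable. Hence passing to the opposite category
  dualizes statements about \<open>Hom\<close> and \<open>Ext\<close> only, and the two long exact
  sequences need separate arguments: the contravariant one carries the induction on the degree, and
  the covariant one follows because every class is killed by some deflation. The second obstacle is
  that the third component of a morphism of triangles is not determined by the other two. The counts
  therefore run over pairs of fillers; the ambiguities on the two sides are kernels of maps onto one
  and the same subgroup of an extension group, and the kernel orders in the Euler form are what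
  cancels them.\<close>

context linear_category
begin

abbreviation H :: "'o \<Rightarrow> 'o \<Rightarrow> ('k, 'm) module"
  where "H X Y \<equiv> Hom \<C> X Y"

text \<open>The object memberships are bundled into the typing judgement, so that typing facts
  compose without extra premises.\<close>

definition mor :: "'m \<Rightarrow> 'o \<Rightarrow> 'o \<Rightarrow> bool" (\<open>_ \<Colon> _ \<rightarrow> _\<close> [61, 61, 61] 60)
  where "f \<Colon> X \<rightarrow> Y \<longleftrightarrow> X \<in> Ob \<C> \<and> Y \<in> Ob \<C> \<and> f \<in> Homset \<C> X Y"

lemma morD:
  assumes "f \<Colon> X \<rightarrow> Y"
  shows "X \<in> Ob \<C>" "Y \<in> Ob \<C>" "f \<in> Homset \<C> X Y"
  using assms by (auto simp: mor_def)

lemma mor_iff: "\<lbrakk>X \<in> Ob \<C>; Y \<in> Ob \<C>\<rbrakk> \<Longrightarrow> f \<in> Homset \<C> X Y \<longleftrightarrow> f \<Colon> X \<rightarrow> Y"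
  by (simp add: mor_def)

lemma hom_group: "\<lbrakk>X \<in> Ob \<C>; Y \<in> Ob \<C>\<rbrakk> \<Longrightarrow> abelian_group (H X Y)"
  using Hom_vectorspace by (simp add: vectorspace_def module_def)

lemma hom_groupD: "f \<Colon> X \<rightarrow> Y \<Longrightarrow> abelian_group (H X Y)"
  using hom_group morD by blast

lemma mor_id [intro]: "X \<in> Ob \<C> \<Longrightarrow> Id \<C> X \<Colon> X \<rightarrow> X"
  by (simp add: mor_def Id_closed)

lemma mor_cmp [intro]:
  assumes "f \<Colon> X \<rightarrow> Y" "g \<Colon> Y \<rightarrow> Z"
  shows "g \<cdot> f \<Colon> X \<rightarrow> Z"
proof -
  interpret linear_map K "H X Y" "H X Z" "\<lambda>f. g \<cdot> f"
    using assms by (intro cmp_linear_right) (auto simp: mor_def)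
  show ?thesis using assms T_im by (auto simp: mor_def)
qed

lemma mor_add [intro]: "\<lbrakk>f \<Colon> X \<rightarrow> Y; g \<Colon> X \<rightarrow> Y\<rbrakk> \<Longrightarrow> f \<oplus>\<^bsub>H X Y\<^esub> g \<Colon> X \<rightarrow> Y"
  using abelian_monoid.a_closed[of "H X Y"] hom_group abelian_group_def by (fastforce simp: mor_def)

lemma mor_zero [intro]: "\<lbrakk>X \<in> Ob \<C>; Y \<in> Ob \<C>\<rbrakk> \<Longrightarrow> \<zero>\<^bsub>H X Y\<^esub> \<Colon> X \<rightarrow> Y"
  using abelian_monoid.zero_closed[of "H X Y"] hom_group abelian_group_def by (fastforce simp: mor_def)

lemma mor_neg [intro]: "f \<Colon> X \<rightarrow> Y \<Longrightarrow> \<ominus>\<^bsub>H X Y\<^esub> f \<Colon> X \<rightarrow> Y"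
  using abelian_group.a_inv_closed[of "H X Y"] hom_group by (fastforce simp: mor_def)

lemma mor_smult [intro]: "\<lbrakk>k \<in> carrier K; f \<Colon> X \<rightarrow> Y\<rbrakk> \<Longrightarrow> k \<odot>\<^bsub>H X Y\<^esub> f \<Colon> X \<rightarrow> Y"
  using Hom_vectorspace[of X Y] module.smult_closed[of K "H X Y"]
  by (auto simp: mor_def vectorspace_def)

lemma id_cmp [simp]: "f \<Colon> X \<rightarrow> Y \<Longrightarrow> Id \<C> Y \<cdot> f = f"
  and cmp_id [simp]: "f \<Colon> X \<rightarrow> Y \<Longrightarrow> f \<cdot> Id \<C> X = f"
  using Id_left Id_right by (auto simp: mor_def)

lemma assoc: "\<lbrakk>f \<Colon> W \<rightarrow> X; g \<Colon> X \<rightarrow> Y; h \<Colon> Y \<rightarrow> Z\<rbrakk> \<Longrightarrow> (h \<cdot> g) \<cdot> f = h \<cdot> (g \<cdot> f)"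
  using cmp_assoc[of W X Y Z f g h] by (simp add: mor_def)

lemma cmp_add_right:
  assumes "f \<Colon> X \<rightarrow> Y" "f' \<Colon> X \<rightarrow> Y" "g \<Colon> Y \<rightarrow> Z"
  shows "g \<cdot> (f \<oplus>\<^bsub>H X Y\<^esub> f') = (g \<cdot> f) \<oplus>\<^bsub>H X Z\<^esub> (g \<cdot> f')"
    and "g \<cdot> \<zero>\<^bsub>H X Y\<^esub> = \<zero>\<^bsub>H X Z\<^esub>" and "g \<cdot> (\<ominus>\<^bsub>H X Y\<^esub> f) = \<ominus>\<^bsub>H X Z\<^esub> (g \<cdot> f)"
proof -
  interpret linear_map K "H X Y" "H X Z" "\<lambda>f. g \<cdot> f"
    using assms by (intro cmp_linear_right) (auto simp: mor_def)
  show "g \<cdot> (f \<oplus>\<^bsub>H X Y\<^esub> f') = (g \<cdot> f) \<oplus>\<^bsub>H X Z\<^esub> (g \<cdot> f')"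
    "g \<cdot> \<zero>\<^bsub>H X Y\<^esub> = \<zero>\<^bsub>H X Z\<^esub>" "g \<cdot> (\<ominus>\<^bsub>H X Y\<^esub> f) = \<ominus>\<^bsub>H X Z\<^esub> (g \<cdot> f)"
    using assms T_add T0_is_0 T_neg by (auto simp: mor_def)
qed

lemma cmp_add_left:
  assumes "g \<Colon> Y \<rightarrow> Z" "g' \<Colon> Y \<rightarrow> Z" "f \<Colon> X \<rightarrow> Y"
  shows "(g \<oplus>\<^bsub>H Y Z\<^esub> g') \<cdot> f = (g \<cdot> f) \<oplus>\<^bsub>H X Z\<^esub> (g' \<cdot> f)"
    and "\<zero>\<^bsub>H Y Z\<^esub> \<cdot> f = \<zero>\<^bsub>H X Z\<^esub>" and "(\<ominus>\<^bsub>H Y Z\<^esub> g) \<cdot> f = \<ominus>\<^bsub>H X Z\<^esub> (g \<cdot> f)"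
proof -
  interpret linear_map K "H Y Z" "H X Z" "\<lambda>g. g \<cdot> f"
    using assms by (intro cmp_linear_left) (auto simp: mor_def)
  show "(g \<oplus>\<^bsub>H Y Z\<^esub> g') \<cdot> f = (g \<cdot> f) \<oplus>\<^bsub>H X Z\<^esub> (g' \<cdot> f)"
    "\<zero>\<^bsub>H Y Z\<^esub> \<cdot> f = \<zero>\<^bsub>H X Z\<^esub>" "(\<ominus>\<^bsub>H Y Z\<^esub> g) \<cdot> f = \<ominus>\<^bsub>H X Z\<^esub> (g \<cdot> f)"
    using assms T_add T0_is_0 T_neg by (auto simp: mor_def)
qed

lemma cmp_zero_right: "\<lbrakk>g \<Colon> Y \<rightarrow> Z; X \<in> Ob \<C>\<rbrakk> \<Longrightarrow> g \<cdot> \<zero>\<^bsub>H X Y\<^esub> = \<zero>\<^bsub>H X Z\<^esub>"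
  using cmp_add_right(2)[OF mor_zero mor_zero, of X Y g Z] morD by blast

lemma cmp_zero_left: "\<lbrakk>f \<Colon> X \<rightarrow> Y; Z \<in> Ob \<C>\<rbrakk> \<Longrightarrow> \<zero>\<^bsub>H Y Z\<^esub> \<cdot> f = \<zero>\<^bsub>H X Z\<^esub>"
  using cmp_add_left(2)[OF mor_zero mor_zero, of Y Z f X] morD by blast

lemma hom_add_assoc:
  "\<lbrakk>f \<Colon> X \<rightarrow> Y; g \<Colon> X \<rightarrow> Y; h \<Colon> X \<rightarrow> Y\<rbrakk> \<Longrightarrow>
    (f \<oplus>\<^bsub>H X Y\<^esub> g) \<oplus>\<^bsub>H X Y\<^esub> h = f \<oplus>\<^bsub>H X Y\<^esub> (g \<oplus>\<^bsub>H X Y\<^esub> h)"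
  using abelian_monoid.a_assoc[of "H X Y"] hom_groupD abelian_group_def morD(3) by metis

lemma hom_add_comm:
  "\<lbrakk>f \<Colon> X \<rightarrow> Y; g \<Colon> X \<rightarrow> Y\<rbrakk> \<Longrightarrow> f \<oplus>\<^bsub>H X Y\<^esub> g = g \<oplus>\<^bsub>H X Y\<^esub> f"
  using abelian_monoid.a_comm[of "H X Y"] hom_groupD abelian_group_def morD(3) by metis

lemma hom_add_lcomm:
  "\<lbrakk>f \<Colon> X \<rightarrow> Y; g \<Colon> X \<rightarrow> Y; h \<Colon> X \<rightarrow> Y\<rbrakk> \<Longrightarrow>
    f \<oplus>\<^bsub>H X Y\<^esub> (g \<oplus>\<^bsub>H X Y\<^esub> h) = g \<oplus>\<^bsub>H X Y\<^esub> (f \<oplus>\<^bsub>H X Y\<^esub> h)"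
  by (metis hom_add_assoc hom_add_comm)

lemma hom_add_zero [simp]:
  "f \<Colon> X \<rightarrow> Y \<Longrightarrow> f \<oplus>\<^bsub>H X Y\<^esub> \<zero>\<^bsub>H X Y\<^esub> = f" "f \<Colon> X \<rightarrow> Y \<Longrightarrow> \<zero>\<^bsub>H X Y\<^esub> \<oplus>\<^bsub>H X Y\<^esub> f = f"
  using abelian_monoid.r_zero[of "H X Y"] abelian_monoid.l_zero[of "H X Y"]
    hom_groupD abelian_group_def morD(3) by metis+

lemma hom_add_neg [simp]:
  "f \<Colon> X \<rightarrow> Y \<Longrightarrow> f \<oplus>\<^bsub>H X Y\<^esub> (\<ominus>\<^bsub>H X Y\<^esub> f) = \<zero>\<^bsub>H X Y\<^esub>"
  "f \<Colon> X \<rightarrow> Y \<Longrightarrow> (\<ominus>\<^bsub>H X Y\<^esub> f) \<oplus>\<^bsub>H X Y\<^esub> f = \<zero>\<^bsub>H X Y\<^esub>"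
  using abelian_group.r_neg[of "H X Y"] abelian_group.l_neg[of "H X Y"] hom_groupD morD(3) by metis+

lemma hom_cancel_neg [simp]:
  "\<lbrakk>f \<Colon> X \<rightarrow> Y; g \<Colon> X \<rightarrow> Y\<rbrakk> \<Longrightarrow> (\<ominus>\<^bsub>H X Y\<^esub> f) \<oplus>\<^bsub>H X Y\<^esub> (f \<oplus>\<^bsub>H X Y\<^esub> g) = g"
  "\<lbrakk>f \<Colon> X \<rightarrow> Y; g \<Colon> X \<rightarrow> Y\<rbrakk> \<Longrightarrow> f \<oplus>\<^bsub>H X Y\<^esub> ((\<ominus>\<^bsub>H X Y\<^esub> f) \<oplus>\<^bsub>H X Y\<^esub> g) = g"
  by (metis hom_add_assoc hom_add_neg hom_add_zero(2) mor_neg)+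

lemma hom_cancel_neg3 [simp]:
  "\<lbrakk>f \<Colon> X \<rightarrow> Y; g \<Colon> X \<rightarrow> Y\<rbrakk> \<Longrightarrow> f \<oplus>\<^bsub>H X Y\<^esub> (g \<oplus>\<^bsub>H X Y\<^esub> (\<ominus>\<^bsub>H X Y\<^esub> f)) = g"
  "\<lbrakk>f \<Colon> X \<rightarrow> Y; g \<Colon> X \<rightarrow> Y\<rbrakk> \<Longrightarrow> (\<ominus>\<^bsub>H X Y\<^esub> f) \<oplus>\<^bsub>H X Y\<^esub> (g \<oplus>\<^bsub>H X Y\<^esub> f) = g"
  by (metis hom_add_lcomm hom_add_neg hom_add_zero(1) mor_neg)+

lemma hom_neg_zero [simp]:
  "\<lbrakk>X \<in> Ob \<C>; Y \<in> Ob \<C>\<rbrakk> \<Longrightarrow> \<ominus>\<^bsub>H X Y\<^esub> \<zero>\<^bsub>H X Y\<^esub> = \<zero>\<^bsub>H X Y\<^esub>"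
  by (metis hom_add_neg(1) hom_add_zero(2) mor_neg mor_zero)

lemma isoD:
  assumes "f \<in> isos \<C> X Y" "X \<in> Ob \<C>" "Y \<in> Ob \<C>"
  obtains g where "g \<Colon> Y \<rightarrow> X" "g \<cdot> f = Id \<C> X" "f \<cdot> g = Id \<C> Y" "g \<in> isos \<C> Y X" "f \<Colon> X \<rightarrow> Y"
  using assms unfolding isos_def mor_def by auto

lemma isoI:
  assumes "f \<Colon> X \<rightarrow> Y" "g \<Colon> Y \<rightarrow> X" "g \<cdot> f = Id \<C> X" "f \<cdot> g = Id \<C> Y"
  shows "f \<in> isos \<C> X Y"
  using assms unfolding isos_def mor_def by auto

lemma iso_mor: "\<lbrakk>f \<in> isos \<C> X Y; X \<in> Ob \<C>; Y \<in> Ob \<C>\<rbrakk> \<Longrightarrow> f \<Colon> X \<rightarrow> Y"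
  unfolding isos_def mor_def by auto

lemma isoI2:
  assumes f: "f \<Colon> X \<rightarrow> Y" and g: "g \<Colon> Y \<rightarrow> X" and h: "h \<Colon> Y \<rightarrow> X"
    and gf: "g \<cdot> f = Id \<C> X" and fh: "f \<cdot> h = Id \<C> Y"
  shows "f \<in> isos \<C> X Y"
proof -
  have "g = g \<cdot> (f \<cdot> h)" using fh g by simp
  also have "\<dots> = h" using assoc[OF h f g] gf h by simp
  finally show ?thesis using isoI[OF f g gf] fh by simp
qed

lemma iso_id: "X \<in> Ob \<C> \<Longrightarrow> Id \<C> X \<in> isos \<C> X X"
  using isoI[of "Id \<C> X" X X "Id \<C> X"] by auto

lemma iso_cmp:
  assumes "f \<in> isos \<C> X Y" "g \<in> isos \<C> Y Z" "X \<in> Ob \<C>" "Y \<in> Ob \<C>" "Z \<in> Ob \<C>"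
  shows "g \<cdot> f \<in> isos \<C> X Z"
proof -
  obtain f' where f: "f' \<Colon> Y \<rightarrow> X" "f' \<cdot> f = Id \<C> X" "f \<cdot> f' = Id \<C> Y" "f \<Colon> X \<rightarrow> Y"
    using isoD[of f X Y] assms by metis
  obtain g' where g: "g' \<Colon> Z \<rightarrow> Y" "g' \<cdot> g = Id \<C> Y" "g \<cdot> g' = Id \<C> Z" "g \<Colon> Y \<rightarrow> Z"
    using isoD[of g Y Z] assms by metis
  have gf: "g \<cdot> f \<Colon> X \<rightarrow> Z" and fg: "f' \<cdot> g' \<Colon> Z \<rightarrow> X" using f g by blast+
  have "(f' \<cdot> g') \<cdot> (g \<cdot> f) = f' \<cdot> (g' \<cdot> (g \<cdot> f))" using assoc[OF gf g(1) f(1)] .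
  also have "g' \<cdot> (g \<cdot> f) = f" using assoc[OF f(4) g(4) g(1)] g(2) f(4) by simp
  finally have 1: "(f' \<cdot> g') \<cdot> (g \<cdot> f) = Id \<C> X" using f by simp
  have "(g \<cdot> f) \<cdot> (f' \<cdot> g') = g \<cdot> (f \<cdot> (f' \<cdot> g'))" using assoc[OF fg f(4) g(4)] .
  also have "f \<cdot> (f' \<cdot> g') = g'" using assoc[OF g(1) f(1) f(4)] f(3) g(1) by simp
  finally have 2: "(g \<cdot> f) \<cdot> (f' \<cdot> g') = Id \<C> Z" using g by simp
  show ?thesis using isoI[OF gf fg 1 2] .
qed

text \<open>The inverse is \<open>1 - v\<close>, since both products of \<open>1 + v\<close> and
  \<open>1 - v\<close> equal \<open>1 - v v\<close>.\<close>

lemma iso_square_zero: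
  assumes v: "v \<Colon> X \<rightarrow> X" and vv: "v \<cdot> v = \<zero>\<^bsub>H X X\<^esub>"
  shows "Id \<C> X \<oplus>\<^bsub>H X X\<^esub> v \<in> isos \<C> X X"
proof -
  have X: "X \<in> Ob \<C>" using v morD by blast
  let ?i = "Id \<C> X" and ?n = "\<ominus>\<^bsub>H X X\<^esub> v"
  have i: "?i \<Colon> X \<rightarrow> X" and n: "?n \<Colon> X \<rightarrow> X" using X v by auto
  have 1: "(?i \<oplus>\<^bsub>H X X\<^esub> ?n) \<cdot> (?i \<oplus>\<^bsub>H X X\<^esub> v) = ?i"
    using cmp_add_left[OF i n mor_add[OF i v]] cmp_add_left[OF v v mor_add[OF i v]]
      cmp_add_right[OF i v v] cmp_add_right[OF v i v] vv v i n id_cmp[OF mor_add[OF i v]]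
    by (simp add: mor_add hom_add_assoc mor_zero X hom_add_comm[OF i v])
  have 2: "(?i \<oplus>\<^bsub>H X X\<^esub> v) \<cdot> (?i \<oplus>\<^bsub>H X X\<^esub> ?n) = ?i"
    using cmp_add_left[OF i v mor_add[OF i n]]
      cmp_add_right[OF i n v] cmp_add_right[OF v v v] cmp_add_right[OF v i v] vv v i n
        id_cmp[OF mor_add[OF i n]]
    by (simp add: mor_add hom_add_assoc mor_zero X)
  show ?thesis using isoI[OF mor_add[OF i v] mor_add[OF i n] 1 2] .
qed

end

section \<open>The opposite of an extriangulated category\<close>

definition flip :: "'m \<times> 'o \<times> 'm \<Rightarrow> 'm \<times> 'o \<times> 'm"
  where "flip = (\<lambda>(x, B, y). (y, B, x))"

lemma flip_simp [simp]: "flip (x, B, y) = (y, B, x)"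
  by (simp add: flip_def)

lemma flip_image_iff [simp]: "(x, B, y) \<in> flip ` S \<longleftrightarrow> (y, B, x) \<in> S"
  by (force simp: flip_def image_iff)

text \<open>The axioms come in dual pairs, so the opposite is again extriangulated. Most later
  statements about \<open>Hom\<close> and \<open>Ext\<close> are proved once, and their duals are
  the instances at \<open>op_cat\<close>.\<close>

definition op_cat :: "('k, 'o, 'm, 'e) extri_cat \<Rightarrow> ('k, 'o, 'm, 'e) extri_cat"
  where "op_cat \<C> =
    \<lparr>Ob = Ob \<C>, Hom = (\<lambda>X Y. Hom \<C> Y X), Id = Id \<C>, cmp = (\<lambda>g f. cmp \<C> f g),
     Ext = (\<lambda>C A. Ext \<C> A C), push = pull \<C>, pull = push \<C>,
     realn = (\<lambda>C A \<delta>. flip ` realn \<C> A C \<delta>)\<rparr>"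

lemma op_cat_simps [simp]:
  "Ob (op_cat \<C>) = Ob \<C>" "Hom (op_cat \<C>) X Y = Hom \<C> Y X" "Id (op_cat \<C>) = Id \<C>"
  "cmp (op_cat \<C>) g f = cmp \<C> f g" "Ext (op_cat \<C>) C A = Ext \<C> A C"
  "push (op_cat \<C>) = pull \<C>" "pull (op_cat \<C>) = push \<C>"
  "realn (op_cat \<C>) C A \<delta> = flip ` realn \<C> A C \<delta>"
  by (simp_all add: op_cat_def)

lemma triangle_op [simp]: "triangle (op_cat \<C>) A x B y C \<delta> \<longleftrightarrow> triangle \<C> C y B x A \<delta>"
  by (auto simp: triangle_def)

lemma biproduct_op [simp]: "biproduct (op_cat \<C>) A B P i j p q \<longleftrightarrow> biproduct \<C> A B P p q i j"
  by (auto simp: biproduct_def)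

lemma isos_op [simp]: "isos (op_cat \<C>) X Y = isos \<C> Y X"
  by (auto simp: isos_def)

lemma zero_object_op [simp]: "zero_object (op_cat \<C>) Z \<longleftrightarrow> zero_object \<C> Z"
  by (auto simp: zero_object_def)

lemma sequences_op: "sequences (op_cat \<C>) C A = flip ` sequences \<C> A C"
  by (force simp: sequences_def flip_def image_iff)

context linear_category
begin

lemma isos_inverse:
  assumes "b \<in> isos \<C> B B'" "B \<in> Ob \<C>" "B' \<in> Ob \<C>" "C \<in> Ob \<C>" "A \<in> Ob \<C>"
    "x \<in> Homset \<C> A B" "x' \<in> Homset \<C> A B'" "y \<in> Homset \<C> B C" "y' \<in> Homset \<C> B' C"
    "b \<cdot> x = x'" "y' \<cdot> b = y"
  shows "\<exists>b' \<in> isos \<C> B' B. b' \<cdot> x' = x \<and> y \<cdot> b' = y'"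
proof -
  obtain g where g: "g \<Colon> B' \<rightarrow> B" "g \<cdot> b = Id \<C> B" "b \<cdot> g = Id \<C> B'" "g \<in> isos \<C> B' B" "b \<Colon> B \<rightarrow> B'"
    using assms isoD by metis
  have m: "x \<Colon> A \<rightarrow> B" "x' \<Colon> A \<rightarrow> B'" "y \<Colon> B \<rightarrow> C" "y' \<Colon> B' \<rightarrow> C" using assms by (auto simp: mor_def)
  have "g \<cdot> x' = x" using assms(10) assoc[OF m(1) g(5,1)] g(2) m by auto
  moreover have "y \<cdot> g = y'" using assms(11) assoc[OF g(1,5) m(4)] g(3) m by auto
  ultimately show ?thesis using g(4) by blast
qed

end

text \<open>Dualizing reverses the direction of the isomorphism between the middle terms, so its
  inverse has to be used.\<close>

lemma (in extriangulated) seq_equiv_op: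
  assumes "C \<in> Ob \<C>" "A \<in> Ob \<C>"
  shows "((x, B, y), (x', B', y')) \<in> seq_equiv (op_cat \<C>) C A \<longleftrightarrow> ((y, B, x), (y', B', x')) \<in> seq_equiv \<C> A C"
proof
  assume "((x, B, y), (x', B', y')) \<in> seq_equiv (op_cat \<C>) C A"
  then obtain b where b: "b \<in> isos \<C> B' B" "x \<cdot> b = x'" "b \<cdot> y' = y"
    and m: "B \<in> Ob \<C>" "B' \<in> Ob \<C>" "x \<in> Homset \<C> B A" "x' \<in> Homset \<C> B' A"
      "y \<in> Homset \<C> C B" "y' \<in> Homset \<C> C B'"
    by (auto simp: seq_equiv_def sequences_def)
  obtain b' where "b' \<in> isos \<C> B B'" "b' \<cdot> y = y'" "x' \<cdot> b' = x"
    using isos_inverse[OF b(1) m(2) m(1) assms(2) assms(1) m(6,5,4,3) b(3,2)] by blast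
  then show "((y, B, x), (y', B', x')) \<in> seq_equiv \<C> A C"
    using m by (auto simp: seq_equiv_def sequences_def)
next
  assume "((y, B, x), (y', B', x')) \<in> seq_equiv \<C> A C"
  then obtain b where b: "b \<in> isos \<C> B B'" "b \<cdot> y = y'" "x' \<cdot> b = x"
    and m: "B \<in> Ob \<C>" "B' \<in> Ob \<C>" "x \<in> Homset \<C> B A" "x' \<in> Homset \<C> B' A"
      "y \<in> Homset \<C> C B" "y' \<in> Homset \<C> C B'"
    by (auto simp: seq_equiv_def sequences_def)
  obtain b' where "b' \<in> isos \<C> B' B" "b' \<cdot> y' = y" "x \<cdot> b' = x'"
    using isos_inverse[OF b(1) m(1,2) assms(2,1) m(5,6,3,4) b(2,3)] by blast
  then show "((x, B, y), (x', B', y')) \<in> seq_equiv (op_cat \<C>) C A"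
    using m by (auto simp: seq_equiv_def sequences_def)
qed

lemma (in extriangulated) realn_class_op:
  assumes "C \<in> Ob \<C>" "A \<in> Ob \<C>" "\<delta> \<in> Extset \<C> A C"
  shows "flip ` realn \<C> A C \<delta> \<in> sequences (op_cat \<C>) C A // seq_equiv (op_cat \<C>) C A"
proof -
  obtain s where s: "s \<in> sequences \<C> A C" and r: "realn \<C> A C \<delta> = seq_equiv \<C> A C `` {s}"
    using realn_class[OF assms(2,1,3)] by (auto simp: quotient_def)
  have ff: "flip (flip t) = t" for t :: "'m \<times> 'o \<times> 'm" by (cases t) simp
  have "flip ` (seq_equiv \<C> A C `` {s}) = seq_equiv (op_cat \<C>) C A `` {flip s}"
    by (cases s) (force simp: seq_equiv_op[OF assms(1,2)] image_iff)
  moreover have "flip s \<in> sequences (op_cat \<C>) C A" using s by (simp add: sequences_op)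
  ultimately show ?thesis unfolding r by (auto simp: quotient_def)
qed

context extriangulated
begin

lemma triangle_mor:
  assumes "triangle \<C> A x B y C \<delta>"
  shows "x \<Colon> A \<rightarrow> B" "y \<Colon> B \<rightarrow> C" "\<delta> \<in> Extset \<C> C A"
proof -
  have *: "A \<in> Ob \<C>" "C \<in> Ob \<C>" "\<delta> \<in> Extset \<C> C A" "(x, B, y) \<in> realn \<C> C A \<delta>"
    using assms by (auto simp: triangle_def)
  then have "(x, B, y) \<in> sequences \<C> C A"
    using realn_class[OF *(2,1,3)] by (auto simp: quotient_def seq_equiv_def)
  then show "x \<Colon> A \<rightarrow> B" "y \<Colon> B \<rightarrow> C" "\<delta> \<in> Extset \<C> C A" using * by (auto simp: sequences_def mor_def)
qed

lemma biproductD: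
  assumes "biproduct \<C> A B P i j p q"
  shows "i \<Colon> A \<rightarrow> P" "j \<Colon> B \<rightarrow> P" "p \<Colon> P \<rightarrow> A" "q \<Colon> P \<rightarrow> B"
    "p \<cdot> i = Id \<C> A" "q \<cdot> j = Id \<C> B" "q \<cdot> i = \<zero>\<^bsub>H A B\<^esub>" "p \<cdot> j = \<zero>\<^bsub>H B A\<^esub>"
    "(i \<cdot> p) \<oplus>\<^bsub>H P P\<^esub> (j \<cdot> q) = Id \<C> P" "A \<in> Ob \<C>" "B \<in> Ob \<C>" "P \<in> Ob \<C>"
  using assms by (auto simp: biproduct_def mor_def)

lemma biproductI:
  assumes "i \<Colon> A \<rightarrow> P" "j \<Colon> B \<rightarrow> P" "p \<Colon> P \<rightarrow> A" "q \<Colon> P \<rightarrow> B"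
    "p \<cdot> i = Id \<C> A" "q \<cdot> j = Id \<C> B" "q \<cdot> i = \<zero>\<^bsub>H A B\<^esub>" "p \<cdot> j = \<zero>\<^bsub>H B A\<^esub>"
    "(i \<cdot> p) \<oplus>\<^bsub>H P P\<^esub> (j \<cdot> q) = Id \<C> P"
  shows "biproduct \<C> A B P i j p q"
  using assms by (auto simp: biproduct_def mor_def)

lemma biproduct_swap:
  assumes "biproduct \<C> A B P i j p q"
  shows "biproduct \<C> B A P j i q p"
proof -
  note b = biproductD[OF assms]
  show ?thesis
    using b hom_add_comm[OF mor_cmp[OF b(3,1)] mor_cmp[OF b(4,2)]] by (intro biproductI) auto
qed

lemma extriangulated_op: "extriangulated K (op_cat \<C>)"
proof (intro extriangulated.intro additive_category.intro linear_category.intro field_axioms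
  linear_category_axioms.intro additive_category_axioms.intro extriangulated_axioms.intro,
  unfold op_cat_simps triangle_op biproduct_op zero_object_op, goal_cases)
  case 1 then show ?case using Hom_vectorspace by blast
next
  case 2 then show ?case using Id_closed by blast
next
  case 3 then show ?case using Id_left by blast
next
  case 4 then show ?case using Id_right by blast
next
  case 5 then show ?case using cmp_assoc by metis
next
  case 6 then show ?case using cmp_linear_left by blast
next
  case 7 then show ?case using cmp_linear_right by blast
next
  case 8 then show ?case using zero_object_exists .
next
  case 9 then show ?case using biproduct_exists by blast
next
  case 10 then show ?case using Ext_vectorspace by blast
next
  case 11 then show ?case using pull_linear by blast
next
  case 12 then show ?case using pull_linear_mor by blast
next
  case 13 then show ?case using pull_Id by blast
next
  case 14 then show ?case using pull_cmp by blast
next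
  case 15 then show ?case using push_linear by blast
next
  case 16 then show ?case using push_linear_mor by blast
next
  case 17 then show ?case using push_Id by blast
next
  case 18 then show ?case using push_cmp by blast
next
  case 19 then show ?case using push_pull by metis
next
  case 20 then show ?case by (rule realn_class_op)
next
  case 21 then show ?case using realn_morphism by (metis (no_types, lifting))
next
  case 22 then show ?case using realn_zero[OF biproduct_swap] by simp
next
  case (23 A x B y C \<delta> A' x' B' y' C' \<delta>' A\<^sub>s iA jA pA qA B\<^sub>s iB jB pB qB C\<^sub>s iC jC pC qC)
  note t = 23(1,2) note b = 23(3-5)
  have m: "iA \<Colon> A\<^sub>s \<rightarrow> A" "jA \<Colon> A\<^sub>s \<rightarrow> A'" "iB \<Colon> B\<^sub>s \<rightarrow> B" "jB \<Colon> B\<^sub>s \<rightarrow> B'"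
    "pB \<Colon> B \<rightarrow> B\<^sub>s" "qB \<Colon> B' \<rightarrow> B\<^sub>s" "pC \<Colon> C \<rightarrow> C\<^sub>s" "qC \<Colon> C' \<rightarrow> C\<^sub>s" "pA \<Colon> A \<rightarrow> A\<^sub>s" "qA \<Colon> A' \<rightarrow> A\<^sub>s"
    "iC \<Colon> C\<^sub>s \<rightarrow> C" "jC \<Colon> C\<^sub>s \<rightarrow> C'"
    using b by (auto simp: biproduct_def mor_def)
  have xy: "x \<Colon> B \<rightarrow> A" "y \<Colon> C \<rightarrow> B" "x' \<Colon> B' \<rightarrow> A'" "y' \<Colon> C' \<rightarrow> B'" "\<delta> \<in> Extset \<C> A C" "\<delta>' \<in> Extset \<C> A' C'"
    using t triangle_mor by auto
  \<comment> \<open>Dualizing exchanges pushing with pulling and mirrors the bracketing of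
    composites; the axiom on sums matches the goal only after both are put back in order.\<close>
  have r: "push \<C> pC (pull \<C> iA \<delta>) = pull \<C> iA (push \<C> pC \<delta>)"
    "push \<C> qC (pull \<C> jA \<delta>') = pull \<C> jA (push \<C> qC \<delta>')"
    using push_pull m xy by (auto simp: mor_def)
  have a: "(pB \<cdot> y) \<cdot> iC = pB \<cdot> (y \<cdot> iC)" "(qB \<cdot> y') \<cdot> jC = qB \<cdot> (y' \<cdot> jC)"
    "(pA \<cdot> x) \<cdot> iB = pA \<cdot> (x \<cdot> iB)" "(qA \<cdot> x') \<cdot> jB = qA \<cdot> (x' \<cdot> jB)"
    using assoc m xy by blast+
  show ?case using realn_sum[OF t b(3,2,1)] unfolding flip_image_iff r a .
next
  case 24 then show ?case using ET3_op by (metis (no_types, lifting))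
next
  case 25 then show ?case using ET3 by (metis (no_types, lifting))
next
  case 26 then show ?case using ET4_op by blast
next
  case 27 then show ?case using ET4 by blast
qed

end

section \<open>Extensions and triangles\<close>

lemma linear_map_simps:
  assumes "linear_map K V W F" "d \<in> carrier V" "d' \<in> carrier V"
  shows "F d \<in> carrier W" "F (d \<oplus>\<^bsub>V\<^esub> d') = F d \<oplus>\<^bsub>W\<^esub> F d'"
    "F \<zero>\<^bsub>V\<^esub> = \<zero>\<^bsub>W\<^esub>" "F (\<ominus>\<^bsub>V\<^esub> d) = \<ominus>\<^bsub>W\<^esub> F d"
    "k \<in> carrier K \<Longrightarrow> F (k \<odot>\<^bsub>V\<^esub> d) = k \<odot>\<^bsub>W\<^esub> F d"
proof -
  have m: "mod_hom K V W F" using assms(1) by (simp add: linear_map_def)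
  note h = mod_hom.f_hom[OF m]
  show "F d \<in> carrier W" by (rule mod_hom.f_im[OF m assms(2)])
  show "F (d \<oplus>\<^bsub>V\<^esub> d') = F d \<oplus>\<^bsub>W\<^esub> F d'" by (rule module_hom_add[OF h assms(2,3)])
  show "F \<zero>\<^bsub>V\<^esub> = \<zero>\<^bsub>W\<^esub>" by (rule mod_hom.f0_is_0[OF m])
  show "F (\<ominus>\<^bsub>V\<^esub> d) = \<ominus>\<^bsub>W\<^esub> F d" by (rule mod_hom.f_neg[OF m assms(2)])
  show "k \<in> carrier K \<Longrightarrow> F (k \<odot>\<^bsub>V\<^esub> d) = k \<odot>\<^bsub>W\<^esub> F d" by (rule module_hom_smult[OF h _ assms(2)])
qed

context extriangulated
begin

abbreviation E :: "'o \<Rightarrow> 'o \<Rightarrow> ('k, 'e) module"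
  where "E C A \<equiv> Ext \<C> C A"

abbreviation push_infix (infixr \<open>\<triangleright>\<close> 72)
  where "a \<triangleright> \<delta> \<equiv> push \<C> a \<delta>"

abbreviation pull_infix (infixl \<open>\<triangleleft>\<close> 73)
  where "\<delta> \<triangleleft> c \<equiv> pull \<C> c \<delta>"

definition exten :: "'e \<Rightarrow> 'o \<Rightarrow> 'o \<Rightarrow> bool"
  where "exten \<delta> C A \<longleftrightarrow> C \<in> Ob \<C> \<and> A \<in> Ob \<C> \<and> \<delta> \<in> Extset \<C> C A"

lemma extenI: "\<lbrakk>C \<in> Ob \<C>; A \<in> Ob \<C>; \<delta> \<in> Extset \<C> C A\<rbrakk> \<Longrightarrow> exten \<delta> C A"
  by (simp add: exten_def)

lemma extenD:
  assumes "exten \<delta> C A"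
  shows "C \<in> Ob \<C>" "A \<in> Ob \<C>" "\<delta> \<in> Extset \<C> C A"
  using assms by (auto simp: exten_def)

lemma ext_group: "\<lbrakk>C \<in> Ob \<C>; A \<in> Ob \<C>\<rbrakk> \<Longrightarrow> abelian_group (E C A)"
  using Ext_vectorspace by (simp add: vectorspace_def module_def)

lemma ext_groupD: "exten \<delta> C A \<Longrightarrow> abelian_group (E C A)"
  using ext_group extenD by blast

lemma exten_add [intro]: "\<lbrakk>exten d C A; exten d' C A\<rbrakk> \<Longrightarrow> exten (d \<oplus>\<^bsub>E C A\<^esub> d') C A"
  using abelian_monoid.a_closed[of "E C A"] ext_group abelian_group_def by (fastforce simp: exten_def)

lemma exten_zero [intro]: "\<lbrakk>C \<in> Ob \<C>; A \<in> Ob \<C>\<rbrakk> \<Longrightarrow> exten \<zero>\<^bsub>E C A\<^esub> C A"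
  using abelian_monoid.zero_closed[of "E C A"] ext_group abelian_group_def by (fastforce simp: exten_def)

lemma exten_neg [intro]: "exten d C A \<Longrightarrow> exten (\<ominus>\<^bsub>E C A\<^esub> d) C A"
  using abelian_group.a_inv_closed[of "E C A"] ext_group by (fastforce simp: exten_def)

lemma exten_smult [intro]: "\<lbrakk>k \<in> carrier K; exten d C A\<rbrakk> \<Longrightarrow> exten (k \<odot>\<^bsub>E C A\<^esub> d) C A"
  using Ext_vectorspace[of C A] module.smult_closed[of K "E C A"]
  by (auto simp: exten_def vectorspace_def)

lemma push_linear_map: "\<lbrakk>a \<Colon> A \<rightarrow> A'; C \<in> Ob \<C>\<rbrakk> \<Longrightarrow> linear_map K (E C A) (E C A') (\<lambda>\<delta>. a \<triangleright> \<delta>)"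
  using push_linear by (auto simp: mor_def)

lemma pull_linear_map: "\<lbrakk>c \<Colon> C' \<rightarrow> C; A \<in> Ob \<C>\<rbrakk> \<Longrightarrow> linear_map K (E C A) (E C' A) (\<lambda>\<delta>. \<delta> \<triangleleft> c)"
  using pull_linear by (auto simp: mor_def)

lemma exten_push [intro]: "\<lbrakk>a \<Colon> A \<rightarrow> A'; exten d C A\<rbrakk> \<Longrightarrow> exten (a \<triangleright> d) C A'"
  using push_linear_map[of a A A' C] mod_hom.f_im[of K "E C A" "E C A'"]
  by (auto simp: linear_map_def mor_def exten_def)

lemma exten_pull [intro]: "\<lbrakk>c \<Colon> C' \<rightarrow> C; exten d C A\<rbrakk> \<Longrightarrow> exten (d \<triangleleft> c) C' A"
  using pull_linear_map[of c C' C A] mod_hom.f_im[of K "E C A" "E C' A"]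
  by (auto simp: linear_map_def mor_def exten_def)

lemma ext_linear_map:
  assumes "linear_map K (E C A) (E C' A') F" "exten d C A" "exten d' C A"
  shows "F (d \<oplus>\<^bsub>E C A\<^esub> d') = F d \<oplus>\<^bsub>E C' A'\<^esub> F d'"
    "F \<zero>\<^bsub>E C A\<^esub> = \<zero>\<^bsub>E C' A'\<^esub>" "F (\<ominus>\<^bsub>E C A\<^esub> d) = \<ominus>\<^bsub>E C' A'\<^esub> F d"
    "k \<in> carrier K \<Longrightarrow> F (k \<odot>\<^bsub>E C A\<^esub> d) = k \<odot>\<^bsub>E C' A'\<^esub> F d"
  using linear_map_simps[OF assms(1)] extenD(3)[OF assms(2)] extenD(3)[OF assms(3)] by blast+

lemma push_add:
  assumes "a \<Colon> A \<rightarrow> A'" "exten d C A" "exten d' C A"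
  shows "a \<triangleright> (d \<oplus>\<^bsub>E C A\<^esub> d') = (a \<triangleright> d) \<oplus>\<^bsub>E C A'\<^esub> (a \<triangleright> d')"
  using ext_linear_map(1)[OF push_linear_map[of a A A' C] assms(2,3)] assms extenD by simp

lemma push_zero: "\<lbrakk>a \<Colon> A \<rightarrow> A'; C \<in> Ob \<C>\<rbrakk> \<Longrightarrow> a \<triangleright> \<zero>\<^bsub>E C A\<^esub> = \<zero>\<^bsub>E C A'\<^esub>"
  using ext_linear_map(2)[OF push_linear_map[of a A A' C] exten_zero exten_zero] morD by simp

lemma push_smult:
  "\<lbrakk>a \<Colon> A \<rightarrow> A'; exten d C A; k \<in> carrier K\<rbrakk> \<Longrightarrow> a \<triangleright> (k \<odot>\<^bsub>E C A\<^esub> d) = k \<odot>\<^bsub>E C A'\<^esub> (a \<triangleright> d)"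
  using ext_linear_map(4)[OF push_linear_map[of a A A' C], of d d k] extenD by simp

lemma pull_add:
  assumes "c \<Colon> C' \<rightarrow> C" "exten d C A" "exten d' C A"
  shows "(d \<oplus>\<^bsub>E C A\<^esub> d') \<triangleleft> c = (d \<triangleleft> c) \<oplus>\<^bsub>E C' A\<^esub> (d' \<triangleleft> c)"
  using ext_linear_map(1)[OF pull_linear_map[of c C' C A] assms(2,3)] assms extenD by simp

lemma pull_zero: "\<lbrakk>c \<Colon> C' \<rightarrow> C; A \<in> Ob \<C>\<rbrakk> \<Longrightarrow> \<zero>\<^bsub>E C A\<^esub> \<triangleleft> c = \<zero>\<^bsub>E C' A\<^esub>"
  using ext_linear_map(2)[OF pull_linear_map[of c C' C A] exten_zero exten_zero] morD by simp

lemma pull_smult: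
  "\<lbrakk>c \<Colon> C' \<rightarrow> C; exten d C A; k \<in> carrier K\<rbrakk> \<Longrightarrow> (k \<odot>\<^bsub>E C A\<^esub> d) \<triangleleft> c = k \<odot>\<^bsub>E C' A\<^esub> (d \<triangleleft> c)"
  using ext_linear_map(4)[OF pull_linear_map[of c C' C A], of d d k] extenD by simp

lemma push_mor_linear:
  assumes "a \<Colon> A \<rightarrow> A'" "a' \<Colon> A \<rightarrow> A'" "exten d C A"
  shows "(a \<oplus>\<^bsub>H A A'\<^esub> a') \<triangleright> d = (a \<triangleright> d) \<oplus>\<^bsub>E C A'\<^esub> (a' \<triangleright> d)"
    "\<zero>\<^bsub>H A A'\<^esub> \<triangleright> d = \<zero>\<^bsub>E C A'\<^esub>" "(\<ominus>\<^bsub>H A A'\<^esub> a) \<triangleright> d = \<ominus>\<^bsub>E C A'\<^esub> (a \<triangleright> d)"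
    "k \<in> carrier K \<Longrightarrow> (k \<odot>\<^bsub>H A A'\<^esub> a) \<triangleright> d = k \<odot>\<^bsub>E C A'\<^esub> (a \<triangleright> d)"
proof -
  have L: "linear_map K (H A A') (E C A') (\<lambda>a. a \<triangleright> d)"
    using assms by (intro push_linear_mor) (auto simp: mor_def exten_def)
  note l = linear_map_simps[OF L morD(3)[OF assms(1)] morD(3)[OF assms(2)]]
  show "(a \<oplus>\<^bsub>H A A'\<^esub> a') \<triangleright> d = (a \<triangleright> d) \<oplus>\<^bsub>E C A'\<^esub> (a' \<triangleright> d)"
    "\<zero>\<^bsub>H A A'\<^esub> \<triangleright> d = \<zero>\<^bsub>E C A'\<^esub>" "(\<ominus>\<^bsub>H A A'\<^esub> a) \<triangleright> d = \<ominus>\<^bsub>E C A'\<^esub> (a \<triangleright> d)"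
    "k \<in> carrier K \<Longrightarrow> (k \<odot>\<^bsub>H A A'\<^esub> a) \<triangleright> d = k \<odot>\<^bsub>E C A'\<^esub> (a \<triangleright> d)"
    using l(2-5) by blast+
qed

lemma pull_mor_linear:
  assumes "c \<Colon> C' \<rightarrow> C" "c' \<Colon> C' \<rightarrow> C" "exten d C A"
  shows "d \<triangleleft> (c \<oplus>\<^bsub>H C' C\<^esub> c') = (d \<triangleleft> c) \<oplus>\<^bsub>E C' A\<^esub> (d \<triangleleft> c')"
    "d \<triangleleft> \<zero>\<^bsub>H C' C\<^esub> = \<zero>\<^bsub>E C' A\<^esub>" "d \<triangleleft> (\<ominus>\<^bsub>H C' C\<^esub> c) = \<ominus>\<^bsub>E C' A\<^esub> (d \<triangleleft> c)"
    "k \<in> carrier K \<Longrightarrow> d \<triangleleft> (k \<odot>\<^bsub>H C' C\<^esub> c) = k \<odot>\<^bsub>E C' A\<^esub> (d \<triangleleft> c)"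
proof -
  have L: "linear_map K (H C' C) (E C' A) (\<lambda>c. d \<triangleleft> c)"
    using assms by (intro pull_linear_mor) (auto simp: mor_def exten_def)
  note l = linear_map_simps[OF L morD(3)[OF assms(1)] morD(3)[OF assms(2)]]
  show "d \<triangleleft> (c \<oplus>\<^bsub>H C' C\<^esub> c') = (d \<triangleleft> c) \<oplus>\<^bsub>E C' A\<^esub> (d \<triangleleft> c')"
    "d \<triangleleft> \<zero>\<^bsub>H C' C\<^esub> = \<zero>\<^bsub>E C' A\<^esub>" "d \<triangleleft> (\<ominus>\<^bsub>H C' C\<^esub> c) = \<ominus>\<^bsub>E C' A\<^esub> (d \<triangleleft> c)"
    "k \<in> carrier K \<Longrightarrow> d \<triangleleft> (k \<odot>\<^bsub>H C' C\<^esub> c) = k \<odot>\<^bsub>E C' A\<^esub> (d \<triangleleft> c)"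
    using l(2-5) by blast+
qed

lemma push_zero_mor: "\<lbrakk>exten d C A; A' \<in> Ob \<C>\<rbrakk> \<Longrightarrow> \<zero>\<^bsub>H A A'\<^esub> \<triangleright> d = \<zero>\<^bsub>E C A'\<^esub>"
  using push_mor_linear(2) mor_zero extenD by metis

lemma push_id [simp]: "exten d C A \<Longrightarrow> Id \<C> A \<triangleright> d = d"
  and pull_id [simp]: "exten d C A \<Longrightarrow> d \<triangleleft> Id \<C> C = d"
  using push_Id[of C A d] pull_Id[of C A d] by (simp_all add: exten_def)

lemma push_push: "\<lbrakk>a \<Colon> A \<rightarrow> A'; a' \<Colon> A' \<rightarrow> A''; exten d C A\<rbrakk> \<Longrightarrow> (a' \<cdot> a) \<triangleright> d = a' \<triangleright> (a \<triangleright> d)"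
  using push_cmp[of C A A' A'' a a' d] by (simp add: exten_def mor_def)

lemma pull_pull: "\<lbrakk>c \<Colon> C' \<rightarrow> C; c' \<Colon> C'' \<rightarrow> C'; exten d C A\<rbrakk> \<Longrightarrow> d \<triangleleft> (c \<cdot> c') = d \<triangleleft> c \<triangleleft> c'"
  using pull_cmp[of C C' C'' A c c' d] by (simp add: exten_def mor_def)

lemma pull_push: "\<lbrakk>a \<Colon> A \<rightarrow> A'; c \<Colon> C' \<rightarrow> C; exten d C A\<rbrakk> \<Longrightarrow> (a \<triangleright> d) \<triangleleft> c = a \<triangleright> (d \<triangleleft> c)"
  using push_pull[of C C' A A' a c d] by (simp add: exten_def mor_def)

lemma ext_add_zero [simp]:
  "exten d C A \<Longrightarrow> d \<oplus>\<^bsub>E C A\<^esub> \<zero>\<^bsub>E C A\<^esub> = d" "exten d C A \<Longrightarrow> \<zero>\<^bsub>E C A\<^esub> \<oplus>\<^bsub>E C A\<^esub> d = d"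
  using abelian_monoid.r_zero[of "E C A"] abelian_monoid.l_zero[of "E C A"]
    ext_groupD abelian_group_def extenD(3) by metis+

lemma ext_add_neg [simp]:
  "exten d C A \<Longrightarrow> d \<oplus>\<^bsub>E C A\<^esub> (\<ominus>\<^bsub>E C A\<^esub> d) = \<zero>\<^bsub>E C A\<^esub>"
  "exten d C A \<Longrightarrow> (\<ominus>\<^bsub>E C A\<^esub> d) \<oplus>\<^bsub>E C A\<^esub> d = \<zero>\<^bsub>E C A\<^esub>"
  using abelian_group.r_neg[of "E C A"] abelian_group.l_neg[of "E C A"] ext_groupD extenD(3) by metis+

lemma ext_add_assoc:
  "\<lbrakk>exten d C A; exten d' C A; exten d'' C A\<rbrakk> \<Longrightarrow>
    (d \<oplus>\<^bsub>E C A\<^esub> d') \<oplus>\<^bsub>E C A\<^esub> d'' = d \<oplus>\<^bsub>E C A\<^esub> (d' \<oplus>\<^bsub>E C A\<^esub> d'')"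
  using abelian_monoid.a_assoc[of "E C A"] ext_groupD abelian_group_def extenD(3) by metis

lemma ext_add_comm:
  "\<lbrakk>exten d C A; exten d' C A\<rbrakk> \<Longrightarrow> d \<oplus>\<^bsub>E C A\<^esub> d' = d' \<oplus>\<^bsub>E C A\<^esub> d"
  using abelian_monoid.a_comm[of "E C A"] ext_groupD abelian_group_def extenD(3) by metis

lemma ext_add_neg_eq: "\<lbrakk>exten d C A; exten d' C A; d \<oplus>\<^bsub>E C A\<^esub> (\<ominus>\<^bsub>E C A\<^esub> d') = \<zero>\<^bsub>E C A\<^esub>\<rbrakk> \<Longrightarrow> d = d'"
  by (metis ext_add_assoc ext_add_neg(2) ext_add_zero exten_neg)

lemma triangleD:
  assumes "triangle \<C> A x B y C \<delta>"
  shows "x \<Colon> A \<rightarrow> B" "y \<Colon> B \<rightarrow> C" "exten \<delta> C A" "A \<in> Ob \<C>" "B \<in> Ob \<C>" "C \<in> Ob \<C>"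
  using triangle_mor[OF assms] by (auto simp: exten_def mor_def)

lemma triangle_exists:
  assumes "exten \<delta> C A"
  shows "\<exists>x B y. triangle \<C> A x B y C \<delta>"
proof -
  obtain s where "s \<in> sequences \<C> C A" "realn \<C> C A \<delta> = seq_equiv \<C> C A `` {s}"
    using realn_class[OF extenD[OF assms]] by (auto simp: quotient_def)
  moreover obtain x B y where "s = (x, B, y)" by (cases s)
  moreover have "(s, s) \<in> seq_equiv \<C> C A"
  proof -
    have "B \<in> Ob \<C>" "x \<Colon> A \<rightarrow> B" "y \<Colon> B \<rightarrow> C"
      using calculation extenD[OF assms] by (auto simp: sequences_def mor_def)
    then show ?thesis using calculation iso_id[of B]
      by (auto simp: seq_equiv_def sequences_def intro!: bexI[of _ "Id \<C> B"])
  qed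
  ultimately show ?thesis using assms by (auto simp: triangle_def exten_def sequences_def)
qed

text \<open>The class \<open>realn\<close> is only known through some representative
  \<open>(u, D, v)\<close>. Comparison through it shows that every triangle on
  \<open>\<delta>\<close> may serve as the representative.\<close>

lemma triangle_iff_equiv:
  assumes "triangle \<C> A x B y C \<delta>"
  shows "triangle \<C> A x' B' y' C \<delta> \<longleftrightarrow> ((x, B, y), (x', B', y')) \<in> seq_equiv \<C> C A"
proof -
  note t = triangleD[OF assms]
  obtain s where s: "s \<in> sequences \<C> C A" "realn \<C> C A \<delta> = seq_equiv \<C> C A `` {s}"
    using realn_class[OF extenD[OF t(3)]] by (auto simp: quotient_def)
  obtain u D v where suv: "s = (u, D, v)" by (cases s)
  have "((u, D, v), (x, B, y)) \<in> seq_equiv \<C> C A"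
    using assms s suv by (auto simp: triangle_def)
  then obtain b where b: "b \<in> isos \<C> D B" "b \<cdot> u = x" "y \<cdot> b = v" and D: "D \<in> Ob \<C>"
    "u \<Colon> A \<rightarrow> D" "v \<Colon> D \<rightarrow> C"
    using t by (auto simp: seq_equiv_def sequences_def mor_def)
  note bm = iso_mor[OF b(1) D(1) t(5)]
  have *: "(\<exists>c\<in>isos \<C> D B'. c \<cdot> u = x' \<and> y' \<cdot> c = v) \<longleftrightarrow> (\<exists>c\<in>isos \<C> B B'. c \<cdot> x = x' \<and> y' \<cdot> c = y)"
    (is "?L \<longleftrightarrow> ?R")
    if B': "B' \<in> Ob \<C>" "x' \<Colon> A \<rightarrow> B'" "y' \<Colon> B' \<rightarrow> C"
  proof
    assume ?L
    then obtain c where c: "c \<in> isos \<C> D B'" "c \<cdot> u = x'" "y' \<cdot> c = v" by blast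
    obtain b' where b': "b' \<in> isos \<C> B D" "b' \<cdot> x = u" "v \<cdot> b' = y"
      using isos_inverse[OF b(1) D(1) t(5) t(6) t(4) _ _ _ _ b(2,3)] t D by (auto simp: mor_def)
    note cm = iso_mor[OF c(1) D(1) B'(1)] and b'm = iso_mor[OF b'(1) t(5) D(1)]
    have "(c \<cdot> b') \<cdot> x = x'" using assoc[OF t(1) b'm cm] b'(2) c(2) by simp
    moreover have "y' \<cdot> (c \<cdot> b') = y" using assoc[OF b'm cm B'(3)] c(3) b'(3) by simp
    ultimately show ?R using iso_cmp[OF b'(1) c(1) t(5) D(1) B'(1)] by blast
  next
    assume ?R
    then obtain c where c: "c \<in> isos \<C> B B'" "c \<cdot> x = x'" "y' \<cdot> c = y" by blast
    note cm = iso_mor[OF c(1) t(5) B'(1)]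
    have "(c \<cdot> b) \<cdot> u = x'" using assoc[OF D(2) bm cm] b(2) c(2) by simp
    moreover have "y' \<cdot> (c \<cdot> b) = v" using assoc[OF bm cm B'(3)] c(3) b(3) by simp
    ultimately show ?L using iso_cmp[OF b(1) c(1) D(1) t(5) B'(1)] by blast
  qed
  have "triangle \<C> A x' B' y' C \<delta> \<longleftrightarrow> B' \<in> Ob \<C> \<and> ((u, D, v), (x', B', y')) \<in> seq_equiv \<C> C A"
    using t s suv by (auto simp: triangle_def exten_def)
  also have "\<dots> \<longleftrightarrow> ((x, B, y), (x', B', y')) \<in> seq_equiv \<C> C A"
    using * t D by (auto simp: seq_equiv_def sequences_def mor_def)
  finally show ?thesis .
qed

lemma triangle_middle_iso:
  assumes t: "triangle \<C> A x B y C \<delta>" and b: "b \<in> isos \<C> B B'" "B' \<in> Ob \<C>"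
    and b': "b' \<Colon> B' \<rightarrow> B" "b' \<cdot> b = Id \<C> B" "b \<cdot> b' = Id \<C> B'"
  shows "triangle \<C> A (b \<cdot> x) B' (y \<cdot> b') C \<delta>"
proof -
  note t' = triangleD[OF t]
  have bm: "b \<Colon> B \<rightarrow> B'" using iso_mor b t' by blast
  have "y \<cdot> b' \<cdot> b = y" using assoc[OF bm b'(1) t'(2)] b'(2) t' by simp
  moreover have "b \<cdot> x \<Colon> A \<rightarrow> B'" "y \<cdot> b' \<Colon> B' \<rightarrow> C" using bm b' t' by blast+
  ultimately show ?thesis unfolding triangle_iff_equiv[OF t]
    using t' b by (auto simp: seq_equiv_def sequences_def mor_def)
qed

section \<open>Exactness and isomorphisms of triangles\<close>

lemma mor_op: "linear_category.mor (op_cat \<C>) f X Y \<longleftrightarrow> f \<Colon> Y \<rightarrow> X"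
proof -
  have "linear_category K (op_cat \<C>)"
    using extriangulated_op by (simp add: extriangulated_def additive_category_def)
  from linear_category.mor_def[OF this] show ?thesis by (auto simp: mor_def)
qed

lemma exten_op: "extriangulated.exten (op_cat \<C>) d C A \<longleftrightarrow> exten d A C"
  using extriangulated.exten_def[OF extriangulated_op] by (auto simp: exten_def)

text \<open>Rewriting an instance at the opposite category with these equations turns it into the
  dual statement about \<open>\<C>\<close> itself.\<close>

lemmas op_unfold = op_cat_simps triangle_op biproduct_op isos_op zero_object_op mor_op exten_op

lemma zero_objectD:
  assumes "zero_object \<C> Z"
  shows "Z \<in> Ob \<C>" "\<lbrakk>f \<Colon> X \<rightarrow> Z; g \<Colon> X \<rightarrow> Z\<rbrakk> \<Longrightarrow> f = g" "\<lbrakk>f \<Colon> Z \<rightarrow> X; g \<Colon> Z \<rightarrow> X\<rbrakk> \<Longrightarrow> f = g"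
  using assms by (auto simp: zero_object_def mor_def)

lemma biproduct_zero:
  assumes Z: "zero_object \<C> Z" and A: "A \<in> Ob \<C>"
  shows "biproduct \<C> A Z A (Id \<C> A) \<zero>\<^bsub>H Z A\<^esub> (Id \<C> A) \<zero>\<^bsub>H A Z\<^esub>"
proof -
  note z = zero_objectD[OF Z]
  have m: "\<zero>\<^bsub>H Z A\<^esub> \<Colon> Z \<rightarrow> A" "\<zero>\<^bsub>H A Z\<^esub> \<Colon> A \<rightarrow> Z" "Id \<C> A \<Colon> A \<rightarrow> A" "Id \<C> Z \<Colon> Z \<rightarrow> Z"
    using z A by auto
  show ?thesis
    using m cmp_zero_left[OF m(2) A] z(2)[OF mor_cmp[OF m(1,2)] m(4)] z
    by (intro biproductI) (auto intro: z(2,3) simp: A)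
qed

text \<open>This split triangle and its mirror \<open>triangle_id_right\<close> are test objects:
  mapping them to or from a given triangle yields the vanishing and exactness statements in degree
  zero.\<close>

lemma triangle_id_left:
  assumes Z: "zero_object \<C> Z" and A: "A \<in> Ob \<C>"
  shows "triangle \<C> A (Id \<C> A) A \<zero>\<^bsub>H A Z\<^esub> Z \<zero>\<^bsub>E Z A\<^esub>"
  using realn_zero[OF biproduct_zero[OF assms]] zero_objectD(1)[OF Z] A exten_zero
  by (auto simp: triangle_def exten_def)

lemma triangle_id_right:
  assumes Z: "zero_object \<C> Z" and A: "A \<in> Ob \<C>"
  shows "triangle \<C> Z \<zero>\<^bsub>H Z A\<^esub> A (Id \<C> A) A \<zero>\<^bsub>E A Z\<^esub>"
  using realn_zero[OF biproduct_swap[OF biproduct_zero[OF assms]]] zero_objectD(1)[OF Z] A exten_zero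
  by (auto simp: triangle_def exten_def)

lemma realn_morphism':
  assumes "triangle \<C> A x B y C \<delta>" "triangle \<C> A' x' B' y' C' \<delta>'" "a \<Colon> A \<rightarrow> A'" "c \<Colon> C \<rightarrow> C'" "a \<triangleright> \<delta> = \<delta>' \<triangleleft> c"
  obtains b where "b \<Colon> B \<rightarrow> B'" "b \<cdot> x = x' \<cdot> a" "y' \<cdot> b = c \<cdot> y"
  using realn_morphism[OF assms(1,2) morD(3)[OF assms(3)] morD(3)[OF assms(4)] assms(5)]
    triangleD(5)[OF assms(1)] triangleD(5)[OF assms(2)] by (auto simp: mor_def)

lemma ET3':
  assumes "triangle \<C> A x B y C \<delta>" "triangle \<C> A' x' B' y' C' \<delta>'" "a \<Colon> A \<rightarrow> A'" "b \<Colon> B \<rightarrow> B'" "b \<cdot> x = x' \<cdot> a"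
  obtains c where "c \<Colon> C \<rightarrow> C'" "c \<cdot> y = y' \<cdot> b" "a \<triangleright> \<delta> = \<delta>' \<triangleleft> c"
  using ET3[OF assms(1,2) morD(3)[OF assms(3)] morD(3)[OF assms(4)] assms(5)]
    triangleD(6)[OF assms(1)] triangleD(6)[OF assms(2)] by (auto simp: mor_def)

lemma ET3_op':
  assumes "triangle \<C> A x B y C \<delta>" "triangle \<C> A' x' B' y' C' \<delta>'" "b \<Colon> B \<rightarrow> B'" "c \<Colon> C \<rightarrow> C'" "c \<cdot> y = y' \<cdot> b"
  obtains a where "a \<Colon> A \<rightarrow> A'" "b \<cdot> x = x' \<cdot> a" "a \<triangleright> \<delta> = \<delta>' \<triangleleft> c"
  using ET3_op[OF assms(1,2) morD(3)[OF assms(3)] morD(3)[OF assms(4)] assms(5)]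
    triangleD(4)[OF assms(1)] triangleD(4)[OF assms(2)] by (auto simp: mor_def)

text \<open>The pair \<open>(x, 1)\<close> maps the triangle to
  \<open>B = B \<rightarrow> 0\<close>, and the resulting morphism of cones exhibits the pushed
  extension as a pullback of a zero extension.\<close>

lemma triangle_push_zero:
  assumes t: "triangle \<C> A x B y C \<delta>"
  shows "x \<triangleright> \<delta> = \<zero>\<^bsub>E C B\<^esub>"
proof -
  note d = triangleD[OF t]
  obtain Z where Z: "zero_object \<C> Z" using zero_object_exists by blast
  obtain c where c: "c \<Colon> C \<rightarrow> Z" "x \<triangleright> \<delta> = \<zero>\<^bsub>E Z B\<^esub> \<triangleleft> c"
    using ET3'[OF t triangle_id_left[OF Z d(5)] d(1) mor_id[OF d(5)]] d by auto
  then show ?thesis using pull_zero d by auto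
qed

lemma triangle_cmp_zero:
  assumes t: "triangle \<C> A x B y C \<delta>"
  shows "y \<cdot> x = \<zero>\<^bsub>H A C\<^esub>"
proof -
  note d = triangleD[OF t]
  obtain Z where Z: "zero_object \<C> Z" using zero_object_exists by blast
  note z = zero_objectD(1)[OF Z]
  obtain c where c: "c \<Colon> Z \<rightarrow> C" "c \<cdot> \<zero>\<^bsub>H A Z\<^esub> = y \<cdot> x"
    using ET3'[OF triangle_id_left[OF Z d(4)] t mor_id[OF d(4)] d(1)] by auto
  then show ?thesis using cmp_zero_right d by auto
qed

text \<open>As \<open>c\<close> pulls \<open>\<delta>\<close> back to zero, \<open>(0, c)\<close> is
  a morphism to \<open>\<delta>\<close> from the zero extension of \<open>X\<close> by a zero
  object; its realization on the middle terms is the lift.\<close>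

lemma lift_along_deflation:
  assumes t: "triangle \<C> A x B y C \<delta>" and c: "c \<Colon> X \<rightarrow> C" "\<delta> \<triangleleft> c = \<zero>\<^bsub>E X A\<^esub>"
  obtains b where "b \<Colon> X \<rightarrow> B" "y \<cdot> b = c"
proof -
  note d = triangleD[OF t]
  obtain Z where Z: "zero_object \<C> Z" using zero_object_exists by blast
  note z = zero_objectD(1)[OF Z] and X = morD(1)[OF c(1)]
  have m: "\<zero>\<^bsub>H Z A\<^esub> \<Colon> Z \<rightarrow> A" using z d by auto
  have "\<zero>\<^bsub>H Z A\<^esub> \<triangleright> \<zero>\<^bsub>E X Z\<^esub> = \<delta> \<triangleleft> c" using push_zero[OF m X] c by simp
  from realn_morphism'[OF triangle_id_right[OF Z X] t m c(1) this] that c show ?thesis by auto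
qed

text \<open>The square with corners \<open>X\<close>, \<open>0\<close>, \<open>B\<close>,
  \<open>C\<close> commutes, so the dual of (ET3) maps \<open>X = X \<rightarrow> 0\<close> to the
  triangle, and the first component of this map is the factor.\<close>

lemma factor_through_inflation:
  assumes t: "triangle \<C> A x B y C \<delta>" and b: "b \<Colon> X \<rightarrow> B" "y \<cdot> b = \<zero>\<^bsub>H X C\<^esub>"
  obtains a where "a \<Colon> X \<rightarrow> A" "x \<cdot> a = b"
proof -
  note d = triangleD[OF t]
  obtain Z where Z: "zero_object \<C> Z" using zero_object_exists by blast
  note z = zero_objectD(1)[OF Z] and X = morD(1)[OF b(1)]
  have m: "\<zero>\<^bsub>H Z C\<^esub> \<Colon> Z \<rightarrow> C" "\<zero>\<^bsub>H X Z\<^esub> \<Colon> X \<rightarrow> Z" using z d X by auto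
  have "\<zero>\<^bsub>H Z C\<^esub> \<cdot> \<zero>\<^bsub>H X Z\<^esub> = y \<cdot> b" using cmp_zero_left[OF m(2) d(6)] b by simp
  from ET3_op'[OF triangle_id_left[OF Z X] t b(1) m(1) this] that b show ?thesis by auto
qed

end

lemmas (in extriangulated) triangle_pull_zero =
  extriangulated.triangle_push_zero[OF extriangulated_op, unfolded op_unfold]
lemmas (in extriangulated) extend_along_inflation =
  extriangulated.lift_along_deflation[OF extriangulated_op, unfolded op_unfold]
lemmas (in extriangulated) factor_through_deflation =
  extriangulated.factor_through_inflation[OF extriangulated_op, unfolded op_unfold]

section \<open>Exactness for extensions in degree one\<close>

context extriangulated
begin

text \<open>An extension that dies in \<open>B\<close> lets \<open>x\<close> extend over the
  inflation that realizes it; the map of cones induced by this extension is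
  \<open>c\<close>.\<close>

lemma ext_exact_left:
  assumes t: "triangle \<C> A x B y C \<delta>" and e: "exten e X A" "x \<triangleright> e = \<zero>\<^bsub>E X B\<^esub>"
  obtains c where "c \<Colon> X \<rightarrow> C" "e = \<delta> \<triangleleft> c"
proof -
  note d = triangleD[OF t]
  obtain x' N y' where t': "triangle \<C> A x' N y' X e" using triangle_exists[OF e(1)] by blast
  note d' = triangleD[OF t']
  obtain b where b: "b \<Colon> N \<rightarrow> B" "b \<cdot> x' = x" using extend_along_inflation[OF t' d(1) e(2)] by blast
  from ET3'[OF t' t mor_id[OF d(4)] b(1)] b d e that show ?thesis by (metis cmp_id push_id)
qed

text \<open>The octahedron on the composite \<open>A \<rightarrow> B \<rightarrow> N\<close> gives
  \<open>\<delta>''\<close> whose push along \<open>x\<close> is the pullback of \<open>e\<close>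
  along \<open>v\<close>. Since \<open>y\<close> pushes \<open>e\<close> to zero, \<open>v\<close>
  has a section \<open>r\<close>, and pulling \<open>\<delta>''\<close> back along \<open>r\<close>
  gives the preimage.\<close>

lemma ext_exact_middle:
  assumes t: "triangle \<C> A x B y C \<delta>" and e: "exten e X B" "y \<triangleright> e = \<zero>\<^bsub>E X C\<^esub>"
  obtains e' where "exten e' X A" "x \<triangleright> e' = e"
proof -
  note d = triangleD[OF t]
  obtain g N g' where t': "triangle \<C> B g N g' X e" using triangle_exists[OF e(1)] by blast
  obtain E' h h' u v \<delta>'' where
    t1: "triangle \<C> A h N h' E' \<delta>''" and t2: "triangle \<C> C u E' v X (y \<triangleright> e)" and
    eq: "x \<triangleright> \<delta>'' = e \<triangleleft> v"
    using ET4[OF t t'] by blast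
  note d1 = triangleD[OF t1] note d2 = triangleD[OF t2]
  have "(y \<triangleright> e) \<triangleleft> Id \<C> X = \<zero>\<^bsub>E X C\<^esub>" using e d2 by simp
  then obtain r where r: "r \<Colon> X \<rightarrow> E'" "v \<cdot> r = Id \<C> X"
    using lift_along_deflation[OF t2 mor_id[OF d2(6)]] by blast
  have "x \<triangleright> (\<delta>'' \<triangleleft> r) = e \<triangleleft> v \<triangleleft> r" using pull_push[OF d(1) r(1) d1(3)] eq by simp
  also have "\<dots> = e" using pull_pull[OF d2(2) r(1) e(1)] r(2) e by simp
  finally show ?thesis using that exten_pull[OF r(1) d1(3)] by blast
qed

end

lemmas (in extriangulated) ext_exact_left_op =
  extriangulated.ext_exact_left[OF extriangulated_op, unfolded op_unfold]
lemmas (in extriangulated) ext_exact_middle_op =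
  extriangulated.ext_exact_middle[OF extriangulated_op, unfolded op_unfold]

section \<open>Five lemma, uniqueness of cones, weak pushouts\<close>

context extriangulated
begin

text \<open>One half of a five lemma. Fillers are not unique, so only a right inverse is
  constructed; the left inverse comes from the dual statement.\<close>

lemma middle_split_epi:
  assumes t: "triangle \<C> A x B y C \<delta>" and t': "triangle \<C> A' x' B' y' C' \<delta>'"
    and a: "a \<in> isos \<C> A A'" and c: "c \<in> isos \<C> C C'" and ac: "a \<triangleright> \<delta> = \<delta>' \<triangleleft> c"
    and b: "b \<Colon> B \<rightarrow> B'" "b \<cdot> x = x' \<cdot> a" "y' \<cdot> b = c \<cdot> y"
  obtains s where "s \<Colon> B' \<rightarrow> B" "b \<cdot> s = Id \<C> B'"
proof -
  note d = triangleD[OF t] note d' = triangleD[OF t']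
  obtain a' where a': "a' \<Colon> A' \<rightarrow> A" "a' \<cdot> a = Id \<C> A" "a \<cdot> a' = Id \<C> A'" "a \<Colon> A \<rightarrow> A'"
    using isoD[OF a d(4) d'(4)] by metis
  obtain c' where c': "c' \<Colon> C' \<rightarrow> C" "c' \<cdot> c = Id \<C> C" "c \<cdot> c' = Id \<C> C'" "c \<Colon> C \<rightarrow> C'"
    using isoD[OF c d(6) d'(6)] by metis
  have cy: "c' \<cdot> y' \<Colon> B' \<rightarrow> C" using c' d' by blast
  have "\<delta> = a' \<triangleright> (a \<triangleright> \<delta>)" using push_push[OF a'(4,1) d(3)] a' d by simp
  then have "\<delta> \<triangleleft> (c' \<cdot> y') = (a' \<triangleright> (\<delta>' \<triangleleft> c)) \<triangleleft> (c' \<cdot> y')" using ac by simp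
  also have "\<dots> = a' \<triangleright> (\<delta>' \<triangleleft> c \<triangleleft> (c' \<cdot> y'))" using pull_push[OF a'(1) cy] c' d' by blast
  also have "\<delta>' \<triangleleft> c \<triangleleft> (c' \<cdot> y') = \<delta>' \<triangleleft> (c \<cdot> (c' \<cdot> y'))" using pull_pull[OF c'(4) cy d'(3)] by simp
  also have "c \<cdot> (c' \<cdot> y') = y'" using assoc[OF d'(2) c'(1,4)] c'(3) d' by simp
  also have "\<delta>' \<triangleleft> y' = \<zero>\<^bsub>E B' A'\<^esub>" using triangle_pull_zero[OF t'] .
  finally have "\<delta> \<triangleleft> (c' \<cdot> y') = \<zero>\<^bsub>E B' A\<^esub>" using push_zero[OF a'(1) d'(5)] by simp
  then obtain s where s: "s \<Colon> B' \<rightarrow> B" "y \<cdot> s = c' \<cdot> y'" using lift_along_deflation[OF t cy] by blast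
  have y'bs: "y' \<cdot> (b \<cdot> s) = y'"
    using assoc[OF s(1) b(1) d'(2)] b(3) assoc[OF s(1) d(2) c'(4)] s(2) assoc[OF d'(2) c'(1,4)] c'(3) d'
      by simp
  have bs: "b \<cdot> s \<Colon> B' \<rightarrow> B'" using b s by blast
  \<comment> \<open>The defect of \<open>s\<close> as a section of \<open>b\<close>. It is killed by
    \<open>y'\<close>, so it comes from \<open>A'\<close> and can be compensated by a map through
    \<open>x\<close>.\<close>
  let ?w = "Id \<C> B' \<oplus>\<^bsub>H B' B'\<^esub> (\<ominus>\<^bsub>H B' B'\<^esub> (b \<cdot> s))"
  have i: "Id \<C> B' \<Colon> B' \<rightarrow> B'" using d' by auto
  have n: "\<ominus>\<^bsub>H B' B'\<^esub> (b \<cdot> s) \<Colon> B' \<rightarrow> B'" using bs by auto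
  have w: "?w \<Colon> B' \<rightarrow> B'" using i n by blast
  have "y' \<cdot> ?w = \<zero>\<^bsub>H B' C'\<^esub>"
    using cmp_add_right[OF i n d'(2)] cmp_add_right(3)[OF bs bs d'(2)] y'bs d' by simp
  then obtain t where tt: "t \<Colon> B' \<rightarrow> A'" "x' \<cdot> t = ?w" using factor_through_inflation[OF t' w] by blast
  have at: "a' \<cdot> t \<Colon> B' \<rightarrow> A" and xat: "x \<cdot> (a' \<cdot> t) \<Colon> B' \<rightarrow> B" using a' tt d by blast+
  have "b \<cdot> (x \<cdot> (a' \<cdot> t)) = x' \<cdot> (a \<cdot> (a' \<cdot> t))"
    using assoc[OF at d(1) b(1)] b(2) assoc[OF at a'(4) d'(1)] by simp
  also have "a \<cdot> (a' \<cdot> t) = t" using assoc[OF tt(1) a'(1,4)] a'(3) tt by simp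
  finally have "b \<cdot> (x \<cdot> (a' \<cdot> t)) = ?w" using tt by simp
  then have "b \<cdot> (s \<oplus>\<^bsub>H B' B\<^esub> (x \<cdot> (a' \<cdot> t))) = (b \<cdot> s) \<oplus>\<^bsub>H B' B'\<^esub> ?w"
    using cmp_add_right[OF s(1) xat b(1)] by simp
  also have "\<dots> = Id \<C> B'" using hom_cancel_neg3(1)[OF bs i] .
  finally show ?thesis using that mor_add[OF s(1) xat] by blast
qed

end

lemmas (in extriangulated) middle_split_mono =
  extriangulated.middle_split_epi[OF extriangulated_op, unfolded op_unfold]

context extriangulated
begin

lemma middle_iso:
  assumes t: "triangle \<C> A x B y C \<delta>" and t': "triangle \<C> A' x' B' y' C' \<delta>'"
    and a: "a \<in> isos \<C> A A'" and c: "c \<in> isos \<C> C C'" and ac: "a \<triangleright> \<delta> = \<delta>' \<triangleleft> c"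
    and b: "b \<Colon> B \<rightarrow> B'" "b \<cdot> x = x' \<cdot> a" "y' \<cdot> b = c \<cdot> y"
  shows "b \<in> isos \<C> B B'"
proof -
  obtain s where s: "s \<Colon> B' \<rightarrow> B" "b \<cdot> s = Id \<C> B'" using middle_split_epi[OF assms] .
  obtain r where r: "r \<Colon> B' \<rightarrow> B" "r \<cdot> b = Id \<C> B"
    using middle_split_mono[OF t' t c a ac[symmetric] b(1) b(3) b(2)] .
  show ?thesis using isoI2[OF b(1) r(1) s(1) r(2) s(2)] .
qed

text \<open>Since \<open>u\<close> pulls \<open>\<delta>\<close> back to zero,
  \<open>u = y w\<close> for some \<open>w\<close>; then \<open>u u = u y w = 0\<close>, and
  \<open>1 + u\<close> is invertible.\<close>

lemma cone_endo_iso: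
  assumes t: "triangle \<C> A x B y C \<delta>" and u: "u \<Colon> C \<rightarrow> C" "u \<cdot> y = \<zero>\<^bsub>H B C\<^esub>" "\<delta> \<triangleleft> u = \<zero>\<^bsub>E C A\<^esub>"
  shows "Id \<C> C \<oplus>\<^bsub>H C C\<^esub> u \<in> isos \<C> C C"
proof -
  note d = triangleD[OF t]
  obtain w where w: "w \<Colon> C \<rightarrow> B" "y \<cdot> w = u" using lift_along_deflation[OF t u(1,3)] .
  have "u \<cdot> u = u \<cdot> y \<cdot> w" using assoc[OF w(1) d(2) u(1)] w by simp
  then have "u \<cdot> u = \<zero>\<^bsub>H C C\<^esub>" using u cmp_zero_left[OF w(1)] d by simp
  then show ?thesis using iso_square_zero[OF u(1)] by simp
qed

lemma cone_endo_iso':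
  assumes t: "triangle \<C> A x B y C \<delta>" and c: "c \<Colon> C \<rightarrow> C" "c \<cdot> y = y" "\<delta> \<triangleleft> c = \<delta>"
  shows "c \<in> isos \<C> C C"
proof -
  note d = triangleD[OF t]
  have i: "Id \<C> C \<Colon> C \<rightarrow> C" using d by auto
  have n: "\<ominus>\<^bsub>H C C\<^esub> Id \<C> C \<Colon> C \<rightarrow> C" using i by auto
  let ?u = "(\<ominus>\<^bsub>H C C\<^esub> Id \<C> C) \<oplus>\<^bsub>H C C\<^esub> c"
  have u: "?u \<Colon> C \<rightarrow> C" using n c by blast
  have "?u \<cdot> y = \<zero>\<^bsub>H B C\<^esub>"
    using cmp_add_left[OF n c(1) d(2)] cmp_add_left(3)[OF i i d(2)] c d by simp
  moreover have "\<delta> \<triangleleft> ?u = \<zero>\<^bsub>E C A\<^esub>"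
    using pull_mor_linear[OF n c(1) d(3)] pull_mor_linear(3)[OF i i d(3)] c d by simp
  ultimately have "Id \<C> C \<oplus>\<^bsub>H C C\<^esub> ?u \<in> isos \<C> C C" using cone_endo_iso[OF t u] by blast
  then show ?thesis using i c by simp
qed

text \<open>(ET3) gives morphisms of cones in both directions. Their composites fix the deflation
  and the extension, hence are invertible by \<open>cone_endo_iso'\<close>, and so are the morphisms
  themselves.\<close>

lemma cone_unique:
  assumes t: "triangle \<C> A x B y C \<delta>" and t': "triangle \<C> A x B y' C' \<delta>'"
  obtains c where "c \<in> isos \<C> C C'" "c \<cdot> y = y'" "\<delta>' \<triangleleft> c = \<delta>"
proof -
  note d = triangleD[OF t] note d' = triangleD[OF t']
  have e: "Id \<C> B \<cdot> x = x \<cdot> Id \<C> A" using d by simp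
  obtain c where c: "c \<Colon> C \<rightarrow> C'" "c \<cdot> y = y'" "\<delta>' \<triangleleft> c = \<delta>"
    using ET3'[OF t t' mor_id[OF d(4)] mor_id[OF d(5)] e] d d' by (metis cmp_id push_id)
  obtain c' where c': "c' \<Colon> C' \<rightarrow> C" "c' \<cdot> y' = y" "\<delta> \<triangleleft> c' = \<delta>'"
    using ET3'[OF t' t mor_id[OF d(4)] mor_id[OF d(5)] e] d d' by (metis cmp_id push_id)
  have "c' \<cdot> c \<in> isos \<C> C C"
    using cone_endo_iso'[OF t mor_cmp[OF c(1) c'(1)]] assoc[OF d(2) c(1) c'(1)] pull_pull[OF c'(1) c(1) d(3)]
      c c' by simp
  then obtain l where l: "l \<Colon> C \<rightarrow> C" "l \<cdot> (c' \<cdot> c) = Id \<C> C" using isoD d by metis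
  have "c \<cdot> c' \<in> isos \<C> C' C'"
    using cone_endo_iso'[OF t' mor_cmp[OF c'(1) c(1)]] assoc[OF d'(2) c'(1) c(1)]
      pull_pull[OF c(1) c'(1) d'(3)] c c' by simp
  then obtain r where r: "r \<Colon> C' \<rightarrow> C'" "(c \<cdot> c') \<cdot> r = Id \<C> C'" using isoD d' by metis
  have lc: "l \<cdot> c' \<Colon> C' \<rightarrow> C" "l \<cdot> c' \<cdot> c = Id \<C> C" using l c' c assoc[OF c(1) c'(1) l(1)] by auto
  have cr: "c' \<cdot> r \<Colon> C' \<rightarrow> C" "c \<cdot> (c' \<cdot> r) = Id \<C> C'" using r c' c assoc[OF r(1) c'(1) c(1)] by auto
  show ?thesis using that isoI2[OF c(1) lc(1) cr(1) lc(2) cr(2)] c by blast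
qed

text \<open>The transported extension has some realization, and the five lemma identifies its middle
  term with \<open>B\<close> compatibly with the transported maps.\<close>

lemma triangle_transport:
  assumes t: "triangle \<C> A x B y C \<delta>"
    and a: "a \<in> isos \<C> A A'" "A' \<in> Ob \<C>" "a' \<Colon> A' \<rightarrow> A" "a' \<cdot> a = Id \<C> A" "a \<cdot> a' = Id \<C> A'"
    and c: "c \<in> isos \<C> C C'" "C' \<in> Ob \<C>" "c' \<Colon> C' \<rightarrow> C" "c' \<cdot> c = Id \<C> C" "c \<cdot> c' = Id \<C> C'"
  shows "triangle \<C> A' (x \<cdot> a') B (c \<cdot> y) C' (a \<triangleright> (\<delta> \<triangleleft> c'))"
proof -
  note d = triangleD[OF t]
  have am: "a \<Colon> A \<rightarrow> A'" using iso_mor[OF a(1) d(4) a(2)] .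
  have cm: "c \<Colon> C \<rightarrow> C'" using iso_mor[OF c(1) d(6) c(2)] .
  let ?d = "a \<triangleright> (\<delta> \<triangleleft> c')"
  have e: "exten ?d C' A'" using am c d by blast
  obtain u D v where t': "triangle \<C> A' u D v C' ?d" using triangle_exists[OF e] by blast
  note d' = triangleD[OF t']
  have ac: "a \<triangleright> \<delta> = ?d \<triangleleft> c"
    using pull_push[OF am cm exten_pull[OF c(3) d(3)]] pull_pull[OF c(3) cm d(3)] c(4) d by simp
  obtain b where b: "b \<Colon> B \<rightarrow> D" "b \<cdot> x = u \<cdot> a" "v \<cdot> b = c \<cdot> y"
    using realn_morphism'[OF t t' am cm ac] .
  have bi: "b \<in> isos \<C> B D" using middle_iso[OF t t' a(1) c(1) ac b] .
  have "b \<cdot> (x \<cdot> a') = u"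
    using assoc[OF a(3) d(1) b(1)] b(2) assoc[OF a(3) am d'(1)] a(5) d' by simp
  then obtain b' where b': "b' \<in> isos \<C> D B" "b' \<cdot> u = x \<cdot> a'" "c \<cdot> y \<cdot> b' = v"
    using isos_inverse[OF bi d(5) d'(5) c(2) a(2) morD(3)[OF mor_cmp[OF a(3) d(1)]] morD(3)[OF d'(1)]
      morD(3)[OF mor_cmp[OF d(2) cm]] morD(3)[OF d'(2)] _ b(3)] by blast
  moreover have "x \<cdot> a' \<Colon> A' \<rightarrow> B" "c \<cdot> y \<Colon> B \<rightarrow> C'" using d a cm by blast+
  ultimately show ?thesis unfolding triangle_iff_equiv[OF t']
    using d d' a c by (auto simp: seq_equiv_def sequences_def mor_def)
qed

text \<open>This replaces a pushout of \<open>x\<close> and \<open>f\<close>: the cone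
  \<open>W\<close> of \<open>(x, f)\<close> is a weak one, up to a sign. The map is an inflation as
  a composite of two: the split inflation \<open>(1, f)\<close> into \<open>A \<oplus> N\<close>,
  and the direct sum of \<open>x\<close> with the identity of \<open>N\<close>.\<close>

lemma inflation_pair:
  assumes t: "triangle \<C> A x B y C \<delta>" and f: "f \<Colon> A \<rightarrow> N" and P: "biproduct \<C> B N P i j p q"
  obtains W \<pi> \<delta>' where "triangle \<C> A ((i \<cdot> x) \<oplus>\<^bsub>H A P\<^esub> (j \<cdot> f)) P \<pi> W \<delta>'"
proof -
  note d = triangleD[OF t] and b = biproductD[OF P] and N = morD(2)[OF f]
  obtain Z where Z: "zero_object \<C> Z" using zero_object_exists by blast
  obtain S iA jA pA qA where S: "biproduct \<C> A N S iA jA pA qA" using biproduct_exists d N by meson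
  obtain C' iC jC pC qC where C': "biproduct \<C> C Z C' iC jC pC qC"
    using biproduct_exists d zero_objectD(1)[OF Z] by meson
  note s = biproductD[OF S]
  let ?g = "(i \<cdot> x \<cdot> pA) \<oplus>\<^bsub>H S P\<^esub> (j \<cdot> Id \<C> N \<cdot> qA)"
  obtain g' \<delta>1 where t1: "triangle \<C> S ?g P g' C' \<delta>1"
  proof -
    have e: "exten (iA \<triangleright> (\<delta> \<triangleleft> pC)) C' S" "exten (jA \<triangleright> (\<zero>\<^bsub>E Z N\<^esub> \<triangleleft> qC)) C' S"
      using s d N zero_objectD(1)[OF Z] biproductD(3,4)[OF C'] by blast+
    then show ?thesis
      using that realn_sum[OF t triangle_id_left[OF Z N] S P C'] exten_add[OF e] b(12)
      by (auto simp: triangle_def exten_def)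
  qed
  \<comment> \<open>Sheared coordinates on \<open>S\<close>: with \<open>?i = (1, f)\<close> as
    first inclusion and \<open>?q\<close> as second projection, \<open>S\<close> is again a
    biproduct of \<open>A\<close> and \<open>N\<close>, so \<open>?i\<close> is a split
    inflation.\<close>
  let ?i = "iA \<oplus>\<^bsub>H A S\<^esub> (jA \<cdot> f)" and ?q = "qA \<oplus>\<^bsub>H S N\<^esub> (\<ominus>\<^bsub>H S N\<^esub> (f \<cdot> pA))"
  have jf: "jA \<cdot> f \<Colon> A \<rightarrow> S" and fp: "f \<cdot> pA \<Colon> S \<rightarrow> N" using s f by blast+
  have nfp: "\<ominus>\<^bsub>H S N\<^esub> (f \<cdot> pA) \<Colon> S \<rightarrow> N" using fp by blast
  have pjf: "pA \<cdot> (jA \<cdot> f) = \<zero>\<^bsub>H A A\<^esub>"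
    using assoc[OF f s(2,3)] s(8) cmp_zero_left[OF f d(4)] by simp
  have qjf: "qA \<cdot> (jA \<cdot> f) = f" using assoc[OF f s(2,4)] s(6) f by simp
  have "biproduct \<C> A N S ?i jA pA ?q"
  proof (rule biproductI)
    show i1: "?i \<Colon> A \<rightarrow> S" using s jf by blast
    show q1: "?q \<Colon> S \<rightarrow> N" using s nfp by blast
    show "jA \<Colon> N \<rightarrow> S" "pA \<Colon> S \<rightarrow> A" "pA \<cdot> jA = \<zero>\<^bsub>H N A\<^esub>" using s by auto
    show "pA \<cdot> ?i = Id \<C> A" using cmp_add_right(1)[OF s(1) jf s(3)] s(5) pjf mor_id[OF d(4)] by simp
    have "(f \<cdot> pA) \<cdot> jA = \<zero>\<^bsub>H N N\<^esub>" using assoc[OF s(2,3) f] s(8) cmp_zero_right[OF f] N by simp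
    then show "?q \<cdot> jA = Id \<C> N"
      using cmp_add_left(1)[OF s(4) nfp s(2)] cmp_add_left(3)[OF fp fp s(2)] s(6) N mor_id[OF N] by simp
    have 1: "(f \<cdot> pA) \<cdot> iA = f" using assoc[OF s(1,3) f] s(5) f by simp
    have 2: "(f \<cdot> pA) \<cdot> (jA \<cdot> f) = \<zero>\<^bsub>H A N\<^esub>" using assoc[OF jf s(3) f] pjf cmp_zero_right[OF f d(4)] by simp
    have 3: "(f \<cdot> pA) \<cdot> ?i = f" using cmp_add_right(1)[OF s(1) jf fp] 1 2 f by simp
    have 4: "qA \<cdot> ?i = f" using cmp_add_right(1)[OF s(1) jf s(4)] s(7) qjf f by simp
    show "?q \<cdot> ?i = \<zero>\<^bsub>H A N\<^esub>"
      using cmp_add_left(1)[OF s(4) nfp i1] cmp_add_left(3)[OF fp fp i1] 3 4 f by simp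
    have m: "iA \<cdot> pA \<Colon> S \<rightarrow> S" "jA \<cdot> (f \<cdot> pA) \<Colon> S \<rightarrow> S" "jA \<cdot> qA \<Colon> S \<rightarrow> S" using s fp by blast+
    have "?i \<cdot> pA = (iA \<cdot> pA) \<oplus>\<^bsub>H S S\<^esub> (jA \<cdot> (f \<cdot> pA))"
      using cmp_add_left(1)[OF s(1) jf s(3)] assoc[OF s(3) f s(2)] by simp
    moreover have "jA \<cdot> ?q = (jA \<cdot> qA) \<oplus>\<^bsub>H S S\<^esub> (\<ominus>\<^bsub>H S S\<^esub> (jA \<cdot> (f \<cdot> pA)))"
      using cmp_add_right(1)[OF s(4) nfp s(2)] cmp_add_right(3)[OF fp fp s(2)] by simp
    ultimately have "(?i \<cdot> pA) \<oplus>\<^bsub>H S S\<^esub> (jA \<cdot> ?q) = (iA \<cdot> pA) \<oplus>\<^bsub>H S S\<^esub> ((jA \<cdot> (f \<cdot> pA)) \<oplus>\<^bsub>H S S\<^esub>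
      ((jA \<cdot> qA) \<oplus>\<^bsub>H S S\<^esub> (\<ominus>\<^bsub>H S S\<^esub> (jA \<cdot> (f \<cdot> pA)))))"
      using hom_add_assoc[OF m(1,2) mor_add[OF m(3) mor_neg[OF m(2)]]] by simp
    also have "\<dots> = Id \<C> S" using hom_cancel_neg3(1)[OF m(2,3)] s(9) by simp
    finally show "(?i \<cdot> pA) \<oplus>\<^bsub>H S S\<^esub> (jA \<cdot> ?q) = Id \<C> S" .
  qed
  then have t0: "triangle \<C> A ?i S ?q N \<zero>\<^bsub>E N A\<^esub>"
    using realn_zero[of A N S ?i jA pA ?q] d N s exten_zero[OF N d(4)] by (auto simp: triangle_def exten_def)
  obtain W h' \<delta>2 where t2: "triangle \<C> A (?g \<cdot> ?i) P h' W \<delta>2"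
    using ET4[OF t0 t1] by metis
  have ix: "i \<cdot> x \<Colon> A \<rightarrow> P" using b d by blast
  have m1: "i \<cdot> x \<cdot> pA \<Colon> S \<rightarrow> P" and m2: "j \<cdot> Id \<C> N \<cdot> qA \<Colon> S \<rightarrow> P" using b d s ix by auto
  have i1: "?i \<Colon> A \<rightarrow> S" using s jf by blast
  have "pA \<cdot> ?i = Id \<C> A" "qA \<cdot> ?i = f"
    using cmp_add_right(1)[OF s(1) jf s(3)] cmp_add_right(1)[OF s(1) jf s(4)] s(5,7) pjf qjf f mor_id[OF d(4)]
    by simp_all
  then have "?g \<cdot> ?i = (i \<cdot> x) \<oplus>\<^bsub>H A P\<^esub> (j \<cdot> f)"
    using cmp_add_left(1)[OF m1 m2 i1] assoc[OF i1 s(3) ix] assoc[OF i1 s(4) b(2)] b(2) ix by simp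
  then show ?thesis using t2 that by metis
qed

end

lemmas (in extriangulated) deflation_pair =
  extriangulated.inflation_pair[OF extriangulated_op, unfolded op_unfold]

section \<open>Higher extensions\<close>

primrec ypush :: "('k, 'o, 'm, 'e, 'z) extri_cat_scheme \<Rightarrow> 'm \<Rightarrow> ('k, 'o, 'e) yterm \<Rightarrow> ('k, 'o, 'e) yterm"
  where
    "ypush \<C> a (Emb \<epsilon>) = Emb (push \<C> a \<epsilon>)"
  | "ypush \<C> a Zero = Zero"
  | "ypush \<C> a (Plus s t) = Plus (ypush \<C> a s) (ypush \<C> a t)"
  | "ypush \<C> a (Scale k t) = Scale k (ypush \<C> a t)"
  | "ypush \<C> a (Tensor M t \<epsilon>) = Tensor M (ypush \<C> a t) \<epsilon>"

text \<open>The connecting map of the covariant long exact sequence.\<close>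

primrec yconn :: "'o \<Rightarrow> 'e \<Rightarrow> ('k, 'o, 'e) yterm \<Rightarrow> ('k, 'o, 'e) yterm"
  where
    "yconn C \<delta> (Emb \<epsilon>) = Tensor C (Emb \<delta>) \<epsilon>"
  | "yconn C \<delta> Zero = Zero"
  | "yconn C \<delta> (Plus s t) = Plus (yconn C \<delta> s) (yconn C \<delta> t)"
  | "yconn C \<delta> (Scale k t) = Scale k (yconn C \<delta> t)"
  | "yconn C \<delta> (Tensor M t \<epsilon>) = Tensor M (yconn C \<delta> t) \<epsilon>"

section \<open>Functoriality of terms and compatibility with the congruence\<close>

context extriangulated
begin

abbreviation wf_yterm :: "nat \<Rightarrow> 'o \<Rightarrow> 'o \<Rightarrow> ('k, 'o, 'e) yterm \<Rightarrow> bool"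
  where "wf_yterm \<equiv> ywf K \<C>"

abbreviation yeq_infix (\<open>(_ \<approx>\<^bsub>_,_,_\<^esub> _)\<close> [51, 0, 0, 0, 51] 50)
  where "s \<approx>\<^bsub>n,C,A\<^esub> t \<equiv> yeq K \<C> n C A s t"

lemmas yeq_trans' [trans] = yeq_trans[of K \<C>]

lemma ywfD:
  assumes "wf_yterm n C A t"
  shows "n \<ge> 1" "C \<in> Ob \<C>" "A \<in> Ob \<C>"
  using assms by (induction; simp)+

lemma ywf_simps [simp]:
  "wf_yterm n C A (Emb e) \<longleftrightarrow> n = 1 \<and> exten e C A"
  "wf_yterm n C A Zero \<longleftrightarrow> n \<ge> 1 \<and> C \<in> Ob \<C> \<and> A \<in> Ob \<C>"
  "wf_yterm n C A (Plus s t) \<longleftrightarrow> wf_yterm n C A s \<and> wf_yterm n C A t"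
  "wf_yterm n C A (Scale k t) \<longleftrightarrow> k \<in> carrier K \<and> wf_yterm n C A t"
  "wf_yterm (Suc n) C A (Tensor M t e) \<longleftrightarrow> wf_yterm n M A t \<and> exten e C M"
  by (auto elim: ywf.cases intro: ywf.intros ywf.intros(1)[unfolded One_nat_def] simp: exten_def dest: ywfD)

lemmas yeq_Emb_add' = yeq.yeq_Emb_add[unfolded One_nat_def]
  and yeq_Emb_smult' = yeq.yeq_Emb_smult[unfolded One_nat_def]

lemma ywf_Tensor: "wf_yterm n C A (Tensor M t e) \<longleftrightarrow> (\<exists>m. n = Suc m \<and> wf_yterm m M A t \<and> exten e C M)"
  by (cases n) (auto elim: ywf.cases)

lemma ypull_wf: "\<lbrakk>wf_yterm n C A t; c \<Colon> C' \<rightarrow> C\<rbrakk> \<Longrightarrow> wf_yterm n C' A (ypull \<C> c t)"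
  by (induction rule: ywf.induct)
    (auto simp: ywf_Tensor intro!: exten_pull[of c C' _ _ _] dest: morD simp: extenI)

lemma ypush_wf: "\<lbrakk>wf_yterm n C A t; a \<Colon> A \<rightarrow> A'\<rbrakk> \<Longrightarrow> wf_yterm n C A' (ypush \<C> a t)"
  by (induction rule: ywf.induct)
    (auto simp: ywf_Tensor intro!: exten_push[of a _ A' _ _] dest: morD simp: extenI)

lemma yconn_wf: "\<lbrakk>wf_yterm n X C t; exten \<delta> C A\<rbrakk> \<Longrightarrow> wf_yterm (Suc n) X A (yconn C \<delta> t)"
  by (induction rule: ywf.induct) (auto simp: extenI dest: extenD)

lemma yeq_wf: "s \<approx>\<^bsub>n,C,A\<^esub> t \<Longrightarrow> wf_yterm n C A s \<and> wf_yterm n C A t"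
proof (induction rule: yeq.induct)
  case (yeq_coend C M N f n A t \<epsilon>)
  have "f \<Colon> M \<rightarrow> N" using yeq_coend by (auto simp: mor_def)
  then show ?case using yeq_coend by (auto simp: ypull_wf extenI)
qed (auto simp: extenI exten_add exten_smult dest: ywfD)

text \<open>Functoriality holds strictly on terms; only linearity in the morphism requires the
  congruence.\<close>

lemma ypull_ypull:
  "\<lbrakk>wf_yterm n C A t; c \<Colon> C' \<rightarrow> C; c' \<Colon> C'' \<rightarrow> C'\<rbrakk> \<Longrightarrow> ypull \<C> (c \<cdot> c') t = ypull \<C> c' (ypull \<C> c t)"
proof (induction rule: ywf.induct)
  case (ywf_Emb C A e)
  then show ?case using pull_pull[of c C' C c' C'' e A] by (simp add: extenI)
next
  case (ywf_Tensor C M n A t e)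
  then show ?case using pull_pull[of c C' C c' C'' e M] by (simp add: extenI)
qed auto

lemma ypull_id: "wf_yterm n C A t \<Longrightarrow> ypull \<C> (Id \<C> C) t = t"
  by (induction rule: ywf.induct) (auto simp: pull_Id)

lemma ypush_ypush:
  "\<lbrakk>wf_yterm n C A t; a \<Colon> A \<rightarrow> A'; a' \<Colon> A' \<rightarrow> A''\<rbrakk> \<Longrightarrow> ypush \<C> (a' \<cdot> a) t = ypush \<C> a' (ypush \<C> a t)"
proof (induction rule: ywf.induct)
  case (ywf_Emb C A e)
  then show ?case using push_push[of a A A' a' A'' e C] by (simp add: extenI)
qed auto

lemma ypull_ypush:
  "\<lbrakk>wf_yterm n C A t; a \<Colon> A \<rightarrow> A'; c \<Colon> C' \<rightarrow> C\<rbrakk> \<Longrightarrow> ypull \<C> c (ypush \<C> a t) = ypush \<C> a (ypull \<C> c t)"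
  by (induction rule: ywf.induct) (auto simp: pull_push extenI)

lemma ypull_yconn:
  "\<lbrakk>wf_yterm n X C t; c \<Colon> X' \<rightarrow> X\<rbrakk> \<Longrightarrow> ypull \<C> c (yconn C \<delta> t) = yconn C \<delta> (ypull \<C> c t)"
  by (induction rule: ywf.induct) auto

lemma ypull_cong: "\<lbrakk>s \<approx>\<^bsub>n,C,A\<^esub> t; c \<Colon> C' \<rightarrow> C\<rbrakk> \<Longrightarrow> ypull \<C> c s \<approx>\<^bsub>n,C',A\<^esub> ypull \<C> c t"
proof (induction rule: yeq.induct)
  case (yeq_trans n C A s t u)
  from yeq_trans.IH[OF yeq_trans.prems] show ?case by (rule yeq.yeq_trans)
next
  case (yeq_Plus n C A s s' t t')
  then show ?case by (auto intro: yeq.yeq_Plus)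
next
  case (yeq_Emb_add C A e e')
  then show ?case using pull_add[of c C' C e A e'] exten_pull[of c C' C e A] exten_pull[of c C' C e' A]
    by (auto simp: extenI intro!: yeq_Emb_add' dest: morD extenD)
next
  case (yeq_Emb_smult C A k e)
  then show ?case using pull_smult[of c C' C e A k] exten_pull[of c C' C e A]
    by (auto simp: extenI intro!: yeq_Emb_smult' dest: morD extenD)
next
  case (yeq_Tensor_add_right C M n A t e e')
  then show ?case using pull_add[of c C' C e M e'] exten_pull[of c C' C e M] exten_pull[of c C' C e' M]
    by (auto simp: extenI intro!: yeq.yeq_Tensor_add_right dest: morD extenD)
next
  case (yeq_Tensor_smult_right C M k n A t e)
  then show ?case using pull_smult[of c C' C e M k] exten_pull[of c C' C e M]
    by (auto simp: extenI intro!: yeq.yeq_Tensor_smult_right dest: morD extenD)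
next
  case (yeq_coend C M N f n A t e)
  then have f: "f \<Colon> M \<rightarrow> N" and e: "exten e C M" by (auto simp: mor_def exten_def)
  then have "(f \<triangleright> e) \<triangleleft> c = f \<triangleright> (e \<triangleleft> c)" using pull_push yeq_coend.prems by blast
  then show ?case using yeq_coend exten_pull[OF yeq_coend.prems e]
    by (auto intro!: yeq.yeq_coend dest: morD extenD)
next
  case (yeq_sym n C A s t)
  then show ?case by (meson yeq.yeq_sym)
next
  case (yeq_Tensor C M n A t t' e)
  then show ?case using exten_pull[OF yeq_Tensor.prems, of e M]
    by (auto intro!: yeq.yeq_Tensor simp: exten_def)
next
  case (yeq_Tensor_add_left C M n A s t e)
  then show ?case using exten_pull[OF yeq_Tensor_add_left.prems, of e M]
    by (auto intro!: yeq.yeq_Tensor_add_left simp: exten_def)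
next
  case (yeq_Tensor_smult_left C M k n A t e)
  then show ?case using exten_pull[OF yeq_Tensor_smult_left.prems, of e M]
    by (auto intro!: yeq.yeq_Tensor_smult_left simp: exten_def)
qed (auto intro!: yeq.intros(1,5,7-14) intro: ypull_wf)

lemma ypush_cong: "\<lbrakk>s \<approx>\<^bsub>n,C,A\<^esub> t; a \<Colon> A \<rightarrow> A'\<rbrakk> \<Longrightarrow> ypush \<C> a s \<approx>\<^bsub>n,C,A'\<^esub> ypush \<C> a t"
proof (induction rule: yeq.induct)
  case (yeq_trans n C A s t u)
  from yeq_trans.IH[OF yeq_trans.prems] show ?case by (rule yeq.yeq_trans)
next
  case (yeq_Plus n C A s s' t t')
  then show ?case by (auto intro: yeq.yeq_Plus)
next
  case (yeq_Emb_add C A e e')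
  then show ?case using push_add[of a A A' e C e'] exten_push[of a A A' e C] exten_push[of a A A' e' C]
    by (auto simp: extenI intro!: yeq_Emb_add' dest: morD extenD)
next
  case (yeq_Emb_smult C A k e)
  then show ?case using push_smult[of a A A' e C k] exten_push[of a A A' e C]
    by (auto simp: extenI intro!: yeq_Emb_smult' dest: morD extenD)
next
  case (yeq_coend C M N f n A t e)
  then have f: "f \<Colon> M \<rightarrow> N" by (auto simp: mor_def)
  have "ypush \<C> a (ypull \<C> f t) = ypull \<C> f (ypush \<C> a t)"
    using ypull_ypush[OF _ yeq_coend.prems f] yeq_coend by simp
  then show ?case using yeq_coend ypush_wf by (auto intro!: yeq.yeq_coend)
next
  case (yeq_sym n C A s t)
  then show ?case by (meson yeq.yeq_sym)
qed (auto intro!: yeq.intros(1,5-14,17-20) intro: ypush_wf)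

lemma yconn_cong: "\<lbrakk>s \<approx>\<^bsub>n,X,C\<^esub> t; exten \<delta> C A\<rbrakk> \<Longrightarrow> yconn C \<delta> s \<approx>\<^bsub>Suc n,X,A\<^esub> yconn C \<delta> t"
proof (induction rule: yeq.induct)
  case (yeq_trans n C A s t u)
  from yeq_trans.IH[OF yeq_trans.prems] show ?case by (rule yeq.yeq_trans)
next
  case (yeq_Plus n C A s s' t t')
  then show ?case by (auto intro: yeq.yeq_Plus)
next
  case (yeq_Emb_add X C e e')
  then show ?case using yeq.yeq_Tensor_add_right[of X \<C> C K "Suc 0" A "Emb \<delta>" e e'] by (auto dest: extenD)
next
  case (yeq_Emb_smult X C k e)
  then show ?case using yeq.yeq_Tensor_smult_right[of X \<C> C k K "Suc 0" A "Emb \<delta>" e] by (auto dest: extenD)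
next
  case (yeq_coend X M N f n C t e)
  then have f: "f \<Colon> M \<rightarrow> N" by (auto simp: mor_def)
  have "yconn C \<delta> (ypull \<C> f t) = ypull \<C> f (yconn C \<delta> t)"
    using ypull_yconn[OF _ f] yeq_coend by simp
  then show ?case using yeq_coend yconn_wf by (auto intro!: yeq.yeq_coend)
next
  case (yeq_sym n C A s t)
  then show ?case by (meson yeq.yeq_sym)
qed (auto intro!: yeq.intros(1,5-14,17-20) intro: yconn_wf)

section \<open>Linear identities that follow from the generating relations\<close>

lemma yeq_reflI: "wf_yterm n C A t \<Longrightarrow> t \<approx>\<^bsub>n,C,A\<^esub> t"
  by (rule yeq.yeq_refl)

lemma yeqD1: "s \<approx>\<^bsub>n,C,A\<^esub> t \<Longrightarrow> wf_yterm n C A s" and yeqD2: "s \<approx>\<^bsub>n,C,A\<^esub> t \<Longrightarrow> wf_yterm n C A t"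
  using yeq_wf by blast+

lemma yPlus_Zero: "wf_yterm n C A t \<Longrightarrow> Plus t Zero \<approx>\<^bsub>n,C,A\<^esub> t"
  using yeq.yeq_comm[of K \<C> n C A t Zero] yeq.yeq_Zero[of K \<C> n C A t] ywfD yeq.yeq_trans by fastforce

text \<open>\<open>Zero\<close> is a formal symbol governed by the rules for
  \<open>Plus Zero t\<close> and for scaling by 0. Statements that a map sends zero to zero are
  derived by writing the zero element as a multiple by the scalar 0.\<close>

lemma yScale_Zero:
  assumes "k \<in> carrier K" "n \<ge> 1" "C \<in> Ob \<C>" "A \<in> Ob \<C>"
  shows "Scale k Zero \<approx>\<^bsub>n,C,A\<^esub> Zero"
proof -
  have z: "wf_yterm n C A Zero" using assms by simp
  have "Scale k Zero \<approx>\<^bsub>n,C,A\<^esub> Scale k (Scale \<zero>\<^bsub>K\<^esub> Zero)"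
    using assms(1) z by (intro yeq.yeq_Scale yeq.yeq_sym[OF yeq.yeq_Scale_zero])
  also have "\<dots> \<approx>\<^bsub>n,C,A\<^esub> Scale (k \<otimes>\<^bsub>K\<^esub> \<zero>\<^bsub>K\<^esub>) Zero"
    using assms(1) z by (intro yeq.yeq_sym[OF yeq.yeq_Scale_mult]) auto
  also have "\<dots> \<approx>\<^bsub>n,C,A\<^esub> Zero" using assms(1) yeq.yeq_Scale_zero[OF z] by simp
  finally show ?thesis .
qed

lemma yTensor_Zero_left:
  assumes "exten e C M" "n \<ge> 1" "A \<in> Ob \<C>"
  shows "Tensor M Zero e \<approx>\<^bsub>Suc n,C,A\<^esub> Zero"
proof -
  note e = extenD[OF assms(1)]
  have z: "wf_yterm n M A Zero" using assms e by simp
  have "Tensor M Zero e \<approx>\<^bsub>Suc n,C,A\<^esub> Tensor M (Scale \<zero>\<^bsub>K\<^esub> Zero) e"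
    using e z by (intro yeq.yeq_Tensor yeq.yeq_sym[OF yeq.yeq_Scale_zero])
  also have "\<dots> \<approx>\<^bsub>Suc n,C,A\<^esub> Scale \<zero>\<^bsub>K\<^esub> (Tensor M Zero e)" using e z by (intro yeq.yeq_Tensor_smult_left) auto
  also have "\<dots> \<approx>\<^bsub>Suc n,C,A\<^esub> Zero" using e z assms by (intro yeq.yeq_Scale_zero) auto
  finally show ?thesis .
qed

lemma yTensor_zero_right:
  assumes "wf_yterm n M A t" "C \<in> Ob \<C>"
  shows "Tensor M t \<zero>\<^bsub>E C M\<^esub> \<approx>\<^bsub>Suc n,C,A\<^esub> Zero"
proof -
  have M: "M \<in> Ob \<C>" using assms ywfD by blast
  note e = exten_zero[OF assms(2) M]
  interpret V: module K "E C M" using Ext_vectorspace[OF assms(2) M] by (simp add: vectorspace_def)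
  have "Tensor M t (\<zero>\<^bsub>K\<^esub> \<odot>\<^bsub>E C M\<^esub> \<zero>\<^bsub>E C M\<^esub>) \<approx>\<^bsub>Suc n,C,A\<^esub> Scale \<zero>\<^bsub>K\<^esub> (Tensor M t \<zero>\<^bsub>E C M\<^esub>)"
    using e assms M by (intro yeq.yeq_Tensor_smult_right) (auto dest: extenD)
  also have "\<dots> \<approx>\<^bsub>Suc n,C,A\<^esub> Zero" using e assms by (intro yeq.yeq_Scale_zero) auto
  finally show ?thesis using e by (simp add: exten_def)
qed

abbreviation yneg :: "('k, 'o, 'e) yterm \<Rightarrow> ('k, 'o, 'e) yterm"
  where "yneg t \<equiv> Scale (\<ominus>\<^bsub>K\<^esub> \<one>\<^bsub>K\<^esub>) t"

lemma neg_one_closed [simp, intro]: "\<ominus>\<^bsub>K\<^esub> \<one>\<^bsub>K\<^esub> \<in> carrier K"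
  by simp

lemma yneg_Plus:
  assumes t: "wf_yterm n C A t"
  shows "Plus (yneg t) t \<approx>\<^bsub>n,C,A\<^esub> Zero"
proof -
  have "Plus (yneg t) t \<approx>\<^bsub>n,C,A\<^esub> Plus (yneg t) (Scale \<one>\<^bsub>K\<^esub> t)"
    using t by (intro yeq.yeq_Plus yeq_reflI yeq.yeq_sym[OF yeq.yeq_Scale_one]) auto
  also have "\<dots> \<approx>\<^bsub>n,C,A\<^esub> Scale ((\<ominus>\<^bsub>K\<^esub> \<one>\<^bsub>K\<^esub>) \<oplus>\<^bsub>K\<^esub> \<one>\<^bsub>K\<^esub>) t"
    using t by (intro yeq.yeq_sym[OF yeq.yeq_Scale_add]) auto
  also have "(\<ominus>\<^bsub>K\<^esub> \<one>\<^bsub>K\<^esub>) \<oplus>\<^bsub>K\<^esub> \<one>\<^bsub>K\<^esub> = \<zero>\<^bsub>K\<^esub>" by (simp add: l_neg)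
  also have "Scale \<zero>\<^bsub>K\<^esub> t \<approx>\<^bsub>n,C,A\<^esub> Zero" using t by (rule yeq.yeq_Scale_zero)
  finally show ?thesis .
qed

lemma yPlus_neg:
  assumes t: "wf_yterm n C A t"
  shows "Plus t (yneg t) \<approx>\<^bsub>n,C,A\<^esub> Zero"
  using yeq.yeq_trans[OF yeq.yeq_comm yneg_Plus[OF t]] t by auto

lemma yPlus_interchange:
  assumes "wf_yterm n C A a" "wf_yterm n C A b" "wf_yterm n C A c" "wf_yterm n C A d"
  shows "Plus (Plus a b) (Plus c d) \<approx>\<^bsub>n,C,A\<^esub> Plus (Plus a c) (Plus b d)"
proof -
  have "Plus (Plus a b) (Plus c d) \<approx>\<^bsub>n,C,A\<^esub> Plus a (Plus b (Plus c d))"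
    using assms by (intro yeq.yeq_assoc) auto
  also have "\<dots> \<approx>\<^bsub>n,C,A\<^esub> Plus a (Plus (Plus b c) d)"
    using assms by (intro yeq.yeq_Plus yeq_reflI yeq.yeq_sym[OF yeq.yeq_assoc]) auto
  also have "\<dots> \<approx>\<^bsub>n,C,A\<^esub> Plus a (Plus (Plus c b) d)"
    using assms by (intro yeq.yeq_Plus yeq_reflI yeq.yeq_comm) auto
  also have "\<dots> \<approx>\<^bsub>n,C,A\<^esub> Plus a (Plus c (Plus b d))"
    using assms by (intro yeq.yeq_Plus yeq_reflI yeq.yeq_assoc) auto
  also have "\<dots> \<approx>\<^bsub>n,C,A\<^esub> Plus (Plus a c) (Plus b d)"
    using assms by (intro yeq.yeq_sym[OF yeq.yeq_assoc]) auto
  finally show ?thesis .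
qed

text \<open>\<open>ypull\<close> changes only the outermost extensions, where additivity in the
  morphism is that of \<open>pull\<close>; the resulting sums are regrouped by
  \<open>yPlus_interchange\<close>.\<close>

lemma ypull_add:
  assumes "wf_yterm n C A t" "c \<Colon> C' \<rightarrow> C" "c' \<Colon> C' \<rightarrow> C"
  shows "ypull \<C> (c \<oplus>\<^bsub>H C' C\<^esub> c') t \<approx>\<^bsub>n,C',A\<^esub> Plus (ypull \<C> c t) (ypull \<C> c' t)"
  using assms
proof (induction rule: ywf.induct)
  case (ywf_Emb C A e)
  then have e: "exten e C A" by (simp add: extenI)
  show ?case
    using pull_mor_linear(1)[OF ywf_Emb(4,5) e] extenD[OF exten_pull[OF ywf_Emb(4) e]]
      extenD[OF exten_pull[OF ywf_Emb(5) e]]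
    by (auto intro: yeq_Emb_add')
next
  case (ywf_Zero n C A)
  then show ?case using yeq.yeq_sym[OF yeq.yeq_Zero[of K \<C> n C' A Zero]] by (auto dest: morD)
next
  case (ywf_Plus n C A s t)
  note w = ywf_Plus(1,2)[THEN ypull_wf]
  show ?case
    using yeq.yeq_trans[OF yeq.yeq_Plus[OF ywf_Plus.IH(1,2)] yPlus_interchange] ywf_Plus.prems w by auto
next
  case (ywf_Scale k n C A t)
  show ?case
    using yeq.yeq_trans[OF yeq.yeq_Scale[OF ywf_Scale(1) ywf_Scale.IH] yeq.yeq_Scale_Plus[OF ywf_Scale(1)]]
      ywf_Scale.prems ywf_Scale(2)[THEN ypull_wf] by auto
next
  case (ywf_Tensor C M n A t e)
  then have e: "exten e C M" by (simp add: extenI)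
  show ?case
    using pull_mor_linear(1)[OF ywf_Tensor.prems e] extenD[OF exten_pull[OF ywf_Tensor.prems(1) e]]
      extenD[OF exten_pull[OF ywf_Tensor.prems(2) e]] ywf_Tensor(3)
    by (auto intro: yeq.yeq_Tensor_add_right)
qed

lemma ypull_smult:
  assumes "wf_yterm n C A t" "c \<Colon> C' \<rightarrow> C" "k \<in> carrier K"
  shows "ypull \<C> (k \<odot>\<^bsub>H C' C\<^esub> c) t \<approx>\<^bsub>n,C',A\<^esub> Scale k (ypull \<C> c t)"
  using assms
proof (induction rule: ywf.induct)
  case (ywf_Emb C A e)
  then have e: "exten e C A" by (simp add: extenI)
  show ?case
    using pull_mor_linear(4)[OF ywf_Emb(4,4) e ywf_Emb(5)] extenD[OF exten_pull[OF ywf_Emb(4) e]] ywf_Emb(5)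
    by (auto intro: yeq_Emb_smult')
next
  case (ywf_Zero n C A)
  then show ?case using yeq.yeq_sym[OF yScale_Zero[of k n C' A]] by (auto dest: morD)
next
  case (ywf_Plus n C A s t)
  show ?case
    using yeq.yeq_trans[OF yeq.yeq_Plus[OF ywf_Plus.IH(1,2)] yeq.yeq_sym[OF yeq.yeq_Scale_Plus]]
      ywf_Plus.prems ywf_Plus(1,2)[THEN ypull_wf] by auto
next
  case (ywf_Scale l n C A t)
  have w: "wf_yterm n C' A (ypull \<C> c t)" using ywf_Scale by (auto intro: ypull_wf)
  have "Scale l (ypull \<C> (k \<odot>\<^bsub>H C' C\<^esub> c) t) \<approx>\<^bsub>n,C',A\<^esub> Scale l (Scale k (ypull \<C> c t))"
    using ywf_Scale by (intro yeq.yeq_Scale) auto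
  also have "\<dots> \<approx>\<^bsub>n,C',A\<^esub> Scale (l \<otimes>\<^bsub>K\<^esub> k) (ypull \<C> c t)"
    using ywf_Scale w by (intro yeq.yeq_sym[OF yeq.yeq_Scale_mult]) auto
  also have "l \<otimes>\<^bsub>K\<^esub> k = k \<otimes>\<^bsub>K\<^esub> l" using ywf_Scale m_comm by simp
  also have "Scale (k \<otimes>\<^bsub>K\<^esub> l) (ypull \<C> c t) \<approx>\<^bsub>n,C',A\<^esub> Scale k (Scale l (ypull \<C> c t))"
    using ywf_Scale w by (intro yeq.yeq_Scale_mult) auto
  finally show ?case by simp
next
  case (ywf_Tensor C M n A t e)
  then have e: "exten e C M" by (simp add: extenI)
  show ?case
    using pull_mor_linear(4)[OF ywf_Tensor.prems(1,1) e ywf_Tensor.prems(2)]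
      extenD[OF exten_pull[OF ywf_Tensor.prems(1) e]] ywf_Tensor(3) ywf_Tensor.prems(2)
    by (auto intro: yeq.yeq_Tensor_smult_right)
qed

lemma hom_smult_simps:
  assumes "X \<in> Ob \<C>" "Y \<in> Ob \<C>"
  shows "\<zero>\<^bsub>K\<^esub> \<odot>\<^bsub>H X Y\<^esub> \<zero>\<^bsub>H X Y\<^esub> = \<zero>\<^bsub>H X Y\<^esub>"
    and "f \<Colon> X \<rightarrow> Y \<Longrightarrow> (\<ominus>\<^bsub>K\<^esub> \<one>\<^bsub>K\<^esub>) \<odot>\<^bsub>H X Y\<^esub> f = \<ominus>\<^bsub>H X Y\<^esub> f"
proof -
  interpret V: module K "H X Y" using Hom_vectorspace[OF assms] by (simp add: vectorspace_def)
  show "\<zero>\<^bsub>K\<^esub> \<odot>\<^bsub>H X Y\<^esub> \<zero>\<^bsub>H X Y\<^esub> = \<zero>\<^bsub>H X Y\<^esub>" by simp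
  show "f \<Colon> X \<rightarrow> Y \<Longrightarrow> (\<ominus>\<^bsub>K\<^esub> \<one>\<^bsub>K\<^esub>) \<odot>\<^bsub>H X Y\<^esub> f = \<ominus>\<^bsub>H X Y\<^esub> f"
    using V.smult_l_minus[of "\<one>\<^bsub>K\<^esub>" f] by (simp add: mor_def)
qed

lemma ypull_neg:
  assumes "wf_yterm n C A t" "c \<Colon> C' \<rightarrow> C"
  shows "ypull \<C> (\<ominus>\<^bsub>H C' C\<^esub> c) t \<approx>\<^bsub>n,C',A\<^esub> yneg (ypull \<C> c t)"
  using ypull_smult[OF assms neg_one_closed] hom_smult_simps(2)[OF morD(1,2)[OF assms(2)] assms(2)] by simp

lemma ypull_zero_mor:
  assumes "wf_yterm n C A t" "C' \<in> Ob \<C>"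
  shows "ypull \<C> \<zero>\<^bsub>H C' C\<^esub> t \<approx>\<^bsub>n,C',A\<^esub> Zero"
proof -
  have C: "C \<in> Ob \<C>" using ywfD assms by blast
  note m = mor_zero[OF assms(2) C]
  have "ypull \<C> (\<zero>\<^bsub>K\<^esub> \<odot>\<^bsub>H C' C\<^esub> \<zero>\<^bsub>H C' C\<^esub>) t \<approx>\<^bsub>n,C',A\<^esub> Scale \<zero>\<^bsub>K\<^esub> (ypull \<C> \<zero>\<^bsub>H C' C\<^esub> t)"
    using ypull_smult[OF assms(1) m] by simp
  also have "\<dots> \<approx>\<^bsub>n,C',A\<^esub> Zero" using ypull_wf[OF assms(1) m] by (rule yeq.yeq_Scale_zero)
  finally show ?thesis using hom_smult_simps(1)[OF assms(2) C] by simp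
qed

lemma yEmb_zero:
  assumes "C \<in> Ob \<C>" "A \<in> Ob \<C>"
  shows "Emb \<zero>\<^bsub>E C A\<^esub> \<approx>\<^bsub>1,C,A\<^esub> Zero"
proof -
  interpret V: module K "E C A" using Ext_vectorspace[OF assms] by (simp add: vectorspace_def)
  note e = exten_zero[OF assms]
  have "Emb (\<zero>\<^bsub>K\<^esub> \<odot>\<^bsub>E C A\<^esub> \<zero>\<^bsub>E C A\<^esub>) \<approx>\<^bsub>1,C,A\<^esub> Scale \<zero>\<^bsub>K\<^esub> (Emb \<zero>\<^bsub>E C A\<^esub>)"
    using e assms by (intro yeq.yeq_Emb_smult) auto
  also have "\<dots> \<approx>\<^bsub>1,C,A\<^esub> Zero" using e by (intro yeq.yeq_Scale_zero) auto
  finally show ?thesis using e by (simp add: exten_def)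
qed

lemma ypush_zero_mor:
  assumes "wf_yterm n C A t" "A' \<in> Ob \<C>"
  shows "ypush \<C> \<zero>\<^bsub>H A A'\<^esub> t \<approx>\<^bsub>n,C,A'\<^esub> Zero"
  using assms
proof (induction rule: ywf.induct)
  case (ywf_Emb C A e)
  then show ?case using push_zero_mor[of e C A A'] yEmb_zero by (simp add: extenI)
next
  case (ywf_Plus n C A s t)
  note w = ywf_Plus.IH[OF ywf_Plus.prems]
  show ?case using yeq.yeq_trans[OF yeq.yeq_Plus[OF w] yeq.yeq_Zero] yeqD2[OF w(1)] by simp
next
  case (ywf_Scale k n C A t)
  note w = ywf_Scale.IH[OF ywf_Scale.prems]
  show ?case using yeq.yeq_trans[OF yeq.yeq_Scale[OF ywf_Scale(1) w] yScale_Zero] yeqD2[OF w] ywf_Scale(1)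
    by simp
next
  case (ywf_Tensor C M n A t e)
  note w = ywf_Tensor.IH[OF ywf_Tensor.prems]
  have e: "exten e C M" using ywf_Tensor by (simp add: extenI)
  show ?case using yeq.yeq_trans[OF yeq.yeq_Tensor[OF _ _ w] yTensor_Zero_left[OF e]] ywf_Tensor yeqD2[OF w]
    by simp
qed (auto intro: yeq_reflI)

text \<open>Evaluation of level one terms in \<open>Ext\<close>. The value on tensors is a default,
  since tensors have level at least 2. Being constant on classes at level one, it shows that the
  congruence identifies no two different extensions there.\<close>

primrec yeval :: "'o \<Rightarrow> 'o \<Rightarrow> ('k, 'o, 'e) yterm \<Rightarrow> 'e"
  where
    "yeval C A (Emb e) = e"
  | "yeval C A Zero = \<zero>\<^bsub>E C A\<^esub>"
  | "yeval C A (Plus s t) = yeval C A s \<oplus>\<^bsub>E C A\<^esub> yeval C A t"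
  | "yeval C A (Scale k t) = k \<odot>\<^bsub>E C A\<^esub> yeval C A t"
  | "yeval C A (Tensor M t e) = \<zero>\<^bsub>E C A\<^esub>"

lemma yeval_exten: "wf_yterm n C A t \<Longrightarrow> n = 1 \<Longrightarrow> exten (yeval C A t) C A"
  by (induction rule: ywf.induct) (auto simp: extenI exten_zero exten_add exten_smult dest: ywfD)

lemma yeval_yeq: "wf_yterm n C A t \<Longrightarrow> n = 1 \<Longrightarrow> t \<approx>\<^bsub>n,C,A\<^esub> Emb (yeval C A t)"
proof (induction rule: ywf.induct)
  case (ywf_Zero n C A)
  then show ?case using yeq.yeq_sym[OF yEmb_zero] by simp
next
  case (ywf_Plus n C A s t)
  note e = yeval_exten[OF ywf_Plus(1,5)] yeval_exten[OF ywf_Plus(2,5)]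
  note i = yeq.yeq_Plus[OF ywf_Plus.IH(1)[OF ywf_Plus.prems] ywf_Plus.IH(2)[OF ywf_Plus.prems], unfolded
    ywf_Plus.prems]
  show ?case using yeq.yeq_trans[OF i yeq.yeq_sym[OF yeq.yeq_Emb_add]] ywf_Plus.prems e
    by (auto dest: extenD)
next
  case (ywf_Scale k n C A t)
  note e = yeval_exten[OF ywf_Scale(2,4)]
  note i = yeq.yeq_Scale[OF ywf_Scale(1) ywf_Scale.IH[OF ywf_Scale.prems], unfolded ywf_Scale.prems]
  show ?case using yeq.yeq_trans[OF i yeq.yeq_sym[OF yeq.yeq_Emb_smult]] ywf_Scale(1) ywf_Scale.prems e
    by (auto dest: extenD)
next
  case (ywf_Tensor C M n A t e)
  then show ?case using ywfD by fastforce
qed (auto intro: yeq_reflI simp: exten_def)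

lemma yeval_cong: "s \<approx>\<^bsub>n,C,A\<^esub> t \<Longrightarrow> n = 1 \<Longrightarrow> yeval C A s = yeval C A t"
proof (induction rule: yeq.induct)
  case (yeq_assoc n C A s t u)
  then show ?case using ext_add_assoc[OF yeval_exten yeval_exten yeval_exten] by simp
next
  case (yeq_comm n C A s t)
  then show ?case using ext_add_comm[OF yeval_exten yeval_exten] by simp
next
  case (yeq_Zero n C A t)
  then show ?case using yeval_exten[of n C A t] by simp
next
  case (yeq_Scale_zero n C A t)
  interpret V: module K "E C A" using Ext_vectorspace[of C A] ywfD[OF yeq_Scale_zero(1)]
    by (simp add: vectorspace_def)
  show ?case using yeval_exten[OF yeq_Scale_zero] by (simp add: exten_def)
next
  case (yeq_Scale_one n C A t)
  interpret V: module K "E C A" using Ext_vectorspace[of C A] ywfD[OF yeq_Scale_one(1)]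
    by (simp add: vectorspace_def)
  show ?case using yeval_exten[OF yeq_Scale_one] by (simp add: exten_def)
next
  case (yeq_Scale_mult k l n C A t)
  interpret V: module K "E C A" using Ext_vectorspace[of C A] ywfD[OF yeq_Scale_mult(3)]
    by (simp add: vectorspace_def)
  show ?case using yeval_exten[OF yeq_Scale_mult(3,4)] V.smult_assoc1 yeq_Scale_mult by (simp add: exten_def)
next
  case (yeq_Scale_add k l n C A t)
  interpret V: module K "E C A" using Ext_vectorspace[of C A] ywfD[OF yeq_Scale_add(3)]
    by (simp add: vectorspace_def)
  show ?case using yeval_exten[OF yeq_Scale_add(3,4)] V.smult_l_distr yeq_Scale_add by (simp add: exten_def)
next
  case (yeq_Scale_Plus k n C A s t)
  interpret V: module K "E C A" using Ext_vectorspace[of C A] ywfD[OF yeq_Scale_Plus(2)]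
    by (simp add: vectorspace_def)
  show ?case using yeval_exten[OF yeq_Scale_Plus(2,4)] yeval_exten[OF yeq_Scale_Plus(3,4)] V.smult_r_distr
    yeq_Scale_Plus
    by (simp add: exten_def)
qed (auto dest: ywfD)

lemma yEmb_iff:
  assumes "exten e C A" "exten e' C A"
  shows "Emb e \<approx>\<^bsub>1,C,A\<^esub> Emb e' \<longleftrightarrow> e = e'"
  using yeval_cong[of 1 C A "Emb e" "Emb e'"] yeq_reflI[of 1 C A "Emb e"] assms by auto

lemma yEmb_Zero_iff:
  assumes "exten e C A"
  shows "Emb e \<approx>\<^bsub>1,C,A\<^esub> Zero \<longleftrightarrow> e = \<zero>\<^bsub>E C A\<^esub>"
  using yeval_cong[of 1 C A "Emb e" Zero] yEmb_zero[of C A] assms by (auto dest: extenD)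

section \<open>Equality of tensors in the coend\<close>

text \<open>\<open>carried n X A N \<sigma> s \<eta>\<close>: moving all tensors of \<open>s\<close> along morphisms into \<open>N\<close>, using the coend
  relation in one direction only, turns \<open>s\<close> into \<open>\<sigma> \<otimes> \<eta>\<close>. Two terms represent the same element
  of the coend iff they are carried to a common \<open>\<sigma> \<otimes> \<eta>\<close>, provided that \<open>\<E>\<^sup>n(-,A)\<close> is half exact.\<close>

primrec carried :: "nat \<Rightarrow> 'o \<Rightarrow> 'o \<Rightarrow> 'o \<Rightarrow> ('k, 'o, 'e) yterm \<Rightarrow> ('k, 'o, 'e) yterm \<Rightarrow> 'e \<Rightarrow> bool"
  where
    "carried n X A N \<sigma> (Emb e) \<eta> \<longleftrightarrow> False"
  | "carried n X A N \<sigma> Zero \<eta> \<longleftrightarrow> \<eta> = \<zero>\<^bsub>E X N\<^esub>"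
  | "carried n X A N \<sigma> (Plus s t) \<eta> \<longleftrightarrow>
      (\<exists>\<eta>\<^sub>1 \<eta>\<^sub>2. carried n X A N \<sigma> s \<eta>\<^sub>1 \<and> carried n X A N \<sigma> t \<eta>\<^sub>2 \<and> \<eta> = \<eta>\<^sub>1 \<oplus>\<^bsub>E X N\<^esub> \<eta>\<^sub>2)"
  | "carried n X A N \<sigma> (Scale k t) \<eta> \<longleftrightarrow> (\<exists>\<eta>\<^sub>1. carried n X A N \<sigma> t \<eta>\<^sub>1 \<and> \<eta> = k \<odot>\<^bsub>E X N\<^esub> \<eta>\<^sub>1)"
  | "carried n X A N \<sigma> (Tensor M t e) \<eta> \<longleftrightarrow>
      (\<exists>x. x \<Colon> M \<rightarrow> N \<and> t \<approx>\<^bsub>n,M,A\<^esub> ypull \<C> x \<sigma> \<and> \<eta> = x \<triangleright> e)"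

lemma carried_exten:
  "\<lbrakk>wf_yterm m X A s; m = Suc n; carried n X A N \<sigma> s \<eta>; N \<in> Ob \<C>\<rbrakk> \<Longrightarrow> exten \<eta> X N"
  by (induction arbitrary: \<eta> rule: ywf.induct) (auto simp: extenI)

text \<open>A term carried into \<open>N\<close> can be carried further along any morphism
  \<open>z\<close> through which \<open>\<sigma>\<close> is a pullback.\<close>

lemma carried_mono:
  assumes "wf_yterm m X A s" "m = Suc n" "carried n X A N \<sigma> s \<eta>" "z \<Colon> N \<rightarrow> N'"
    "\<sigma> \<approx>\<^bsub>n,N,A\<^esub> ypull \<C> z \<sigma>'" "wf_yterm n N' A \<sigma>'"
  shows "carried n X A N' \<sigma>' s (z \<triangleright> \<eta>)"
  using assms
proof (induction arbitrary: \<eta> rule: ywf.induct)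
  case (ywf_Zero m X A)
  then show ?case using push_zero by simp
next
  case (ywf_Plus m X A s t)
  have N: "N \<in> Ob \<C>" using ywf_Plus morD by blast
  obtain h1 h2 where h: "carried n X A N \<sigma> s h1" "carried n X A N \<sigma> t h2" "\<eta> = h1 \<oplus>\<^bsub>E X N\<^esub> h2"
    using ywf_Plus by auto
  note e = carried_exten[OF ywf_Plus(1,5) h(1) N] carried_exten[OF ywf_Plus(2,5) h(2) N]
  show ?case using push_add[OF ywf_Plus.prems(3) e] ywf_Plus.IH ywf_Plus.prems h by auto
next
  case (ywf_Scale k m X A t)
  have N: "N \<in> Ob \<C>" using ywf_Scale morD by blast
  obtain h where h: "carried n X A N \<sigma> t h" "\<eta> = k \<odot>\<^bsub>E X N\<^esub> h"
    using ywf_Scale by auto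
  note e = carried_exten[OF ywf_Scale(2,4) h(1) N]
  show ?case using push_smult[OF ywf_Scale.prems(3) e ywf_Scale(1)] ywf_Scale.IH ywf_Scale.prems h by auto
next
  case (ywf_Tensor X M m A t e)
  then obtain x where x: "x \<Colon> M \<rightarrow> N" "t \<approx>\<^bsub>n,M,A\<^esub> ypull \<C> x \<sigma>" "\<eta> = x \<triangleright> e" by auto
  have "t \<approx>\<^bsub>n,M,A\<^esub> ypull \<C> (z \<cdot> x) \<sigma>'"
    using yeq.yeq_trans[OF x(2) ypull_cong[OF ywf_Tensor.prems(4) x(1)]]
      ypull_ypull[OF ywf_Tensor.prems(5,3) x(1)] by simp
  moreover have "z \<triangleright> \<eta> = (z \<cdot> x) \<triangleright> e"
    using push_push[OF x(1) ywf_Tensor.prems(3) extenI[OF ywf_Tensor(1,2,4)]] x(3) by simp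
  ultimately show ?case using x ywf_Tensor.prems(3) by auto
qed auto

lemma copair:
  assumes P: "biproduct \<C> A B P i j p q" and f: "f \<Colon> A \<rightarrow> N" and g: "g \<Colon> B \<rightarrow> N"
  shows "(f \<cdot> p) \<oplus>\<^bsub>H P N\<^esub> (g \<cdot> q) \<Colon> P \<rightarrow> N" "((f \<cdot> p) \<oplus>\<^bsub>H P N\<^esub> (g \<cdot> q)) \<cdot> i = f"
    "((f \<cdot> p) \<oplus>\<^bsub>H P N\<^esub> (g \<cdot> q)) \<cdot> j = g"
proof -
  note b = biproductD[OF P] and N = morD(2)[OF f]
  have m: "f \<cdot> p \<Colon> P \<rightarrow> N" "g \<cdot> q \<Colon> P \<rightarrow> N" using b f g by blast+
  show "(f \<cdot> p) \<oplus>\<^bsub>H P N\<^esub> (g \<cdot> q) \<Colon> P \<rightarrow> N" using m by blast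
  have "(f \<cdot> p) \<cdot> i = f" "(g \<cdot> q) \<cdot> i = \<zero>\<^bsub>H A N\<^esub>" "(f \<cdot> p) \<cdot> j = \<zero>\<^bsub>H B N\<^esub>" "(g \<cdot> q) \<cdot> j = g"
    using assoc[OF b(1,3) f] assoc[OF b(1,4) g] assoc[OF b(2,3) f] assoc[OF b(2,4) g] b f g cmp_zero_right N
      by auto
  then show "((f \<cdot> p) \<oplus>\<^bsub>H P N\<^esub> (g \<cdot> q)) \<cdot> i = f" "((f \<cdot> p) \<oplus>\<^bsub>H P N\<^esub> (g \<cdot> q)) \<cdot> j = g"
    using cmp_add_left(1)[OF m b(1)] cmp_add_left(1)[OF m b(2)] f g by auto
qed

text \<open>The term \<open>r\<close> plays the role of the pair \<open>(s, t)\<close>: higher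
  extensions turn a biproduct in the contravariant variable into a product.\<close>

lemma ypair:
  assumes P: "biproduct \<C> A B P i j p q" and s: "wf_yterm n A Y s" and t: "wf_yterm n B Y t"
  defines "r \<equiv> Plus (ypull \<C> p s) (ypull \<C> q t)"
  shows "wf_yterm n P Y r" "ypull \<C> i r \<approx>\<^bsub>n,A,Y\<^esub> s" "ypull \<C> j r \<approx>\<^bsub>n,B,Y\<^esub> t"
proof -
  note b = biproductD[OF P]
  show "wf_yterm n P Y r" unfolding r_def using ypull_wf[OF s b(3)] ypull_wf[OF t b(4)] by simp
  have "ypull \<C> i r = Plus s (ypull \<C> \<zero>\<^bsub>H A B\<^esub> t)"
    unfolding r_def using ypull_ypull[OF s b(3,1)] ypull_ypull[OF t b(4,1)] b ypull_id[OF s] by simp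
  also have "\<dots> \<approx>\<^bsub>n,A,Y\<^esub> Plus s Zero" using yeq_reflI[OF s] ypull_zero_mor[OF t b(10)] by (rule yeq.yeq_Plus)
  also have "\<dots> \<approx>\<^bsub>n,A,Y\<^esub> s" using yPlus_Zero[OF s] .
  finally show "ypull \<C> i r \<approx>\<^bsub>n,A,Y\<^esub> s" .
  have "ypull \<C> j r = Plus (ypull \<C> \<zero>\<^bsub>H B A\<^esub> s) t"
    unfolding r_def using ypull_ypull[OF s b(3,2)] ypull_ypull[OF t b(4,2)] b ypull_id[OF t] by simp
  also have "\<dots> \<approx>\<^bsub>n,B,Y\<^esub> Plus Zero t" using ypull_zero_mor[OF s b(11)] yeq_reflI[OF t] by (rule yeq.yeq_Plus)
  also have "\<dots> \<approx>\<^bsub>n,B,Y\<^esub> t" using yeq.yeq_Zero[OF t] .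
  finally show "ypull \<C> j r \<approx>\<^bsub>n,B,Y\<^esub> t" .
qed

text \<open>A sum of two tensors over \<open>M1\<close> and \<open>M2\<close> is one tensor of pairs
  over their biproduct. The last conjunct asserts more than equality in the coend: the single tensor
  can be carried to exactly the same places, so that questions about \<open>carried\<close> reduce
  to one tensor, where they concern one morphism.\<close>

lemma pure_tensor:
  assumes "wf_yterm m X A s" "m = Suc n" "n \<ge> 1"
  shows "\<exists>M t e. wf_yterm n M A t \<and> exten e X M \<and> s \<approx>\<^bsub>m,X,A\<^esub> Tensor M t e \<and>
    (\<forall>N \<sigma> \<eta>. wf_yterm n N A \<sigma> \<longrightarrow>
      (carried n X A N \<sigma> s \<eta> \<longleftrightarrow> carried n X A N \<sigma> (Tensor M t e) \<eta>))"
  using assms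
proof (induction rule: ywf.induct)
  case (ywf_Zero m X A)
  \<comment> \<open>The empty sum is a tensor over a zero object, which has a morphism to every
    target.\<close>
  obtain Z where Z: "zero_object \<C> Z" using zero_object_exists by blast
  note z = zero_objectD[OF Z]
  have t: "wf_yterm n Z A Zero" and e: "exten \<zero>\<^bsub>E X Z\<^esub> X Z" using ywf_Zero z by auto
  have "Zero \<approx>\<^bsub>m,X,A\<^esub> Tensor Z Zero \<zero>\<^bsub>E X Z\<^esub>"
    using yeq.yeq_sym[OF yTensor_zero_right[OF t ywf_Zero(2)]] ywf_Zero by simp
  moreover have "carried n X A N \<sigma> Zero \<eta> \<longleftrightarrow> carried n X A N \<sigma> (Tensor Z Zero \<zero>\<^bsub>E X Z\<^esub>) \<eta>"
    if s: "wf_yterm n N A \<sigma>" for N \<sigma> \<eta>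
  proof -
    have N: "N \<in> Ob \<C>" using ywfD s by blast
    have "\<zero>\<^bsub>H Z N\<^esub> \<Colon> Z \<rightarrow> N" using z N by auto
    moreover have "x \<triangleright> \<zero>\<^bsub>E X Z\<^esub> = \<zero>\<^bsub>E X N\<^esub>" if "x \<Colon> Z \<rightarrow> N" for x using push_zero[OF that ywf_Zero(2)] .
    moreover have "Zero \<approx>\<^bsub>n,Z,A\<^esub> ypull \<C> \<zero>\<^bsub>H Z N\<^esub> \<sigma>" using yeq.yeq_sym[OF ypull_zero_mor[OF s z(1)]] .
    ultimately show ?thesis by auto
  qed
  ultimately show ?case using t e by blast
next
  case (ywf_Plus m X A s1 s2)
  obtain M1 t1 e1 where 1: "wf_yterm n M1 A t1" "exten e1 X M1" "s1 \<approx>\<^bsub>m,X,A\<^esub> Tensor M1 t1 e1"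
    "\<And>N \<sigma> \<eta>. wf_yterm n N A \<sigma> \<Longrightarrow> carried n X A N \<sigma> s1 \<eta> \<longleftrightarrow> carried n X A N \<sigma> (Tensor M1 t1 e1) \<eta>"
    using ywf_Plus.IH(1)[OF ywf_Plus.prems] by blast
  obtain M2 t2 e2 where 2: "wf_yterm n M2 A t2" "exten e2 X M2" "s2 \<approx>\<^bsub>m,X,A\<^esub> Tensor M2 t2 e2"
    "\<And>N \<sigma> \<eta>. wf_yterm n N A \<sigma> \<Longrightarrow> carried n X A N \<sigma> s2 \<eta> \<longleftrightarrow> carried n X A N \<sigma> (Tensor M2 t2 e2) \<eta>"
    using ywf_Plus.IH(2)[OF ywf_Plus.prems] by blast
  obtain P i j p q where P: "biproduct \<C> M1 M2 P i j p q" using biproduct_exists 1(2) 2(2) extenD by meson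
  note b = biproductD[OF P]
  note r = ypair[OF P 1(1) 2(1)]
  have ie: "exten (i \<triangleright> e1) X P" "exten (j \<triangleright> e2) X P" using 1 2 b by blast+
  have X: "X \<in> Ob \<C>" using 1 extenD by blast
  let ?t = "Plus (ypull \<C> p t1) (ypull \<C> q t2)" and ?e = "(i \<triangleright> e1) \<oplus>\<^bsub>E X P\<^esub> (j \<triangleright> e2)"
  have e: "exten ?e X P" using ie by blast
  have pe: "p \<triangleright> ?e = e1"
    using push_add[OF b(3) ie] push_push[OF b(1,3) 1(2), symmetric] push_push[OF b(2,3) 2(2), symmetric] b
      1(2) push_zero_mor[OF 2(2) b(10)] by simp
  have qe: "q \<triangleright> ?e = e2"
    using push_add[OF b(4) ie] push_push[OF b(1,4) 1(2), symmetric] push_push[OF b(2,4) 2(2), symmetric] b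
      2(2) push_zero_mor[OF 1(2) b(11)] by simp
  have "Tensor P ?t ?e \<approx>\<^bsub>Suc n,X,A\<^esub> Plus (Tensor P (ypull \<C> p t1) ?e) (Tensor P (ypull \<C> q t2) ?e)"
    using r(1) e by (intro yeq.yeq_Tensor_add_left) (auto dest: extenD)
  also have "\<dots> \<approx>\<^bsub>Suc n,X,A\<^esub> Plus (Tensor M1 t1 (p \<triangleright> ?e)) (Tensor M2 t2 (q \<triangleright> ?e))"
    using b 1(1) 2(1) e by (intro yeq.yeq_Plus yeq.yeq_coend) (auto dest: extenD morD)
  also have "\<dots> \<approx>\<^bsub>Suc n,X,A\<^esub> Plus s1 s2"
    unfolding pe qe using 1(3) 2(3) ywf_Plus.prems by (auto intro: yeq.yeq_Plus yeq.yeq_sym)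
  finally have "Plus s1 s2 \<approx>\<^bsub>m,X,A\<^esub> Tensor P ?t ?e" unfolding ywf_Plus.prems(1) by (rule yeq.yeq_sym)
  moreover have "carried n X A N \<sigma> (Plus s1 s2) \<eta> \<longleftrightarrow> carried n X A N \<sigma> (Tensor P ?t ?e) \<eta>"
    if s: "wf_yterm n N A \<sigma>" for N \<sigma> \<eta>
  proof
    assume "carried n X A N \<sigma> (Plus s1 s2) \<eta>"
    then obtain x1 x2 where x: "x1 \<Colon> M1 \<rightarrow> N" "x2 \<Colon> M2 \<rightarrow> N" "t1 \<approx>\<^bsub>n,M1,A\<^esub> ypull \<C> x1 \<sigma>"
      "t2 \<approx>\<^bsub>n,M2,A\<^esub> ypull \<C> x2 \<sigma>"
      "\<eta> = (x1 \<triangleright> e1) \<oplus>\<^bsub>E X N\<^esub> (x2 \<triangleright> e2)" using 1(4)[OF s] 2(4)[OF s] by auto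
    let ?x = "(x1 \<cdot> p) \<oplus>\<^bsub>H P N\<^esub> (x2 \<cdot> q)"
    note c = copair[OF P x(1,2)]
    have xp: "x1 \<cdot> p \<Colon> P \<rightarrow> N" "x2 \<cdot> q \<Colon> P \<rightarrow> N" using x b by blast+
    have "ypull \<C> ?x \<sigma> \<approx>\<^bsub>n,P,A\<^esub> Plus (ypull \<C> (x1 \<cdot> p) \<sigma>) (ypull \<C> (x2 \<cdot> q) \<sigma>)" using ypull_add[OF s xp] .
    also have "\<dots> = Plus (ypull \<C> p (ypull \<C> x1 \<sigma>)) (ypull \<C> q (ypull \<C> x2 \<sigma>))"
      using ypull_ypull[OF s] x b by simp
    also have "\<dots> \<approx>\<^bsub>n,P,A\<^esub> ?t"
      by (intro yeq.yeq_Plus ypull_cong[OF yeq.yeq_sym[OF x(3)] b(3)]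
        ypull_cong[OF yeq.yeq_sym[OF x(4)] b(4)])
    finally have "?t \<approx>\<^bsub>n,P,A\<^esub> ypull \<C> ?x \<sigma>" by (rule yeq.yeq_sym)
    moreover have "?x \<triangleright> ?e = \<eta>"
      using push_add[OF c(1) ie] push_push[OF b(1) c(1) 1(2)] push_push[OF b(2) c(1) 2(2)] c(2,3) x(5) by simp
    ultimately show "carried n X A N \<sigma> (Tensor P ?t ?e) \<eta>" using c(1) by auto
  next
    assume "carried n X A N \<sigma> (Tensor P ?t ?e) \<eta>"
    then obtain x where x: "x \<Colon> P \<rightarrow> N" "?t \<approx>\<^bsub>n,P,A\<^esub> ypull \<C> x \<sigma>" "\<eta> = x \<triangleright> ?e" by auto
    have "t1 \<approx>\<^bsub>n,M1,A\<^esub> ypull \<C> i (ypull \<C> x \<sigma>)"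
      using yeq.yeq_trans[OF yeq.yeq_sym[OF r(2)] ypull_cong[OF x(2) b(1)]] .
    moreover have "t2 \<approx>\<^bsub>n,M2,A\<^esub> ypull \<C> j (ypull \<C> x \<sigma>)"
      using yeq.yeq_trans[OF yeq.yeq_sym[OF r(3)] ypull_cong[OF x(2) b(2)]] .
    moreover have "\<eta> = ((x \<cdot> i) \<triangleright> e1) \<oplus>\<^bsub>E X N\<^esub> ((x \<cdot> j) \<triangleright> e2)"
      using push_add[OF x(1) ie] push_push[OF b(1) x(1) 1(2)] push_push[OF b(2) x(1) 2(2)] x(3) by simp
    moreover have "x \<cdot> i \<Colon> M1 \<rightarrow> N" "x \<cdot> j \<Colon> M2 \<rightarrow> N" using x b by blast+
    ultimately have "carried n X A N \<sigma> s1 ((x \<cdot> i) \<triangleright> e1)" "carried n X A N \<sigma> s2 ((x \<cdot> j) \<triangleright> e2)"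
      "\<eta> = ((x \<cdot> i) \<triangleright> e1) \<oplus>\<^bsub>E X N\<^esub> ((x \<cdot> j) \<triangleright> e2)"
      unfolding 1(4)[OF s] 2(4)[OF s] carried.simps
      using ypull_ypull[OF s x(1) b(1)] ypull_ypull[OF s x(1) b(2)] by auto
    then show "carried n X A N \<sigma> (Plus s1 s2) \<eta>" by auto
  qed
  ultimately show ?case using r(1) e by blast
next
  case (ywf_Scale k m X A s)
  obtain M t e where 1: "wf_yterm n M A t" "exten e X M" "s \<approx>\<^bsub>m,X,A\<^esub> Tensor M t e"
    "\<And>N \<sigma> \<eta>. wf_yterm n N A \<sigma> \<Longrightarrow> carried n X A N \<sigma> s \<eta> \<longleftrightarrow> carried n X A N \<sigma> (Tensor M t e) \<eta>"
    using ywf_Scale.IH[OF ywf_Scale.prems] by blast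
  have e: "exten (k \<odot>\<^bsub>E X M\<^esub> e) X M" using 1(2) ywf_Scale(1) by blast
  have "Scale k s \<approx>\<^bsub>m,X,A\<^esub> Scale k (Tensor M t e)" using ywf_Scale(1) 1(3) by (rule yeq.yeq_Scale)
  also have "\<dots> \<approx>\<^bsub>m,X,A\<^esub> Tensor M t (k \<odot>\<^bsub>E X M\<^esub> e)"
    unfolding ywf_Scale.prems
    using ywf_Scale(1) 1 extenD[OF 1(2)] by (intro yeq.yeq_sym[OF yeq.yeq_Tensor_smult_right]) auto
  finally have "Scale k s \<approx>\<^bsub>m,X,A\<^esub> Tensor M t (k \<odot>\<^bsub>E X M\<^esub> e)" .
  moreover have "carried n X A N \<sigma> (Scale k s) \<eta> \<longleftrightarrow> carried n X A N \<sigma> (Tensor M t (k \<odot>\<^bsub>E X M\<^esub> e)) \<eta>"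
    if "wf_yterm n N A \<sigma>" for N \<sigma> \<eta>
    using 1(4)[OF that] push_smult[OF _ 1(2) ywf_Scale(1)] by auto
  ultimately show ?case using 1(1) e by blast
next
  case (ywf_Tensor X M m A t e)
  then have "exten e X M" "wf_yterm n M A t" by (auto simp: extenI)
  moreover then have "Tensor M t e \<approx>\<^bsub>Suc n,X,A\<^esub> Tensor M t e" by (intro yeq_reflI) auto
  ultimately show ?case using ywf_Tensor.prems by blast
qed auto

lemma carried_exists:
  assumes "wf_yterm (Suc n) X A s" "n \<ge> 1"
  obtains N \<sigma> \<eta> where "wf_yterm n N A \<sigma>" "exten \<eta> X N" "carried n X A N \<sigma> s \<eta>"
proof -
  obtain M t e where 1: "wf_yterm n M A t" "exten e X M"
    "carried n X A M t s e \<longleftrightarrow> carried n X A M t (Tensor M t e) e"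
    using pure_tensor[OF assms(1) refl assms(2)] by blast
  have "carried n X A M t (Tensor M t e) e"
    using 1 ypull_id[OF 1(1)] yeq_reflI[OF 1(1)] extenD[OF 1(2)] by (auto intro!: exI[of _ "Id \<C> M"])
  then show ?thesis using 1 that by blast
qed

text \<open>This is all that level \<open>Suc n\<close> needs to know about level \<open>n\<close>
  in order to compare tensors.\<close>

definition half_exact :: "nat \<Rightarrow> 'o \<Rightarrow> bool"
  where "half_exact n A \<longleftrightarrow> (\<forall>M x N y X \<delta> t. triangle \<C> M x N y X \<delta> \<longrightarrow> wf_yterm n N A t \<longrightarrow>
    ypull \<C> x t \<approx>\<^bsub>n,M,A\<^esub> Zero \<longrightarrow> (\<exists>s. wf_yterm n X A s \<and> t \<approx>\<^bsub>n,N,A\<^esub> ypull \<C> y s))"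

text \<open>Take the weak pushout \<open>W\<close> of \<open>z\<close> and the inflation
  \<open>g\<close> realizing \<open>e\<close>. The pair \<open>(0, s)\<close> on
  \<open>Q \<oplus> V\<close> restricts to zero on \<open>M\<close>, so it descends to
  \<open>W\<close> by half exactness. In \<open>W\<close> the composite of \<open>z\<close> is, up
  to sign, a map through \<open>g\<close>, and \<open>g\<close> pushes \<open>e\<close> to
  zero.\<close>

lemma half_exact_extend:
  assumes he: "half_exact n A" and e: "exten e X M" and z: "z \<Colon> M \<rightarrow> V"
    and s: "wf_yterm n V A s" "ypull \<C> z s \<approx>\<^bsub>n,M,A\<^esub> Zero"
  obtains W \<pi> \<sigma> where "\<pi> \<Colon> V \<rightarrow> W" "wf_yterm n W A \<sigma>" "s \<approx>\<^bsub>n,V,A\<^esub> ypull \<C> \<pi> \<sigma>" "(\<pi> \<cdot> z) \<triangleright> e = \<zero>\<^bsub>E X W\<^esub>"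
proof -
  obtain g Q g' where t: "triangle \<C> M g Q g' X e" using triangle_exists[OF e] by blast
  note d = triangleD[OF t] and V = morD(2)[OF z]
  obtain P i j p q where P: "biproduct \<C> Q V P i j p q" using biproduct_exists d(5) V by meson
  note b = biproductD[OF P]
  let ?f = "(i \<cdot> g) \<oplus>\<^bsub>H M P\<^esub> (j \<cdot> z)"
  obtain W \<pi>' \<delta>' where tw: "triangle \<C> M ?f P \<pi>' W \<delta>'" using inflation_pair[OF t z P] .
  note dw = triangleD[OF tw]
  have ig: "i \<cdot> g \<Colon> M \<rightarrow> P" and jz: "j \<cdot> z \<Colon> M \<rightarrow> P" using b d z by blast+
  have qf: "q \<cdot> ?f = z"
    using cmp_add_right(1)[OF ig jz b(4)] assoc[OF d(1) b(1,4), symmetric] assoc[OF z b(2,4), symmetric] b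
      cmp_zero_left[OF d(1) V] z by simp
  have qs: "wf_yterm n P A (ypull \<C> q s)" using ypull_wf[OF s(1) b(4)] .
  have "ypull \<C> ?f (ypull \<C> q s) = ypull \<C> z s" using ypull_ypull[OF s(1) b(4) dw(1)] qf by simp
  then obtain \<sigma> where \<sigma>: "wf_yterm n W A \<sigma>" "ypull \<C> q s \<approx>\<^bsub>n,P,A\<^esub> ypull \<C> \<pi>' \<sigma>"
    using he tw qs s(2) unfolding half_exact_def by metis
  have pj: "\<pi>' \<cdot> j \<Colon> V \<rightarrow> W" and pi: "\<pi>' \<cdot> i \<Colon> Q \<rightarrow> W" using dw b by blast+
  have "s = ypull \<C> j (ypull \<C> q s)" using ypull_ypull[OF s(1) b(4,2)] b(6) ypull_id[OF s(1)] by simp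
  also have "\<dots> \<approx>\<^bsub>n,V,A\<^esub> ypull \<C> j (ypull \<C> \<pi>' \<sigma>)" using ypull_cong[OF \<sigma>(2) b(2)] .
  also have "\<dots> = ypull \<C> (\<pi>' \<cdot> j) \<sigma>" using ypull_ypull[OF \<sigma>(1) dw(2) b(2)] by simp
  finally have 1: "s \<approx>\<^bsub>n,V,A\<^esub> ypull \<C> (\<pi>' \<cdot> j) \<sigma>" .
  have W: "exten ((\<pi>' \<cdot> j \<cdot> z) \<triangleright> e) X W" using pj z e by blast
  have m: "\<pi>' \<cdot> i \<cdot> g \<Colon> M \<rightarrow> W" "\<pi>' \<cdot> j \<cdot> z \<Colon> M \<rightarrow> W" using pi pj d z by blast+
  have "\<pi>' \<cdot> ?f = (\<pi>' \<cdot> i \<cdot> g) \<oplus>\<^bsub>H M W\<^esub> (\<pi>' \<cdot> j \<cdot> z)"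
    using cmp_add_right(1)[OF ig jz dw(2)] assoc[OF d(1) b(1) dw(2)] assoc[OF z b(2) dw(2)] by simp
  then have "\<zero>\<^bsub>H M W\<^esub> = (\<pi>' \<cdot> i \<cdot> g) \<oplus>\<^bsub>H M W\<^esub> (\<pi>' \<cdot> j \<cdot> z)" using triangle_cmp_zero[OF tw] by simp
  then have "\<zero>\<^bsub>H M W\<^esub> \<triangleright> e = ((\<pi>' \<cdot> i \<cdot> g) \<triangleright> e) \<oplus>\<^bsub>E X W\<^esub> ((\<pi>' \<cdot> j \<cdot> z) \<triangleright> e)"
    using push_mor_linear(1)[OF m e] by simp
  also have "(\<pi>' \<cdot> i \<cdot> g) \<triangleright> e = \<zero>\<^bsub>E X W\<^esub>"
    using push_push[OF d(1) pi e] triangle_push_zero[OF t] push_zero[OF pi d(6)] by simp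
  finally have "(\<pi>' \<cdot> j \<cdot> z) \<triangleright> e = \<zero>\<^bsub>E X W\<^esub>" using push_zero_mor[OF e dw(6)] W by simp
  then show ?thesis using that pj \<sigma>(1) 1 by blast
qed

text \<open>For a single tensor both carryings are morphisms \<open>x\<close> and \<open>x'\<close>
  out of \<open>M\<close>. The pair \<open>(\<sigma>, \<sigma>')\<close> vanishes on the difference
  \<open>(x, -x')\<close>, so \<open>half_exact_extend\<close> maps both targets to a common one in
  which this difference kills \<open>e\<close>.\<close>

lemma carried_amalgam:
  assumes he: "half_exact n A" and s: "wf_yterm (Suc n) X A s" "n \<ge> 1"
    and c: "carried n X A N \<sigma> s \<eta>" "wf_yterm n N A \<sigma>" and c': "carried n X A N' \<sigma>' s \<eta>'" "wf_yterm n N' A \<sigma>'"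
  obtains W z z' \<tau> where "z \<Colon> N \<rightarrow> W" "z' \<Colon> N' \<rightarrow> W" "wf_yterm n W A \<tau>"
    "\<sigma> \<approx>\<^bsub>n,N,A\<^esub> ypull \<C> z \<tau>" "\<sigma>' \<approx>\<^bsub>n,N',A\<^esub> ypull \<C> z' \<tau>" "z \<triangleright> \<eta> = z' \<triangleright> \<eta>'"
proof -
  obtain M t e where 1: "wf_yterm n M A t" "exten e X M"
    "\<And>N \<sigma> \<eta>. wf_yterm n N A \<sigma> \<Longrightarrow> carried n X A N \<sigma> s \<eta> \<longleftrightarrow> carried n X A N \<sigma> (Tensor M t e) \<eta>"
    using pure_tensor[OF s(1) refl s(2)] by blast
  obtain x where x: "x \<Colon> M \<rightarrow> N" "t \<approx>\<^bsub>n,M,A\<^esub> ypull \<C> x \<sigma>" "\<eta> = x \<triangleright> e" using c 1(3)[OF c(2)] by auto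
  obtain x' where x': "x' \<Colon> M \<rightarrow> N'" "t \<approx>\<^bsub>n,M,A\<^esub> ypull \<C> x' \<sigma>'" "\<eta>' = x' \<triangleright> e" using c' 1(3)[OF c'(2)] by auto
  obtain P i j p q where P: "biproduct \<C> N N' P i j p q" using biproduct_exists x(1) x'(1) morD by meson
  note b = biproductD[OF P]
  note r = ypair[OF P c(2) c'(2)]
  let ?s = "Plus (ypull \<C> p \<sigma>) (ypull \<C> q \<sigma>')"
  have ix: "i \<cdot> x \<Colon> M \<rightarrow> P" and jx: "j \<cdot> x' \<Colon> M \<rightarrow> P" using b x x' by blast+
  have njx: "\<ominus>\<^bsub>H M P\<^esub> (j \<cdot> x') \<Colon> M \<rightarrow> P" using jx by blast
  let ?z = "(i \<cdot> x) \<oplus>\<^bsub>H M P\<^esub> (\<ominus>\<^bsub>H M P\<^esub> (j \<cdot> x'))"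
  have z: "?z \<Colon> M \<rightarrow> P" using ix njx by blast
  have a: "ypull \<C> (i \<cdot> x) ?s \<approx>\<^bsub>n,M,A\<^esub> t"
  proof -
    have "ypull \<C> (i \<cdot> x) ?s = ypull \<C> x (ypull \<C> i ?s)" using ypull_ypull[OF r(1) b(1) x(1)] .
    also have "\<dots> \<approx>\<^bsub>n,M,A\<^esub> ypull \<C> x \<sigma>" using ypull_cong[OF r(2) x(1)] .
    also have "\<dots> \<approx>\<^bsub>n,M,A\<^esub> t" using yeq.yeq_sym[OF x(2)] .
    finally show ?thesis .
  qed
  have a': "ypull \<C> (j \<cdot> x') ?s \<approx>\<^bsub>n,M,A\<^esub> t"
  proof -
    have "ypull \<C> (j \<cdot> x') ?s = ypull \<C> x' (ypull \<C> j ?s)" using ypull_ypull[OF r(1) b(2) x'(1)] .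
    also have "\<dots> \<approx>\<^bsub>n,M,A\<^esub> ypull \<C> x' \<sigma>'" using ypull_cong[OF r(3) x'(1)] .
    also have "\<dots> \<approx>\<^bsub>n,M,A\<^esub> t" using yeq.yeq_sym[OF x'(2)] .
    finally show ?thesis .
  qed
  have "ypull \<C> ?z ?s \<approx>\<^bsub>n,M,A\<^esub> Plus (ypull \<C> (i \<cdot> x) ?s) (ypull \<C> (\<ominus>\<^bsub>H M P\<^esub> (j \<cdot> x')) ?s)"
    using ypull_add[OF r(1) ix njx] .
  also have "\<dots> \<approx>\<^bsub>n,M,A\<^esub> Plus t (yneg t)"
    using yeq.yeq_trans[OF ypull_neg[OF r(1) jx] yeq.yeq_Scale[OF neg_one_closed a']] a
      by (intro yeq.yeq_Plus)
  also have "\<dots> \<approx>\<^bsub>n,M,A\<^esub> Zero" using yPlus_neg[OF 1(1)] .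
  finally have "ypull \<C> ?z ?s \<approx>\<^bsub>n,M,A\<^esub> Zero" .
  then obtain W \<pi> \<tau> where w: "\<pi> \<Colon> P \<rightarrow> W" "wf_yterm n W A \<tau>" "?s \<approx>\<^bsub>n,P,A\<^esub> ypull \<C> \<pi> \<tau>" "(\<pi> \<cdot> ?z) \<triangleright> e
    = \<zero>\<^bsub>E X W\<^esub>"
    using half_exact_extend[OF he 1(2) z r(1)] by blast
  have m: "\<pi> \<cdot> i \<Colon> N \<rightarrow> W" "\<pi> \<cdot> j \<Colon> N' \<rightarrow> W" using w b by blast+
  have "\<sigma> \<approx>\<^bsub>n,N,A\<^esub> ypull \<C> (\<pi> \<cdot> i) \<tau>"
    using yeq.yeq_trans[OF yeq.yeq_sym[OF r(2)] ypull_cong[OF w(3) b(1)]] ypull_ypull[OF w(2,1) b(1)] by simp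
  moreover have "\<sigma>' \<approx>\<^bsub>n,N',A\<^esub> ypull \<C> (\<pi> \<cdot> j) \<tau>"
    using yeq.yeq_trans[OF yeq.yeq_sym[OF r(3)] ypull_cong[OF w(3) b(2)]] ypull_ypull[OF w(2,1) b(2)] by simp
  moreover have "(\<pi> \<cdot> i) \<triangleright> \<eta> = (\<pi> \<cdot> j) \<triangleright> \<eta>'"
  proof -
    have k: "\<pi> \<cdot> (i \<cdot> x) \<Colon> M \<rightarrow> W" "\<pi> \<cdot> (j \<cdot> x') \<Colon> M \<rightarrow> W" using w ix jx by blast+
    have nk: "\<ominus>\<^bsub>H M W\<^esub> (\<pi> \<cdot> (j \<cdot> x')) \<Colon> M \<rightarrow> W" using k by blast
    have "\<pi> \<cdot> ?z = (\<pi> \<cdot> (i \<cdot> x)) \<oplus>\<^bsub>H M W\<^esub> (\<ominus>\<^bsub>H M W\<^esub> (\<pi> \<cdot> (j \<cdot> x')))"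
      using cmp_add_right(1)[OF ix njx w(1)] cmp_add_right(3)[OF jx jx w(1)] by simp
    then have "(\<pi> \<cdot> (i \<cdot> x)) \<triangleright> e \<oplus>\<^bsub>E X W\<^esub> (\<ominus>\<^bsub>E X W\<^esub> ((\<pi> \<cdot> (j \<cdot> x')) \<triangleright> e)) = \<zero>\<^bsub>E X W\<^esub>"
      using w(4) push_mor_linear(1)[OF k(1) nk 1(2)] push_mor_linear(3)[OF k(2,2) 1(2)] by simp
    then have "(\<pi> \<cdot> (i \<cdot> x)) \<triangleright> e = (\<pi> \<cdot> (j \<cdot> x')) \<triangleright> e"
      using ext_add_neg_eq[OF exten_push[OF k(1) 1(2)] exten_push[OF k(2) 1(2)]] by blast
    then show ?thesis using x(3) x'(3) push_push[OF x(1) m(1) 1(2)] push_push[OF x'(1) m(2) 1(2)]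
        assoc[OF x(1) b(1) w(1)] assoc[OF x'(1) b(2) w(1)] by simp
  qed
  ultimately show ?thesis using that m w(2) by blast
qed

definition linked :: "nat \<Rightarrow> 'o \<Rightarrow> 'o \<Rightarrow> ('k, 'o, 'e) yterm \<Rightarrow> ('k, 'o, 'e) yterm \<Rightarrow> bool"
  where "linked n X A s s' \<longleftrightarrow>
    (\<exists>N \<sigma> \<eta>. wf_yterm n N A \<sigma> \<and> carried n X A N \<sigma> s \<eta> \<and> carried n X A N \<sigma> s' \<eta>)"

lemma linkedI: "\<lbrakk>wf_yterm n N A \<sigma>; carried n X A N \<sigma> s \<eta>; carried n X A N \<sigma> s' \<eta>\<rbrakk> \<Longrightarrow> linked n X A s s'"
  unfolding linked_def by blast

text \<open>Both targets are included in their biproduct, which carries the pair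
  \<open>(\<sigma>1, \<sigma>2)\<close>.\<close>

lemma linked_Plus:
  assumes w: "wf_yterm (Suc n) X A s" "wf_yterm (Suc n) X A s'" "wf_yterm (Suc n) X A t"
    "wf_yterm (Suc n) X A t'"
    and l: "linked n X A s s'" "linked n X A t t'"
  shows "linked n X A (Plus s t) (Plus s' t')"
proof -
  obtain N1 \<sigma>1 \<eta>1 where 1: "wf_yterm n N1 A \<sigma>1" "carried n X A N1 \<sigma>1 s \<eta>1" "carried n X A N1 \<sigma>1 s' \<eta>1"
    using l(1) unfolding linked_def by blast
  obtain N2 \<sigma>2 \<eta>2 where 2: "wf_yterm n N2 A \<sigma>2" "carried n X A N2 \<sigma>2 t \<eta>2" "carried n X A N2 \<sigma>2 t' \<eta>2"
    using l(2) unfolding linked_def by blast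
  obtain P i j p q where P: "biproduct \<C> N1 N2 P i j p q"
    using biproduct_exists ywfD(2)[OF 1(1)] ywfD(2)[OF 2(1)] by meson
  note b = biproductD[OF P]
  note r = ypair[OF P 1(1) 2(1)]
  note m1 = carried_mono[OF _ refl _ b(1) yeq.yeq_sym[OF r(2)] r(1)]
  note m2 = carried_mono[OF _ refl _ b(2) yeq.yeq_sym[OF r(3)] r(1)]
  let ?s = "Plus (ypull \<C> p \<sigma>1) (ypull \<C> q \<sigma>2)" and ?e = "(i \<triangleright> \<eta>1) \<oplus>\<^bsub>E X P\<^esub> (j \<triangleright> \<eta>2)"
  have "carried n X A P ?s (Plus s t) ?e" using m1[OF w(1) 1(2)] m2[OF w(3) 2(2)]
    by (subst carried.simps) blast
  moreover have "carried n X A P ?s (Plus s' t') ?e" using m1[OF w(2) 1(3)] m2[OF w(4) 2(3)]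
    by (subst carried.simps) blast
  ultimately show ?thesis using linkedI[OF r(1)] by blast
qed

text \<open>Two cospans that share the term \<open>t\<close> are completed by amalgamation to one;
  this is how zigzags of coend relations are shortened.\<close>

lemma linked_trans:
  assumes he: "half_exact n A" "n \<ge> 1"
    and w: "wf_yterm (Suc n) X A s" "wf_yterm (Suc n) X A t" "wf_yterm (Suc n) X A u"
    and l: "linked n X A s t" "linked n X A t u"
  shows "linked n X A s u"
proof -
  obtain N1 \<sigma>1 \<eta>1 where 1: "wf_yterm n N1 A \<sigma>1" "carried n X A N1 \<sigma>1 s \<eta>1" "carried n X A N1 \<sigma>1 t \<eta>1"
    using l(1) unfolding linked_def by blast
  obtain N2 \<sigma>2 \<eta>2 where 2: "wf_yterm n N2 A \<sigma>2" "carried n X A N2 \<sigma>2 t \<eta>2" "carried n X A N2 \<sigma>2 u \<eta>2"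
    using l(2) unfolding linked_def by blast
  obtain W z z' \<tau> where W: "z \<Colon> N1 \<rightarrow> W" "z' \<Colon> N2 \<rightarrow> W" "wf_yterm n W A \<tau>"
    "\<sigma>1 \<approx>\<^bsub>n,N1,A\<^esub> ypull \<C> z \<tau>" "\<sigma>2 \<approx>\<^bsub>n,N2,A\<^esub> ypull \<C> z' \<tau>" "z \<triangleright> \<eta>1 = z' \<triangleright> \<eta>2"
    using carried_amalgam[OF he(1) w(2) he(2) 1(3,1) 2(2,1)] .
  show ?thesis
    using linkedI[OF W(3) carried_mono[OF w(1) refl 1(2) W(1,4,3)]] carried_mono[OF w(3) refl 2(3) W(2,5,3)]
      W(6) by simp
qed

section \<open>Long exact sequences\<close>

lemma carried_Id:
  "\<lbrakk>t \<approx>\<^bsub>n,M,A\<^esub> s; exten e X M\<rbrakk> \<Longrightarrow> carried n X A M s (Tensor M t e) e"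
  using ypull_id[of n M A s] yeqD2 by (auto intro!: exI[of _ "Id \<C> M"] dest: extenD)

lemma ext_smult_simps:
  assumes "exten e X N"
  shows "\<zero>\<^bsub>K\<^esub> \<odot>\<^bsub>E X N\<^esub> e = \<zero>\<^bsub>E X N\<^esub>" "\<one>\<^bsub>K\<^esub> \<odot>\<^bsub>E X N\<^esub> e = e"
    "\<lbrakk>k \<in> carrier K; l \<in> carrier K\<rbrakk> \<Longrightarrow> (k \<otimes>\<^bsub>K\<^esub> l) \<odot>\<^bsub>E X N\<^esub> e = k \<odot>\<^bsub>E X N\<^esub> (l \<odot>\<^bsub>E X N\<^esub> e)"
    "\<lbrakk>k \<in> carrier K; l \<in> carrier K\<rbrakk> \<Longrightarrow> (k \<oplus>\<^bsub>K\<^esub> l) \<odot>\<^bsub>E X N\<^esub> e = (k \<odot>\<^bsub>E X N\<^esub> e) \<oplus>\<^bsub>E X N\<^esub> (l \<odot>\<^bsub>E X N\<^esub> e)"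
    "\<lbrakk>k \<in> carrier K; exten e' X N\<rbrakk> \<Longrightarrow> k \<odot>\<^bsub>E X N\<^esub> (e \<oplus>\<^bsub>E X N\<^esub> e') = (k \<odot>\<^bsub>E X N\<^esub> e) \<oplus>\<^bsub>E X N\<^esub> (k \<odot>\<^bsub>E X N\<^esub> e')"
proof -
  interpret V: module K "E X N" using Ext_vectorspace[OF extenD(1,2)[OF assms]] by (simp add: vectorspace_def)
  note e = extenD(3)[OF assms]
  show "\<zero>\<^bsub>K\<^esub> \<odot>\<^bsub>E X N\<^esub> e = \<zero>\<^bsub>E X N\<^esub>" "\<one>\<^bsub>K\<^esub> \<odot>\<^bsub>E X N\<^esub> e = e" using e by simp_all
  show "\<lbrakk>k \<in> carrier K; l \<in> carrier K\<rbrakk> \<Longrightarrow> (k \<otimes>\<^bsub>K\<^esub> l) \<odot>\<^bsub>E X N\<^esub> e = k \<odot>\<^bsub>E X N\<^esub> (l \<odot>\<^bsub>E X N\<^esub> e)"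
    by (rule V.smult_assoc1[OF _ _ e])
  show "\<lbrakk>k \<in> carrier K; l \<in> carrier K\<rbrakk> \<Longrightarrow> (k \<oplus>\<^bsub>K\<^esub> l) \<odot>\<^bsub>E X N\<^esub> e = (k \<odot>\<^bsub>E X N\<^esub> e) \<oplus>\<^bsub>E X N\<^esub> (l \<odot>\<^bsub>E X N\<^esub> e)"
    by (rule V.smult_l_distr[OF _ _ e])
  show "\<lbrakk>k \<in> carrier K; exten e' X N\<rbrakk> \<Longrightarrow> k \<odot>\<^bsub>E X N\<^esub> (e \<oplus>\<^bsub>E X N\<^esub> e') = (k \<odot>\<^bsub>E X N\<^esub> e) \<oplus>\<^bsub>E X N\<^esub> (k \<odot>\<^bsub>E X N\<^esub> e')"
    by (rule V.smult_r_distr[OF _ e extenD(3)])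
qed

text \<open>Induction on the congruence. Each generating relation has an explicit common target, and
  half exactness enters only through transitivity.\<close>

lemma yeq_linked:
  "\<lbrakk>s \<approx>\<^bsub>m,X,A\<^esub> s'; m = Suc n; n \<ge> 1; half_exact n A\<rbrakk> \<Longrightarrow> linked n X A s s'"
proof (induction rule: yeq.induct)
  case (yeq_refl m X A t)
  then show ?case using carried_exists linkedI by metis
next
  case (yeq_sym m X A s t)
  then show ?case unfolding linked_def by blast
next
  case (yeq_trans m X A s t u)
  show ?case
    using linked_trans[OF yeq_trans.prems(3,2) _ _ _ yeq_trans.IH(1)[OF yeq_trans.prems]
      yeq_trans.IH(2)[OF yeq_trans.prems]]
      yeq_wf[OF yeq_trans(1)] yeq_wf[OF yeq_trans(2)] yeq_trans.prems(1) by blast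
next
  case (yeq_Plus m X A s s' t t')
  show ?case
    using linked_Plus[OF _ _ _ _ yeq_Plus.IH(1)[OF yeq_Plus.prems] yeq_Plus.IH(2)[OF yeq_Plus.prems]]
      yeq_wf[OF yeq_Plus(1)] yeq_wf[OF yeq_Plus(2)] yeq_Plus.prems(1) by blast
next
  case (yeq_Scale k m X A t t')
  then show ?case unfolding linked_def carried.simps by blast
next
  case (yeq_Tensor X M m A t t' e)
  then have e: "exten e X M" by (simp add: extenI)
  have t: "t \<approx>\<^bsub>n,M,A\<^esub> t'" using yeq_Tensor by simp
  show ?case using linkedI[OF yeqD2[OF t] carried_Id[OF t e] carried_Id[OF yeq_reflI[OF yeqD2[OF t]] e]] .
next
  case (yeq_assoc m X A s t u)
  have "wf_yterm (Suc n) X A (Plus (Plus s t) u)" using yeq_assoc by simp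
  then obtain N \<sigma> \<eta> where c: "wf_yterm n N A \<sigma>" "carried n X A N \<sigma> (Plus (Plus s t) u) \<eta>"
    using carried_exists yeq_assoc.prems by metis
  then obtain a b d where h: "carried n X A N \<sigma> s a" "carried n X A N \<sigma> t b" "carried n X A N \<sigma> u d"
    "\<eta> = (a \<oplus>\<^bsub>E X N\<^esub> b) \<oplus>\<^bsub>E X N\<^esub> d" by auto
  note N = ywfD(2)[OF c(1)]
  have "exten a X N" "exten b X N" "exten d X N" using carried_exten h N yeq_assoc by blast+
  then have "\<eta> = a \<oplus>\<^bsub>E X N\<^esub> (b \<oplus>\<^bsub>E X N\<^esub> d)" using ext_add_assoc h by blast
  then have "carried n X A N \<sigma> (Plus s (Plus t u)) \<eta>" using h unfolding carried.simps by blast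
  then show ?case using linkedI c by blast
next
  case (yeq_comm m X A s t)
  have "wf_yterm (Suc n) X A (Plus s t)" using yeq_comm by simp
  then obtain N \<sigma> \<eta> where c: "wf_yterm n N A \<sigma>" "carried n X A N \<sigma> (Plus s t) \<eta>"
    using carried_exists yeq_comm.prems by metis
  then obtain a b where h: "carried n X A N \<sigma> s a" "carried n X A N \<sigma> t b" "\<eta> = a \<oplus>\<^bsub>E X N\<^esub> b" by auto
  note N = ywfD(2)[OF c(1)]
  have "exten a X N" "exten b X N" using carried_exten h N yeq_comm by blast+
  then have "\<eta> = b \<oplus>\<^bsub>E X N\<^esub> a" using ext_add_comm h by blast
  then have "carried n X A N \<sigma> (Plus t s) \<eta>" using h unfolding carried.simps by blast
  then show ?case using linkedI c by blast
next
  case (yeq_Zero m X A t)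
  then obtain N \<sigma> \<eta> where c: "wf_yterm n N A \<sigma>" "carried n X A N \<sigma> t \<eta>"
    using carried_exists by metis
  note N = ywfD(2)[OF c(1)]
  have "exten \<eta> X N" using carried_exten c N yeq_Zero by blast
  then have "\<eta> = \<zero>\<^bsub>E X N\<^esub> \<oplus>\<^bsub>E X N\<^esub> \<eta>" by simp
  then have "carried n X A N \<sigma> (Plus Zero t) \<eta>" using c unfolding carried.simps by blast
  then show ?case using linkedI c by blast
next
  case (yeq_Scale_zero m X A t)
  then obtain N \<sigma> \<eta> where c: "wf_yterm n N A \<sigma>" "carried n X A N \<sigma> t \<eta>"
    using carried_exists by metis
  note N = ywfD(2)[OF c(1)] and X = ywfD(2)[OF yeq_Scale_zero(1)]
  have "exten \<eta> X N" using carried_exten c N yeq_Scale_zero by blast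
  then have "\<zero>\<^bsub>E X N\<^esub> = \<zero>\<^bsub>K\<^esub> \<odot>\<^bsub>E X N\<^esub> \<eta>" using ext_smult_simps(1) by simp
  then have "carried n X A N \<sigma> (Scale \<zero>\<^bsub>K\<^esub> t) \<zero>\<^bsub>E X N\<^esub>" using c unfolding carried.simps by blast
  then show ?case using linkedI[OF c(1), of X _ "\<zero>\<^bsub>E X N\<^esub>" Zero] by simp
next
  case (yeq_Scale_one m X A t)
  then obtain N \<sigma> \<eta> where c: "wf_yterm n N A \<sigma>" "carried n X A N \<sigma> t \<eta>"
    using carried_exists by metis
  note N = ywfD(2)[OF c(1)] and X = ywfD(2)[OF yeq_Scale_one(1)]
  have "exten \<eta> X N" using carried_exten c N yeq_Scale_one by blast
  then have "\<eta> = \<one>\<^bsub>K\<^esub> \<odot>\<^bsub>E X N\<^esub> \<eta>" using ext_smult_simps(2) by simp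
  then have "carried n X A N \<sigma> (Scale \<one>\<^bsub>K\<^esub> t) \<eta>" using c unfolding carried.simps by blast
  then show ?case using linkedI c by blast
next
  case (yeq_Scale_mult k l m X A t)
  then obtain N \<sigma> \<eta> where c: "wf_yterm n N A \<sigma>" "carried n X A N \<sigma> t \<eta>"
    using carried_exists by metis
  note N = ywfD(2)[OF c(1)] and X = ywfD(2)[OF yeq_Scale_mult(3)]
  have "exten \<eta> X N" using carried_exten c N yeq_Scale_mult by blast
  then have "(k \<otimes>\<^bsub>K\<^esub> l) \<odot>\<^bsub>E X N\<^esub> \<eta> = k \<odot>\<^bsub>E X N\<^esub> (l \<odot>\<^bsub>E X N\<^esub> \<eta>)"
    using ext_smult_simps(3) yeq_Scale_mult by simp
  then have "carried n X A N \<sigma> (Scale k (Scale l t)) ((k \<otimes>\<^bsub>K\<^esub> l) \<odot>\<^bsub>E X N\<^esub> \<eta>)"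
    "carried n X A N \<sigma> (Scale (k \<otimes>\<^bsub>K\<^esub> l) t) ((k \<otimes>\<^bsub>K\<^esub> l) \<odot>\<^bsub>E X N\<^esub> \<eta>)"
    using c unfolding carried.simps by blast+
  then show ?case using linkedI c by blast
next
  case (yeq_Scale_add k l m X A t)
  then obtain N \<sigma> \<eta> where c: "wf_yterm n N A \<sigma>" "carried n X A N \<sigma> t \<eta>"
    using carried_exists by metis
  note N = ywfD(2)[OF c(1)] and X = ywfD(2)[OF yeq_Scale_add(3)]
  have "exten \<eta> X N" using carried_exten c N yeq_Scale_add by blast
  then have "(k \<oplus>\<^bsub>K\<^esub> l) \<odot>\<^bsub>E X N\<^esub> \<eta> = (k \<odot>\<^bsub>E X N\<^esub> \<eta>) \<oplus>\<^bsub>E X N\<^esub> (l \<odot>\<^bsub>E X N\<^esub> \<eta>)"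
    using ext_smult_simps(4) yeq_Scale_add by simp
  then have "carried n X A N \<sigma> (Plus (Scale k t) (Scale l t)) ((k \<oplus>\<^bsub>K\<^esub> l) \<odot>\<^bsub>E X N\<^esub> \<eta>)"
    "carried n X A N \<sigma> (Scale (k \<oplus>\<^bsub>K\<^esub> l) t) ((k \<oplus>\<^bsub>K\<^esub> l) \<odot>\<^bsub>E X N\<^esub> \<eta>)"
    using c unfolding carried.simps by blast+
  then show ?case using linkedI c by blast
next
  case (yeq_Scale_Plus k m X A s t)
  have "wf_yterm (Suc n) X A (Plus s t)" using yeq_Scale_Plus by simp
  then obtain N \<sigma> \<eta> where c: "wf_yterm n N A \<sigma>" "carried n X A N \<sigma> (Plus s t) \<eta>"
    using carried_exists yeq_Scale_Plus.prems by metis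
  then obtain a b where h: "carried n X A N \<sigma> s a" "carried n X A N \<sigma> t b" "\<eta> = a \<oplus>\<^bsub>E X N\<^esub> b" by auto
  note N = ywfD(2)[OF c(1)] and X = ywfD(2)[OF yeq_Scale_Plus(2)]
  have "exten a X N" "exten b X N" using carried_exten h N yeq_Scale_Plus by blast+
  then have "k \<odot>\<^bsub>E X N\<^esub> \<eta> = (k \<odot>\<^bsub>E X N\<^esub> a) \<oplus>\<^bsub>E X N\<^esub> (k \<odot>\<^bsub>E X N\<^esub> b)"
    using ext_smult_simps(5) yeq_Scale_Plus h by simp
  then have "carried n X A N \<sigma> (Plus (Scale k s) (Scale k t)) (k \<odot>\<^bsub>E X N\<^esub> \<eta>)"
    "carried n X A N \<sigma> (Scale k (Plus s t)) (k \<odot>\<^bsub>E X N\<^esub> \<eta>)"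
    using h unfolding carried.simps by blast+
  then show ?case using linkedI c by blast
next
  case (yeq_Tensor_add_left X M m A s t e)
  then have e: "exten e X M" by (simp add: extenI)
  have w: "wf_yterm n M A s" "wf_yterm n M A t" using yeq_Tensor_add_left by auto
  obtain P i j p q where P: "biproduct \<C> M M P i j p q" using biproduct_exists extenD[OF e] by meson
  note b = biproductD[OF P]
  note r = ypair[OF P w]
  let ?s = "Plus (ypull \<C> p s) (ypull \<C> q t)"
  have "carried n X A P ?s (Tensor M s e) (i \<triangleright> e)" "carried n X A P ?s (Tensor M t e) (j \<triangleright> e)"
    using b yeq.yeq_sym[OF r(2)] yeq.yeq_sym[OF r(3)] unfolding carried.simps by blast+
  then have 1: "carried n X A P ?s (Plus (Tensor M s e) (Tensor M t e)) ((i \<triangleright> e) \<oplus>\<^bsub>E X P\<^esub> (j \<triangleright> e))"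
    by (subst carried.simps) blast
  \<comment> \<open>The diagonal \<open>i + j\<close> of \<open>M\<close> pulls the pair
    \<open>(s, t)\<close> back to \<open>s + t\<close> and pushes \<open>e\<close> to
    \<open>(e, e)\<close>, which is also where the two separate tensors are carried in
    total.\<close>
  have F: "ypull \<C> (i \<oplus>\<^bsub>H M P\<^esub> j) ?s \<approx>\<^bsub>n,M,A\<^esub> Plus s t"
    using yeq.yeq_trans[OF ypull_add[OF r(1) b(1,2)] yeq.yeq_Plus[OF r(2,3)]] .
  then have 2: "carried n X A P ?s (Tensor M (Plus s t) e) ((i \<triangleright> e) \<oplus>\<^bsub>E X P\<^esub> (j \<triangleright> e))"
    unfolding carried.simps
    by - (rule exI[of _ "i \<oplus>\<^bsub>H M P\<^esub> j"],
      intro conjI mor_add[OF b(1,2)] yeq.yeq_sym[OF F] push_mor_linear(1)[OF b(1,2) e, symmetric])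
  show ?case using linkedI[OF r(1) 2 1] .
next
  case (yeq_Tensor_smult_left X M k m A t e)
  then have e: "exten e X M" and w: "wf_yterm n M A t" by (auto simp: extenI)
  note i = mor_id[OF extenD(2)[OF e]]
  \<comment> \<open>The scalar \<open>k\<close> moves across the tensor as the endomorphism
    \<open>k 1\<close> of \<open>M\<close>.\<close>
  have "ypull \<C> (k \<odot>\<^bsub>H M M\<^esub> Id \<C> M) t \<approx>\<^bsub>n,M,A\<^esub> Scale k t"
    using ypull_smult[OF w i yeq_Tensor_smult_left(3)] ypull_id[OF w] by simp
  moreover have "(k \<odot>\<^bsub>H M M\<^esub> Id \<C> M) \<triangleright> e = k \<odot>\<^bsub>E X M\<^esub> e"
    using push_mor_linear(4)[OF i i e yeq_Tensor_smult_left(3)] e by simp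
  ultimately have "carried n X A M t (Tensor M (Scale k t) e) (k \<odot>\<^bsub>E X M\<^esub> e)"
    unfolding carried.simps using mor_smult[OF yeq_Tensor_smult_left(3) i] yeq.yeq_sym by metis
  moreover have "carried n X A M t (Scale k (Tensor M t e)) (k \<odot>\<^bsub>E X M\<^esub> e)"
    using carried_Id[OF yeq_reflI[OF w] e] by (subst carried.simps) blast
  ultimately show ?case using linkedI w by blast
next
  case (yeq_Tensor_add_right X M m A t e e')
  then have e: "exten e X M" "exten e' X M" and w: "wf_yterm n M A t" by (auto simp: extenI)
  have "carried n X A M t (Plus (Tensor M t e) (Tensor M t e')) (e \<oplus>\<^bsub>E X M\<^esub> e')"
    using carried_Id[OF yeq_reflI[OF w] e(1)] carried_Id[OF yeq_reflI[OF w] e(2)]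
      by (subst carried.simps) blast
  then show ?case using linkedI[OF w carried_Id[OF yeq_reflI[OF w] exten_add[OF e]]] by blast
next
  case (yeq_Tensor_smult_right X M k m A t e)
  then have e: "exten e X M" and w: "wf_yterm n M A t" by (auto simp: extenI)
  have "carried n X A M t (Scale k (Tensor M t e)) (k \<odot>\<^bsub>E X M\<^esub> e)"
    using carried_Id[OF yeq_reflI[OF w] e] by (subst carried.simps) blast
  then show ?case
    using linkedI[OF w carried_Id[OF yeq_reflI[OF w] exten_smult[OF yeq_Tensor_smult_right(3) e]]] by blast
next
  case (yeq_coend X M N f m A t e)
  then have f: "f \<Colon> M \<rightarrow> N" and e: "exten e X M" and w: "wf_yterm n N A t" by (auto simp: extenI mor_def)
  have "carried n X A N t (Tensor M (ypull \<C> f t) e) (f \<triangleright> e)"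
    using f yeq_reflI[OF ypull_wf[OF w f]] by auto
  then show ?case using linkedI[OF w _ carried_Id[OF yeq_reflI[OF w] exten_push[OF f e]]] by blast
qed auto

text \<open>\<open>Zero\<close> is only carried to the value zero, so a cospan linking the tensor
  with \<open>Zero\<close> is a morphism that kills \<open>e\<close> and through which
  \<open>t\<close> is a pullback. All later arguments about vanishing tensors start here.\<close>

lemma Tensor_zeroD:
  assumes he: "half_exact n A" "n \<ge> 1" and z: "Tensor M t e \<approx>\<^bsub>Suc n,X,A\<^esub> Zero"
  obtains N u s where "u \<Colon> M \<rightarrow> N" "wf_yterm n N A s" "t \<approx>\<^bsub>n,M,A\<^esub> ypull \<C> u s" "u \<triangleright> e = \<zero>\<^bsub>E X N\<^esub>"
  using yeq_linked[OF z refl he(2,1)] that unfolding linked_def by auto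

section \<open>Exactness in the contravariant variable\<close>

lemma Tensor_cong_left: "\<lbrakk>t \<approx>\<^bsub>n,M,A\<^esub> t'; exten e X M\<rbrakk> \<Longrightarrow> Tensor M t e \<approx>\<^bsub>Suc n,X,A\<^esub> Tensor M t' e"
  by (intro yeq.yeq_Tensor) (auto dest: extenD)

lemma coend_rel:
  "\<lbrakk>wf_yterm n N A t; f \<Colon> M \<rightarrow> N; exten e X M\<rbrakk> \<Longrightarrow> Tensor M (ypull \<C> f t) e \<approx>\<^bsub>Suc n,X,A\<^esub> Tensor N t (f \<triangleright> e)"
  by (intro yeq.yeq_coend) (auto dest: extenD morD)

text \<open>The morphism \<open>u\<close> that witnesses the vanishing kills
  \<open>\<delta>\<close>, hence extends over the inflation \<open>x\<close>.\<close>

lemma contra_exact_left: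
  assumes he: "half_exact n A" "n \<ge> 1" and t: "triangle \<C> M x N y X \<delta>"
    and s: "wf_yterm n M A s" "Tensor M s \<delta> \<approx>\<^bsub>Suc n,X,A\<^esub> Zero"
  shows "\<exists>r. wf_yterm n N A r \<and> s \<approx>\<^bsub>n,M,A\<^esub> ypull \<C> x r"
proof -
  obtain V u r where u: "u \<Colon> M \<rightarrow> V" "wf_yterm n V A r" "s \<approx>\<^bsub>n,M,A\<^esub> ypull \<C> u r" "u \<triangleright> \<delta> = \<zero>\<^bsub>E X V\<^esub>"
    using Tensor_zeroD[OF he s(2)] .
  obtain b where b: "b \<Colon> N \<rightarrow> V" "b \<cdot> x = u" using extend_along_inflation[OF t u(1,4)] .
  show ?thesis using u(3) ypull_ypull[OF u(2) b(1) triangleD(1)[OF t]] b(2) ypull_wf[OF u(2) b(1)] by auto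
qed

text \<open>Write \<open>s\<close> as one tensor with last factor \<open>e\<close>. Its vanishing
  over \<open>N\<close> gives \<open>u\<close> such that \<open>u \<triangleright> e\<close> dies
  along \<open>y\<close>; exactness in degree one makes it a push of \<open>\<delta>\<close> along
  some \<open>c\<close>, and \<open>c\<close> is moved across the tensor.\<close>

lemma contra_exact_right:
  assumes he: "half_exact n A" "n \<ge> 1" and t: "triangle \<C> M x N y X \<delta>"
    and s: "wf_yterm (Suc n) X A s" "ypull \<C> y s \<approx>\<^bsub>Suc n,N,A\<^esub> Zero"
  shows "\<exists>r. wf_yterm n M A r \<and> s \<approx>\<^bsub>Suc n,X,A\<^esub> Tensor M r \<delta>"
proof -
  note d = triangleD[OF t]
  obtain M' t' e where p: "wf_yterm n M' A t'" "exten e X M'" "s \<approx>\<^bsub>Suc n,X,A\<^esub> Tensor M' t' e"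
    using pure_tensor[OF s(1) refl he(2)] by blast
  have z: "Tensor M' t' (e \<triangleleft> y) \<approx>\<^bsub>Suc n,N,A\<^esub> Zero"
    using yeq.yeq_trans[OF yeq.yeq_sym[OF ypull_cong[OF p(3) d(2)]] s(2)] by simp
  obtain V u r where u: "u \<Colon> M' \<rightarrow> V" "wf_yterm n V A r" "t' \<approx>\<^bsub>n,M',A\<^esub> ypull \<C> u r" "u \<triangleright> (e \<triangleleft> y) = \<zero>\<^bsub>E N V\<^esub>"
    using Tensor_zeroD[OF he z] .
  have ue: "exten (u \<triangleright> e) X V" using u(1) p(2) by blast
  have "(u \<triangleright> e) \<triangleleft> y = \<zero>\<^bsub>E N V\<^esub>" using u pull_push[OF u(1) d(2) p(2)] by simp
  then obtain c where c: "c \<Colon> M \<rightarrow> V" "u \<triangleright> e = c \<triangleright> \<delta>" using ext_exact_left_op[OF t ue] by blast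
  note p(3)
  also have "Tensor M' t' e \<approx>\<^bsub>Suc n,X,A\<^esub> Tensor M' (ypull \<C> u r) e" using Tensor_cong_left[OF u(3) p(2)] .
  also have "\<dots> \<approx>\<^bsub>Suc n,X,A\<^esub> Tensor V r (u \<triangleright> e)" using coend_rel[OF u(2,1) p(2)] .
  also have "\<dots> \<approx>\<^bsub>Suc n,X,A\<^esub> Tensor M (ypull \<C> c r) \<delta>" unfolding c(2)
    using yeq.yeq_sym[OF coend_rel[OF u(2) c(1) d(3)]] .
  finally show ?thesis using ypull_wf[OF u(2) c(1)] by blast
qed

text \<open>After moving along the witness \<open>u\<close>, the last factor restricts to zero along
  \<open>x\<close>, so exactness in degree one makes it a pullback along \<open>y\<close>, and with
  it the whole tensor.\<close>

lemma half_exact_Suc: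
  assumes he: "half_exact n A" "n \<ge> 1"
  shows "half_exact (Suc n) A"
  unfolding half_exact_def
proof (intro allI impI)
  fix M x N y X \<delta> s
  assume t: "triangle \<C> M x N y X \<delta>" and s: "wf_yterm (Suc n) N A s" "ypull \<C> x s \<approx>\<^bsub>Suc n,M,A\<^esub> Zero"
  note d = triangleD[OF t]
  obtain M' t' e where p: "wf_yterm n M' A t'" "exten e N M'" "s \<approx>\<^bsub>Suc n,N,A\<^esub> Tensor M' t' e"
    using pure_tensor[OF s(1) refl he(2)] by blast
  have z: "Tensor M' t' (e \<triangleleft> x) \<approx>\<^bsub>Suc n,M,A\<^esub> Zero"
    using yeq.yeq_trans[OF yeq.yeq_sym[OF ypull_cong[OF p(3) d(1)]] s(2)] by simp
  obtain V u r where u: "u \<Colon> M' \<rightarrow> V" "wf_yterm n V A r" "t' \<approx>\<^bsub>n,M',A\<^esub> ypull \<C> u r" "u \<triangleright> (e \<triangleleft> x) = \<zero>\<^bsub>E M V\<^esub>"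
    using Tensor_zeroD[OF he z] .
  have ue: "exten (u \<triangleright> e) N V" using u(1) p(2) by blast
  have "(u \<triangleright> e) \<triangleleft> x = \<zero>\<^bsub>E M V\<^esub>" using u pull_push[OF u(1) d(1) p(2)] by simp
  then obtain e' where e': "exten e' X V" "e' \<triangleleft> y = u \<triangleright> e" using ext_exact_middle_op[OF t ue] by blast
  note p(3)
  also have "Tensor M' t' e \<approx>\<^bsub>Suc n,N,A\<^esub> Tensor M' (ypull \<C> u r) e" using Tensor_cong_left[OF u(3) p(2)] .
  also have "\<dots> \<approx>\<^bsub>Suc n,N,A\<^esub> Tensor V r (u \<triangleright> e)" using coend_rel[OF u(2,1) p(2)] .
  also have "Tensor V r (u \<triangleright> e) = ypull \<C> y (Tensor V r e')" using e' by simp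
  finally have "s \<approx>\<^bsub>Suc n,N,A\<^esub> ypull \<C> y (Tensor V r e')" .
  moreover have "wf_yterm (Suc n) X A (Tensor V r e')" using e' u by simp
  ultimately show "\<exists>s'. wf_yterm (Suc n) X A s' \<and> s \<approx>\<^bsub>Suc n,N,A\<^esub> ypull \<C> y s'" by blast
qed

lemma half_exact_1:
  assumes "A \<in> Ob \<C>"
  shows "half_exact 1 A"
  unfolding half_exact_def
proof (intro allI impI)
  fix M x N y X \<delta> s
  assume t: "triangle \<C> M x N y X \<delta>" and s: "wf_yterm 1 N A s" "ypull \<C> x s \<approx>\<^bsub>1,M,A\<^esub> Zero"
  note d = triangleD[OF t]
  let ?e = "yeval N A s"
  have e: "exten ?e N A" and se: "s \<approx>\<^bsub>1,N,A\<^esub> Emb ?e" using yeval_exten[OF s(1)] yeval_yeq[OF s(1)] by auto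
  have "Emb (?e \<triangleleft> x) \<approx>\<^bsub>1,M,A\<^esub> Zero" using yeq.yeq_trans[OF yeq.yeq_sym[OF ypull_cong[OF se d(1)]] s(2)]
    by simp
  then have "?e \<triangleleft> x = \<zero>\<^bsub>E M A\<^esub>" using yEmb_Zero_iff[OF exten_pull[OF d(1) e]] by simp
  then obtain e' where e': "exten e' X A" "e' \<triangleleft> y = ?e" using ext_exact_middle_op[OF t e] by blast
  then have "s \<approx>\<^bsub>1,N,A\<^esub> ypull \<C> y (Emb e')" using se by simp
  then show "\<exists>s'. wf_yterm 1 X A s' \<and> s \<approx>\<^bsub>1,N,A\<^esub> ypull \<C> y s'" using e' by (intro exI[of _ "Emb e'"]) auto
qed

lemma half_exact:
  assumes "A \<in> Ob \<C>" "n \<ge> 1"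
  shows "half_exact n A"
  using assms(2) by (induction rule: dec_induct) (use half_exact_1[OF assms(1)] half_exact_Suc in auto)

section \<open>Exactness in the covariant variable\<close>

lemma efface:
  assumes s: "wf_yterm n N A s"
  obtains M k N' w \<delta> where "triangle \<C> M k N' w N \<delta>" "ypull \<C> w s \<approx>\<^bsub>n,N',A\<^esub> Zero"
proof (cases "n = 1")
  case True
  let ?e = "yeval N A s"
  have e: "exten ?e N A" and se: "s \<approx>\<^bsub>1,N,A\<^esub> Emb ?e" using yeval_exten[OF s True] yeval_yeq[OF s True] True
    by auto
  obtain k N' w where t: "triangle \<C> A k N' w N ?e" using triangle_exists[OF e] by blast
  note d = triangleD[OF t]
  \<comment> \<open>The deflation in a realization pulls its own extension back to zero. In higher
    degrees the same is applied to the last factor of a single tensor.\<close>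
  have "ypull \<C> w s \<approx>\<^bsub>1,N',A\<^esub> Zero"
    using yeq.yeq_trans[OF ypull_cong[OF se d(2)]] triangle_pull_zero[OF t] yEmb_zero[OF d(5,4)] by simp
  then show ?thesis using that t True by blast
next
  case False
  then obtain m where m: "n = Suc m" "m \<ge> 1" using ywfD(1)[OF s] by (cases n) auto
  obtain M t e where p: "wf_yterm m M A t" "exten e N M" "s \<approx>\<^bsub>n,N,A\<^esub> Tensor M t e"
    using pure_tensor[OF s m] by blast
  obtain k N' w where t: "triangle \<C> M k N' w N e" using triangle_exists[OF p(2)] by blast
  note d = triangleD[OF t]
  have "ypull \<C> w s \<approx>\<^bsub>n,N',A\<^esub> Zero"
    using yeq.yeq_trans[OF ypull_cong[OF p(3) d(2)]] triangle_pull_zero[OF t] yTensor_zero_right[OF p(1) d(5)]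
      m by simp
  then show ?thesis using that t by blast
qed

text \<open>The criterion of \<open>Tensor_zeroD\<close> is turned around: instead of a map out of
  \<open>M\<close> killing \<open>e\<close>, a map \<open>a\<close> into \<open>M\<close> killing
  \<open>t\<close>. Choose a deflation \<open>w\<close> that kills \<open>s\<close> and let
  \<open>R\<close> be the cocone of \<open>(w, u)\<close>, a weak pullback. Since \<open>u\<close>
  kills \<open>e\<close>, the extension \<open>e\<close> lifts to \<open>R\<close>; and on
  \<open>R\<close> the map through \<open>u\<close> agrees up to sign with one through
  \<open>w\<close>, so \<open>t\<close> becomes zero there.\<close>

lemma Tensor_zero_lift:
  assumes n: "n \<ge> 1" and z: "Tensor M t e \<approx>\<^bsub>Suc n,X,A\<^esub> Zero"
  obtains R a r where "a \<Colon> R \<rightarrow> M" "exten r X R" "a \<triangleright> r = e" "ypull \<C> a t \<approx>\<^bsub>n,R,A\<^esub> Zero"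
proof -
  have t: "wf_yterm n M A t" and e: "exten e X M" using yeqD1[OF z] by auto
  have A: "A \<in> Ob \<C>" using ywfD[OF t] by simp
  obtain N u s where u: "u \<Colon> M \<rightarrow> N" "wf_yterm n N A s" "t \<approx>\<^bsub>n,M,A\<^esub> ypull \<C> u s" "u \<triangleright> e = \<zero>\<^bsub>E X N\<^esub>"
    using Tensor_zeroD[OF half_exact[OF A n] n z] .
  obtain L k N' w \<delta> where w: "triangle \<C> L k N' w N \<delta>" "ypull \<C> w s \<approx>\<^bsub>n,N',A\<^esub> Zero" using efface[OF u(2)] .
  note d = triangleD[OF w(1)] and M = morD(1)[OF u(1)] and X = extenD(1)[OF e]
  obtain P i j p q where P: "biproduct \<C> N' M P i j p q" using biproduct_exists d(5) M by meson
  note b = biproductD[OF P]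
  let ?f = "(w \<cdot> p) \<oplus>\<^bsub>H P N\<^esub> (u \<cdot> q)"
  obtain R l \<delta>' where tr: "triangle \<C> R l P ?f N \<delta>'"
    using deflation_pair[OF w(1) u(1) P] by blast
  note dr = triangleD[OF tr]
  note c = copair[OF P d(2) u(1)]
  have je: "exten (j \<triangleright> e) X P" using b e by blast
  have "?f \<triangleright> (j \<triangleright> e) = \<zero>\<^bsub>E X N\<^esub>" using push_push[OF b(2) c(1) e] c(3) u(4) by simp
  then obtain r where r: "exten r X R" "l \<triangleright> r = j \<triangleright> e" using ext_exact_middle[OF tr je] by blast
  have ql: "q \<cdot> l \<Colon> R \<rightarrow> M" and pl: "p \<cdot> l \<Colon> R \<rightarrow> N'" using b dr by blast+
  have "(q \<cdot> l) \<triangleright> r = e" using push_push[OF dr(1) b(4) r(1)] r(2) push_push[OF b(2,4) e] b(6) e by simp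
  moreover have "ypull \<C> (q \<cdot> l) t \<approx>\<^bsub>n,R,A\<^esub> Zero"
  proof -
    have m: "w \<cdot> (p \<cdot> l) \<Colon> R \<rightarrow> N" "u \<cdot> (q \<cdot> l) \<Colon> R \<rightarrow> N" using d u ql pl by blast+
    have "w \<cdot> p \<Colon> P \<rightarrow> N" "u \<cdot> q \<Colon> P \<rightarrow> N" using d u b by blast+
    from cmp_add_left(1)[OF this dr(1)]
    have "(w \<cdot> (p \<cdot> l)) \<oplus>\<^bsub>H R N\<^esub> (u \<cdot> (q \<cdot> l)) = \<zero>\<^bsub>H R N\<^esub>"
      using triangle_cmp_zero[OF tr] assoc[OF dr(1) b(3) d(2)] assoc[OF dr(1) b(4) u(1)] by simp
    then have "Plus (ypull \<C> (w \<cdot> (p \<cdot> l)) s) (ypull \<C> (u \<cdot> (q \<cdot> l)) s) \<approx>\<^bsub>n,R,A\<^esub> Zero"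
      using yeq.yeq_trans[OF yeq.yeq_sym[OF ypull_add[OF u(2) m]]] ypull_zero_mor[OF u(2) dr(4)] by simp
    moreover have "ypull \<C> (w \<cdot> (p \<cdot> l)) s \<approx>\<^bsub>n,R,A\<^esub> Zero"
      using ypull_ypull[OF u(2) d(2) pl] ypull_cong[OF w(2) pl] by simp
    moreover have us: "ypull \<C> (u \<cdot> (q \<cdot> l)) s \<approx>\<^bsub>n,R,A\<^esub> ypull \<C> (q \<cdot> l) t"
      using ypull_ypull[OF u(2,1) ql] ypull_cong[OF yeq.yeq_sym[OF u(3)] ql] by simp
    ultimately have "Plus Zero (ypull \<C> (q \<cdot> l) t) \<approx>\<^bsub>n,R,A\<^esub> Zero"
      by (rule yeq.yeq_trans[OF yeq.yeq_sym[OF yeq.yeq_Plus], rotated 2])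
    then show ?thesis by (rule yeq.yeq_trans[OF yeq.yeq_sym[OF yeq.yeq_Zero[OF ypull_wf[OF t ql]]]])
  qed
  ultimately show ?thesis using that ql r(1) by blast
qed

text \<open>Tensoring with \<open>\<E>(X,-)\<close> preserves exactness at \<open>\<E>\<^sup>n(-,B)\<close>, because \<open>\<E>\<^sup>m(-,C)\<close> is effaceable.\<close>

lemma tensor_exact:
  assumes m: "m \<ge> 1" "n \<ge> 1"
    and f_cong: "\<And>X s t. s \<approx>\<^bsub>Suc n,X,B\<^esub> t \<Longrightarrow> f s \<approx>\<^bsub>Suc m,X,C\<^esub> f t"
    and f_pull: "\<And>a M R t. \<lbrakk>wf_yterm n M B t; a \<Colon> R \<rightarrow> M\<rbrakk> \<Longrightarrow> ypull \<C> a (f t) = f (ypull \<C> a t)"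
    and f_Tensor: "\<And>M t e. f (Tensor M t e) = Tensor M (f t) e"
    and g_Tensor: "\<And>M t e. g (Tensor M t e) = Tensor M (g t) e"
    and exact: "\<And>M t. \<lbrakk>wf_yterm n M B t; f t \<approx>\<^bsub>m,M,C\<^esub> Zero\<rbrakk> \<Longrightarrow> \<exists>s. wf_yterm l M A s \<and> t \<approx>\<^bsub>n,M,B\<^esub> g s"
    and s: "wf_yterm (Suc n) X B s" "f s \<approx>\<^bsub>Suc m,X,C\<^esub> Zero"
  shows "\<exists>r. wf_yterm (Suc l) X A r \<and> s \<approx>\<^bsub>Suc n,X,B\<^esub> g r"
proof -
  obtain M t e where p: "wf_yterm n M B t" "exten e X M" "s \<approx>\<^bsub>Suc n,X,B\<^esub> Tensor M t e"
    using pure_tensor[OF s(1) refl m(2)] by blast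
  have z: "Tensor M (f t) e \<approx>\<^bsub>Suc m,X,C\<^esub> Zero"
    using yeq.yeq_trans[OF yeq.yeq_sym[OF f_cong[OF p(3)]] s(2)] f_Tensor by simp
  obtain R a r where a: "a \<Colon> R \<rightarrow> M" "exten r X R" "a \<triangleright> r = e" "ypull \<C> a (f t) \<approx>\<^bsub>m,R,C\<^esub> Zero"
    using Tensor_zero_lift[OF m(1) z] .
  then obtain s' where s': "wf_yterm l R A s'" "ypull \<C> a t \<approx>\<^bsub>n,R,B\<^esub> g s'"
    using exact[OF ypull_wf[OF p(1) a(1)]] f_pull[OF p(1) a(1)] by auto
  note p(3)
  also have "Tensor M t e \<approx>\<^bsub>Suc n,X,B\<^esub> Tensor R (ypull \<C> a t) r"
    unfolding a(3)[symmetric] using yeq.yeq_sym[OF coend_rel[OF p(1) a(1,2)]] .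
  also have "\<dots> \<approx>\<^bsub>Suc n,X,B\<^esub> Tensor R (g s') r" using Tensor_cong_left[OF s'(2) a(2)] .
  finally have "s \<approx>\<^bsub>Suc n,X,B\<^esub> g (Tensor R s' r)" using g_Tensor by simp
  then show ?thesis using s'(1) a(2) by (intro exI[of _ "Tensor R s' r"]) simp
qed

text \<open>Degree one is the exactness of \<open>Ext\<close> itself; every further degree is
  obtained from the previous one by tensoring with another extension.\<close>

lemma co_exact_middle:
  assumes t: "triangle \<C> A x B y C \<delta>" and "n \<ge> 1" "wf_yterm n X B s" "ypush \<C> y s \<approx>\<^bsub>n,X,C\<^esub> Zero"
  shows "\<exists>r. wf_yterm n X A r \<and> s \<approx>\<^bsub>n,X,B\<^esub> ypush \<C> x r"
  using assms(2-4)
proof (induction n arbitrary: X s rule: dec_induct)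
  case base
  note d = triangleD[OF t]
  let ?e = "yeval X B s"
  have e: "exten ?e X B" and se: "s \<approx>\<^bsub>1,X,B\<^esub> Emb ?e" using yeval_exten[OF base(1)] yeval_yeq[OF base(1)]
    by auto
  have "Emb (y \<triangleright> ?e) \<approx>\<^bsub>1,X,C\<^esub> Zero" using yeq.yeq_trans[OF yeq.yeq_sym[OF ypush_cong[OF se d(2)]] base(2)]
    by simp
  then have "y \<triangleright> ?e = \<zero>\<^bsub>E X C\<^esub>" using yEmb_Zero_iff[OF exten_push[OF d(2) e]] by simp
  then obtain e' where e': "exten e' X A" "x \<triangleright> e' = ?e" using ext_exact_middle[OF t e] by blast
  then show ?case using se by (intro exI[of _ "Emb e'"]) auto
next
  case (step n)
  show ?case
    by (rule tensor_exact[OF step(1,1) ypush_cong ypull_ypush _ _ _ step.prems])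
      (use triangleD(2)[OF t] step.IH in auto)
qed

text \<open>In the lowest degree the tensor of \<open>\<delta>\<close> with an extension vanishes.
  The extension then lifts along some \<open>a\<close> that pulls \<open>\<delta>\<close> back to
  zero, and such an \<open>a\<close> factors through the deflation \<open>y\<close>.\<close>

lemma co_exact_right:
  assumes t: "triangle \<C> A x B y C \<delta>" and "n \<ge> 1" "wf_yterm n X C s" "yconn C \<delta> s \<approx>\<^bsub>Suc n,X,A\<^esub> Zero"
  shows "\<exists>r. wf_yterm n X B r \<and> s \<approx>\<^bsub>n,X,C\<^esub> ypush \<C> y r"
  using assms(2-4)
proof (induction n arbitrary: X s rule: dec_induct)
  case base
  note d = triangleD[OF t]
  let ?e = "yeval X C s"
  have e: "exten ?e X C" and se: "s \<approx>\<^bsub>1,X,C\<^esub> Emb ?e" using yeval_exten[OF base(1)] yeval_yeq[OF base(1)]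
    by auto
  have z: "Tensor C (Emb \<delta>) ?e \<approx>\<^bsub>Suc 1,X,A\<^esub> Zero"
    using yeq.yeq_trans[OF yeq.yeq_sym[OF yconn_cong[OF se d(3)]] base(2)] by simp
  obtain R a r where a: "a \<Colon> R \<rightarrow> C" "exten r X R" "a \<triangleright> r = ?e" "ypull \<C> a (Emb \<delta>) \<approx>\<^bsub>1,R,A\<^esub> Zero"
    using Tensor_zero_lift[OF order_refl z] .
  have "\<delta> \<triangleleft> a = \<zero>\<^bsub>E R A\<^esub>" using a(4) yEmb_Zero_iff[OF exten_pull[OF a(1) d(3)]] by simp
  then obtain b where b: "b \<Colon> R \<rightarrow> B" "y \<cdot> b = a" using lift_along_deflation[OF t a(1)] by blast
  have "y \<triangleright> (b \<triangleright> r) = ?e" using push_push[OF b(1) d(2) a(2)] b(2) a(3) by simp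
  then show ?case using se exten_push[OF b(1) a(2)] by (intro exI[of _ "Emb (b \<triangleright> r)"]) auto
next
  case (step n)
  show ?case
    by (rule tensor_exact[OF _ step(1) yconn_cong ypull_yconn _ _ _ step.prems])
      (use triangleD(3)[OF t] step in auto)
qed

text \<open>In the lowest degree, represent \<open>s\<close> as a tensor of two extensions. After
  lifting the second along \<open>a\<close>, the first becomes an extension killed by
  \<open>x\<close>, hence a pullback of \<open>\<delta>\<close> along some \<open>c\<close>; moving
  \<open>c\<close> across the tensor exhibits a value of the connecting map.\<close>

lemma co_exact_left:
  assumes t: "triangle \<C> A x B y C \<delta>" and "n \<ge> 1" "wf_yterm (Suc n) X A s" "ypush \<C> x s \<approx>\<^bsub>Suc n,X,B\<^esub> Zero"
  shows "\<exists>r. wf_yterm n X C r \<and> s \<approx>\<^bsub>Suc n,X,A\<^esub> yconn C \<delta> r"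
  using assms(2-4)
proof (induction n arbitrary: X s rule: dec_induct)
  case base
  note d = triangleD[OF t]
  obtain M u e where p: "wf_yterm 1 M A u" "exten e X M" "s \<approx>\<^bsub>Suc 1,X,A\<^esub> Tensor M u e"
    using pure_tensor[OF base(1), of 1] by auto
  let ?e = "yeval M A u"
  have e: "exten ?e M A" and ue: "u \<approx>\<^bsub>1,M,A\<^esub> Emb ?e" using yeval_exten[OF p(1)] yeval_yeq[OF p(1)] by auto
  have su: "s \<approx>\<^bsub>Suc 1,X,A\<^esub> Tensor M (Emb ?e) e" using yeq.yeq_trans[OF p(3) Tensor_cong_left[OF ue p(2)]] .
  have z: "Tensor M (Emb (x \<triangleright> ?e)) e \<approx>\<^bsub>Suc 1,X,B\<^esub> Zero"
    using yeq.yeq_trans[OF yeq.yeq_sym[OF ypush_cong[OF su d(1)]]] base(2) by simp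
  obtain R a r where a: "a \<Colon> R \<rightarrow> M" "exten r X R" "a \<triangleright> r = e" "ypull \<C> a (Emb (x \<triangleright> ?e)) \<approx>\<^bsub>1,R,B\<^esub> Zero"
    using Tensor_zero_lift[OF order_refl z] .
  have ea: "exten (?e \<triangleleft> a) R A" using a(1) e by blast
  have "x \<triangleright> (?e \<triangleleft> a) = \<zero>\<^bsub>E R B\<^esub>"
    using a(4) yEmb_Zero_iff[OF exten_pull[OF a(1) exten_push[OF d(1) e]]] pull_push[OF d(1) a(1) e] by simp
  then obtain c where c: "c \<Colon> R \<rightarrow> C" "?e \<triangleleft> a = \<delta> \<triangleleft> c" using ext_exact_left[OF t ea] by blast
  note su
  also have "Tensor M (Emb ?e) e \<approx>\<^bsub>Suc 1,X,A\<^esub> Tensor R (ypull \<C> a (Emb ?e)) r"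
    unfolding a(3)[symmetric] using e a by (intro yeq.yeq_sym[OF coend_rel]) auto
  also have "Tensor R (ypull \<C> a (Emb ?e)) r = Tensor R (ypull \<C> c (Emb \<delta>)) r" using c by simp
  also have "\<dots> \<approx>\<^bsub>Suc 1,X,A\<^esub> Tensor C (Emb \<delta>) (c \<triangleright> r)" using d a c by (intro coend_rel) auto
  finally show ?case using exten_push[OF c(1) a(2)] by (intro exI[of _ "Emb (c \<triangleright> r)"]) auto
next
  case (step n)
  show ?case
    by (rule tensor_exact[OF _ _ ypush_cong ypull_ypush _ _ _ step.prems])
      (use triangleD(1)[OF t] step in auto)
qed

section \<open>Consecutive maps of the long sequences compose to zero\<close>

lemma ypush_comp_zero:
  assumes t: "triangle \<C> A x B y C \<delta>" and s: "wf_yterm n X A s"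
  shows "ypush \<C> y (ypush \<C> x s) \<approx>\<^bsub>n,X,C\<^esub> Zero"
  using ypush_ypush[OF s triangleD(1,2)[OF t]] triangle_cmp_zero[OF t] ypush_zero_mor[OF s triangleD(6)[OF t]]
    by simp

lemma ypull_comp_zero:
  assumes t: "triangle \<C> M x N y X \<delta>" and s: "wf_yterm n X A s"
  shows "ypull \<C> x (ypull \<C> y s) \<approx>\<^bsub>n,M,A\<^esub> Zero"
  using ypull_ypull[OF s triangleD(2,1)[OF t]] triangle_cmp_zero[OF t] ypull_zero_mor[OF s triangleD(4)[OF t]]
    by simp

lemma Tensor_comp_zero:
  assumes t: "triangle \<C> M x N y X \<delta>"
  shows "wf_yterm n N A s \<Longrightarrow> Tensor M (ypull \<C> x s) \<delta> \<approx>\<^bsub>Suc n,X,A\<^esub> Zero"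
    and "wf_yterm n M A s' \<Longrightarrow> ypull \<C> y (Tensor M s' \<delta>) \<approx>\<^bsub>Suc n,N,A\<^esub> Zero"
proof -
  note d = triangleD[OF t]
  show "Tensor M (ypull \<C> x s) \<delta> \<approx>\<^bsub>Suc n,X,A\<^esub> Zero" if s: "wf_yterm n N A s"
    using yeq.yeq_trans[OF coend_rel[OF s d(1,3)]] triangle_push_zero[OF t] yTensor_zero_right[OF s d(6)]
      by simp
  show "ypull \<C> y (Tensor M s' \<delta>) \<approx>\<^bsub>Suc n,N,A\<^esub> Zero" if s: "wf_yterm n M A s'"
    using yTensor_zero_right[OF s d(5)] triangle_pull_zero[OF t] by simp
qed

lemma yconn_comp_zero:
  assumes t: "triangle \<C> A x B y C \<delta>"
  shows "wf_yterm n X B s \<Longrightarrow> yconn C \<delta> (ypush \<C> y s) \<approx>\<^bsub>Suc n,X,A\<^esub> Zero"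
    and "wf_yterm n X C s' \<Longrightarrow> ypush \<C> x (yconn C \<delta> s') \<approx>\<^bsub>Suc n,X,B\<^esub> Zero"
proof -
  note d = triangleD[OF t]
  have P: "Plus a b \<approx>\<^bsub>n,X,A\<^esub> Zero" if "a \<approx>\<^bsub>n,X,A\<^esub> Zero" "b \<approx>\<^bsub>n,X,A\<^esub> Zero" for a b n X A
    using yeq.yeq_trans[OF yeq.yeq_Plus[OF that] yeq.yeq_Zero] yeqD2[OF that(1)] by simp
  have S: "Scale k a \<approx>\<^bsub>n,X,A\<^esub> Zero" if "k \<in> carrier K" "a \<approx>\<^bsub>n,X,A\<^esub> Zero" for k a n X A
    using yeq.yeq_trans[OF yeq.yeq_Scale[OF that] yScale_Zero[OF that(1)]] yeqD2[OF that(2)] by simp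
  have T: "Tensor M a e \<approx>\<^bsub>Suc n,X,A\<^esub> Zero" if "exten e X M" "a \<approx>\<^bsub>n,M,A\<^esub> Zero" for M a e n X A
    using yeq.yeq_trans[OF Tensor_cong_left[OF that(2,1)] yTensor_Zero_left[OF that(1)]] yeqD2[OF that(2)]
      by simp
  have "yconn C \<delta> (ypush \<C> y s) \<approx>\<^bsub>Suc n,X,A\<^esub> Zero" if "wf_yterm n X B' s" "B' = B" for n X B' s
    using that
  proof (induction n X B' s rule: ywf.induct)
    case (ywf_Emb X B' e)
    then have e: "exten e X B" by (simp add: extenI)
    have w: "wf_yterm (Suc 0) C A (Emb \<delta>)" using d by simp
    have "Tensor C (Emb \<delta>) (y \<triangleright> e) \<approx>\<^bsub>Suc (Suc 0),X,A\<^esub> Tensor B (Emb (\<delta> \<triangleleft> y)) e"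
      using yeq.yeq_sym[OF coend_rel[OF w d(2) e]] by simp
    also have "\<dots> \<approx>\<^bsub>Suc (Suc 0),X,A\<^esub> Zero"
      using triangle_pull_zero[OF t] T[OF e yEmb_zero[OF d(5,4)]] by simp
    finally show ?case by simp
  qed (auto intro: P S T simp: extenI d yeq_reflI)
  then show "wf_yterm n X B s \<Longrightarrow> yconn C \<delta> (ypush \<C> y s) \<approx>\<^bsub>Suc n,X,A\<^esub> Zero" by simp
  have "ypush \<C> x (yconn C \<delta> s) \<approx>\<^bsub>Suc n,X,B\<^esub> Zero" if "wf_yterm n X C' s" "C' = C" for n X C' s
    using that
  proof (induction n X C' s rule: ywf.induct)
    case (ywf_Emb X C' e)
    then have e: "exten e X C" by (simp add: extenI)
    show ?case using triangle_push_zero[OF t] T[OF e yEmb_zero[OF d(6,5)]] by simp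
  qed (auto intro: P S T simp: extenI d yeq_reflI)
  then show "wf_yterm n X C s' \<Longrightarrow> ypush \<C> x (yconn C \<delta> s') \<approx>\<^bsub>Suc n,X,B\<^esub> Zero" by simp
qed

end

section \<open>Counting along exact sequences\<close>

lemma card_kernel_image:
  assumes G: "abelian_group G" and H: "abelian_group H" and fin: "finite (carrier G)"
    and closed: "\<And>a. a \<in> carrier G \<Longrightarrow> f a \<in> carrier H"
    and add: "\<And>a b. \<lbrakk>a \<in> carrier G; b \<in> carrier G\<rbrakk> \<Longrightarrow> f (a \<oplus>\<^bsub>G\<^esub> b) = f a \<oplus>\<^bsub>H\<^esub> f b"
  shows "card (carrier G) = card {a \<in> carrier G. f a = \<zero>\<^bsub>H\<^esub>} * card (f ` carrier G)"
proof -
  interpret G: abelian_group G by (rule assms(1))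
  interpret H: abelian_group H by (rule assms(2))
  let ?K = "{a \<in> carrier G. f a = \<zero>\<^bsub>H\<^esub>}"
  have f0: "f \<zero>\<^bsub>G\<^esub> = \<zero>\<^bsub>H\<^esub>"
    using add[of "\<zero>\<^bsub>G\<^esub>" "\<zero>\<^bsub>G\<^esub>"] closed[of "\<zero>\<^bsub>G\<^esub>"] H.add.l_cancel_one'[of "f \<zero>\<^bsub>G\<^esub>" "f \<zero>\<^bsub>G\<^esub>"] by simp
  have fm: "f (\<ominus>\<^bsub>G\<^esub> a) = \<ominus>\<^bsub>H\<^esub> f a" if a: "a \<in> carrier G" for a
  proof -
    have "f (\<ominus>\<^bsub>G\<^esub> a) \<oplus>\<^bsub>H\<^esub> f a = \<zero>\<^bsub>H\<^esub>"
      using add[OF G.a_inv_closed[OF a] a] f0 G.l_neg[OF a] by simp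
    from H.minus_equality[OF this closed[OF a] closed[OF G.a_inv_closed[OF a]]] show ?thesis by (rule sym)
  qed
  have fib: "card {a \<in> carrier G. f a = h} = card ?K" if h: "h \<in> f ` carrier G" for h
  proof -
    from h obtain b where b: "b \<in> carrier G" "h = f b" by blast
    have "bij_betw (\<lambda>a. a \<oplus>\<^bsub>G\<^esub> b) ?K {a \<in> carrier G. f a = h}"
    proof (rule bij_betwI[where g = "\<lambda>a. a \<oplus>\<^bsub>G\<^esub> (\<ominus>\<^bsub>G\<^esub> b)"]; (rule Pi_I)?)
      fix a assume a: "a \<in> ?K"
      then have "f (a \<oplus>\<^bsub>G\<^esub> b) = f b" using add[OF _ b(1), of a] H.l_zero[OF closed[OF b(1)]] by simp
      then show "a \<oplus>\<^bsub>G\<^esub> b \<in> {a \<in> carrier G. f a = h}" using a b by simp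
      show "a \<oplus>\<^bsub>G\<^esub> b \<oplus>\<^bsub>G\<^esub> (\<ominus>\<^bsub>G\<^esub> b) = a" using a b(1) by (simp add: G.a_assoc G.r_neg)
    next
      fix a assume a: "a \<in> {a \<in> carrier G. f a = h}"
      then have ac: "a \<in> carrier G" and fa: "f a = f b" using b(2) by auto
      have "f (a \<oplus>\<^bsub>G\<^esub> (\<ominus>\<^bsub>G\<^esub> b)) = f b \<oplus>\<^bsub>H\<^esub> (\<ominus>\<^bsub>H\<^esub> f b)"
        unfolding add[OF ac G.a_inv_closed[OF b(1)]] fm[OF b(1)] fa ..
      also have "\<dots> = \<zero>\<^bsub>H\<^esub>" by (rule H.r_neg[OF closed[OF b(1)]])
      finally show "a \<oplus>\<^bsub>G\<^esub> (\<ominus>\<^bsub>G\<^esub> b) \<in> ?K" using ac G.a_closed[OF ac G.a_inv_closed[OF b(1)]] by blast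
      show "a \<oplus>\<^bsub>G\<^esub> (\<ominus>\<^bsub>G\<^esub> b) \<oplus>\<^bsub>G\<^esub> b = a" using a b(1) by (simp add: G.a_assoc G.l_neg)
    qed
    then show ?thesis by (rule bij_betw_same_card[symmetric])
  qed
  have "card (carrier G) = (\<Sum>h\<in>f ` carrier G. card {a \<in> carrier G. f a = h})"
  proof -
    have "card (carrier G) = sum (\<lambda>_. 1) (carrier G)" by simp
    also have "\<dots> = (\<Sum>h\<in>f ` carrier G. sum (\<lambda>_. 1) {a \<in> carrier G. f a = h})"
      using sum.image_gen[OF fin, of "\<lambda>_. 1::nat" f] by simp
    finally show ?thesis by simp
  qed
  then show ?thesis using fib by simp
qed

text \<open>For a long exact sequence whose terms have orders \<open>a i\<close>, \<open>b i\<close>, \<open>c i\<close>, the numbers \<open>k i\<close>, \<open>l i\<close>, \<open>m i\<close> are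
  the orders of the kernels of the three kinds of maps.\<close>

lemma alternating_product_telescope:
  fixes a b c k l m :: "nat \<Rightarrow> nat"
  assumes a: "\<And>i. a i = k i * l i" and b: "\<And>i. b i = l i * m i" and c: "\<And>i. c i = m i * k (Suc i)"
    and pos: "\<And>i. a i > 0" "\<And>i. c i > 0"
  shows "(\<Prod>i<N. (of_nat (a i) :: rat) powi ((-1) ^ i)) * (\<Prod>i<N. of_nat (c i) powi ((-1) ^ i)) * of_nat (k N)
    powi ((-1) ^ N)
    = (\<Prod>i<N. of_nat (b i) powi ((-1) ^ i)) * of_nat (k 0)"
proof (induction N)
  case (Suc N)
  have p: "k i > 0" "l i > 0" "m i > 0" for i using a[of i] c[of i] pos[of i] by auto
  define P where "P x = (of_nat x :: rat) powi ((-1) ^ N)" for x :: nat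
  have Pm: "P (x * y) = P x * P y" for x y by (simp add: P_def power_int_mult_distrib)
  \<comment> \<open>The exponent changes sign with \<open>N\<close>, so the new boundary term enters
    inverted and cancels the factor \<open>k (Suc N)\<close> of \<open>c N\<close>.\<close>
  have Q: "(of_nat (k (Suc N)) :: rat) powi ((-1) ^ Suc N) = inverse (P (k (Suc N)))"
    by (simp add: P_def power_int_minus)
  have nz: "P (k (Suc N)) \<noteq> 0" using p(1)[of "Suc N"] by (simp add: P_def power_int_eq_0_iff)
  have e: "P (a N) * P (c N) * inverse (P (k (Suc N))) = P (b N) * P (k N)"
    unfolding a b c Pm using nz by (simp add: mult_ac)
  let ?A = "\<Prod>i<N. (of_nat (a i) :: rat) powi ((-1) ^ i)"
    and ?B = "\<Prod>i<N. (of_nat (b i) :: rat) powi ((-1) ^ i)"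
    and ?C = "\<Prod>i<N. (of_nat (c i) :: rat) powi ((-1) ^ i)"
  have "(?A * P (a N)) * (?C * P (c N)) * inverse (P (k (Suc N)))
    = (?A * ?C) * (P (a N) * P (c N) * inverse (P (k (Suc N))))" by (simp only: mult_ac)
  also have "\<dots> = (?A * ?C * P (k N)) * P (b N)" unfolding e by (simp only: mult_ac)
  also have "?A * ?C * P (k N) = ?B * of_nat (k 0)" using Suc by (simp add: P_def)
  finally have "(?A * P (a N)) * (?C * P (c N)) * inverse (P (k (Suc N))) = (?B * P (b N)) * of_nat (k 0)"
    by (simp only: mult_ac)
  then show ?case unfolding Q prod.lessThan_Suc P_def .
qed simp

text \<open>Every vector is a linear combination over a finite generating set, and coefficient
  functions restricted to this set are finite in number.\<close>

lemma (in vectorspace) finite_carrier_if_fin_dim: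
  assumes "finite (carrier K)" "fin_dim"
  shows "finite (carrier V)"
proof -
  obtain A where A: "finite A" "A \<subseteq> carrier V" "gen_set A" using assms(2) by (auto simp: fin_dim_def)
  have "carrier V = {lincomb a A | a. a \<in> (A \<rightarrow> carrier K)}" using A finite_span by auto
  also have "\<dots> \<subseteq> (\<lambda>a. lincomb a A) ` (A \<rightarrow>\<^sub>E carrier K)"
  proof
    fix v assume "v \<in> {lincomb a A | a. a \<in> (A \<rightarrow> carrier K)}"
    then obtain a where a: "v = lincomb a A" "a \<in> A \<rightarrow> carrier K" by blast
    have "lincomb a A = lincomb (restrict a A) A"
      unfolding lincomb_def
    proof (rule M.finsum_cong'[OF refl])
      show "(\<lambda>v. restrict a A v \<odot>\<^bsub>V\<^esub> v) \<in> A \<rightarrow> carrier V"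
      proof (rule Pi_I)
        fix v assume v: "v \<in> A"
        then have "a v \<in> carrier K" "v \<in> carrier V" using a(2) A(2) by blast+
        then show "restrict a A v \<odot>\<^bsub>V\<^esub> v \<in> carrier V" unfolding restrict_apply'[OF v] by (rule smult_closed)
      qed
    qed simp
    then show "v \<in> (\<lambda>a. lincomb a A) ` (A \<rightarrow>\<^sub>E carrier K)" using a by auto
  qed
  finally show ?thesis using finite_PiE[OF A(1)] assms(1) by (meson finite_imageI finite_subset)
qed

lemma (in vectorspace) carrier_if_dim_0:
  assumes "fin_dim" "dim = 0"
  shows "carrier V = {\<zero>\<^bsub>V\<^esub>}"
proof -
  obtain A where "finite A" "A \<subseteq> carrier V" "gen_set A" using assms(1) by (auto simp: fin_dim_def)
  then have "\<exists>n. \<exists>A. finite A \<and> card A = n \<and> A \<subseteq> carrier V \<and> gen_set A" by blast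
  from LeastI_ex[OF this] obtain A where "finite A" "card A = 0" "gen_set A"
    using assms(2) unfolding dim_def by auto
  then have "span {} = carrier V" by simp
  then show ?thesis using finite_span[of "{}"] by (auto simp: lincomb_def)
qed

text \<open>The terms of a summable series tend to 0, and a natural number below 1 is 0.\<close>

lemma summable_nat_eventually_0:
  fixes f :: "nat \<Rightarrow> nat"
  assumes "summable (\<lambda>i. real (f i))"
  shows "\<exists>N. \<forall>i\<ge>N. f i = 0"
proof -
  have "(\<lambda>i. real (f i)) \<longlonglongrightarrow> 0" using assms by (rule summable_LIMSEQ_zero)
  then obtain N where "\<forall>i\<ge>N. norm (real (f i) - 0) < 1" using LIMSEQ_D[of _ 0 1] by force
  then show ?thesis by auto
qed

section \<open>Higher extensions as vector spaces, and orders of kernels\<close>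

context extriangulated
begin

abbreviation HE :: "nat \<Rightarrow> 'o \<Rightarrow> 'o \<Rightarrow> ('k, ('k, 'o, 'e) yterm set) module"
  where "HE n C A \<equiv> higher_Ext K \<C> n C A"

abbreviation cls :: "nat \<Rightarrow> 'o \<Rightarrow> 'o \<Rightarrow> ('k, 'o, 'e) yterm \<Rightarrow> ('k, 'o, 'e) yterm set"
  where "cls n C A t \<equiv> ycls K \<C> n C A t"

lemma cls_eq_iff:
  assumes s: "wf_yterm n C A s"
  shows "cls n C A s = cls n C A t \<longleftrightarrow> s \<approx>\<^bsub>n,C,A\<^esub> t"
proof
  assume "cls n C A s = cls n C A t"
  then have "s \<in> cls n C A t" using yeq_reflI[OF s] by (auto simp: ycls_def)
  then show "s \<approx>\<^bsub>n,C,A\<^esub> t" by (auto simp: ycls_def intro: yeq.yeq_sym)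
next
  assume st: "s \<approx>\<^bsub>n,C,A\<^esub> t"
  show "cls n C A s = cls n C A t"
    using yeq.yeq_trans[OF st] yeq.yeq_trans[OF yeq.yeq_sym[OF st]] by (auto simp: ycls_def)
qed

lemma mem_cls: "s \<in> cls n C A t \<longleftrightarrow> t \<approx>\<^bsub>n,C,A\<^esub> s"
  by (simp add: ycls_def)

lemma HE_carrier: "carrier (HE n C A) = cls n C A ` {t. wf_yterm n C A t}"
  by (simp add: higher_Ext_def)

lemma HE_zero: "\<zero>\<^bsub>HE n C A\<^esub> = cls n C A Zero"
  by (simp add: higher_Ext_def)

text \<open>The union in the definition of the sum collapses, because all choices of representatives
  give the same class.\<close>

lemma HE_add:
  assumes "wf_yterm n C A s" "wf_yterm n C A t"
  shows "cls n C A s \<oplus>\<^bsub>HE n C A\<^esub> cls n C A t = cls n C A (Plus s t)"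
proof -
  have "cls n C A (Plus s' t') = cls n C A (Plus s t)" if "s' \<in> cls n C A s" "t' \<in> cls n C A t" for s' t'
    using that assms yeq.yeq_Plus[of K \<C> n C A s s' t t'] cls_eq_iff[of n C A "Plus s t" "Plus s' t'"]
      by (simp add: mem_cls)
  moreover have "s \<in> cls n C A s" "t \<in> cls n C A t" using assms by (auto simp: mem_cls intro: yeq_reflI)
  ultimately have "(\<Union>s'\<in>cls n C A s. \<Union>t'\<in>cls n C A t. cls n C A (Plus s' t')) = cls n C A (Plus s t)" by blast
  then show ?thesis by (simp add: higher_Ext_def)
qed

lemma HE_smult:
  assumes "k \<in> carrier K" "wf_yterm n C A t"
  shows "k \<odot>\<^bsub>HE n C A\<^esub> cls n C A t = cls n C A (Scale k t)"
proof -
  have "cls n C A (Scale k t') = cls n C A (Scale k t)" if "t' \<in> cls n C A t" for t'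
    using that assms yeq.yeq_Scale[of k K \<C> n C A t t'] cls_eq_iff[of n C A "Scale k t" "Scale k t'"]
      by (simp add: mem_cls)
  moreover have "t \<in> cls n C A t" using assms by (auto simp: mem_cls intro: yeq_reflI)
  ultimately have "(\<Union>t'\<in>cls n C A t. cls n C A (Scale k t')) = cls n C A (Scale k t)" by blast
  then show ?thesis by (simp add: higher_Ext_def)
qed

lemma HE_group:
  assumes "n \<ge> 1" "C \<in> Ob \<C>" "A \<in> Ob \<C>"
  shows "abelian_group (HE n C A)"
proof (rule abelian_groupI)
  have z: "wf_yterm n C A Zero" using assms by simp
  show "\<zero>\<^bsub>HE n C A\<^esub> \<in> carrier (HE n C A)" using z by (auto simp: HE_carrier HE_zero)
  fix x assume "x \<in> carrier (HE n C A)"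
  then obtain s where s: "x = cls n C A s" "wf_yterm n C A s" by (auto simp: HE_carrier)
  show "\<zero>\<^bsub>HE n C A\<^esub> \<oplus>\<^bsub>HE n C A\<^esub> x = x"
    using HE_add[OF z s(2)] cls_eq_iff[of n C A "Plus Zero s" s] yeq.yeq_Zero[OF s(2)] s z
      by (simp add: HE_zero)
  have "cls n C A (yneg s) \<oplus>\<^bsub>HE n C A\<^esub> x = \<zero>\<^bsub>HE n C A\<^esub>"
    using HE_add[of n C A "yneg s" s] cls_eq_iff[of n C A "Plus (yneg s) s" Zero] yneg_Plus[OF s(2)] s
      by (simp add: HE_zero)
  moreover have "cls n C A (yneg s) \<in> carrier (HE n C A)" unfolding HE_carrier
    by (rule imageI) (use s in simp)
  ultimately show "\<exists>y\<in>carrier (HE n C A). y \<oplus>\<^bsub>HE n C A\<^esub> x = \<zero>\<^bsub>HE n C A\<^esub>" by (rule bexI)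
  fix y assume "y \<in> carrier (HE n C A)"
  then obtain t where t: "y = cls n C A t" "wf_yterm n C A t" by (auto simp: HE_carrier)
  show "x \<oplus>\<^bsub>HE n C A\<^esub> y \<in> carrier (HE n C A)" using HE_add[OF s(2) t(2)] s t by (auto simp: HE_carrier)
  show "x \<oplus>\<^bsub>HE n C A\<^esub> y = y \<oplus>\<^bsub>HE n C A\<^esub> x"
    using HE_add[OF s(2) t(2)] HE_add[OF t(2) s(2)] cls_eq_iff[of n C A "Plus s t" "Plus t s"]
      yeq.yeq_comm[OF s(2) t(2)] s t by simp
  fix z assume "z \<in> carrier (HE n C A)"
  then obtain u where u: "z = cls n C A u" "wf_yterm n C A u" by (auto simp: HE_carrier)
  show "x \<oplus>\<^bsub>HE n C A\<^esub> y \<oplus>\<^bsub>HE n C A\<^esub> z = x \<oplus>\<^bsub>HE n C A\<^esub> (y \<oplus>\<^bsub>HE n C A\<^esub> z)"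
    using HE_add[OF s(2) t(2)] HE_add[OF t(2) u(2)] HE_add[of n C A "Plus s t" u]
      HE_add[of n C A s "Plus t u"]
      cls_eq_iff[of n C A "Plus (Plus s t) u" "Plus s (Plus t u)"] yeq.yeq_assoc[OF s(2) t(2) u(2)] s t u
        by simp
qed

lemma HE_vectorspace:
  assumes "n \<ge> 1" "C \<in> Ob \<C>" "A \<in> Ob \<C>"
  shows "vectorspace K (HE n C A)"
proof (intro vectorspace.intro moduleI field_axioms)
  show "cring K" by (rule is_cring)
  show "abelian_group (HE n C A)" by (rule HE_group[OF assms])
  { fix x assume "x \<in> carrier (HE n C A)"
    then obtain s where s: "x = cls n C A s" "wf_yterm n C A s" by (auto simp: HE_carrier)
    show "\<one>\<^bsub>K\<^esub> \<odot>\<^bsub>HE n C A\<^esub> x = x"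
      using HE_smult[OF one_closed s(2)] cls_eq_iff[of n C A "Scale \<one>\<^bsub>K\<^esub> s" s] yeq.yeq_Scale_one[OF s(2)] s
        by simp }
  fix k x assume k: "k \<in> carrier K" and "x \<in> carrier (HE n C A)"
  then obtain s where s: "x = cls n C A s" "wf_yterm n C A s" by (auto simp: HE_carrier)
  show "k \<odot>\<^bsub>HE n C A\<^esub> x \<in> carrier (HE n C A)" using HE_smult[OF k s(2)] s k by (auto simp: HE_carrier)
  { fix l assume l: "l \<in> carrier K"
    have w: "wf_yterm n C A (Scale k s)" "wf_yterm n C A (Scale l s)" using k l s by auto
    show "(k \<oplus>\<^bsub>K\<^esub> l) \<odot>\<^bsub>HE n C A\<^esub> x = k \<odot>\<^bsub>HE n C A\<^esub> x \<oplus>\<^bsub>HE n C A\<^esub> l \<odot>\<^bsub>HE n C A\<^esub> x"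
      using HE_smult[OF k s(2)] HE_smult[OF l s(2)] HE_smult[OF add.m_closed[OF k l] s(2)] HE_add[OF w]
        cls_eq_iff[of n C A "Scale (k \<oplus>\<^bsub>K\<^esub> l) s"] yeq.yeq_Scale_add[OF k l s(2)] s k l by simp
    show "(k \<otimes>\<^bsub>K\<^esub> l) \<odot>\<^bsub>HE n C A\<^esub> x = k \<odot>\<^bsub>HE n C A\<^esub> (l \<odot>\<^bsub>HE n C A\<^esub> x)"
      using HE_smult[OF l s(2)] HE_smult[OF m_closed[OF k l] s(2)] HE_smult[OF k w(2)]
        cls_eq_iff[of n C A "Scale (k \<otimes>\<^bsub>K\<^esub> l) s"] yeq.yeq_Scale_mult[OF k l s(2)] s k l by simp }
  fix y assume "y \<in> carrier (HE n C A)"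
  then obtain t where t: "y = cls n C A t" "wf_yterm n C A t" by (auto simp: HE_carrier)
  have w: "wf_yterm n C A (Scale k s)" "wf_yterm n C A (Scale k t)" "wf_yterm n C A (Plus s t)" using k s t
    by auto
  show "k \<odot>\<^bsub>HE n C A\<^esub> (x \<oplus>\<^bsub>HE n C A\<^esub> y) = k \<odot>\<^bsub>HE n C A\<^esub> x \<oplus>\<^bsub>HE n C A\<^esub> k \<odot>\<^bsub>HE n C A\<^esub> y"
    using HE_add[OF s(2) t(2)] HE_smult[OF k s(2)] HE_smult[OF k t(2)] HE_smult[OF k w(3)] HE_add[OF w(1,2)]
      cls_eq_iff[of n C A "Scale k (Plus s t)"] yeq.yeq_Scale_Plus[OF k s(2) t(2)] s t k by simp
qed

text \<open>The maps of the long exact sequences stay maps on terms. The order of the kernel of the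
  induced map is counted in classes, without naming that map.\<close>

definition ker_card ::
    "nat \<Rightarrow> 'o \<Rightarrow> 'o \<Rightarrow> nat \<Rightarrow> 'o \<Rightarrow> 'o \<Rightarrow> (('k, 'o, 'e) yterm \<Rightarrow> ('k, 'o, 'e) yterm) \<Rightarrow> nat"
  where "ker_card n C A m D B f = card (cls n C A ` {t. wf_yterm n C A t \<and> f t \<approx>\<^bsub>m,D,B\<^esub> Zero})"

text \<open>The order of a finite group is that of the kernel times that of the image, and by
  exactness the image is the next kernel.\<close>

lemma HE_exact:
  assumes ob: "n \<ge> 1" "C \<in> Ob \<C>" "A \<in> Ob \<C>" "m \<ge> 1" "D \<in> Ob \<C>" "B \<in> Ob \<C>"
    and fin: "finite (carrier (HE n C A))"
    and cong: "\<And>s t. s \<approx>\<^bsub>n,C,A\<^esub> t \<Longrightarrow> f s \<approx>\<^bsub>m,D,B\<^esub> f t"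
    and f_Plus: "\<And>s t. \<lbrakk>wf_yterm n C A s; wf_yterm n C A t\<rbrakk> \<Longrightarrow> f (Plus s t) \<approx>\<^bsub>m,D,B\<^esub> Plus (f s) (f t)"
    and g_cong: "\<And>s t. s \<approx>\<^bsub>m,D,B\<^esub> t \<Longrightarrow> g s \<approx>\<^bsub>l,F,G\<^esub> g t"
    and exact: "\<And>s. \<lbrakk>wf_yterm m D B s; g s \<approx>\<^bsub>l,F,G\<^esub> Zero\<rbrakk> \<Longrightarrow> \<exists>r. wf_yterm n C A r \<and> s \<approx>\<^bsub>m,D,B\<^esub> f r"
    and comp: "\<And>r. wf_yterm n C A r \<Longrightarrow> g (f r) \<approx>\<^bsub>l,F,G\<^esub> Zero"
  shows "card (carrier (HE n C A)) = ker_card n C A m D B f * ker_card m D B l F G g"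
proof -
  define h where "h c = cls m D B (f (SOME t. t \<in> c))" for c
  have h: "h (cls n C A t) = cls m D B (f t)" if t: "wf_yterm n C A t" for t
  proof -
    have "(SOME s. s \<in> cls n C A t) \<in> cls n C A t" by (rule someI[of _ t]) (simp add: mem_cls yeq_reflI[OF t])
    then have "f t \<approx>\<^bsub>m,D,B\<^esub> f (SOME s. s \<in> cls n C A t)" using cong by (simp add: mem_cls)
    then show ?thesis unfolding h_def using cls_eq_iff[OF yeqD1] by metis
  qed
  have fw: "wf_yterm m D B (f t)" if "wf_yterm n C A t" for t using cong[OF yeq_reflI[OF that]] yeqD1 by blast
  have "card (carrier (HE n C A)) = card {a \<in> carrier (HE n C A). h a = \<zero>\<^bsub>HE m D B\<^esub>} *
    card (h ` carrier (HE n C A))"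
  proof (rule card_kernel_image[OF HE_group[OF ob(1-3)] HE_group[OF ob(4-6)] fin])
    fix a assume "a \<in> carrier (HE n C A)"
    then obtain s where s: "a = cls n C A s" "wf_yterm n C A s" by (auto simp: HE_carrier)
    show "h a \<in> carrier (HE m D B)" using h s fw by (auto simp: HE_carrier)
    fix b assume "b \<in> carrier (HE n C A)"
    then obtain t where t: "b = cls n C A t" "wf_yterm n C A t" by (auto simp: HE_carrier)
    show "h (a \<oplus>\<^bsub>HE n C A\<^esub> b) = h a \<oplus>\<^bsub>HE m D B\<^esub> h b"
      using HE_add[OF s(2) t(2)] HE_add[OF fw[OF s(2)] fw[OF t(2)]] h s t f_Plus[OF s(2) t(2)]
        cls_eq_iff[OF yeqD1[OF f_Plus[OF s(2) t(2)]], of "Plus (f s) (f t)"] by simp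
  qed
  also have "{a \<in> carrier (HE n C A). h a = \<zero>\<^bsub>HE m D B\<^esub>}
    = cls n C A ` {t. wf_yterm n C A t \<and> f t \<approx>\<^bsub>m,D,B\<^esub> Zero}"
  proof -
    have "h (cls n C A t) = \<zero>\<^bsub>HE m D B\<^esub> \<longleftrightarrow> f t \<approx>\<^bsub>m,D,B\<^esub> Zero" if "wf_yterm n C A t" for t
      unfolding h[OF that] HE_zero by (rule cls_eq_iff[OF fw[OF that]])
    then show ?thesis unfolding HE_carrier by blast
  qed
  also have "h ` carrier (HE n C A) = cls m D B ` {t. wf_yterm m D B t \<and> g t \<approx>\<^bsub>l,F,G\<^esub> Zero}"
  proof (intro equalityI subsetI)
    fix c assume "c \<in> h ` carrier (HE n C A)"
    then obtain r where "wf_yterm n C A r" "c = cls m D B (f r)" using h by (auto simp: HE_carrier)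
    then show "c \<in> cls m D B ` {t. wf_yterm m D B t \<and> g t \<approx>\<^bsub>l,F,G\<^esub> Zero}" using fw comp by blast
  next
    fix c assume "c \<in> cls m D B ` {t. wf_yterm m D B t \<and> g t \<approx>\<^bsub>l,F,G\<^esub> Zero}"
    then obtain s where s: "c = cls m D B s" "wf_yterm m D B s" "g s \<approx>\<^bsub>l,F,G\<^esub> Zero" by blast
    obtain r where r: "wf_yterm n C A r" "s \<approx>\<^bsub>m,D,B\<^esub> f r" using exact[OF s(2,3)] by blast
    then have "c = h (cls n C A r)" using h[OF r(1)] cls_eq_iff[OF s(2)] s by simp
    then show "c \<in> h ` carrier (HE n C A)" using r by (auto simp: HE_carrier)
  qed
  finally show ?thesis unfolding ker_card_def .
qed

text \<open>The same count at the passage from degree 0 to degree 1. It is stated separately because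
  the morphism groups are not quotients of terms, whereas the kernel they map onto is counted in the
  term model.\<close>

lemma HE_exact_start:
  assumes ob: "abelian_group G" "finite (carrier G)" "D \<in> Ob \<C>" "B \<in> Ob \<C>"
    and f: "\<And>a. a \<in> carrier G \<Longrightarrow> exten (f a) D B"
    and f_add: "\<And>a b. \<lbrakk>a \<in> carrier G; b \<in> carrier G\<rbrakk> \<Longrightarrow> f (a \<oplus>\<^bsub>G\<^esub> b) = f a \<oplus>\<^bsub>E D B\<^esub> f b"
    and g: "\<And>s t. s \<approx>\<^bsub>1,D,B\<^esub> t \<Longrightarrow> g s \<approx>\<^bsub>1,F,G'\<^esub> g t"
    and exact: "\<And>e. \<lbrakk>exten e D B; g (Emb e) \<approx>\<^bsub>1,F,G'\<^esub> Zero\<rbrakk> \<Longrightarrow> \<exists>a\<in>carrier G. e = f a"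
    and comp: "\<And>a. a \<in> carrier G \<Longrightarrow> g (Emb (f a)) \<approx>\<^bsub>1,F,G'\<^esub> Zero"
  shows "card (carrier G) = card {a \<in> carrier G. f a = \<zero>\<^bsub>E D B\<^esub>} * ker_card 1 D B 1 F G' g"
proof -
  have "card (carrier G) = card {a \<in> carrier G. f a = \<zero>\<^bsub>E D B\<^esub>} * card (f ` carrier G)"
    using f f_add extenD(3) by (intro card_kernel_image[OF ob(1) ext_group[OF ob(3,4)] ob(2)]) blast+
  also have "card (f ` carrier G) = card ((\<lambda>e. cls 1 D B (Emb e)) ` (f ` carrier G))"
  proof (rule card_image[symmetric], rule inj_onI)
    fix e e' assume ee: "e \<in> f ` carrier G" "e' \<in> f ` carrier G" "cls 1 D B (Emb e) = cls 1 D B (Emb e')"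
    have "exten e D B" "exten e' D B" using ee f by auto
    then show "e = e'" using ee(3) cls_eq_iff[of 1 D B "Emb e" "Emb e'"] yEmb_iff[of e D B e'] by simp
  qed
  also have "(\<lambda>e. cls 1 D B (Emb e)) ` (f ` carrier G)
    = cls 1 D B ` {t. wf_yterm 1 D B t \<and> g t \<approx>\<^bsub>1,F,G'\<^esub> Zero}"
  proof (intro equalityI subsetI)
    fix c assume "c \<in> (\<lambda>e. cls 1 D B (Emb e)) ` (f ` carrier G)"
    then show "c \<in> cls 1 D B ` {t. wf_yterm 1 D B t \<and> g t \<approx>\<^bsub>1,F,G'\<^esub> Zero}" using f comp by fastforce
  next
    fix c assume "c \<in> cls 1 D B ` {t. wf_yterm 1 D B t \<and> g t \<approx>\<^bsub>1,F,G'\<^esub> Zero}"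
    then obtain s where s: "c = cls 1 D B s" "wf_yterm 1 D B s" "g s \<approx>\<^bsub>1,F,G'\<^esub> Zero" by blast
    note e = yeval_exten[OF s(2) refl] and v = yeval_yeq[OF s(2) refl]
    have "g (Emb (yeval D B s)) \<approx>\<^bsub>1,F,G'\<^esub> Zero" using yeq.yeq_trans[OF yeq.yeq_sym[OF g[OF v]] s(3)] .
    then obtain a where "a \<in> carrier G" "yeval D B s = f a" using exact[OF e] by blast
    then show "c \<in> (\<lambda>e. cls 1 D B (Emb e)) ` (f ` carrier G)" using s(1) v cls_eq_iff[OF s(2)] by auto
  qed
  finally show ?thesis unfolding ker_card_def .
qed

end

section \<open>The Euler form\<close>

locale ext_finite_extriangulated = extriangulated K \<C>
  for K :: "'k ring" and \<C> :: "('k, 'o, 'm, 'e) extri_cat" (structure) +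
  assumes finite_field: "finite (carrier K)" and ext_fin: "ext_finite K \<C>"
begin

section \<open>Finiteness of the extension groups\<close>

lemma ext_fin_dim: "\<lbrakk>X \<in> Ob \<C>; Y \<in> Ob \<C>\<rbrakk> \<Longrightarrow> ext_fin_dim K \<C> i X Y"
  using ext_fin unfolding ext_finite_def by blast

lemma finite_hom: "\<lbrakk>X \<in> Ob \<C>; Y \<in> Ob \<C>\<rbrakk> \<Longrightarrow> finite (Homset \<C> X Y)"
  using vectorspace.finite_carrier_if_fin_dim[OF Hom_vectorspace finite_field] ext_fin_dim[of X Y 0] by simp

lemma finite_ext: "\<lbrakk>X \<in> Ob \<C>; Y \<in> Ob \<C>\<rbrakk> \<Longrightarrow> finite (Extset \<C> X Y)"
  using vectorspace.finite_carrier_if_fin_dim[OF Ext_vectorspace finite_field] ext_fin_dim[of X Y 1] by simp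

text \<open>\<open>ext_card\<close> counts \<open>Ext\<close> itself in degree 1, while the exact
  sequences count its copy in the term model.\<close>

lemma HE_1_bij:
  assumes "X \<in> Ob \<C>" "Y \<in> Ob \<C>"
  shows "bij_betw (\<lambda>e. cls 1 X Y (Emb e)) (Extset \<C> X Y) (carrier (HE 1 X Y))"
proof (rule bij_betw_imageI)
  show "inj_on (\<lambda>e. cls 1 X Y (Emb e)) (Extset \<C> X Y)"
  proof (rule inj_onI)
    fix e e' assume e: "e \<in> Extset \<C> X Y" "e' \<in> Extset \<C> X Y" "cls 1 X Y (Emb e) = cls 1 X Y (Emb e')"
    have x: "exten e X Y" "exten e' X Y" using e assms by (auto intro: extenI)
    then show "e = e'" using e(3) cls_eq_iff[of 1 X Y "Emb e" "Emb e'"] yEmb_iff[OF x] by simp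
  qed
  show "(\<lambda>e. cls 1 X Y (Emb e)) ` Extset \<C> X Y = carrier (HE 1 X Y)"
  proof (intro equalityI subsetI)
    fix c assume "c \<in> (\<lambda>e. cls 1 X Y (Emb e)) ` Extset \<C> X Y"
    then obtain e where "e \<in> Extset \<C> X Y" "c = cls 1 X Y (Emb e)" by blast
    then show "c \<in> carrier (HE 1 X Y)" unfolding HE_carrier using assms by (auto simp: extenI)
  next
    fix c assume "c \<in> carrier (HE 1 X Y)"
    then obtain s where s: "wf_yterm 1 X Y s" "c = cls 1 X Y s" unfolding HE_carrier by blast
    then have "c = cls 1 X Y (Emb (yeval X Y s))" using cls_eq_iff[OF s(1)] yeval_yeq[OF s(1)] by simp
    then show "c \<in> (\<lambda>e. cls 1 X Y (Emb e)) ` Extset \<C> X Y"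
      using extenD(3)[OF yeval_exten[OF s(1) refl]] by blast
  qed
qed

lemma HE_card:
  assumes "n \<ge> 1" "X \<in> Ob \<C>" "Y \<in> Ob \<C>"
  shows "finite (carrier (HE n X Y))" "card (carrier (HE n X Y)) = ext_card K \<C> n X Y"
proof -
  have "finite (carrier (HE n X Y)) \<and> card (carrier (HE n X Y)) = ext_card K \<C> n X Y"
  proof (cases "n = 1")
    case True
    then show ?thesis
      using bij_betw_same_card[OF HE_1_bij[OF assms(2,3)]] bij_betw_finite[OF HE_1_bij[OF assms(2,3)]]
        finite_ext[OF assms(2,3)] by simp
  next
    case False
    then obtain m where m: "n = Suc (Suc m)" using assms(1)
      by (metis One_nat_def not0_implies_Suc not_one_le_zero)
    then show ?thesis
      using vectorspace.finite_carrier_if_fin_dim[OF HE_vectorspace[OF assms] finite_field]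
        ext_fin_dim[OF assms(2,3), of n] by simp
  qed
  then show "finite (carrier (HE n X Y))" "card (carrier (HE n X Y)) = ext_card K \<C> n X Y" by blast+
qed

lemma ext_card_pos:
  assumes "X \<in> Ob \<C>" "Y \<in> Ob \<C>"
  shows "ext_card K \<C> n X Y > 0"
proof (cases n)
  case 0
  have "\<zero>\<^bsub>H X Y\<^esub> \<in> Homset \<C> X Y" using mor_zero[OF assms] by (simp add: mor_def)
  then show ?thesis using finite_hom[OF assms] 0 by (auto simp: card_gt_0_iff)
next
  case (Suc m)
  then have "n \<ge> 1" by simp
  moreover then have "cls n X Y Zero \<in> carrier (HE n X Y)" unfolding HE_carrier using assms by simp
  ultimately show ?thesis using HE_card[of n X Y] assms by (metis card_gt_0_iff empty_iff)
qed

lemma ext_card_eventually_1: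
  assumes "X \<in> Ob \<C>" "Y \<in> Ob \<C>"
  shows "\<exists>N. \<forall>i\<ge>N. ext_card K \<C> i X Y = 1"
proof -
  have "summable (\<lambda>i. real (ext_dim K \<C> i X Y))" using ext_fin assms unfolding ext_finite_def by blast
  from summable_nat_eventually_0[OF this] obtain N where N: "\<And>i. i \<ge> N \<Longrightarrow> ext_dim K \<C> i X Y = 0" by blast
  \<comment> \<open>The shift by 2 puts the index in the range where \<open>ext_dim\<close> and
    \<open>ext_card\<close> refer to the term model.\<close>
  have "ext_card K \<C> i X Y = 1" if i: "i \<ge> N + 2" for i
  proof -
    define m where "m = i - 2"
    have m: "i = Suc (Suc m)" using i by (simp add: m_def)
    have "i \<ge> 1" using m by simp
    then have "carrier (HE i X Y) = {\<zero>\<^bsub>HE i X Y\<^esub>}"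
      using vectorspace.carrier_if_dim_0[OF HE_vectorspace] assms ext_fin_dim[OF assms, of i] N[of i] m i
        by simp
    then show ?thesis using m by simp
  qed
  then show ?thesis by blast
qed

definition euler :: "'o \<Rightarrow> 'o \<Rightarrow> rat"
  where "euler X Y = curly K \<C> X Y * of_nat (card (Homset \<C> X Y))"

text \<open>Telescoping needs finite products. The equality is stated for all large
  \<open>N\<close>, so that several pairs of objects can share one bound.\<close>

lemma euler_eq:
  assumes "X \<in> Ob \<C>" "Y \<in> Ob \<C>"
  shows "\<exists>N\<^sub>0. \<forall>N\<ge>N\<^sub>0. euler X Y = (\<Prod>i<N. of_nat (ext_card K \<C> i X Y) powi ((-1) ^ i))"
proof -
  obtain N where N: "\<And>i. i \<ge> N \<Longrightarrow> ext_card K \<C> i X Y = 1" using ext_card_eventually_1[OF assms] by blast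
  let ?f = "\<lambda>i. of_nat (ext_card K \<C> i X Y) powi ((-1) ^ i) :: rat"
  have "euler X Y = (\<Prod>i<n. ?f i)" if n: "n \<ge> Suc N" for n
  proof -
    let ?S = "{i. i > 0 \<and> ext_card K \<C> i X Y \<noteq> 1}"
    have "?S \<subseteq> {1..<n}"
    proof
      fix i assume i: "i \<in> ?S"
      then have "\<not> i \<ge> N" using N[of i] by auto
      then show "i \<in> {1..<n}" using i n by simp
    qed
    then have "prod ?f ?S = prod ?f {1..<n}" by (intro prod.mono_neutral_left) auto
    moreover have "{..<n} = insert 0 {1..<n}" using n by auto
    ultimately show ?thesis unfolding euler_def curly_def by (simp add: mult.commute)
  qed
  then show ?thesis by blast
qed

lemma euler_pos:
  assumes "X \<in> Ob \<C>" "Y \<in> Ob \<C>"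
  shows "euler X Y > 0"
proof -
  obtain N where "euler X Y = (\<Prod>i<N. of_nat (ext_card K \<C> i X Y) powi ((-1) ^ i))" using euler_eq[OF assms]
    by blast
  moreover have "(of_nat (ext_card K \<C> i X Y) :: rat) powi ((-1) ^ i) > 0" for i
    using ext_card_pos[OF assms, of i] by (intro zero_less_power_int) simp
  ultimately show ?thesis by (simp add: prod_pos)
qed

lemma yPlus_refl:
  "\<lbrakk>wf_yterm n C A s; wf_yterm n C A t\<rbrakk> \<Longrightarrow> Plus s t \<approx>\<^bsub>n,C,A\<^esub> Plus s t"
  by (rule yeq_reflI) simp

lemma half_exactD:
  "\<lbrakk>half_exact n A; triangle \<C> M x N y X \<delta>; wf_yterm n N A t; ypull \<C> x t \<approx>\<^bsub>n,M,A\<^esub> Zero\<rbrakk>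
    \<Longrightarrow> \<exists>s. wf_yterm n X A s \<and> t \<approx>\<^bsub>n,N,A\<^esub> ypull \<C> y s"
  unfolding half_exact_def by blast

lemma euler_telescope:
  assumes ob: "X \<in> Ob \<C>" "Y \<in> Ob \<C>" "X' \<in> Ob \<C>" "Y' \<in> Ob \<C>" "X'' \<in> Ob \<C>" "Y'' \<in> Ob \<C>"
    and a: "\<And>i. ext_card K \<C> i X Y = k i * l i" and b: "\<And>i. ext_card K \<C> i X' Y' = l i * m i"
    and c: "\<And>i. ext_card K \<C> i X'' Y'' = m i * k (Suc i)"
  shows "euler X Y * euler X'' Y'' = euler X' Y' * of_nat (k 0)"
proof -
  obtain N1 where 1: "\<And>N. N \<ge> N1 \<Longrightarrow> euler X Y = (\<Prod>i<N. of_nat (ext_card K \<C> i X Y) powi ((-1) ^ i))"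
    using euler_eq[OF ob(1,2)] by blast
  obtain N2 where 2: "\<And>N. N \<ge> N2 \<Longrightarrow> euler X' Y' = (\<Prod>i<N. of_nat (ext_card K \<C> i X' Y') powi ((-1) ^ i))"
    using euler_eq[OF ob(3,4)] by blast
  obtain N3 where 3: "\<And>N. N \<ge> N3 \<Longrightarrow> euler X'' Y'' = (\<Prod>i<N. of_nat (ext_card K \<C> i X'' Y'') powi ((-1) ^ i))"
    using euler_eq[OF ob(5,6)] by blast
  obtain N4 where 4: "\<And>i. i \<ge> N4 \<Longrightarrow> ext_card K \<C> i X Y = 1" using ext_card_eventually_1[OF ob(1,2)] by blast
  define N where "N = N1 + N2 + N3 + N4"
  have N: "N \<ge> N1" "N \<ge> N2" "N \<ge> N3" "N \<ge> N4" by (auto simp: N_def)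
  \<comment> \<open>Beyond the bound the groups are trivial, and so is the kernel at the right end
    of the truncated sequence; only the left boundary term \<open>k 0\<close> survives.\<close>
  have "k N = 1" using 4[OF N(4)] a[of N] by simp
  then show ?thesis
    using alternating_product_telescope[of "\<lambda>i. ext_card K \<C> i X Y" k l "\<lambda>i. ext_card K \<C> i X' Y'" m
        "\<lambda>i. ext_card K \<C> i X'' Y''" N, OF a b c ext_card_pos[OF ob(1,2)] ext_card_pos[OF ob(5,6)]]
    unfolding 1[OF N(1)] 2[OF N(2)] 3[OF N(3)] by simp
qed

text \<open>An inflation need not be a monomorphism, so the long sequence is not exact at its left
  end. The order of the kernel there is the deviation from multiplicativity.\<close>

theorem euler_covariant:
  assumes t: "triangle \<C> A x B y C \<delta>" and Z: "Z \<in> Ob \<C>"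
  shows "euler Z A * euler Z C = euler Z B * of_nat (card {u \<in> Homset \<C> Z A. x \<cdot> u = \<zero>\<^bsub>H Z B\<^esub>})"
proof -
  note d = triangleD[OF t]
  let ?K0 = "{u \<in> Homset \<C> Z A. x \<cdot> u = \<zero>\<^bsub>H Z B\<^esub>}" and ?L0 = "{u \<in> Homset \<C> Z B. y \<cdot> u = \<zero>\<^bsub>H Z C\<^esub>}"
    and ?M0 = "{u \<in> Homset \<C> Z C. \<delta> \<triangleleft> u = \<zero>\<^bsub>E Z A\<^esub>}"
  \<comment> \<open>Index 0 concerns morphism groups and is defined apart. The connecting map raises
    the degree, so \<open>m i\<close> is followed by \<open>k (Suc i)\<close>.\<close>
  define k where "k i = (case i of 0 \<Rightarrow> card ?K0 | Suc j \<Rightarrow> ker_card i Z A i Z B (ypush \<C> x))" for i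
  define l where "l i = (case i of 0 \<Rightarrow> card ?L0 | Suc j \<Rightarrow> ker_card i Z B i Z C (ypush \<C> y))" for i
  define m where "m i = (case i of 0 \<Rightarrow> card ?M0 | Suc j \<Rightarrow> ker_card i Z C (Suc i) Z A (yconn C \<delta>))" for i
  have a: "ext_card K \<C> i Z A = k i * l i" for i
  proof (cases i)
    case 0
    have "card (Homset \<C> Z A) = card ?K0 * card ((\<lambda>u. x \<cdot> u) ` Homset \<C> Z A)"
      by (rule card_kernel_image[OF hom_group[OF Z d(4)] hom_group[OF Z d(5)] finite_hom[OF Z d(4)]])
        (use Z d in \<open>simp_all add: mor_iff mor_cmp cmp_add_right(1)\<close>)
    also have "(\<lambda>u. x \<cdot> u) ` Homset \<C> Z A = ?L0"
    proof (intro equalityI subsetI)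
      fix v assume "v \<in> (\<lambda>u. x \<cdot> u) ` Homset \<C> Z A"
      then obtain u where u: "u \<Colon> Z \<rightarrow> A" "v = x \<cdot> u" using Z d by (auto simp: mor_iff)
      have "y \<cdot> v = \<zero>\<^bsub>H Z C\<^esub>" using assoc[OF u(1) d(1,2)] triangle_cmp_zero[OF t] cmp_zero_left[OF u(1) d(6)]
        u(2) by simp
      then show "v \<in> ?L0" using morD(3)[OF mor_cmp[OF u(1) d(1)]] u(2) by simp
    next
      fix v assume "v \<in> ?L0"
      then have v: "v \<Colon> Z \<rightarrow> B" "y \<cdot> v = \<zero>\<^bsub>H Z C\<^esub>" using Z d by (auto simp: mor_iff)
      obtain u where "u \<Colon> Z \<rightarrow> A" "x \<cdot> u = v" using factor_through_inflation[OF t v] .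
      then show "v \<in> (\<lambda>u. x \<cdot> u) ` Homset \<C> Z A" using morD(3) by blast
    qed
    finally show ?thesis using 0 by (simp add: k_def l_def)
  next
    case (Suc j)
    then have i: "i \<ge> 1" by simp
    have "card (carrier (HE i Z A)) = ker_card i Z A i Z B (ypush \<C> x) * ker_card i Z B i Z C (ypush \<C> y)"
      by (rule HE_exact[OF i Z d(4) i Z d(5) HE_card(1)[OF i Z d(4)]])
        (auto intro: ypush_cong[OF _ d(1)] ypush_cong[OF _ d(2)] ypush_wf[OF _ d(1)] yPlus_refl
          co_exact_middle[OF t i] ypush_comp_zero[OF t])
    then show ?thesis using HE_card(2)[OF i Z d(4)] Suc by (simp add: k_def l_def)
  qed
  have b: "ext_card K \<C> i Z B = l i * m i" for i
  proof (cases i)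
    case 0
    have "card (Homset \<C> Z B) = card ?L0 * card ((\<lambda>u. y \<cdot> u) ` Homset \<C> Z B)"
      by (rule card_kernel_image[OF hom_group[OF Z d(5)] hom_group[OF Z d(6)] finite_hom[OF Z d(5)]])
        (use Z d in \<open>simp_all add: mor_iff mor_cmp cmp_add_right(1)\<close>)
    also have "(\<lambda>u. y \<cdot> u) ` Homset \<C> Z B = ?M0"
    proof (intro equalityI subsetI)
      fix v assume "v \<in> (\<lambda>u. y \<cdot> u) ` Homset \<C> Z B"
      then obtain u where u: "u \<Colon> Z \<rightarrow> B" "v = y \<cdot> u" using Z d by (auto simp: mor_iff)
      have "\<delta> \<triangleleft> v = \<zero>\<^bsub>E Z A\<^esub>"
        using pull_pull[OF d(2) u(1) d(3)] triangle_pull_zero[OF t] pull_zero[OF u(1) d(4)] u(2) by simp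
      then show "v \<in> ?M0" using morD(3)[OF mor_cmp[OF u(1) d(2)]] u(2) by simp
    next
      fix v assume "v \<in> ?M0"
      then have v: "v \<Colon> Z \<rightarrow> C" "\<delta> \<triangleleft> v = \<zero>\<^bsub>E Z A\<^esub>" using Z d by (auto simp: mor_iff)
      obtain u where "u \<Colon> Z \<rightarrow> B" "y \<cdot> u = v" using lift_along_deflation[OF t v] .
      then show "v \<in> (\<lambda>u. y \<cdot> u) ` Homset \<C> Z B" using morD(3) by blast
    qed
    finally show ?thesis using 0 by (simp add: l_def m_def)
  next
    case (Suc j)
    then have i: "i \<ge> 1" "Suc i \<ge> 1" by simp_all
    have "card (carrier (HE i Z B)) = ker_card i Z B i Z C (ypush \<C> y) * ker_card i Z C (Suc i)
      Z A (yconn C \<delta>)"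
      by (rule HE_exact[OF i(1) Z d(5) i(1) Z d(6) HE_card(1)[OF i(1) Z d(5)]])
        (auto intro: ypush_cong[OF _ d(2)] yconn_cong[OF _ d(3)] ypush_wf[OF _ d(2)] yPlus_refl
          co_exact_right[OF t i(1)] yconn_comp_zero[OF t])
    then show ?thesis using HE_card(2)[OF i(1) Z d(5)] Suc by (simp add: l_def m_def)
  qed
  have c: "ext_card K \<C> i Z C = m i * k (Suc i)" for i
  proof (cases i)
    case 0
    have "card (Homset \<C> Z C) = card ?M0 * ker_card 1 Z A 1 Z B (ypush \<C> x)"
    proof (rule HE_exact_start[OF hom_group[OF Z d(6)] finite_hom[OF Z d(6)] Z d(4)])
      show "exten (\<delta> \<triangleleft> u) Z A" if "u \<in> Homset \<C> Z C" for u using that Z d by (auto simp: mor_iff)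
      show "\<delta> \<triangleleft> (u \<oplus>\<^bsub>H Z C\<^esub> v) = (\<delta> \<triangleleft> u) \<oplus>\<^bsub>E Z A\<^esub> (\<delta> \<triangleleft> v)" if "u \<in> Homset \<C> Z C" "v \<in> Homset \<C> Z C" for u v
        using that Z d by (simp add: mor_iff pull_mor_linear(1))
      show "ypush \<C> x s \<approx>\<^bsub>1,Z,B\<^esub> ypush \<C> x r" if "s \<approx>\<^bsub>1,Z,A\<^esub> r" for s r using ypush_cong[OF that d(1)] .
      show "\<exists>u\<in>Homset \<C> Z C. e = \<delta> \<triangleleft> u" if e: "exten e Z A" "ypush \<C> x (Emb e) \<approx>\<^bsub>1,Z,B\<^esub> Zero" for e
      proof -
        have "x \<triangleright> e = \<zero>\<^bsub>E Z B\<^esub>" using e yEmb_Zero_iff[OF exten_push[OF d(1) e(1)]] by simp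
        then obtain u where "u \<Colon> Z \<rightarrow> C" "e = \<delta> \<triangleleft> u" using ext_exact_left[OF t e(1)] by blast
        then show ?thesis using morD(3) by blast
      qed
      show "ypush \<C> x (Emb (\<delta> \<triangleleft> u)) \<approx>\<^bsub>1,Z,B\<^esub> Zero" if "u \<in> Homset \<C> Z C" for u
      proof -
        have u: "u \<Colon> Z \<rightarrow> C" using that Z d by (simp add: mor_iff)
        have "x \<triangleright> (\<delta> \<triangleleft> u) = \<zero>\<^bsub>E Z B\<^esub>"
          using pull_push[OF d(1) u d(3)] triangle_push_zero[OF t] pull_zero[OF u d(5)] by simp
        then show ?thesis using yEmb_zero[OF Z d(5)] by simp
      qed
    qed
    then show ?thesis using 0 by (simp add: k_def m_def)
  next
    case (Suc j)
    then have i: "i \<ge> 1" "Suc i \<ge> 1" by simp_all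
    have "card (carrier (HE i Z C)) = ker_card i Z C (Suc i) Z A (yconn C \<delta>) * ker_card (Suc i) Z A (Suc i)
      Z B (ypush \<C> x)"
      by (rule HE_exact[OF i(1) Z d(6) i(2) Z d(4) HE_card(1)[OF i(1) Z d(6)]])
        (auto intro: ypush_cong[OF _ d(1)] yconn_cong[OF _ d(3)] yconn_wf[OF _ d(3)] yPlus_refl
          co_exact_left[OF t i(1)] yconn_comp_zero[OF t])
    then show ?thesis using HE_card(2)[OF i(1) Z d(6)] Suc by (simp add: k_def m_def)
  qed
  from euler_telescope[OF Z d(4) Z d(5) Z d(6) a b c] show ?thesis by (simp add: k_def)
qed

text \<open>Dual boundary effect: a deflation need not be an epimorphism, so the sequence begins
  with the kernel of composition with \<open>y\<close>. The connecting map is the tensor with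
  \<open>\<delta>\<close> as last factor.\<close>

theorem euler_contravariant:
  assumes t: "triangle \<C> A x B y C \<delta>" and Z: "Z \<in> Ob \<C>"
  shows "euler C Z * euler A Z = euler B Z * of_nat (card {u \<in> Homset \<C> C Z. u \<cdot> y = \<zero>\<^bsub>H B Z\<^esub>})"
proof -
  note d = triangleD[OF t]
  let ?K0 = "{u \<in> Homset \<C> C Z. u \<cdot> y = \<zero>\<^bsub>H B Z\<^esub>}" and ?L0 = "{u \<in> Homset \<C> B Z. u \<cdot> x = \<zero>\<^bsub>H A Z\<^esub>}"
    and ?M0 = "{u \<in> Homset \<C> A Z. u \<triangleright> \<delta> = \<zero>\<^bsub>E C Z\<^esub>}"
  define k where "k i = (case i of 0 \<Rightarrow> card ?K0 | Suc j \<Rightarrow> ker_card i C Z i B Z (ypull \<C> y))" for i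
  define l where "l i = (case i of 0 \<Rightarrow> card ?L0 | Suc j \<Rightarrow> ker_card i B Z i A Z (ypull \<C> x))" for i
  define m where "m i = (case i of 0 \<Rightarrow> card ?M0 | Suc j \<Rightarrow> ker_card i A Z (Suc i) C Z (\<lambda>t. Tensor A t \<delta>))"
    for i
  have a: "ext_card K \<C> i C Z = k i * l i" for i
  proof (cases i)
    case 0
    have "card (Homset \<C> C Z) = card ?K0 * card ((\<lambda>u. u \<cdot> y) ` Homset \<C> C Z)"
      by (rule card_kernel_image[OF hom_group[OF d(6) Z] hom_group[OF d(5) Z] finite_hom[OF d(6) Z]])
        (use Z d in \<open>simp_all add: mor_iff mor_cmp cmp_add_left(1)\<close>)
    also have "(\<lambda>u. u \<cdot> y) ` Homset \<C> C Z = ?L0"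
    proof (intro equalityI subsetI)
      fix v assume "v \<in> (\<lambda>u. u \<cdot> y) ` Homset \<C> C Z"
      then obtain u where u: "u \<Colon> C \<rightarrow> Z" "v = u \<cdot> y" using Z d by (auto simp: mor_iff)
      have "v \<cdot> x = \<zero>\<^bsub>H A Z\<^esub>" using assoc[OF d(1,2) u(1)] triangle_cmp_zero[OF t] cmp_zero_right[OF u(1) d(4)]
        u(2) by simp
      then show "v \<in> ?L0" using morD(3)[OF mor_cmp[OF d(2) u(1)]] u(2) by simp
    next
      fix v assume "v \<in> ?L0"
      then have v: "v \<Colon> B \<rightarrow> Z" "v \<cdot> x = \<zero>\<^bsub>H A Z\<^esub>" using Z d by (auto simp: mor_iff)
      obtain u where "u \<Colon> C \<rightarrow> Z" "u \<cdot> y = v" using factor_through_deflation[OF t v] .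
      then show "v \<in> (\<lambda>u. u \<cdot> y) ` Homset \<C> C Z" using morD(3) by blast
    qed
    finally show ?thesis using 0 by (simp add: k_def l_def)
  next
    case (Suc j)
    then have i: "i \<ge> 1" by simp
    have "card (carrier (HE i C Z)) = ker_card i C Z i B Z (ypull \<C> y) * ker_card i B Z i A Z (ypull \<C> x)"
      by (rule HE_exact[OF i d(6) Z i d(5) Z HE_card(1)[OF i d(6) Z]])
        (auto intro: ypull_cong[OF _ d(1)] ypull_cong[OF _ d(2)] ypull_wf[OF _ d(2)] yPlus_refl
           ypull_comp_zero[OF t] half_exactD[OF half_exact[OF Z i] t])
    then show ?thesis using HE_card(2)[OF i d(6) Z] Suc by (simp add: k_def l_def)
  qed
  have b: "ext_card K \<C> i B Z = l i * m i" for i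
  proof (cases i)
    case 0
    have "card (Homset \<C> B Z) = card ?L0 * card ((\<lambda>u. u \<cdot> x) ` Homset \<C> B Z)"
      by (rule card_kernel_image[OF hom_group[OF d(5) Z] hom_group[OF d(4) Z] finite_hom[OF d(5) Z]])
        (use Z d in \<open>simp_all add: mor_iff mor_cmp cmp_add_left(1)\<close>)
    also have "(\<lambda>u. u \<cdot> x) ` Homset \<C> B Z = ?M0"
    proof (intro equalityI subsetI)
      fix v assume "v \<in> (\<lambda>u. u \<cdot> x) ` Homset \<C> B Z"
      then obtain u where u: "u \<Colon> B \<rightarrow> Z" "v = u \<cdot> x" using Z d by (auto simp: mor_iff)
      have "v \<triangleright> \<delta> = \<zero>\<^bsub>E C Z\<^esub>"
        using push_push[OF d(1) u(1) d(3)] triangle_push_zero[OF t] push_zero[OF u(1) d(6)] u(2) by simp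
      then show "v \<in> ?M0" using morD(3)[OF mor_cmp[OF d(1) u(1)]] u(2) by simp
    next
      fix v assume "v \<in> ?M0"
      then have v: "v \<Colon> A \<rightarrow> Z" "v \<triangleright> \<delta> = \<zero>\<^bsub>E C Z\<^esub>" using Z d by (auto simp: mor_iff)
      obtain u where "u \<Colon> B \<rightarrow> Z" "u \<cdot> x = v" using extend_along_inflation[OF t v] .
      then show "v \<in> (\<lambda>u. u \<cdot> x) ` Homset \<C> B Z" using morD(3) by blast
    qed
    finally show ?thesis using 0 by (simp add: l_def m_def)
  next
    case (Suc j)
    then have i: "i \<ge> 1" "Suc i \<ge> 1" by simp_all
    have "card (carrier (HE i B Z)) = ker_card i B Z i A Z (ypull \<C> x) * ker_card i A Z (Suc i)
      C Z (\<lambda>t. Tensor A t \<delta>)"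
      by (rule HE_exact[OF i(1) d(5) Z i(1) d(4) Z HE_card(1)[OF i(1) d(5) Z]])
        (auto intro: ypull_cong[OF _ d(1)] ypull_wf[OF _ d(1)] yPlus_refl Tensor_cong_left[OF _ d(3)]
          contra_exact_left[OF half_exact[OF Z i(1)] i(1) t] Tensor_comp_zero[OF t])
    then show ?thesis using HE_card(2)[OF i(1) d(5) Z] Suc by (simp add: l_def m_def)
  qed
  have c: "ext_card K \<C> i A Z = m i * k (Suc i)" for i
  proof (cases i)
    case 0
    have "card (Homset \<C> A Z) = card ?M0 * ker_card 1 C Z 1 B Z (ypull \<C> y)"
    proof (rule HE_exact_start[OF hom_group[OF d(4) Z] finite_hom[OF d(4) Z] d(6) Z])
      show "exten (u \<triangleright> \<delta>) C Z" if "u \<in> Homset \<C> A Z" for u using that Z d by (auto simp: mor_iff)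
      show "(u \<oplus>\<^bsub>H A Z\<^esub> v) \<triangleright> \<delta> = (u \<triangleright> \<delta>) \<oplus>\<^bsub>E C Z\<^esub> (v \<triangleright> \<delta>)" if "u \<in> Homset \<C> A Z" "v \<in> Homset \<C> A Z" for u v
        using that Z d by (simp add: mor_iff push_mor_linear(1))
      show "ypull \<C> y s \<approx>\<^bsub>1,B,Z\<^esub> ypull \<C> y r" if "s \<approx>\<^bsub>1,C,Z\<^esub> r" for s r using ypull_cong[OF that d(2)] .
      show "\<exists>u\<in>Homset \<C> A Z. e = u \<triangleright> \<delta>" if e: "exten e C Z" "ypull \<C> y (Emb e) \<approx>\<^bsub>1,B,Z\<^esub> Zero" for e
      proof -
        have "e \<triangleleft> y = \<zero>\<^bsub>E B Z\<^esub>" using e yEmb_Zero_iff[OF exten_pull[OF d(2) e(1)]] by simp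
        then obtain u where "u \<Colon> A \<rightarrow> Z" "e = u \<triangleright> \<delta>" using ext_exact_left_op[OF t e(1)] by blast
        then show ?thesis using morD(3) by blast
      qed
      show "ypull \<C> y (Emb (u \<triangleright> \<delta>)) \<approx>\<^bsub>1,B,Z\<^esub> Zero" if "u \<in> Homset \<C> A Z" for u
      proof -
        have u: "u \<Colon> A \<rightarrow> Z" using that Z d by (simp add: mor_iff)
        have "(u \<triangleright> \<delta>) \<triangleleft> y = \<zero>\<^bsub>E B Z\<^esub>"
          using pull_push[OF u d(2) d(3)] triangle_pull_zero[OF t] push_zero[OF u d(5)] by simp
        then show ?thesis using yEmb_zero[OF d(5) Z] by simp
      qed
    qed
    then show ?thesis using 0 by (simp add: k_def m_def)
  next
    case (Suc j)
    then have i: "i \<ge> 1" "Suc i \<ge> 1" by simp_all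
    have "card (carrier (HE i A Z)) = ker_card i A Z (Suc i) C Z (\<lambda>t. Tensor A t \<delta>) * ker_card (Suc i)
      C Z (Suc i) B Z (ypull \<C> y)"
    proof (rule HE_exact[OF i(1) d(4) Z i(2) d(6) Z HE_card(1)[OF i(1) d(4) Z]])
      show "Tensor A (Plus s r) \<delta> \<approx>\<^bsub>Suc i,C,Z\<^esub> Plus (Tensor A s \<delta>) (Tensor A r \<delta>)"
        if "wf_yterm i A Z s" "wf_yterm i A Z r" for s r
        using that d by (intro yeq.yeq_Tensor_add_left) (auto dest: extenD)
    qed (auto intro: ypull_cong[OF _ d(2)] Tensor_cong_left[OF _ d(3)]
          contra_exact_right[OF half_exact[OF Z i(1)] i(1) t] Tensor_comp_zero(2)[OF t, unfolded ypull.simps])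
    then show ?thesis using HE_card(2)[OF i(1) d(4) Z] Suc by (simp add: k_def m_def)
  qed
  from euler_telescope[OF d(6) Z d(5) Z d(4) Z a b c] show ?thesis by (simp add: k_def)
qed

end

section \<open>Units and kernels in the finite case\<close>

lemma card_kernel_image_subgroup:
  assumes G: "abelian_group G" and H: "abelian_group H" and S: "S \<subseteq> carrier G" "\<zero>\<^bsub>G\<^esub> \<in> S"
      "\<And>a b. \<lbrakk>a \<in> S; b \<in> S\<rbrakk> \<Longrightarrow> a \<oplus>\<^bsub>G\<^esub> b \<in> S" "\<And>a. a \<in> S \<Longrightarrow> \<ominus>\<^bsub>G\<^esub> a \<in> S"
    and fin: "finite S"
    and closed: "\<And>a. a \<in> S \<Longrightarrow> f a \<in> carrier H"
    and add: "\<And>a b. \<lbrakk>a \<in> S; b \<in> S\<rbrakk> \<Longrightarrow> f (a \<oplus>\<^bsub>G\<^esub> b) = f a \<oplus>\<^bsub>H\<^esub> f b"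
  shows "card S = card {a \<in> S. f a = \<zero>\<^bsub>H\<^esub>} * card (f ` S)"
proof -
  interpret G: abelian_group G by (rule assms(1))
  let ?G = "G\<lparr>carrier := S\<rparr>"
  have "abelian_group ?G"
  proof (rule abelian_groupI)
    fix a assume a: "a \<in> carrier ?G"
    then have "\<ominus>\<^bsub>G\<^esub> a \<oplus>\<^bsub>G\<^esub> a = \<zero>\<^bsub>G\<^esub>" using S(1) by (auto intro: G.l_neg)
    then show "\<exists>b\<in>carrier ?G. b \<oplus>\<^bsub>?G\<^esub> a = \<zero>\<^bsub>?G\<^esub>" using a S(4) by auto
  qed (use S in \<open>auto simp: subset_iff G.a_assoc intro: G.a_comm\<close>)
  from card_kernel_image[OF this H, of f] show ?thesis using fin closed add by simp
qed

section \<open>Nilpotent elements and units in finite rings\<close>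

context ring
begin

text \<open>The products of \<open>1 + v\<close> and \<open>1 - v\<close> are
  \<open>1 - v v\<close>, and squaring halves the exponent of nilpotency; exponents that are powers
  of 2 make this an induction down to \<open>v = 0\<close>.\<close>

lemma one_plus_nilpotent_unit:
  assumes "v \<in> carrier R" "v [^] ((2::nat) ^ n) = \<zero>"
  shows "\<one> \<oplus> v \<in> Units R"
  using assms
proof (induction n arbitrary: v)
  case 0
  then show ?case by simp
next
  case (Suc n)
  let ?w = "\<ominus> (v \<otimes> v)"
  have v: "v \<in> carrier R" using Suc by simp
  have sq: "(\<ominus> (v \<otimes> v)) [^] ((2::nat) ^ n) = \<zero>"
  proof -
    have "?w [^] ((2::nat) ^ n) = (v \<otimes> v) [^] ((2::nat) ^ n) \<or> ?w [^] ((2::nat) ^ n)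
      = \<ominus> ((v \<otimes> v) [^] ((2::nat) ^ n))"
    proof -
      \<comment> \<open>Only the vanishing of powers is transferred, so the sign may stay
        undetermined.\<close>
      have "?w [^] k = (v \<otimes> v) [^] k \<or> ?w [^] k = \<ominus> ((v \<otimes> v) [^] k)" for k :: nat
        by (induction k) (use v in \<open>auto simp: l_minus r_minus\<close>)
      then show ?thesis by blast
    qed
    moreover have "(v \<otimes> v) [^] ((2::nat) ^ n) = v [^] ((2::nat) ^ Suc n)"
      using nat_pow_pow[OF v, of 2 "2 ^ n"] v by (simp add: numeral_2_eq_2)
    ultimately show ?thesis using Suc.prems(2) by auto
  qed
  have u: "\<one> \<oplus> ?w \<in> Units R" using Suc.IH[OF _ sq] v by simp
  have 1: "(\<one> \<oplus> v) \<otimes> (\<one> \<oplus> (\<ominus> v)) = \<one> \<oplus> ?w"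
  proof -
    have "(\<one> \<oplus> v) \<otimes> (\<one> \<oplus> (\<ominus> v)) = (\<one> \<oplus> v) \<otimes> \<one> \<oplus> (\<one> \<oplus> v) \<otimes> (\<ominus> v)" using v by (intro r_distr) auto
    also have "\<dots> = (\<one> \<oplus> v) \<oplus> (\<ominus> v \<oplus> ?w)" using v by (simp add: l_distr r_minus minus_add)
    finally show ?thesis using v by (simp add: a_assoc r_neg2)
  qed
  have 2: "(\<one> \<oplus> (\<ominus> v)) \<otimes> (\<one> \<oplus> v) = \<one> \<oplus> ?w"
  proof -
    have "(\<one> \<oplus> (\<ominus> v)) \<otimes> (\<one> \<oplus> v) = \<one> \<otimes> (\<one> \<oplus> v) \<oplus> (\<ominus> v) \<otimes> (\<one> \<oplus> v)" using v by (intro l_distr) auto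
    also have "\<dots> = (\<one> \<oplus> v) \<oplus> (\<ominus> v \<oplus> ?w)" using v by (simp add: r_distr l_minus minus_add)
    finally show ?thesis using v by (simp add: a_assoc r_neg2)
  qed
  obtain u' where u': "u' \<in> carrier R" "u' \<otimes> (\<one> \<oplus> ?w) = \<one>" "(\<one> \<oplus> ?w) \<otimes> u' = \<one>"
    using u by (auto simp: Units_def)
  have m: "\<one> \<oplus> v \<in> carrier R" "\<one> \<oplus> (\<ominus> v) \<in> carrier R" using v by auto
  have l: "(u' \<otimes> (\<one> \<oplus> (\<ominus> v))) \<otimes> (\<one> \<oplus> v) = \<one>" using m_assoc[OF u'(1) m(2,1)] 2 u' by simp
  have r: "(\<one> \<oplus> v) \<otimes> ((\<one> \<oplus> (\<ominus> v)) \<otimes> u') = \<one>" using m_assoc[OF m u'(1)] 1 u' by simp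
  have "u' \<otimes> (\<one> \<oplus> (\<ominus> v)) = (\<one> \<oplus> (\<ominus> v)) \<otimes> u'"
    using inv_unique[OF l r m(1)] u' m by simp
  then show ?case using l r m u' by (auto simp: Units_def)
qed

text \<open>By finiteness the powers of \<open>r\<close> are eventually periodic. Any positive
  multiple of the period \<open>p\<close> beyond the preperiod \<open>a\<close> works as
  \<open>N\<close>, and \<open>p * Suc a\<close> is one.\<close>

lemma finite_power_idempotent:
  assumes fin: "finite (carrier R)" and r: "r \<in> carrier R"
  obtains N :: nat where "N \<ge> 1" "r [^] (N + N) = r [^] N"
proof -
  have "\<not> inj (\<lambda>n::nat. r [^] n)"
  proof
    assume "inj (\<lambda>n::nat. r [^] n)"
    moreover have "finite (range (\<lambda>n::nat. r [^] n))" by (rule finite_subset[OF _ fin]) (use r in auto)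
    ultimately show False using finite_imageD infinite_UNIV_nat by blast
  qed
  then obtain a b :: nat where ab: "a < b" "r [^] a = r [^] b"
    unfolding inj_def by (metis linorder_neqE_nat)
  define p where "p = b - a"
  have p: "b = a + p" "p \<ge> 1" using ab by (auto simp: p_def)
  have per: "r [^] (k + p) = r [^] k" if "k \<ge> a" for k
  proof -
    obtain d where d: "k = a + d" using le_Suc_ex[OF \<open>k \<ge> a\<close>] by blast
    have "r [^] (k + p) = r [^] b \<otimes> r [^] d" using r by (simp add: nat_pow_mult d p(1) ac_simps)
    also have "\<dots> = r [^] k" using r by (simp add: ab(2)[symmetric] nat_pow_mult d)
    finally show ?thesis .
  qed
  have "r [^] (k + p * j) = r [^] k" if "k \<ge> a" for k j
  proof (induction j)
    case (Suc j)
    have "r [^] (k + p * Suc j) = r [^] ((k + p * j) + p)" by (simp add: ac_simps)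
    also have "\<dots> = r [^] k" using per[of "k + p * j"] that Suc by simp
    finally show ?case .
  qed simp
  moreover have "p * Suc a \<ge> a" using p(2) by (metis mult_le_mono1 nat_mult_1 le_trans le_SucI order_refl)
  ultimately have "r [^] (p * Suc a + p * Suc a) = r [^] (p * Suc a)" by blast
  then show ?thesis using that[of "p * Suc a"] p(2) by simp
qed

text \<open>Fitting's lemma in disguise: \<open>r (1 - r\<^sup>N)\<close> is the nilpotent part of \<open>r\<close>.\<close>

lemma unit_correction:
  assumes fin: "finite (carrier R)" and r: "r \<in> carrier R"
  obtains N :: nat where "N \<ge> 1" "\<one> \<oplus> (r \<oplus> (\<ominus> (r [^] Suc N))) \<in> Units R"
proof -
  obtain N :: nat where N: "N \<ge> 1" "r [^] (N + N) = r [^] N" using finite_power_idempotent[OF assms] .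
  have per: "r [^] (k + N + N) = r [^] (k + N)" for k
    using N(2) r by (simp add: nat_pow_mult[symmetric] m_assoc)
  \<comment> \<open>This is \<open>r^k (1 - r^N)\<close>. As \<open>r^N\<close> is idempotent,
    \<open>1 - r^N\<close> is idempotent too, so these elements multiply by adding indices, and they
    vanish for \<open>k \<ge> N\<close>.\<close>
  let ?a = "\<lambda>k. r [^] k \<oplus> (\<ominus> (r [^] (k + N)))"
  have mult: "?a j \<otimes> ?a k = ?a (j + k)" for j k
  proof -
    have "?a j \<otimes> ?a k = r [^] (j + k) \<oplus> (\<ominus> (r [^] (j + k + N)))
      \<oplus> ((\<ominus> (r [^] (j + k + N))) \<oplus> r [^] (j + k + N + N))"
      using r by (simp add: r_distr l_distr l_minus r_minus nat_pow_mult minus_add a_assoc ac_simps)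
    then show ?thesis using r by (simp add: per l_neg)
  qed
  have pow: "?a 1 [^] k = ?a k" if "k \<ge> 1" for k :: nat
    using that
  proof (induction k rule: dec_induct)
    case base
    then show ?case using r by simp
  next
    case (step k)
    then show ?case using mult[of k 1] by simp
  qed
  have "?a (2 ^ N) = \<zero>"
  proof -
    have "(2::nat) ^ N \<ge> N" by (simp add: less_imp_le)
    then obtain d where "2 ^ N = d + N" by (metis le_iff_add add.commute)
    then show ?thesis using per[of d] r by (simp add: r_neg)
  qed
  moreover have "(2::nat) ^ N \<ge> 1" by simp
  ultimately have "?a 1 [^] ((2::nat) ^ N) = \<zero>" using pow by simp
  then have "\<one> \<oplus> ?a 1 \<in> Units R" by (rule one_plus_nilpotent_unit[rotated]) (use r in simp)
  then show ?thesis using that[OF N(1)] r by simp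
qed

end

section \<open>Endomorphism rings\<close>

context linear_category
begin

definition end_ring :: "'o \<Rightarrow> 'm ring"
  where "end_ring X = \<lparr>carrier = Homset \<C> X X, mult = (\<lambda>g f. g \<cdot> f), one = Id \<C> X,
    zero = \<zero>\<^bsub>H X X\<^esub>, add = add (H X X)\<rparr>"

lemma end_ring_simps [simp]:
  "carrier (end_ring X) = Homset \<C> X X" "mult (end_ring X) g f = g \<cdot> f" "\<one>\<^bsub>end_ring X\<^esub> = Id \<C> X"
  "\<zero>\<^bsub>end_ring X\<^esub> = \<zero>\<^bsub>H X X\<^esub>" "f \<oplus>\<^bsub>end_ring X\<^esub> g = f \<oplus>\<^bsub>H X X\<^esub> g"
  by (simp_all add: end_ring_def)

lemma end_ring:
  assumes X: "X \<in> Ob \<C>"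
  shows "ring (end_ring X)"
proof (rule ringI)
  interpret G: abelian_group "H X X" by (rule hom_group[OF X X])
  show "abelian_group (end_ring X)"
    by (rule abelian_groupI) (auto simp: G.a_assoc intro: G.l_neg G.a_comm)
  show "monoid (end_ring X)"
    by (rule monoidI) (use X in \<open>auto simp: mor_iff intro: assoc\<close>)
qed (use X in \<open>auto simp: mor_iff cmp_add_left(1) cmp_add_right(1)\<close>)

lemma end_ring_neg:
  assumes "f \<Colon> X \<rightarrow> X"
  shows "\<ominus>\<^bsub>end_ring X\<^esub> f = \<ominus>\<^bsub>H X X\<^esub> f"
proof -
  have X: "X \<in> Ob \<C>" using assms morD by blast
  have R: "abelian_group (end_ring X)" using end_ring[OF X] ring.is_abelian_group by blast
  show ?thesis
    by (rule abelian_group.minus_equality[OF R]) (use assms morD mor_neg[OF assms] in auto)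
qed

lemma end_ring_units: "X \<in> Ob \<C> \<Longrightarrow> f \<in> Units (end_ring X) \<Longrightarrow> f \<in> isos \<C> X X"
  unfolding Units_def isos_def by auto

end

section \<open>Conflations with given end terms\<close>

text \<open>Finiteness of \<open>Hom\<close> and \<open>Ext\<close> alone is visibly self-dual,
  unlike a condition on the higher extensions of the term model. Separating it keeps the passage to
  the opposite category available for all counting arguments.\<close>

locale hom_finite_extriangulated = extriangulated K \<C>
  for K :: "'k ring" and \<C> :: "('k, 'o, 'm, 'e) extri_cat" (structure) +
  assumes finite_Homset: "\<lbrakk>X \<in> Ob \<C>; Y \<in> Ob \<C>\<rbrakk> \<Longrightarrow> finite (Homset \<C> X Y)"
    and finite_Extset: "\<lbrakk>X \<in> Ob \<C>; Y \<in> Ob \<C>\<rbrakk> \<Longrightarrow> finite (Extset \<C> X Y)"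
begin

lemma hom_finite_op: "hom_finite_extriangulated K (op_cat \<C>)"
  by (intro hom_finite_extriangulated.intro hom_finite_extriangulated_axioms.intro extriangulated_op)
    (simp_all add: finite_Homset finite_Extset)

lemma isomorphic_sym: "isomorphic \<C> X Y \<Longrightarrow> isomorphic \<C> Y X"
  unfolding isomorphic_def using isoD by (metis all_not_in_conv)

text \<open>The cone is prescribed only up to isomorphism, and the triangle can be transported along
  this isomorphism without changing the inflation.\<close>

lemma inflations_iff:
  assumes Y: "Y \<in> Ob \<C>"
  shows "f \<in> inflations \<C> X L Y \<longleftrightarrow> (\<exists>g \<delta>. triangle \<C> X f L g Y \<delta>)"
proof
  assume "f \<in> inflations \<C> X L Y"
  then obtain y Y' \<delta> where t: "triangle \<C> X f L y Y' \<delta>" "isomorphic \<C> Y' Y" by (auto simp: inflations_def)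
  note d = triangleD[OF t(1)]
  obtain c where c: "c \<in> isos \<C> Y' Y" using t(2) by (auto simp: isomorphic_def)
  obtain c' where c': "c' \<Colon> Y \<rightarrow> Y'" "c' \<cdot> c = Id \<C> Y'" "c \<cdot> c' = Id \<C> Y" using isoD[OF c d(6) Y] by metis
  have i: "Id \<C> X \<cdot> Id \<C> X = Id \<C> X" using id_cmp[OF mor_id[OF d(4)]] .
  from triangle_transport[OF t(1) iso_id[OF d(4)] d(4) mor_id[OF d(4)] i i c Y c']
  show "\<exists>g \<delta>. triangle \<C> X f L g Y \<delta>" using d by auto
next
  assume "\<exists>g \<delta>. triangle \<C> X f L g Y \<delta>"
  moreover have "isomorphic \<C> Y Y" using Y iso_id by (auto simp: isomorphic_def)
  ultimately show "f \<in> inflations \<C> X L Y" by (auto simp: inflations_def)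
qed

lemma deflations_iff:
  assumes X: "X \<in> Ob \<C>"
  shows "g \<in> deflations \<C> X L Y \<longleftrightarrow> (\<exists>f \<delta>. triangle \<C> X f L g Y \<delta>)"
proof
  assume "g \<in> deflations \<C> X L Y"
  then obtain x X' \<delta> where t: "triangle \<C> X' x L g Y \<delta>" "isomorphic \<C> X' X" by (auto simp: deflations_def)
  note d = triangleD[OF t(1)]
  obtain a where a: "a \<in> isos \<C> X' X" using t(2) by (auto simp: isomorphic_def)
  obtain a' where a': "a' \<Colon> X \<rightarrow> X'" "a' \<cdot> a = Id \<C> X'" "a \<cdot> a' = Id \<C> X" using isoD[OF a d(4) X] by metis
  have i: "Id \<C> Y \<cdot> Id \<C> Y = Id \<C> Y" using id_cmp[OF mor_id[OF d(6)]] .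
  from triangle_transport[OF t(1) a X a' iso_id[OF d(6)] d(6) mor_id[OF d(6)] i i]
  show "\<exists>f \<delta>. triangle \<C> X f L g Y \<delta>" using d by auto
next
  assume "\<exists>f \<delta>. triangle \<C> X f L g Y \<delta>"
  moreover have "isomorphic \<C> X X" using X iso_id by (auto simp: isomorphic_def)
  ultimately show "g \<in> deflations \<C> X L Y" by (auto simp: deflations_def)
qed

lemma inflations_op: "\<lbrakk>X \<in> Ob \<C>; Y \<in> Ob \<C>\<rbrakk> \<Longrightarrow> inflations (op_cat \<C>) Y L X = deflations \<C> X L Y"
  using hom_finite_extriangulated.inflations_iff[OF hom_finite_op, unfolded op_unfold, of X _ Y L]
    deflations_iff
  by blast

lemma Aut_op: "Aut (op_cat \<C>) X = Aut \<C> X"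
  by (simp add: Aut_def)

lemma inflations_subset: "Y \<in> Ob \<C> \<Longrightarrow> inflations \<C> X L Y \<subseteq> {f. f \<Colon> X \<rightarrow> L}"
  using inflations_iff triangleD(1) by blast

lemma deflations_subset: "X \<in> Ob \<C> \<Longrightarrow> deflations \<C> X L Y \<subseteq> {f. f \<Colon> L \<rightarrow> Y}"
  using deflations_iff triangleD(2) by blast

lemma finite_mor: "finite {f. f \<Colon> X \<rightarrow> Y}"
proof (cases "X \<in> Ob \<C> \<and> Y \<in> Ob \<C>")
  case True
  then have "{f. f \<Colon> X \<rightarrow> Y} = Homset \<C> X Y" by (auto simp: mor_def)
  then show ?thesis using finite_Homset True by simp
next
  case False
  then have "{f. f \<Colon> X \<rightarrow> Y} = {}" by (auto simp: mor_def)
  then show ?thesis by (simp only: finite.emptyI)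
qed

lemma finite_inflations: "Y \<in> Ob \<C> \<Longrightarrow> finite (inflations \<C> X L Y)"
  using finite_subset[OF inflations_subset finite_mor] by blast

lemma finite_deflations: "X \<in> Ob \<C> \<Longrightarrow> finite (deflations \<C> X L Y)"
  using finite_subset[OF deflations_subset finite_mor] by blast

lemma Aut_subset: "X \<in> Ob \<C> \<Longrightarrow> Aut \<C> X \<subseteq> {f. f \<Colon> X \<rightarrow> X}"
  using iso_mor by (auto simp: Aut_def)

lemma finite_Aut: "X \<in> Ob \<C> \<Longrightarrow> finite (Aut \<C> X)"
  using finite_subset[OF Aut_subset finite_mor] by blast

lemma card_Aut_pos: "X \<in> Ob \<C> \<Longrightarrow> card (Aut \<C> X) > 0"
  using iso_id[of X] finite_Aut[of X] by (auto simp: card_gt_0_iff Aut_def)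

section \<open>Weighted count of triangles with given end terms\<close>

definition conflations :: "'o \<Rightarrow> 'o \<Rightarrow> 'o \<Rightarrow> ('m \<times> 'm \<times> 'e) set"
  where "conflations X L Y = {(f, g, \<delta>). triangle \<C> X f L g Y \<delta>}"

definition cone_ghosts :: "'o \<Rightarrow> 'o \<Rightarrow> 'o \<Rightarrow> 'm \<Rightarrow> 'e \<Rightarrow> 'm set"
  where "cone_ghosts X L Y g \<delta> = {u. u \<Colon> Y \<rightarrow> Y \<and> u \<cdot> g = \<zero>\<^bsub>H L Y\<^esub> \<and> \<delta> \<triangleleft> u = \<zero>\<^bsub>E Y X\<^esub>}"

lemma finite_conflations: "finite (conflations X L Y)"
proof (cases "X \<in> Ob \<C> \<and> L \<in> Ob \<C> \<and> Y \<in> Ob \<C>")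
  case True
  have "conflations X L Y \<subseteq> Homset \<C> X L \<times> Homset \<C> L Y \<times> Extset \<C> Y X"
    unfolding conflations_def using triangleD(1,2,3) by (auto simp: mor_def exten_def)
  then show ?thesis using True finite_Homset finite_Extset by (meson finite_SigmaI finite_subset)
next
  case False
  then have "conflations X L Y = {}" unfolding conflations_def using triangleD(4,5,6) by auto
  then show ?thesis by simp
qed

text \<open>\<open>Aut Y\<close> acts transitively on the completions of an inflation to a triangle, and the stabilizer of \<open>(g, \<delta>)\<close>
  is \<open>1 + cone_ghosts\<close>.\<close>

lemma card_transporter:
  assumes t0: "triangle \<C> X f L g\<^sub>0 Y \<delta>\<^sub>0" and t: "triangle \<C> X f L g Y \<delta>"
  shows "card {c \<in> Aut \<C> Y. c \<cdot> g\<^sub>0 = g \<and> \<delta> \<triangleleft> c = \<delta>\<^sub>0} = card (cone_ghosts X L Y g \<delta>)"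
proof -
  note d0 = triangleD[OF t0] note d = triangleD[OF t]
  obtain c where c: "c \<in> isos \<C> Y Y" "c \<cdot> g\<^sub>0 = g" "\<delta> \<triangleleft> c = \<delta>\<^sub>0" using cone_unique[OF t0 t] .
  obtain c' where c': "c' \<Colon> Y \<rightarrow> Y" "c' \<cdot> c = Id \<C> Y" "c \<cdot> c' = Id \<C> Y" "c \<Colon> Y \<rightarrow> Y" "c' \<in> isos \<C> Y Y"
    using isoD[OF c(1) d(6,6)] by metis
  have cg: "c' \<cdot> g = g\<^sub>0" using assoc[OF d0(2) c'(4,1)] c(2) c'(2) d0(2) by simp
  have dc: "\<delta>\<^sub>0 \<triangleleft> c' = \<delta>" using pull_pull[OF c'(4,1) d(3)] c(3) c'(3) d(3) by simp
  have i: "Id \<C> Y \<Colon> Y \<rightarrow> Y" using d by auto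
  let ?n = "\<ominus>\<^bsub>H Y Y\<^esub> Id \<C> Y"
  have n: "?n \<Colon> Y \<rightarrow> Y" using i by auto
  have "bij_betw (\<lambda>u. (Id \<C> Y \<oplus>\<^bsub>H Y Y\<^esub> u) \<cdot> c) (cone_ghosts X L Y g \<delta>)
    {c \<in> Aut \<C> Y. c \<cdot> g\<^sub>0 = g \<and> \<delta> \<triangleleft> c = \<delta>\<^sub>0}"
  proof (rule bij_betwI[where g = "\<lambda>b. ?n \<oplus>\<^bsub>H Y Y\<^esub> (b \<cdot> c')"]; (rule Pi_I)?)
    fix u assume "u \<in> cone_ghosts X L Y g \<delta>"
    then have u: "u \<Colon> Y \<rightarrow> Y" "u \<cdot> g = \<zero>\<^bsub>H L Y\<^esub>" "\<delta> \<triangleleft> u = \<zero>\<^bsub>E Y X\<^esub>" by (auto simp: cone_ghosts_def)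
    have v: "Id \<C> Y \<oplus>\<^bsub>H Y Y\<^esub> u \<Colon> Y \<rightarrow> Y" using i u by blast
    have "Id \<C> Y \<oplus>\<^bsub>H Y Y\<^esub> u \<in> isos \<C> Y Y" using cone_endo_iso[OF t u] .
    then have "(Id \<C> Y \<oplus>\<^bsub>H Y Y\<^esub> u) \<cdot> c \<in> Aut \<C> Y" unfolding Aut_def using iso_cmp[OF c(1)] d by blast
    moreover have "((Id \<C> Y \<oplus>\<^bsub>H Y Y\<^esub> u) \<cdot> c) \<cdot> g\<^sub>0 = g"
      using assoc[OF d0(2) c'(4) v] c(2) cmp_add_left(1)[OF i u(1) d(2)] u(2) d by simp
    moreover have "\<delta> \<triangleleft> ((Id \<C> Y \<oplus>\<^bsub>H Y Y\<^esub> u) \<cdot> c) = \<delta>\<^sub>0"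
      using pull_pull[OF v c'(4) d(3)] pull_mor_linear(1)[OF i u(1) d(3)] u(3) d(3) c(3) by simp
    ultimately show "(Id \<C> Y \<oplus>\<^bsub>H Y Y\<^esub> u) \<cdot> c \<in> {c \<in> Aut \<C> Y. c \<cdot> g\<^sub>0 = g \<and> \<delta> \<triangleleft> c = \<delta>\<^sub>0}" by blast
    have "((Id \<C> Y \<oplus>\<^bsub>H Y Y\<^esub> u) \<cdot> c) \<cdot> c' = Id \<C> Y \<oplus>\<^bsub>H Y Y\<^esub> u" using assoc[OF c'(1,4) v] c'(3) v by simp
    then show "?n \<oplus>\<^bsub>H Y Y\<^esub> ((Id \<C> Y \<oplus>\<^bsub>H Y Y\<^esub> u) \<cdot> c \<cdot> c') = u" using i u(1) by simp
  next
    fix b assume "b \<in> {c \<in> Aut \<C> Y. c \<cdot> g\<^sub>0 = g \<and> \<delta> \<triangleleft> c = \<delta>\<^sub>0}"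
    then have b: "b \<Colon> Y \<rightarrow> Y" "b \<cdot> g\<^sub>0 = g" "\<delta> \<triangleleft> b = \<delta>\<^sub>0" using Aut_subset d by auto
    have bc: "b \<cdot> c' \<Colon> Y \<rightarrow> Y" using b c' by blast
    have "(b \<cdot> c') \<cdot> g = g" using assoc[OF d(2) c'(1) b(1)] cg b(2) by simp
    then have 1: "(?n \<oplus>\<^bsub>H Y Y\<^esub> (b \<cdot> c')) \<cdot> g = \<zero>\<^bsub>H L Y\<^esub>"
      using cmp_add_left(1)[OF n bc d(2)] cmp_add_left(3)[OF i i d(2)] d by simp
    have "\<delta> \<triangleleft> (b \<cdot> c') = \<delta>" using pull_pull[OF b(1) c'(1) d(3)] b(3) dc by simp
    then have "\<delta> \<triangleleft> (?n \<oplus>\<^bsub>H Y Y\<^esub> (b \<cdot> c')) = \<zero>\<^bsub>E Y X\<^esub>"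
      using pull_mor_linear(1)[OF n bc d(3)] pull_mor_linear(3)[OF i i d(3)] d(3) by simp
    then show "?n \<oplus>\<^bsub>H Y Y\<^esub> (b \<cdot> c') \<in> cone_ghosts X L Y g \<delta>" using 1 mor_add[OF n bc]
      by (auto simp: cone_ghosts_def)
    have "Id \<C> Y \<oplus>\<^bsub>H Y Y\<^esub> (?n \<oplus>\<^bsub>H Y Y\<^esub> (b \<cdot> c')) = b \<cdot> c'" using hom_cancel_neg(2)[OF i bc] .
    then show "(Id \<C> Y \<oplus>\<^bsub>H Y Y\<^esub> (?n \<oplus>\<^bsub>H Y Y\<^esub> (b \<cdot> c'))) \<cdot> c = b"
      using assoc[OF c'(4,1) b(1)] c'(2) b(1) by simp
  qed
  then show ?thesis by (rule bij_betw_same_card[symmetric])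
qed

text \<open>\<open>Aut Y\<close> is partitioned according to the completion that an automorphism
  reaches from \<open>(g\<^sub>0, \<delta>\<^sub>0)\<close>. By \<open>card_transporter\<close> each
  block has as many elements as there are ghosts of that completion.\<close>

lemma sum_cone_ghosts_fixed_inflation:
  assumes t0: "triangle \<C> X f L g\<^sub>0 Y \<delta>\<^sub>0"
  shows "(\<Sum>(g, \<delta>) | triangle \<C> X f L g Y \<delta>. card (cone_ghosts X L Y g \<delta>)) = card (Aut \<C> Y)"
proof -
  note d0 = triangleD[OF t0]
  let ?S = "{(g, \<delta>). triangle \<C> X f L g Y \<delta>}"
  let ?T = "\<lambda>(g, \<delta>). {c \<in> Aut \<C> Y. c \<cdot> g\<^sub>0 = g \<and> \<delta> \<triangleleft> c = \<delta>\<^sub>0}"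
  have fin: "finite ?S"
  proof -
    have "?S \<subseteq> snd ` conflations X L Y" by (force simp: conflations_def image_iff)
    then show ?thesis using finite_conflations finite_subset by blast
  qed
  have U: "(\<Union>w\<in>?S. ?T w) = Aut \<C> Y"
  proof (intro equalityI subsetI)
    fix c assume c: "c \<in> Aut \<C> Y"
    then have ci: "c \<in> isos \<C> Y Y" by (simp add: Aut_def)
    obtain c' where c': "c' \<Colon> Y \<rightarrow> Y" "c' \<cdot> c = Id \<C> Y" "c \<cdot> c' = Id \<C> Y" "c \<Colon> Y \<rightarrow> Y"
      using isoD[OF ci d0(6,6)] by metis
    have i: "Id \<C> X \<cdot> Id \<C> X = Id \<C> X" using id_cmp[OF mor_id[OF d0(4)]] .
    have "triangle \<C> X f L (c \<cdot> g\<^sub>0) Y (\<delta>\<^sub>0 \<triangleleft> c')"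
      using triangle_transport[OF t0 iso_id[OF d0(4)] d0(4) mor_id[OF d0(4)] i i ci d0(6) c'(1-3)]
        d0 exten_pull[OF c'(1) d0(3)] by simp
    moreover have "\<delta>\<^sub>0 \<triangleleft> c' \<triangleleft> c = \<delta>\<^sub>0" using pull_pull[OF c'(1,4) d0(3)] c'(2) d0(3) by simp
    ultimately show "c \<in> (\<Union>w\<in>?S. ?T w)" using c by auto
  qed auto
  have disj: "?T v \<inter> ?T w = {}" if vw: "v \<in> ?S" "w \<in> ?S" "v \<noteq> w" for v w
  proof (rule ccontr)
    assume "?T v \<inter> ?T w \<noteq> {}"
    then obtain c where c: "c \<in> ?T v" "c \<in> ?T w" by blast
    obtain g \<delta> where v: "v = (g, \<delta>)" by (cases v)
    obtain g' \<delta>' where w: "w = (g', \<delta>')" by (cases w)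
    have cc: "c \<in> isos \<C> Y Y" "c \<cdot> g\<^sub>0 = g" "c \<cdot> g\<^sub>0 = g'" "\<delta> \<triangleleft> c = \<delta>' \<triangleleft> c" using c v w
      by (auto simp: Aut_def)
    obtain c' where c': "c' \<Colon> Y \<rightarrow> Y" "c \<cdot> c' = Id \<C> Y" "c \<Colon> Y \<rightarrow> Y" using isoD[OF cc(1) d0(6,6)] by metis
    have e: "exten \<delta> Y X" "exten \<delta>' Y X" using vw v w triangleD(3) by auto
    have "\<delta> = \<delta> \<triangleleft> c \<triangleleft> c'" using pull_pull[OF c'(3,1) e(1)] c'(2) e(1) by simp
    also have "\<dots> = \<delta>' \<triangleleft> c \<triangleleft> c'" using cc(4) by simp
    also have "\<dots> = \<delta>'" using pull_pull[OF c'(3,1) e(2)] c'(2) e(2) by simp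
    finally show False using vw(3) v w cc by simp
  qed
  have "card (\<Union>w\<in>?S. ?T w) = (\<Sum>w\<in>?S. card (?T w))"
  proof (rule card_UN_disjoint[OF fin])
    show "\<forall>w\<in>?S. finite (?T w)" using finite_Aut[OF d0(6)] by auto
    show "\<forall>v\<in>?S. \<forall>w\<in>?S. v \<noteq> w \<longrightarrow> ?T v \<inter> ?T w = {}" using disj by blast
  qed
  also have "\<dots> = (\<Sum>(g, \<delta>)\<in>?S. card (cone_ghosts X L Y g \<delta>))"
    by (rule sum.cong[OF refl]) (use card_transporter[OF t0] in auto)
  finally show ?thesis unfolding U by simp
qed

text \<open>The stabilizers depend on the triangle, so inflations are not counted as a plain
  quotient of the set of triangles but through a sum weighted by stabilizer orders.\<close>

lemma sum_cone_ghosts: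
  assumes Y: "Y \<in> Ob \<C>"
  shows "(\<Sum>(f, g, \<delta>)\<in>conflations X L Y. card (cone_ghosts X L Y g \<delta>))
    = card (Aut \<C> Y) * card (inflations \<C> X L Y)"
proof -
  let ?W = "conflations X L Y"
  have im: "fst ` ?W = inflations \<C> X L Y"
    using inflations_iff[OF Y] by (force simp: conflations_def image_iff)
  have "(\<Sum>(f, g, \<delta>)\<in>?W. card (cone_ghosts X L Y g \<delta>))
    = (\<Sum>f\<in>fst ` ?W. \<Sum>w\<in>{w\<in>?W. fst w = f}. case w of (f, g, \<delta>) \<Rightarrow> card (cone_ghosts X L Y g \<delta>))"
    by (rule sum.image_gen[OF finite_conflations])
  also have "\<dots> = (\<Sum>f\<in>fst ` ?W. card (Aut \<C> Y))"
  proof (rule sum.cong[OF refl])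
    fix f assume "f \<in> fst ` ?W"
    then obtain g\<^sub>0 \<delta>\<^sub>0 where t0: "triangle \<C> X f L g\<^sub>0 Y \<delta>\<^sub>0" by (auto simp: conflations_def)
    have "(\<Sum>w\<in>{w\<in>?W. fst w = f}. case w of (f, g, \<delta>) \<Rightarrow> card (cone_ghosts X L Y g \<delta>))
      = (\<Sum>(g, \<delta>) | triangle \<C> X f L g Y \<delta>. card (cone_ghosts X L Y g \<delta>))"
    proof -
      have "{w \<in> ?W. fst w = f} = Pair f ` {(g, \<delta>). triangle \<C> X f L g Y \<delta>}"
        by (auto simp: conflations_def)
      moreover have "inj_on (Pair f) {(g, \<delta>). triangle \<C> X f L g Y \<delta>}" by (simp add: inj_on_def)
      ultimately show ?thesis by (simp add: sum.reindex)
    qed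
    then show "(\<Sum>w\<in>{w\<in>?W. fst w = f}. case w of (f, g, \<delta>) \<Rightarrow> card (cone_ghosts X L Y g \<delta>)) = card (Aut \<C> Y)"
      using sum_cone_ghosts_fixed_inflation[OF t0] by simp
  qed
  finally show ?thesis unfolding im by simp
qed

text \<open>Both sides consist of the extensions induced by morphisms of triangles
  \<open>(u, 0, v)\<close> with zero in the middle: (ET3) completes \<open>u\<close> by some
  \<open>v\<close>, and its dual completes \<open>v\<close> by some \<open>u\<close>.\<close>

lemma ghost_images_eq:
  assumes t: "triangle \<C> A x B y C \<delta>" and t': "triangle \<C> A' x' B' y' C' \<delta>'"
  shows "(\<lambda>u. u \<triangleright> \<delta>) ` {u. u \<Colon> A \<rightarrow> A' \<and> x' \<cdot> u = \<zero>\<^bsub>H A B'\<^esub>}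
    = (\<lambda>v. \<delta>' \<triangleleft> v) ` {v. v \<Colon> C \<rightarrow> C' \<and> v \<cdot> y = \<zero>\<^bsub>H B C'\<^esub>}"
proof -
  note d = triangleD[OF t] note d' = triangleD[OF t']
  have z: "\<zero>\<^bsub>H B B'\<^esub> \<Colon> B \<rightarrow> B'" using d d' by auto
  have zx: "\<zero>\<^bsub>H B B'\<^esub> \<cdot> x = \<zero>\<^bsub>H A B'\<^esub>" "y' \<cdot> \<zero>\<^bsub>H B B'\<^esub> = \<zero>\<^bsub>H B C'\<^esub>"
    using cmp_zero_left[OF d(1)] cmp_zero_right[OF d'(2)] d d' by auto
  show ?thesis
  proof (intro equalityI subsetI)
    fix e assume "e \<in> (\<lambda>u. u \<triangleright> \<delta>) ` {u. u \<Colon> A \<rightarrow> A' \<and> x' \<cdot> u = \<zero>\<^bsub>H A B'\<^esub>}"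
    then obtain u where u: "u \<Colon> A \<rightarrow> A'" "x' \<cdot> u = \<zero>\<^bsub>H A B'\<^esub>" "e = u \<triangleright> \<delta>" by blast
    obtain v where "v \<Colon> C \<rightarrow> C'" "v \<cdot> y = y' \<cdot> \<zero>\<^bsub>H B B'\<^esub>" "u \<triangleright> \<delta> = \<delta>' \<triangleleft> v"
      using ET3'[OF t t' u(1) z] zx u by metis
    then show "e \<in> (\<lambda>v. \<delta>' \<triangleleft> v) ` {v. v \<Colon> C \<rightarrow> C' \<and> v \<cdot> y = \<zero>\<^bsub>H B C'\<^esub>}" using zx u by auto
  next
    fix e assume "e \<in> (\<lambda>v. \<delta>' \<triangleleft> v) ` {v. v \<Colon> C \<rightarrow> C' \<and> v \<cdot> y = \<zero>\<^bsub>H B C'\<^esub>}"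
    then obtain v where v: "v \<Colon> C \<rightarrow> C'" "v \<cdot> y = \<zero>\<^bsub>H B C'\<^esub>" "e = \<delta>' \<triangleleft> v" by blast
    obtain u where "u \<Colon> A \<rightarrow> A'" "\<zero>\<^bsub>H B B'\<^esub> \<cdot> x = x' \<cdot> u" "u \<triangleright> \<delta> = \<delta>' \<triangleleft> v"
      using ET3_op'[OF t t' z v(1)] zx v by metis
    then have "u \<in> {u. u \<Colon> A \<rightarrow> A' \<and> x' \<cdot> u = \<zero>\<^bsub>H A B'\<^esub>}" "e = u \<triangleright> \<delta>" using zx(1) v by simp_all
    then show "e \<in> (\<lambda>u. u \<triangleright> \<delta>) ` {u. u \<Colon> A \<rightarrow> A' \<and> x' \<cdot> u = \<zero>\<^bsub>H A B'\<^esub>}" by (rule rev_image_eqI)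
  qed
qed

lemma card_left_ghosts:
  assumes d: "exten \<delta> C A" and x: "x' \<Colon> A' \<rightarrow> B'"
  shows "card {u. u \<Colon> A \<rightarrow> A' \<and> x' \<cdot> u = \<zero>\<^bsub>H A B'\<^esub>} =
    card {u. u \<Colon> A \<rightarrow> A' \<and> x' \<cdot> u = \<zero>\<^bsub>H A B'\<^esub> \<and> u \<triangleright> \<delta> = \<zero>\<^bsub>E C A'\<^esub>} *
    card ((\<lambda>u. u \<triangleright> \<delta>) ` {u. u \<Colon> A \<rightarrow> A' \<and> x' \<cdot> u = \<zero>\<^bsub>H A B'\<^esub>})"
proof -
  let ?S = "{u. u \<Colon> A \<rightarrow> A' \<and> x' \<cdot> u = \<zero>\<^bsub>H A B'\<^esub>}"
  have ob: "A \<in> Ob \<C>" "A' \<in> Ob \<C>" "C \<in> Ob \<C>" "B' \<in> Ob \<C>" using d x by (auto dest: extenD morD)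
  note z = mor_zero[OF ob(1,4)]
  have "card ?S = card {u \<in> ?S. u \<triangleright> \<delta> = \<zero>\<^bsub>E C A'\<^esub>} * card ((\<lambda>u. u \<triangleright> \<delta>) ` ?S)"
  proof (rule card_kernel_image_subgroup[OF hom_group[OF ob(1,2)] ext_group[OF ob(3,2)]])
    show "?S \<subseteq> Homset \<C> A A'" using morD(3) by blast
    show "\<zero>\<^bsub>H A A'\<^esub> \<in> ?S" using mor_zero[OF ob(1,2)] cmp_zero_right[OF x ob(1)] by simp
    show "finite ?S" by (rule finite_subset[OF _ finite_mor[of A A']]) blast
    fix a assume a: "a \<in> ?S"
    show "\<ominus>\<^bsub>H A A'\<^esub> a \<in> ?S" using a cmp_add_right(3)[of a A A' a x' B'] x ob by auto
    show "a \<triangleright> \<delta> \<in> Extset \<C> C A'" using a d extenD(3) by blast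
    fix b assume b: "b \<in> ?S"
    show "a \<oplus>\<^bsub>H A A'\<^esub> b \<in> ?S" using a b cmp_add_right(1)[of a A A' b x' B'] x z by auto
    show "(a \<oplus>\<^bsub>H A A'\<^esub> b) \<triangleright> \<delta> = a \<triangleright> \<delta> \<oplus>\<^bsub>E C A'\<^esub> b \<triangleright> \<delta>" using a b push_mor_linear(1)[of a A A' b \<delta> C] d
      by blast
  qed
  also have "{u \<in> ?S. u \<triangleright> \<delta> = \<zero>\<^bsub>E C A'\<^esub>} = {u. u \<Colon> A \<rightarrow> A' \<and> x' \<cdot> u = \<zero>\<^bsub>H A B'\<^esub> \<and> u \<triangleright> \<delta> = \<zero>\<^bsub>E C A'\<^esub>}" by blast
  finally show ?thesis .
qed

lemmas card_right_ghosts = hom_finite_extriangulated.card_left_ghosts[OF hom_finite_op, unfolded op_unfold]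

definition cocone_ghosts :: "'o \<Rightarrow> 'o \<Rightarrow> 'o \<Rightarrow> 'm \<Rightarrow> 'e \<Rightarrow> 'm set"
  where "cocone_ghosts X L Y f \<delta> = {u. u \<Colon> X \<rightarrow> X \<and> f \<cdot> u = \<zero>\<^bsub>H X L\<^esub> \<and> u \<triangleright> \<delta> = \<zero>\<^bsub>E Y X\<^esub>}"

lemma sum_cocone_ghosts:
  assumes X: "X \<in> Ob \<C>" and Y: "Y \<in> Ob \<C>"
  shows "(\<Sum>(f, g, \<delta>)\<in>conflations X L Y. card (cocone_ghosts X L Y f \<delta>))
    = card (Aut \<C> X) * card (deflations \<C> X L Y)"
proof -
  note cg = hom_finite_extriangulated.cone_ghosts_def[OF hom_finite_op]
    and cf = hom_finite_extriangulated.conflations_def[OF hom_finite_op]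
  have "(\<Sum>(f, g, \<delta>)\<in>conflations X L Y. card (cocone_ghosts X L Y f \<delta>))
    = (\<Sum>(g, f, \<delta>)\<in>hom_finite_extriangulated.conflations (op_cat \<C>) Y L X.
        card (hom_finite_extriangulated.cone_ghosts (op_cat \<C>) Y L X f \<delta>))"
    by (rule sum.reindex_bij_witness[where j = "\<lambda>(f, g, \<delta>). (g, f, \<delta>)" and i = "\<lambda>(f, g, \<delta>). (g, f, \<delta>)"])
      (auto simp: conflations_def cf cg cocone_ghosts_def op_unfold)
  also have "\<dots> = card (Aut \<C> X) * card (deflations \<C> X L Y)"
    using hom_finite_extriangulated.sum_cone_ghosts[OF hom_finite_op, of X Y L] X
    unfolding Aut_op inflations_op[OF X Y] by (simp add: op_cat_simps)
  finally show ?thesis .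
qed

section \<open>Octahedra\<close>

text \<open>The octahedron produces one completion \<open>e\<^sub>2\<close> of \<open>(f, 1)\<close> to a morphism of triangles that is a deflation with
  cocone \<open>Y\<close>. Any other completion is \<open>e\<^sub>2 + g w\<close> with \<open>g w h' = 0\<close>, and it equals \<open>e\<^sub>2 \<phi>\<close> for an automorphism
  \<open>\<phi>\<close>, obtained from \<open>1 + h' w\<close> by removing the non-nilpotent part of \<open>h' w\<close>.\<close>

lemma completion_deflation:
  assumes tl: "triangle \<C> L l M g Z \<delta>'" and th: "triangle \<C> X h M h' L' \<delta>''"
    and f: "l \<cdot> f = h" and e: "e \<Colon> L' \<rightarrow> Z" "e \<cdot> h' = g" and fe: "f \<triangleright> \<delta>'' = \<delta>' \<triangleleft> e"
    and tf: "triangle \<C> X f L f' Y \<delta>"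
  shows "\<exists>d \<epsilon>. triangle \<C> Y d L' e Z \<epsilon>"
proof -
  note dl = triangleD[OF tl] note dh = triangleD[OF th] note df = triangleD[OF tf]
  obtain N\<^sub>1 h\<^sub>1 h\<^sub>1' d e\<^sub>1 \<delta>\<^sub>1 where
    t1: "triangle \<C> X h\<^sub>1 M h\<^sub>1' N\<^sub>1 \<delta>\<^sub>1" and h1: "h\<^sub>1 = l \<cdot> f" and
    t2: "triangle \<C> Y d N\<^sub>1 e\<^sub>1 Z (f' \<triangleright> \<delta>')" and
    eq: "e\<^sub>1 \<cdot> h\<^sub>1' = g" "f \<triangleright> \<delta>\<^sub>1 = \<delta>' \<triangleleft> e\<^sub>1"
    using ET4[OF tf tl] by blast
  note d1 = triangleD[OF t1] note d2 = triangleD[OF t2]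
  have t1': "triangle \<C> X h M h\<^sub>1' N\<^sub>1 \<delta>\<^sub>1" using t1 h1 f by simp
  obtain c where c: "c \<in> isos \<C> L' N\<^sub>1" "c \<cdot> h' = h\<^sub>1'" "\<delta>\<^sub>1 \<triangleleft> c = \<delta>''" using cone_unique[OF th t1'] .
  obtain c' where c': "c' \<Colon> N\<^sub>1 \<rightarrow> L'" "c' \<cdot> c = Id \<C> L'" "c \<cdot> c' = Id \<C> N\<^sub>1" "c' \<in> isos \<C> N\<^sub>1 L'"
    "c \<Colon> L' \<rightarrow> N\<^sub>1"
    using isoD[OF c(1) dh(6) d1(6)] by metis
  let ?e = "e\<^sub>1 \<cdot> c"
  have t3: "triangle \<C> Y (c' \<cdot> d) L' ?e Z (f' \<triangleright> \<delta>')"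
    using triangle_middle_iso[OF t2 c'(4) dh(6) c'(5) c'(3,2)] .
  note d3 = triangleD[OF t3]
  have eh: "?e \<cdot> h' = g" using assoc[OF dh(2) c'(5) d2(2)] c(2) eq(1) by simp
  have fe': "f \<triangleright> \<delta>'' = \<delta>' \<triangleleft> ?e"
    using pull_push[OF df(1) c'(5) d1(3)] pull_pull[OF d2(2) c'(5) dl(3)] c(3) eq(2) by simp
  \<comment> \<open>The difference of the two completions is zero on \<open>h'\<close> and pulls
    \<open>\<delta>'\<close> back to zero; the latter lets it lift along \<open>g\<close>.\<close>
  let ?n = "\<ominus>\<^bsub>H L' Z\<^esub> ?e"
  have n: "?n \<Colon> L' \<rightarrow> Z" using d3 by blast
  let ?v = "?n \<oplus>\<^bsub>H L' Z\<^esub> e"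
  have v: "?v \<Colon> L' \<rightarrow> Z" using n e by blast
  have gM: "g \<Colon> M \<rightarrow> Z" using dl by simp
  have vh: "?v \<cdot> h' = \<zero>\<^bsub>H M Z\<^esub>"
    using cmp_add_left(1)[OF n e(1) dh(2)] cmp_add_left(3)[OF d3(2,2) dh(2)] eh e(2) hom_add_neg(2)[OF gM]
      by simp
  have fd: "exten (\<delta>' \<triangleleft> e) L' L" using e dl by blast
  have "\<delta>' \<triangleleft> ?v = \<zero>\<^bsub>E L' L\<^esub>"
    using pull_mor_linear(1)[OF n e(1) dl(3)] pull_mor_linear(3)[OF d3(2,2) dl(3)] fe fe'
      ext_add_neg(2)[OF fd] by simp
  then obtain w where w: "w \<Colon> L' \<rightarrow> M" "g \<cdot> w = ?v" using lift_along_deflation[OF tl v] by blast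
  let ?r = "h' \<cdot> w"
  have r: "?r \<Colon> L' \<rightarrow> L'" using w dh by blast
  have er: "?e \<cdot> ?r = ?v" using assoc[OF w(1) dh(2) d3(2)] eh w(2) by simp
  have vr: "?v \<cdot> ?r = \<zero>\<^bsub>H L' Z\<^esub>" using assoc[OF w(1) dh(2) v] vh cmp_zero_left[OF w(1)] dl by simp
  interpret R: ring "end_ring L'" by (rule end_ring[OF dh(6)])
  have rR: "?r \<in> carrier (end_ring L')" using r by (simp add: mor_def)
  obtain N :: nat where N: "N \<ge> 1" "\<one>\<^bsub>end_ring L'\<^esub> \<oplus>\<^bsub>end_ring L'\<^esub>
      (?r \<oplus>\<^bsub>end_ring L'\<^esub> (\<ominus>\<^bsub>end_ring L'\<^esub> (?r [^]\<^bsub>end_ring L'\<^esub> Suc N))) \<in> Units (end_ring L')"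
    using R.unit_correction[OF _ rR] finite_Homset[OF dh(6,6)] by auto
  define s where "s = ?r [^]\<^bsub>end_ring L'\<^esub> Suc N"
  have s: "s \<Colon> L' \<rightarrow> L'" using R.nat_pow_closed[OF rR, of "Suc N"] dh(6)
    by (simp add: mor_iff s_def del: nat_pow_Suc)
  \<comment> \<open>Because \<open>N \<ge> 1\<close>, the power \<open>s\<close> contains the square
    of \<open>?r\<close>, and \<open>?e\<close> annihilates that square:
    \<open>?e \<cdot> ?r = ?v\<close> and \<open>?v \<cdot> ?r\<close> is zero since
    \<open>?v\<close> kills \<open>h'\<close>.\<close>
  have es: "?e \<cdot> s = \<zero>\<^bsub>H L' Z\<^esub>"
  proof -
    obtain k where k: "N = Suc k" using N(1) by (cases N) auto
    define q where "q = ?r [^]\<^bsub>end_ring L'\<^esub> k"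
    have q: "q \<Colon> L' \<rightarrow> L'" using R.nat_pow_closed[OF rR, of k] dh(6) by (simp add: mor_iff q_def)
    have "s = ?r [^]\<^bsub>end_ring L'\<^esub> (Suc (Suc 0) + k)" unfolding s_def k by simp
    also have "\<dots> = (?r [^]\<^bsub>end_ring L'\<^esub> Suc (Suc 0)) \<cdot> q" using R.nat_pow_mult[OF rR, of "Suc (Suc 0)" k]
      by (simp add: q_def)
    also have "?r [^]\<^bsub>end_ring L'\<^esub> Suc (Suc 0) = ?r \<cdot> ?r" using rR r by simp
    finally have sq: "s = (?r \<cdot> ?r) \<cdot> q" .
    have rr: "?r \<cdot> ?r \<Colon> L' \<rightarrow> L'" using r by blast
    have "?e \<cdot> (?r \<cdot> ?r) = \<zero>\<^bsub>H L' Z\<^esub>" using assoc[OF r r d3(2)] er vr by simp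
    then show ?thesis unfolding sq using assoc[OF q rr d3(2)] cmp_zero_left[OF q dl(6)] by simp
  qed
  let ?ns = "\<ominus>\<^bsub>H L' L'\<^esub> s"
  have ns: "?ns \<Colon> L' \<rightarrow> L'" using s by blast
  \<comment> \<open>\<open>1 + ?r\<close> already turns \<open>?e\<close> into \<open>e\<close>.
    Subtracting \<open>s\<close> does not affect the product with \<open>?e\<close>, but makes the
    endomorphism invertible.\<close>
  let ?p = "Id \<C> L' \<oplus>\<^bsub>H L' L'\<^esub> (?r \<oplus>\<^bsub>H L' L'\<^esub> ?ns)"
  have rn: "?r \<oplus>\<^bsub>H L' L'\<^esub> ?ns \<Colon> L' \<rightarrow> L'" using r ns by blast
  have i: "Id \<C> L' \<Colon> L' \<rightarrow> L'" using dh by auto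
  have p: "?p \<Colon> L' \<rightarrow> L'" using i rn by blast
  have "?p \<in> Units (end_ring L')" using N(2) unfolding s_def[symmetric] using end_ring_neg[OF s] by simp
  then have pi: "?p \<in> isos \<C> L' L'" using end_ring_units[OF dh(6)] by blast
  obtain p' where p': "p' \<Colon> L' \<rightarrow> L'" "p' \<cdot> ?p = Id \<C> L'" "?p \<cdot> p' = Id \<C> L'" "p' \<in> isos \<C> L' L'"
    using isoD[OF pi dh(6,6)] by metis
  have "?e \<cdot> ?p = e"
  proof -
    have "?e \<cdot> (?r \<oplus>\<^bsub>H L' L'\<^esub> ?ns) = ?v"
      using cmp_add_right(1)[OF r ns d3(2)] cmp_add_right(3)[OF s s d3(2)] er es v dh dl by simp
    then have "?e \<cdot> ?p = ?e \<oplus>\<^bsub>H L' Z\<^esub> ?v" using cmp_add_right(1)[OF i rn d3(2)] cmp_id[OF d3(2)] by simp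
    also have "\<dots> = e" using hom_cancel_neg(2)[OF d3(2) e(1)] .
    finally show ?thesis .
  qed
  then have "triangle \<C> Y (p' \<cdot> (c' \<cdot> d)) L' e Z (f' \<triangleright> \<delta>')"
    using triangle_middle_iso[OF t3 p'(4) dh(6) p p'(3,2)] by simp
  then show ?thesis by blast
qed

lemmas completion_inflation =
  hom_finite_extriangulated.completion_deflation[OF hom_finite_op, unfolded op_unfold]

section \<open>Counting completions to morphisms of triangles\<close>

lemma card_coset:
  assumes h0: "x\<^sub>0 \<Colon> A \<rightarrow> B" "P x\<^sub>0"
    and P: "\<And>x. x \<Colon> A \<rightarrow> B \<Longrightarrow> P x \<longleftrightarrow> Q ((\<ominus>\<^bsub>H A B\<^esub> x\<^sub>0) \<oplus>\<^bsub>H A B\<^esub> x)"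
  shows "card {x. x \<Colon> A \<rightarrow> B \<and> P x} = card {u. u \<Colon> A \<rightarrow> B \<and> Q u}"
proof -
  have n: "\<ominus>\<^bsub>H A B\<^esub> x\<^sub>0 \<Colon> A \<rightarrow> B" using h0 by blast
  have "bij_betw (\<lambda>x. (\<ominus>\<^bsub>H A B\<^esub> x\<^sub>0) \<oplus>\<^bsub>H A B\<^esub> x) {x. x \<Colon> A \<rightarrow> B \<and> P x} {u. u \<Colon> A \<rightarrow> B \<and> Q u}"
  proof (rule bij_betwI[where g = "\<lambda>u. x\<^sub>0 \<oplus>\<^bsub>H A B\<^esub> u"]; (rule Pi_I)?)
    fix x assume x: "x \<in> {x. x \<Colon> A \<rightarrow> B \<and> P x}"
    then show "(\<ominus>\<^bsub>H A B\<^esub> x\<^sub>0) \<oplus>\<^bsub>H A B\<^esub> x \<in> {u. u \<Colon> A \<rightarrow> B \<and> Q u}" using P n by auto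
    show "x\<^sub>0 \<oplus>\<^bsub>H A B\<^esub> ((\<ominus>\<^bsub>H A B\<^esub> x\<^sub>0) \<oplus>\<^bsub>H A B\<^esub> x) = x" using hom_cancel_neg(2)[OF h0(1)] x by blast
  next
    fix u assume u: "u \<in> {u. u \<Colon> A \<rightarrow> B \<and> Q u}"
    then have c: "(\<ominus>\<^bsub>H A B\<^esub> x\<^sub>0) \<oplus>\<^bsub>H A B\<^esub> (x\<^sub>0 \<oplus>\<^bsub>H A B\<^esub> u) = u" using hom_cancel_neg(1)[OF h0(1)] by blast
    have m: "x\<^sub>0 \<oplus>\<^bsub>H A B\<^esub> u \<Colon> A \<rightarrow> B" using mor_add[OF h0(1)] u by blast
    show "x\<^sub>0 \<oplus>\<^bsub>H A B\<^esub> u \<in> {x. x \<Colon> A \<rightarrow> B \<and> P x}" using P[OF m] c u m by simp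
    show "(\<ominus>\<^bsub>H A B\<^esub> x\<^sub>0) \<oplus>\<^bsub>H A B\<^esub> (x\<^sub>0 \<oplus>\<^bsub>H A B\<^esub> u) = u" by (rule c)
  qed
  then show ?thesis by (rule bij_betw_same_card)
qed

definition completions :: "'o \<Rightarrow> 'o \<Rightarrow> 'm \<Rightarrow> 'm \<Rightarrow> 'e \<Rightarrow> 'e \<Rightarrow> 'm \<Rightarrow> 'm set"
  where "completions L' Z h' g \<delta>'' \<delta>' f = {e. e \<Colon> L' \<rightarrow> Z \<and> e \<cdot> h' = g \<and> f \<triangleright> \<delta>'' = \<delta>' \<triangleleft> e}"

text \<open>(ET3) provides one filler, and the others differ from it by morphisms that vanish on
  \<open>h'\<close> and pull \<open>\<delta>'\<close> back to zero. The count is therefore the same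
  for every \<open>f\<close>.\<close>

lemma card_completions:
  assumes tl: "triangle \<C> L l M g Z \<delta>'" and th: "triangle \<C> X h M h' L' \<delta>''"
    and f: "f \<Colon> X \<rightarrow> L" "l \<cdot> f = h"
  shows "card (completions L' Z h' g \<delta>'' \<delta>' f)
    = card {v. v \<Colon> L' \<rightarrow> Z \<and> v \<cdot> h' = \<zero>\<^bsub>H M Z\<^esub> \<and> \<delta>' \<triangleleft> v = \<zero>\<^bsub>E L' L\<^esub>}"
proof -
  note dl = triangleD[OF tl] note dh = triangleD[OF th]
  have "Id \<C> M \<cdot> h = l \<cdot> f" using dh f by simp
  then obtain e where "e \<Colon> L' \<rightarrow> Z" "e \<cdot> h' = g \<cdot> Id \<C> M" "f \<triangleright> \<delta>'' = \<delta>' \<triangleleft> e"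
    using ET3'[OF th tl f(1) mor_id[OF dh(5)]] by blast
  then have e: "e \<Colon> L' \<rightarrow> Z" "e \<cdot> h' = g" "f \<triangleright> \<delta>'' = \<delta>' \<triangleleft> e" using dl by simp_all
  have n: "\<ominus>\<^bsub>H L' Z\<^esub> e \<Colon> L' \<rightarrow> Z" using e by blast
  have gM: "g \<Colon> M \<rightarrow> Z" using dl by simp
  show ?thesis unfolding completions_def
  proof (rule card_coset[OF e(1)])
    show "e \<cdot> h' = g \<and> f \<triangleright> \<delta>'' = \<delta>' \<triangleleft> e" using e by blast
    fix x assume x: "x \<Colon> L' \<rightarrow> Z"
    let ?v = "(\<ominus>\<^bsub>H L' Z\<^esub> e) \<oplus>\<^bsub>H L' Z\<^esub> x"
    have 1: "?v \<cdot> h' = (\<ominus>\<^bsub>H M Z\<^esub> g) \<oplus>\<^bsub>H M Z\<^esub> (x \<cdot> h')"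
      using cmp_add_left(1)[OF n x dh(2)] cmp_add_left(3)[OF e(1,1) dh(2)] e(2) by simp
    have xh: "x \<cdot> h' \<Colon> M \<rightarrow> Z" using x dh by blast
    have a: "x \<cdot> h' = g \<longleftrightarrow> ?v \<cdot> h' = \<zero>\<^bsub>H M Z\<^esub>"
      unfolding 1 using hom_add_neg(2)[OF gM] hom_cancel_neg(2)[OF gM xh] gM by auto
    have 2: "\<delta>' \<triangleleft> ?v = (\<ominus>\<^bsub>E L' L\<^esub> (\<delta>' \<triangleleft> e)) \<oplus>\<^bsub>E L' L\<^esub> (\<delta>' \<triangleleft> x)"
      using pull_mor_linear(1)[OF n x dl(3)] pull_mor_linear(3)[OF e(1,1) dl(3)] by simp
    have ex: "exten (\<delta>' \<triangleleft> e) L' L" "exten (\<delta>' \<triangleleft> x) L' L" using e x dl by blast+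
    have b: "f \<triangleright> \<delta>'' = \<delta>' \<triangleleft> x \<longleftrightarrow> \<delta>' \<triangleleft> ?v = \<zero>\<^bsub>E L' L\<^esub>"
      unfolding 2 e(3)
    proof
      assume "\<delta>' \<triangleleft> e = \<delta>' \<triangleleft> x"
      then show "(\<ominus>\<^bsub>E L' L\<^esub> (\<delta>' \<triangleleft> e)) \<oplus>\<^bsub>E L' L\<^esub> (\<delta>' \<triangleleft> x) = \<zero>\<^bsub>E L' L\<^esub>" using ext_add_neg(2)[OF ex(2)] by simp
    next
      assume "(\<ominus>\<^bsub>E L' L\<^esub> (\<delta>' \<triangleleft> e)) \<oplus>\<^bsub>E L' L\<^esub> (\<delta>' \<triangleleft> x) = \<zero>\<^bsub>E L' L\<^esub>"
      then show "\<delta>' \<triangleleft> e = \<delta>' \<triangleleft> x" using ext_add_neg_eq[OF ex(2,1)] ext_add_comm[OF exten_neg[OF ex(1)] ex(2)]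
        by simp
    qed
    show "(x \<cdot> h' = g \<and> f \<triangleright> \<delta>'' = \<delta>' \<triangleleft> x) = (?v \<cdot> h' = \<zero>\<^bsub>H M Z\<^esub> \<and> \<delta>' \<triangleleft> ?v = \<zero>\<^bsub>E L' L\<^esub>)"
      using a b by blast
  qed
qed

lemmas card_completions_op = hom_finite_extriangulated.card_completions[OF hom_finite_op,
    unfolded hom_finite_extriangulated.completions_def[OF hom_finite_op] op_unfold]

text \<open>Both sides count, up to the size of the same set of ghosts, the morphisms of triangles
  \<open>(f, 1, e) : (X \<rightarrow> M \<rightarrow> L') \<rightarrow> (L \<rightarrow> M \<rightarrow> Z)\<close>.\<close>

lemma card_octahedra:
  assumes tl: "triangle \<C> L l M g Z \<delta>'" and th: "triangle \<C> X h M h' L' \<delta>''" and Y: "Y \<in> Ob \<C>"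
  shows "card {f \<in> inflations \<C> X L Y. l \<cdot> f = h} * card {v. v \<Colon> L' \<rightarrow> Z \<and> v \<cdot> h' = \<zero>\<^bsub>H M Z\<^esub>}
    = card {e \<in> deflations \<C> Y L' Z. e \<cdot> h' = g} * card {u. u \<Colon> X \<rightarrow> L \<and> l \<cdot> u = \<zero>\<^bsub>H X M\<^esub>}"
proof -
  note dl = triangleD[OF tl] note dh = triangleD[OF th]
  let ?F = "{f \<in> inflations \<C> X L Y. l \<cdot> f = h}" and ?D = "{e \<in> deflations \<C> Y L' Z. e \<cdot> h' = g}"
  let ?R = "{(f, e). f \<in> ?F \<and> e \<in> ?D \<and> f \<triangleright> \<delta>'' = \<delta>' \<triangleleft> e}"
  let ?K1 = "{u. u \<Colon> X \<rightarrow> L \<and> l \<cdot> u = \<zero>\<^bsub>H X M\<^esub>}" and ?K2 = "{v. v \<Colon> L' \<rightarrow> Z \<and> v \<cdot> h' = \<zero>\<^bsub>H M Z\<^esub>}"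
  let ?K10 = "{u. u \<Colon> X \<rightarrow> L \<and> l \<cdot> u = \<zero>\<^bsub>H X M\<^esub> \<and> u \<triangleright> \<delta>'' = \<zero>\<^bsub>E L' L\<^esub>}"
    and ?K20 = "{v. v \<Colon> L' \<rightarrow> Z \<and> v \<cdot> h' = \<zero>\<^bsub>H M Z\<^esub> \<and> \<delta>' \<triangleleft> v = \<zero>\<^bsub>E L' L\<^esub>}"
  let ?J = "(\<lambda>u. u \<triangleright> \<delta>'') ` ?K1"
  \<comment> \<open>The two ghost groups \<open>?K1\<close> and \<open>?K2\<close> map onto the same
    set \<open>?J\<close> of extensions, with kernels \<open>?K10\<close> and \<open>?K20\<close>.
    So the ratios of group to kernel agree, which converts the two counts of \<open>?R\<close> into
    the claim.\<close>
  have J: "?J = (\<lambda>v. \<delta>' \<triangleleft> v) ` ?K2" using ghost_images_eq[OF th tl] .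
  have k1: "card ?K1 = card ?K10 * card ?J" using card_left_ghosts[OF dh(3) dl(1)] .
  have k2: "card ?K2 = card ?K20 * card ?J" unfolding J using card_right_ghosts[OF dl(3) dh(2)] .
  have fin: "finite ?F" "finite ?D" using finite_inflations[OF Y] finite_deflations[OF Y] by auto
  have Fm: "f \<Colon> X \<rightarrow> L" if "f \<in> ?F" for f using that inflations_subset[OF Y] by blast
  have Dm: "e \<Colon> L' \<rightarrow> Z" if "e \<in> ?D" for e using that deflations_subset[OF Y] by blast
  have "card ?R = card ?F * card ?K20"
  proof -
    \<comment> \<open>Being a deflation with cocone \<open>Y\<close> is automatic for a filler of
      such an \<open>f\<close> by \<open>completion_deflation\<close>, so the fibre over
      \<open>f\<close> is the full set of fillers.\<close>
    have "?R = Sigma ?F (\<lambda>f. completions L' Z h' g \<delta>'' \<delta>' f)"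
    proof (intro equalityI subrelI)
      fix f e assume "(f, e) \<in> ?R"
      then show "(f, e) \<in> Sigma ?F (\<lambda>f. completions L' Z h' g \<delta>'' \<delta>' f)"
        using Dm by (auto simp: completions_def)
    next
      fix f e assume fe: "(f, e) \<in> Sigma ?F (\<lambda>f. completions L' Z h' g \<delta>'' \<delta>' f)"
      then have f: "f \<in> ?F" and e: "e \<Colon> L' \<rightarrow> Z" "e \<cdot> h' = g" "f \<triangleright> \<delta>'' = \<delta>' \<triangleleft> e"
        by (auto simp: completions_def)
      obtain f' \<delta> where tf: "triangle \<C> X f L f' Y \<delta>" using f inflations_iff[OF Y] by blast
      have "e \<in> deflations \<C> Y L' Z"
        unfolding deflations_iff[OF Y] using completion_deflation[OF tl th _ e tf] f by blast
      then show "(f, e) \<in> ?R" using f e by blast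
    qed
    also have "card \<dots> = (\<Sum>f\<in>?F. card (completions L' Z h' g \<delta>'' \<delta>' f))"
    proof (rule card_SigmaI[OF fin(1)], rule ballI)
      fix f show "finite (completions L' Z h' g \<delta>'' \<delta>' f)"
        unfolding completions_def by (rule finite_subset[OF _ finite_mor[of L' Z]]) blast
    qed
    also have "\<dots> = (\<Sum>f\<in>?F. card ?K20)"
      by (rule sum.cong[OF refl], rule card_completions[OF tl th]) (use Fm in auto)
    finally show ?thesis by simp
  qed
  moreover have "card ?R = card ?D * card ?K10"
  proof -
    let ?C = "\<lambda>e. {f. f \<Colon> X \<rightarrow> L \<and> l \<cdot> f = h \<and> \<delta>' \<triangleleft> e = f \<triangleright> \<delta>''}"
    have "prod.swap ` ?R = Sigma ?D ?C"
    proof (intro equalityI subrelI)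
      fix e f assume "(e, f) \<in> prod.swap ` ?R"
      then show "(e, f) \<in> Sigma ?D ?C" using Fm by auto
    next
      fix e f assume fe: "(e, f) \<in> Sigma ?D ?C"
      then have e: "e \<in> ?D" and f: "f \<Colon> X \<rightarrow> L" "l \<cdot> f = h" "\<delta>' \<triangleleft> e = f \<triangleright> \<delta>''" by auto
      obtain d \<epsilon> where te: "triangle \<C> Y d L' e Z \<epsilon>" using e deflations_iff[OF Y] by blast
      have "f \<in> inflations \<C> X L Y"
        unfolding inflations_iff[OF Y] using completion_inflation[OF th tl _ f te] e by blast
      then have "(f, e) \<in> ?R" using f e by simp
      then show "(e, f) \<in> prod.swap ` ?R" by (rule rev_image_eqI) simp
    qed
    then have "card ?R = card (Sigma ?D ?C)" using card_image[of prod.swap ?R] by simp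
    also have "\<dots> = (\<Sum>e\<in>?D. card (?C e))"
    proof (rule card_SigmaI[OF fin(2)], rule ballI)
      fix e show "finite (?C e)" by (rule finite_subset[OF _ finite_mor[of X L]]) blast
    qed
    also have "\<dots> = (\<Sum>e\<in>?D. card ?K10)"
      by (rule sum.cong[OF refl], rule card_completions_op[OF th tl]) (use Dm in auto)
    finally show ?thesis by simp
  qed
  ultimately show ?thesis unfolding k1 k2 by (simp add: mult_ac)
qed

section \<open>Isomorphism invariance and sums over middle terms\<close>

lemma isomorphicE:
  assumes "isomorphic \<C> X Y"
  obtains f g where "f \<Colon> X \<rightarrow> Y" "g \<Colon> Y \<rightarrow> X" "g \<cdot> f = Id \<C> X" "f \<cdot> g = Id \<C> Y" "f \<in> isos \<C> X Y"
    "g \<in> isos \<C> Y X"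
    "X \<in> Ob \<C>" "Y \<in> Ob \<C>"
  using assms unfolding isomorphic_def by (metis all_not_in_conv isoD)

lemma isomorphic_refl: "X \<in> Ob \<C> \<Longrightarrow> isomorphic \<C> X X"
  using iso_id by (auto simp: isomorphic_def)

lemma isomorphic_trans: "\<lbrakk>isomorphic \<C> X Y; isomorphic \<C> Y Z\<rbrakk> \<Longrightarrow> isomorphic \<C> X Z"
  unfolding isomorphic_def by (metis all_not_in_conv iso_cmp)

lemma isomorphicI: "\<lbrakk>f \<in> isos \<C> X Y; X \<in> Ob \<C>; Y \<in> Ob \<C>\<rbrakk> \<Longrightarrow> isomorphic \<C> X Y"
  by (auto simp: isomorphic_def)

lemma iso_class_eq_iff: "X \<in> Ob \<C> \<Longrightarrow> iso_class \<C> X = iso_class \<C> Y \<longleftrightarrow> isomorphic \<C> X Y"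
  unfolding iso_class_def using isomorphic_refl isomorphic_sym isomorphic_trans by blast

lemma middle_isomorphic:
  assumes "triangle \<C> A x B y C \<delta>" "triangle \<C> A x' B' y' C \<delta>"
  shows "isomorphic \<C> B B'"
  using assms triangle_iff_equiv[OF assms(1)] triangleD(5)[OF assms(1)] triangleD(5)[OF assms(2)]
  by (auto simp: seq_equiv_def isomorphic_def)

lemma cone_isomorphic: "\<lbrakk>triangle \<C> A x B y C \<delta>; triangle \<C> A x B y' C' \<delta>'\<rbrakk> \<Longrightarrow> isomorphic \<C> C C'"
  by (metis cone_unique isomorphicI triangleD(6))

lemma card_deflations_le:
  assumes "isomorphic \<C> X X'" "isomorphic \<C> L L'" "isomorphic \<C> Y Y'"
  shows "card (deflations \<C> X L Y) \<le> card (deflations \<C> X' L' Y')"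
proof -
  obtain x x' where x: "x \<Colon> X \<rightarrow> X'" "x' \<Colon> X' \<rightarrow> X" "x' \<cdot> x = Id \<C> X" "x \<cdot> x' = Id \<C> X'" "x \<in> isos \<C> X X'"
    and X: "X \<in> Ob \<C>" "X' \<in> Ob \<C>"
    using isomorphicE[OF assms(1)] by metis
  obtain l l' where l: "l \<Colon> L \<rightarrow> L'" "l' \<Colon> L' \<rightarrow> L" "l' \<cdot> l = Id \<C> L" "l \<cdot> l' = Id \<C> L'" "l \<in> isos \<C> L L'"
    and L: "L \<in> Ob \<C>" "L' \<in> Ob \<C>"
    using isomorphicE[OF assms(2)] by metis
  obtain y y' where y: "y \<Colon> Y \<rightarrow> Y'" "y' \<Colon> Y' \<rightarrow> Y" "y' \<cdot> y = Id \<C> Y" "y \<cdot> y' = Id \<C> Y'" "y \<in> isos \<C> Y Y'"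
    and Y: "Y \<in> Ob \<C>" "Y' \<in> Ob \<C>"
    using isomorphicE[OF assms(3)] by metis
  show ?thesis
  proof (rule card_inj_on_le[where f = "\<lambda>g. y \<cdot> (g \<cdot> l')"])
    show "finite (deflations \<C> X' L' Y')" by (rule finite_deflations[OF X(2)])
    show "(\<lambda>g. y \<cdot> (g \<cdot> l')) ` deflations \<C> X L Y \<subseteq> deflations \<C> X' L' Y'"
    proof (rule image_subsetI)
      fix g assume "g \<in> deflations \<C> X L Y"
      then obtain f \<delta> where "triangle \<C> X f L g Y \<delta>" using deflations_iff[OF X(1)] by blast
      from triangle_transport[OF triangle_middle_iso[OF this l(5) L(2) l(2,3,4)] x(5) X(2) x(2,3,4) y(5) Y(2)
        y(2,3,4)]
      show "y \<cdot> (g \<cdot> l') \<in> deflations \<C> X' L' Y'" unfolding deflations_iff[OF X(2)] by blast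
    qed
    show "inj_on (\<lambda>g. y \<cdot> (g \<cdot> l')) (deflations \<C> X L Y)"
    proof (rule inj_on_inverseI[where g = "\<lambda>g. (y' \<cdot> g) \<cdot> l"])
      fix g assume "g \<in> deflations \<C> X L Y"
      then have g: "g \<Colon> L \<rightarrow> Y" using deflations_subset[OF X(1)] by blast
      have gl: "g \<cdot> l' \<Colon> L' \<rightarrow> Y" using g l by blast
      have "y' \<cdot> (y \<cdot> (g \<cdot> l')) = g \<cdot> l'" using assoc[OF gl y(1,2)] y(3) gl by simp
      then show "(y' \<cdot> (y \<cdot> (g \<cdot> l'))) \<cdot> l = g" using assoc[OF l(1,2) g] l(3) g by simp
    qed
  qed
qed

lemma card_deflations_iso:
  assumes "isomorphic \<C> X X'" "isomorphic \<C> L L'" "isomorphic \<C> Y Y'"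
  shows "card (deflations \<C> X L Y) = card (deflations \<C> X' L' Y')"
  using card_deflations_le[OF assms] card_deflations_le[OF assms[THEN isomorphic_sym]] by (rule order_antisym)

lemma isomorphic_op: "isomorphic (op_cat \<C>) X Y \<longleftrightarrow> isomorphic \<C> X Y"
  using isomorphic_sym by (auto simp: isomorphic_def)

lemma deflations_op: "\<lbrakk>X \<in> Ob \<C>; Y \<in> Ob \<C>\<rbrakk> \<Longrightarrow> deflations (op_cat \<C>) Y L X = inflations \<C> X L Y"
  using hom_finite_extriangulated.deflations_iff[OF hom_finite_op, unfolded op_unfold, of Y _ L X]
    inflations_iff
  by blast

lemma card_inflations_iso:
  assumes "isomorphic \<C> X X'" "isomorphic \<C> L L'" "isomorphic \<C> Y Y'"
  shows "card (inflations \<C> X L Y) = card (inflations \<C> X' L' Y')"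
proof -
  have ob: "X \<in> Ob \<C>" "X' \<in> Ob \<C>" "Y \<in> Ob \<C>" "Y' \<in> Ob \<C>" using assms by (auto simp: isomorphic_def)
  show ?thesis
    using hom_finite_extriangulated.card_deflations_iso[OF hom_finite_op, unfolded isomorphic_op,
      OF assms(3,2,1)]
    unfolding deflations_op[OF ob(1,3)] deflations_op[OF ob(2,4)] .
qed

lemma card_isos:
  assumes "isomorphic \<C> L Y"
  shows "card (isos \<C> L Y) = card (Aut \<C> Y)"
proof -
  obtain g g' where g: "g \<Colon> L \<rightarrow> Y" "g' \<Colon> Y \<rightarrow> L" "g' \<cdot> g = Id \<C> L" "g \<cdot> g' = Id \<C> Y" "g \<in> isos \<C> L Y"
    "g' \<in> isos \<C> Y L"
    and ob: "L \<in> Ob \<C>" "Y \<in> Ob \<C>" using isomorphicE[OF assms] by metis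
  have "bij_betw (\<lambda>h. h \<cdot> g') (isos \<C> L Y) (Aut \<C> Y)"
    unfolding Aut_def
  proof (rule bij_betwI[where g = "\<lambda>c. c \<cdot> g"]; (rule Pi_I)?)
    fix h assume h: "h \<in> isos \<C> L Y"
    show "h \<cdot> g' \<in> isos \<C> Y Y" using iso_cmp[OF g(6) h ob(2,1,2)] .
    show "h \<cdot> g' \<cdot> g = h" using assoc[OF g(1,2) iso_mor[OF h ob]] g(3) iso_mor[OF h ob] by simp
  next
    fix c assume c: "c \<in> isos \<C> Y Y"
    show "c \<cdot> g \<in> isos \<C> L Y" using iso_cmp[OF g(5) c ob(1,2,2)] .
    show "c \<cdot> g \<cdot> g' = c" using assoc[OF g(2,1) iso_mor[OF c ob(2,2)]] g(4) iso_mor[OF c ob(2,2)] by simp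
  qed
  then show ?thesis by (rule bij_betw_same_card)
qed

lemma card_Aut_iso: "isomorphic \<C> X Y \<Longrightarrow> card (Aut \<C> X) = card (Aut \<C> Y)"
proof -
  assume XY: "isomorphic \<C> X Y"
  then have ob: "X \<in> Ob \<C>" "Y \<in> Ob \<C>" by (auto simp: isomorphic_def)
  have "card (isos \<C> X Y) = card (isos (op_cat \<C>) Y X)" by simp
  also have "\<dots> = card (Aut \<C> X)"
    using hom_finite_extriangulated.card_isos[OF hom_finite_op, unfolded isomorphic_op Aut_op, of Y X]
      isomorphic_sym[OF XY] by simp
  finally show "card (Aut \<C> X) = card (Aut \<C> Y)" using card_isos[OF XY] by simp
qed

section \<open>Conflations with a zero end term\<close>

lemma triangle_iso:
  assumes g: "g \<in> isos \<C> L Y" and ob: "L \<in> Ob \<C>" "Y \<in> Ob \<C>" and Z: "zero_object \<C> Z"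
  shows "\<exists>x \<delta>. triangle \<C> Z x L g Y \<delta>"
proof -
  note z = zero_objectD(1)[OF Z]
  obtain g' where g': "g' \<Colon> Y \<rightarrow> L" "g' \<cdot> g = Id \<C> L" "g \<cdot> g' = Id \<C> Y" "g \<Colon> L \<rightarrow> Y" using isoD[OF g ob]
    by metis
  have i: "Id \<C> Z \<cdot> Id \<C> Z = Id \<C> Z" using id_cmp[OF mor_id[OF z]] .
  from triangle_transport[OF triangle_id_right[OF Z ob(1)] iso_id[OF z] z mor_id[OF z] i i g ob(2) g'(1-3)]
  show ?thesis using cmp_id[OF g'(4)] by auto
qed

text \<open>With zero cocone the extension vanishes, so \<open>g\<close> has a section
  \<open>s\<close>. The difference of \<open>s \<cdot> g\<close> and the identity is killed by
  \<open>g\<close>, hence factors through a zero object and is zero.\<close>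

lemma deflations_zero:
  assumes Z: "zero_object \<C> Z" and ob: "L \<in> Ob \<C>" "Y \<in> Ob \<C>"
  shows "deflations \<C> Z L Y = isos \<C> L Y"
proof (intro equalityI subsetI)
  fix g assume "g \<in> deflations \<C> Z L Y"
  then obtain x \<delta> where t: "triangle \<C> Z x L g Y \<delta>" using deflations_iff zero_objectD(1)[OF Z] by blast
  note d = triangleD[OF t]
  have "Id \<C> Z = \<zero>\<^bsub>H Z Z\<^esub>" using zero_objectD(2)[OF Z, of "Id \<C> Z" Z] d(4) by auto
  then have "\<delta> = \<zero>\<^bsub>E Y Z\<^esub>" using push_id[OF d(3)] push_zero_mor[OF d(3,4)] by simp
  then have "\<delta> \<triangleleft> Id \<C> Y = \<zero>\<^bsub>E Y Z\<^esub>" using d by simp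
  then obtain s where s: "s \<Colon> Y \<rightarrow> L" "g \<cdot> s = Id \<C> Y" using lift_along_deflation[OF t mor_id[OF d(6)]]
    by blast
  have i: "Id \<C> L \<Colon> L \<rightarrow> L" using d by auto
  have sg: "s \<cdot> g \<Colon> L \<rightarrow> L" using s d by blast
  have n: "\<ominus>\<^bsub>H L L\<^esub> Id \<C> L \<Colon> L \<rightarrow> L" using i by blast
  let ?b = "(\<ominus>\<^bsub>H L L\<^esub> Id \<C> L) \<oplus>\<^bsub>H L L\<^esub> (s \<cdot> g)"
  have b: "?b \<Colon> L \<rightarrow> L" using n sg by blast
  have "g \<cdot> (s \<cdot> g) = g" using assoc[OF d(2) s(1) d(2)] s(2) d by simp
  then have "g \<cdot> ?b = \<zero>\<^bsub>H L Y\<^esub>"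
    using cmp_add_right(1)[OF n sg d(2)] cmp_add_right(3)[OF i i d(2)] d(2) by simp
  then obtain a where a: "a \<Colon> L \<rightarrow> Z" "x \<cdot> a = ?b" using factor_through_inflation[OF t b] by blast
  have "a = \<zero>\<^bsub>H L Z\<^esub>" using zero_objectD(2)[OF Z a(1)] mor_zero d by blast
  then have "?b = \<zero>\<^bsub>H L L\<^esub>" using a(2) cmp_zero_right[OF d(1) d(5)] by simp
  then have "Id \<C> L \<oplus>\<^bsub>H L L\<^esub> ?b = Id \<C> L" using i by simp
  then have "s \<cdot> g = Id \<C> L" using hom_cancel_neg(2)[OF i sg] by simp
  then show "g \<in> isos \<C> L Y" using isoI[OF d(2) s(1)] s(2) by blast
next
  fix g assume g: "g \<in> isos \<C> L Y"
  show "g \<in> deflations \<C> Z L Y"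
    unfolding deflations_iff[OF zero_objectD(1)[OF Z]] by (rule triangle_iso[OF g ob Z])
qed

lemma inflations_zero:
  assumes Z: "zero_object \<C> Z" and ob: "X \<in> Ob \<C>" "L \<in> Ob \<C>"
  shows "inflations \<C> X L Z = isos \<C> X L"
  using hom_finite_extriangulated.deflations_zero[OF hom_finite_op, unfolded op_unfold, OF Z ob(2,1)]
  unfolding deflations_op[OF ob(1) zero_objectD(1)[OF Z]] .

text \<open>The middle term is determined up to isomorphism by the extension, and \<open>Ext\<close>
  is finite.\<close>

lemma finite_middle_classes:
  assumes "X \<in> Ob \<C>" "Y \<in> Ob \<C>"
  shows "finite {c. \<exists>L. c = iso_class \<C> L \<and> deflations \<C> X L Y \<noteq> {}}"
proof (rule finite_subset)
  let ?m = "\<lambda>\<delta>. iso_class \<C> (SOME B. \<exists>x y. triangle \<C> X x B y Y \<delta>)"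
  show "{c. \<exists>L. c = iso_class \<C> L \<and> deflations \<C> X L Y \<noteq> {}} \<subseteq> ?m ` Extset \<C> Y X"
  proof
    fix c assume "c \<in> {c. \<exists>L. c = iso_class \<C> L \<and> deflations \<C> X L Y \<noteq> {}}"
    then obtain L g where c: "c = iso_class \<C> L" "g \<in> deflations \<C> X L Y" by blast
    then obtain f \<delta> where t: "triangle \<C> X f L g Y \<delta>" using deflations_iff[OF assms(1)] by blast
    have "\<exists>x y. triangle \<C> X x (SOME B. \<exists>x y. triangle \<C> X x B y Y \<delta>) y Y \<delta>"
      by (rule someI[of "\<lambda>B. \<exists>x y. triangle \<C> X x B y Y \<delta>" L]) (use t in blast)
    then have "isomorphic \<C> L (SOME B. \<exists>x y. triangle \<C> X x B y Y \<delta>)" using middle_isomorphic[OF t] by blast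
    then have "c = ?m \<delta>" unfolding c(1) using iso_class_eq_iff[OF triangleD(5)[OF t]] by blast
    then show "c \<in> ?m ` Extset \<C> Y X" using extenD(3)[OF triangleD(3)[OF t]] by blast
  qed
  show "finite (?m ` Extset \<C> Y X)" using finite_Extset[OF assms(2,1)] by blast
qed

section \<open>Sums over middle terms\<close>

definition deflations_from :: "'o \<Rightarrow> 'o \<Rightarrow> 'm set"
  where "deflations_from M Z = {g. \<exists>L l \<delta>. triangle \<C> L l M g Z \<delta>}"

definition inflations_to :: "'o \<Rightarrow> 'o \<Rightarrow> 'm set"
  where "inflations_to X M = {h. \<exists>h' L \<delta>. triangle \<C> X h M h' L \<delta>}"

lemma inflations_to_op: "hom_finite_extriangulated.inflations_to (op_cat \<C>) X M = deflations_from M X"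
  unfolding hom_finite_extriangulated.inflations_to_def[OF hom_finite_op] deflations_from_def triangle_op
    by blast

lemma deflations_from_op: "hom_finite_extriangulated.deflations_from (op_cat \<C>) M Z = inflations_to Z M"
  unfolding hom_finite_extriangulated.deflations_from_def[OF hom_finite_op] inflations_to_def triangle_op
    by blast

lemma finite_deflations_from: "finite (deflations_from M Z)"
  by (rule finite_subset[OF _ finite_mor[of M Z]]) (auto simp: deflations_from_def dest: triangleD(2))

lemma finite_inflations_to: "finite (inflations_to X M)"
  by (rule finite_subset[OF _ finite_mor[of X M]]) (auto simp: inflations_to_def dest: triangleD(1))

lemmas cocone_isomorphic =
  hom_finite_extriangulated.cone_isomorphic[OF hom_finite_op, unfolded op_unfold isomorphic_op]

text \<open>A deflation from \<open>M\<close> to \<open>Z\<close> determines its cocone up to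
  isomorphism, so summing over \<open>L\<close> and over deflations with cocone \<open>L\<close>
  amounts to summing over all deflations \<open>g\<close>, each with a chosen cocone. An inflation
  \<open>f\<close> into that cocone is then sorted by its composite with \<open>lc g\<close>, again
  an inflation by (ET4). This gives the index set \<open>(g, h)\<close> that both sides of the
  associativity law share.\<close>

lemma sum_over_middle:
  fixes \<kappa> :: "'o \<Rightarrow> rat"
  assumes ob: "X \<in> Ob \<C>" "Y \<in> Ob \<C>" "Z \<in> Ob \<C>"
    and fin: "finite \<L>" and sub: "\<L> \<subseteq> Ob \<C>"
    and sep: "\<And>L L'. \<lbrakk>L \<in> \<L>; L' \<in> \<L>; isomorphic \<C> L L'\<rbrakk> \<Longrightarrow> L = L'"
    and cov: "\<And>L. \<lbrakk>L \<in> Ob \<C>; inflations \<C> X L Y \<noteq> {}; deflations \<C> L M Z \<noteq> {}\<rbrakk> \<Longrightarrow> \<exists>L'\<in>\<L>. isomorphic \<C> L L'"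
    and \<kappa>: "\<And>L L'. isomorphic \<C> L L' \<Longrightarrow> \<kappa> L = \<kappa> L'"
    and ch: "\<And>g. g \<in> deflations_from M Z \<Longrightarrow> triangle \<C> (Lc g) (lc g) M g Z (dc g)"
  shows "(\<Sum>L\<in>\<L>. of_nat (card (inflations \<C> X L Y) * card (deflations \<C> L M Z)) / \<kappa> L)
    = (\<Sum>g\<in>deflations_from M Z. \<Sum>h\<in>inflations_to X M.
        of_nat (card {f \<in> inflations \<C> X (Lc g) Y. lc g \<cdot> f = h}) / \<kappa> (Lc g))"
proof -
  let ?D = "deflations_from M Z"
  let ?t = "\<lambda>g. of_nat (card (inflations \<C> X (Lc g) Y)) / \<kappa> (Lc g)"
  have Lc: "isomorphic \<C> L (Lc g)" if g: "g \<in> deflations \<C> L M Z" and L: "L \<in> \<L>" for L g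
  proof -
    have "L \<in> Ob \<C>" using L sub by blast
    then obtain l \<delta> where t: "triangle \<C> L l M g Z \<delta>" using deflations_iff g by blast
    then have "g \<in> ?D" by (auto simp: deflations_from_def)
    from cocone_isomorphic[OF t ch[OF this]] show ?thesis .
  qed
  have DD: "deflations \<C> L M Z \<subseteq> ?D" if "L \<in> \<L>" for L
    using that sub deflations_iff unfolding deflations_from_def by blast
  have "(\<Sum>L\<in>\<L>. of_nat (card (inflations \<C> X L Y) * card (deflations \<C> L M Z)) / \<kappa> L)
    = (\<Sum>L\<in>\<L>. \<Sum>g\<in>deflations \<C> L M Z. ?t g)"
  proof (rule sum.cong[OF refl])
    fix L assume L: "L \<in> \<L>"
    have "?t g = of_nat (card (inflations \<C> X L Y)) / \<kappa> L" if "g \<in> deflations \<C> L M Z" for g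
      using card_inflations_iso[OF isomorphic_refl[OF ob(1)] Lc[OF that L] isomorphic_refl[OF ob(2)]]
        \<kappa>[OF Lc[OF that L]] by simp
    then have "(\<Sum>g\<in>deflations \<C> L M Z. ?t g)
      = (\<Sum>g\<in>deflations \<C> L M Z. of_nat (card (inflations \<C> X L Y)) / \<kappa> L)"
      by (rule sum.cong[OF refl])
    then show "of_nat (card (inflations \<C> X L Y) * card (deflations \<C> L M Z)) / \<kappa> L
      = (\<Sum>g\<in>deflations \<C> L M Z. ?t g)"
      by simp
  qed
  also have "\<dots> = (\<Sum>g\<in>(\<Union>L\<in>\<L>. deflations \<C> L M Z). ?t g)"
  proof (rule sum.UNION_disjoint[symmetric, OF fin])
    show "\<forall>L\<in>\<L>. finite (deflations \<C> L M Z)" using finite_deflations sub by blast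
    show "\<forall>L\<in>\<L>. \<forall>L'\<in>\<L>. L \<noteq> L' \<longrightarrow> deflations \<C> L M Z \<inter> deflations \<C> L' M Z = {}"
    proof (intro ballI impI, rule ccontr)
      fix L L' assume L: "L \<in> \<L>" "L' \<in> \<L>" "L \<noteq> L'" "deflations \<C> L M Z \<inter> deflations \<C> L' M Z \<noteq> {}"
      then obtain g where g: "g \<in> deflations \<C> L M Z" "g \<in> deflations \<C> L' M Z" by blast
      have "isomorphic \<C> L L'" using isomorphic_trans[OF Lc[OF g(1) L(1)] isomorphic_sym[OF Lc[OF g(2) L(2)]]]
        .
      then show False using sep L by blast
    qed
  qed
  also have "\<dots> = (\<Sum>g\<in>?D. ?t g)"
  proof (rule sum.mono_neutral_left[OF finite_deflations_from])
    show "(\<Union>L\<in>\<L>. deflations \<C> L M Z) \<subseteq> ?D" using DD by blast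
    \<comment> \<open>Deflations whose cocone is not represented in \<open>\<L>\<close> contribute
      nothing, since by \<open>cov\<close> no inflation from \<open>X\<close> with cone
      \<open>Y\<close> enters such a cocone.\<close>
    show "\<forall>g\<in>?D - (\<Union>L\<in>\<L>. deflations \<C> L M Z). ?t g = 0"
    proof
      fix g assume g: "g \<in> ?D - (\<Union>L\<in>\<L>. deflations \<C> L M Z)"
      then have t: "triangle \<C> (Lc g) (lc g) M g Z (dc g)" using ch by blast
      note d = triangleD[OF t]
      have gd: "g \<in> deflations \<C> (Lc g) M Z" unfolding deflations_iff[OF d(4)] using t by blast
      have "inflations \<C> X (Lc g) Y = {}"
      proof (rule ccontr)
        assume "inflations \<C> X (Lc g) Y \<noteq> {}"
        then obtain L' where L': "L' \<in> \<L>" "isomorphic \<C> (Lc g) L'" using cov[OF d(4)] gd by blast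
        then have "g \<in> deflations \<C> L' M Z" using t unfolding deflations_def by blast
        then show False using g L' by blast
      qed
      then show "?t g = 0" by simp
    qed
  qed
  also have "\<dots> = (\<Sum>g\<in>?D. \<Sum>h\<in>inflations_to X M. of_nat (card {f \<in> inflations \<C> X (Lc g) Y. lc g \<cdot> f = h}) /
    \<kappa> (Lc g))"
  proof (rule sum.cong[OF refl])
    fix g assume g: "g \<in> ?D"
    let ?F = "inflations \<C> X (Lc g) Y"
    have "card ?F = (\<Sum>h\<in>inflations_to X M. card {f \<in> ?F. lc g \<cdot> f = h})"
    proof -
      have fin: "finite ?F" using finite_inflations[OF ob(2)] .
      have im: "(\<lambda>f. lc g \<cdot> f) ` ?F \<subseteq> inflations_to X M"
      proof (rule image_subsetI)
        fix f assume "f \<in> ?F"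
        then obtain f' \<delta> where t: "triangle \<C> X f (Lc g) f' Y \<delta>" using inflations_iff[OF ob(2)] by blast
        from ET4[OF t ch[OF g]] show "lc g \<cdot> f \<in> inflations_to X M" unfolding inflations_to_def by blast
      qed
      have "card ?F = sum (\<lambda>f. 1) ?F" by simp
      also have "\<dots> = (\<Sum>h\<in>inflations_to X M. sum (\<lambda>f. 1) {f \<in> ?F. lc g \<cdot> f = h})"
        by (rule sum.group[symmetric, OF fin finite_inflations_to im])
      finally show ?thesis by simp
    qed
    then show "?t g = (\<Sum>h\<in>inflations_to X M. of_nat (card {f \<in> ?F. lc g \<cdot> f = h}) / \<kappa> (Lc g))"
      by (simp add: sum_divide_distrib)
  qed
  finally show ?thesis .
qed

lemma sum_over_middle_op:
  fixes \<kappa> :: "'o \<Rightarrow> rat"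
  assumes ob: "X \<in> Ob \<C>" "Y \<in> Ob \<C>" "Z \<in> Ob \<C>"
    and fin: "finite \<L>" and sub: "\<L> \<subseteq> Ob \<C>"
    and sep: "\<And>L L'. \<lbrakk>L \<in> \<L>; L' \<in> \<L>; isomorphic \<C> L L'\<rbrakk> \<Longrightarrow> L = L'"
    and cov: "\<And>L. \<lbrakk>L \<in> Ob \<C>; deflations \<C> Y L Z \<noteq> {}; inflations \<C> X M L \<noteq> {}\<rbrakk> \<Longrightarrow> \<exists>L'\<in>\<L>. isomorphic \<C> L L'"
    and \<kappa>: "\<And>L L'. isomorphic \<C> L L' \<Longrightarrow> \<kappa> L = \<kappa> L'"
    and ch: "\<And>h. h \<in> inflations_to X M \<Longrightarrow> triangle \<C> X h M (hc h) (Lc h) (dc h)"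
  shows "(\<Sum>L\<in>\<L>. of_nat (card (inflations \<C> X M L) * card (deflations \<C> Y L Z)) / \<kappa> L)
    = (\<Sum>h\<in>inflations_to X M. \<Sum>g\<in>deflations_from M Z.
        of_nat (card {e \<in> deflations \<C> Y (Lc h) Z. e \<cdot> hc h = g}) / \<kappa> (Lc h))"
proof -
  have L: "inflations (op_cat \<C>) Z L Y = deflations \<C> Y L Z" "deflations (op_cat \<C>) L M X
    = inflations \<C> X M L"
    if "L \<in> Ob \<C>" for L
    using inflations_op[OF ob(2,3)] deflations_op[OF ob(1) that] by auto
  have "(\<Sum>L\<in>\<L>. of_nat (card (inflations (op_cat \<C>) Z L Y) * card (deflations (op_cat \<C>) L M X)) / \<kappa> L)
    = (\<Sum>h\<in>inflations_to X M. \<Sum>g\<in>deflations_from M Z.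
        of_nat (card {e \<in> inflations (op_cat \<C>) Z (Lc h) Y. e \<cdot> hc h = g}) / \<kappa> (Lc h))"
    by (rule hom_finite_extriangulated.sum_over_middle[OF hom_finite_op, unfolded op_unfold isomorphic_op
      inflations_to_op deflations_from_op,
        OF ob(3,2,1) fin sub sep _ \<kappa> ch]) (use cov L in auto)
  moreover have "Lc h \<in> Ob \<C>" if "h \<in> inflations_to X M" for h using triangleD(6)[OF ch[OF that]] .
  moreover have "L \<in> Ob \<C>" if "L \<in> \<L>" for L using that sub by blast
  ultimately show ?thesis using L by (simp add: mult.commute cong: sum.cong)
qed

end

section \<open>Hall numbers\<close>

sublocale ext_finite_extriangulated \<subseteq> hom_finite_extriangulated K \<C>
  by unfold_locales (rule finite_hom finite_ext; assumption)+

context ext_finite_extriangulated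
begin

lemma square_eq: "square K \<C> X Y = 1 / euler X Y"
  by (simp add: square_def euler_def)

lemma euler_nonzero: "\<lbrakk>X \<in> Ob \<C>; Y \<in> Ob \<C>\<rbrakk> \<Longrightarrow> euler X Y \<noteq> 0"
  using euler_pos by fastforce

lemma hall_number_eq:
  "hall_number K \<C> X Y L = of_nat (card (deflations \<C> X L Y)) / of_nat (card (Aut \<C> Y)) *
    (euler Y Y / euler L Y)"
  by (simp add: hall_number_def square_eq)

lemma hall_number_inflations_eq:
  "hall_number_inflations K \<C> X Y L = of_nat (card (inflations \<C> X L Y)) / of_nat (card (Aut \<C> X)) *
    (euler X X / euler X L)"
  by (simp add: hall_number_inflations_def square_eq)

lemma card_Hom_kernel:
  assumes "triangle \<C> A x B y C \<delta>" "Z \<in> Ob \<C>"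
  shows "euler Z A * euler Z C = euler Z B * of_nat (card {u. u \<Colon> Z \<rightarrow> A \<and> x \<cdot> u = \<zero>\<^bsub>H Z B\<^esub>})"
    and "euler C Z * euler A Z = euler B Z * of_nat (card {u. u \<Colon> C \<rightarrow> Z \<and> u \<cdot> y = \<zero>\<^bsub>H B Z\<^esub>})"
proof -
  note d = triangleD[OF assms(1)]
  have "{u \<in> Homset \<C> Z A. x \<cdot> u = \<zero>\<^bsub>H Z B\<^esub>} = {u. u \<Colon> Z \<rightarrow> A \<and> x \<cdot> u = \<zero>\<^bsub>H Z B\<^esub>}"
    "{u \<in> Homset \<C> C Z. u \<cdot> y = \<zero>\<^bsub>H B Z\<^esub>} = {u. u \<Colon> C \<rightarrow> Z \<and> u \<cdot> y = \<zero>\<^bsub>H B Z\<^esub>}"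
    using d assms(2) by (auto simp: mor_def)
  then show "euler Z A * euler Z C = euler Z B * of_nat (card {u. u \<Colon> Z \<rightarrow> A \<and> x \<cdot> u = \<zero>\<^bsub>H Z B\<^esub>})"
    "euler C Z * euler A Z = euler B Z * of_nat (card {u. u \<Colon> C \<rightarrow> Z \<and> u \<cdot> y = \<zero>\<^bsub>H B Z\<^esub>})"
    using euler_covariant[OF assms] euler_contravariant[OF assms] by simp_all
qed

theorem hall_numbers_agree:
  assumes ob: "X \<in> Ob \<C>" "Y \<in> Ob \<C>" "L \<in> Ob \<C>"
  shows "hall_number K \<C> X Y L = hall_number_inflations K \<C> X Y L"
proof (cases "conflations X L Y = {}")
  case True
  then have "deflations \<C> X L Y = {}" "inflations \<C> X L Y = {}"
    using deflations_iff[OF ob(1)] inflations_iff[OF ob(2)] by (auto simp: conflations_def)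
  then show ?thesis unfolding hall_number_eq hall_number_inflations_eq by simp
next
  case False
  let ?W = "conflations X L Y"
  \<comment> \<open>\<open>a\<close> and \<open>b\<close> will be the orders of the kernels
    \<open>?k\<close> and \<open>?m\<close> attached to a triangle. Written through the Euler form
    they do not depend on the triangle, so they can be taken out of the weighted sums.\<close>
  define a where "a = euler X X * euler X Y / euler X L"
  define b where "b = euler Y Y * euler X Y / euler L Y"
  note nz = euler_nonzero[OF ob(1,1)] euler_nonzero[OF ob(1,2)] euler_nonzero[OF ob(1,3)]
    euler_nonzero[OF ob(2,2)] euler_nonzero[OF ob(3,2)]
  have w: "of_nat (card (cone_ghosts X L Y g \<delta>)) * a = (of_nat (card (cocone_ghosts X L Y f \<delta>)) * b :: rat)"
    if "(f, g, \<delta>) \<in> ?W" for f g \<delta>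
  proof -
    have t: "triangle \<C> X f L g Y \<delta>" using that by (simp add: conflations_def)
    note d = triangleD[OF t]
    let ?k = "{u. u \<Colon> X \<rightarrow> X \<and> f \<cdot> u = \<zero>\<^bsub>H X L\<^esub>}" and ?m = "{u. u \<Colon> Y \<rightarrow> Y \<and> u \<cdot> g = \<zero>\<^bsub>H L Y\<^esub>}"
    let ?J = "(\<lambda>u. u \<triangleright> \<delta>) ` ?k"
    have a: "a = of_nat (card ?k)" using card_Hom_kernel(1)[OF t ob(1)] nz by (simp add: a_def field_simps)
    have b: "b = of_nat (card ?m)" using card_Hom_kernel(2)[OF t ob(2)] nz by (simp add: b_def field_simps)
    have "card ?k = card (cocone_ghosts X L Y f \<delta>) * card ?J"
      unfolding cocone_ghosts_def by (rule card_left_ghosts[OF d(3,1)])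
    moreover have "card ?m = card (cone_ghosts X L Y g \<delta>) * card ?J"
      unfolding cone_ghosts_def ghost_images_eq[OF t t] by (rule card_right_ghosts[OF d(3,2)])
    ultimately show ?thesis unfolding a b by simp
  qed
  have "of_nat (card (Aut \<C> Y) * card (inflations \<C> X L Y)) * a
    = (\<Sum>(f, g, \<delta>)\<in>?W. of_nat (card (cone_ghosts X L Y g \<delta>)) * a)"
    unfolding sum_cone_ghosts[OF ob(2), symmetric] by (simp add: sum_distrib_right case_prod_unfold)
  also have "\<dots> = (\<Sum>(f, g, \<delta>)\<in>?W. of_nat (card (cocone_ghosts X L Y f \<delta>)) * b)"
    by (rule sum.cong[OF refl]) (use w in auto)
  also have "\<dots> = of_nat (card (Aut \<C> X) * card (deflations \<C> X L Y)) * b"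
    unfolding sum_cocone_ghosts[OF ob(1,2), symmetric] by (simp add: sum_distrib_right case_prod_unfold)
  finally have *: "of_nat (card (Aut \<C> Y)) * of_nat (card (inflations \<C> X L Y)) * a
    = of_nat (card (Aut \<C> X)) * of_nat (card (deflations \<C> X L Y)) * b" by simp
  have p: "(of_nat (card (Aut \<C> X)) :: rat) \<noteq> 0" "(of_nat (card (Aut \<C> Y)) :: rat) \<noteq> 0"
    using card_Aut_pos ob by auto
  show ?thesis unfolding hall_number_eq hall_number_inflations_eq
    using * p nz unfolding a_def b_def by (simp add: field_simps)
qed

text \<open>Multiplicativity on the triangle \<open>0 \<rightarrow> 0 \<rightarrow> 0\<close>, whose
  kernel term is 1, says that the value equals its own square.\<close>

lemma euler_zero:
  assumes Z: "zero_object \<C> Z" and X: "X \<in> Ob \<C>"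
  shows "euler X Z = 1" "euler Z X = 1"
proof -
  note z = zero_objectD[OF Z]
  have t: "triangle \<C> Z (Id \<C> Z) Z \<zero>\<^bsub>H Z Z\<^esub> Z \<zero>\<^bsub>E Z Z\<^esub>" by (rule triangle_id_left[OF Z z(1)])
  have t': "triangle \<C> Z \<zero>\<^bsub>H Z Z\<^esub> Z (Id \<C> Z) Z \<zero>\<^bsub>E Z Z\<^esub>" by (rule triangle_id_right[OF Z z(1)])
  have "{u. u \<Colon> X \<rightarrow> Z \<and> Id \<C> Z \<cdot> u = \<zero>\<^bsub>H X Z\<^esub>} = {\<zero>\<^bsub>H X Z\<^esub>}"
    using mor_zero[OF X z(1)] by auto
  then show "euler X Z = 1" using card_Hom_kernel(1)[OF t X] euler_nonzero[OF X z(1)] by simp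
  have "{u. u \<Colon> Z \<rightarrow> X \<and> u \<cdot> Id \<C> Z = \<zero>\<^bsub>H Z X\<^esub>} = {\<zero>\<^bsub>H Z X\<^esub>}"
    using mor_zero[OF z(1) X] by auto
  then show "euler Z X = 1" using card_Hom_kernel(2)[OF t' X] euler_nonzero[OF z(1) X] by simp
qed

text \<open>An isomorphism is a deflation with zero cocone. On this triangle the kernel terms are 1,
  and the zero object contributes the factor 1.\<close>

lemma euler_iso:
  assumes BC: "isomorphic \<C> B C" and X: "X \<in> Ob \<C>"
  shows "euler X B = euler X C" "euler B X = euler C X"
proof -
  obtain b where b: "b \<in> isos \<C> B C" and ob: "B \<in> Ob \<C>" "C \<in> Ob \<C>" using BC by (auto simp: isomorphic_def)
  obtain Z where Z: "zero_object \<C> Z" using zero_object_exists by blast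
  note z = zero_objectD[OF Z]
  obtain x \<delta> where t: "triangle \<C> Z x B b C \<delta>" using triangle_iso[OF b ob Z] by blast
  note d = triangleD[OF t]
  obtain b' where b': "b' \<Colon> C \<rightarrow> B" "b \<cdot> b' = Id \<C> C" using isoD[OF b ob] by metis
  have "{u. u \<Colon> X \<rightarrow> Z \<and> x \<cdot> u = \<zero>\<^bsub>H X B\<^esub>} = {\<zero>\<^bsub>H X Z\<^esub>}" (is "?U = _")
  proof (rule equalityI)
    show "?U \<subseteq> {\<zero>\<^bsub>H X Z\<^esub>}"
    proof
      fix u assume "u \<in> ?U"
      then have "u = \<zero>\<^bsub>H X Z\<^esub>" using z(2)[OF _ mor_zero[OF X z(1)]] by simp
      then show "u \<in> {\<zero>\<^bsub>H X Z\<^esub>}" by simp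
    qed
    show "{\<zero>\<^bsub>H X Z\<^esub>} \<subseteq> ?U" using mor_zero[OF X z(1)] cmp_zero_right[OF d(1) X] by simp
  qed
  then show "euler X B = euler X C" using card_Hom_kernel(1)[OF t X] euler_zero[OF Z X] by simp
  have "\<forall>u. u \<Colon> C \<rightarrow> X \<and> u \<cdot> b = \<zero>\<^bsub>H B X\<^esub> \<longrightarrow> u = \<zero>\<^bsub>H C X\<^esub>"
  proof (intro allI impI)
    fix u assume "u \<Colon> C \<rightarrow> X \<and> u \<cdot> b = \<zero>\<^bsub>H B X\<^esub>"
    then have u: "u \<Colon> C \<rightarrow> X" "u \<cdot> b = \<zero>\<^bsub>H B X\<^esub>" by simp_all
    have "u = (u \<cdot> b) \<cdot> b'" using assoc[OF b'(1) d(2) u(1)] b'(2) u(1) by simp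
    then show "u = \<zero>\<^bsub>H C X\<^esub>" using u(2) cmp_zero_left[OF b'(1) X] by simp
  qed
  moreover have "\<zero>\<^bsub>H C X\<^esub> \<cdot> b = \<zero>\<^bsub>H B X\<^esub>" by (rule cmp_zero_left[OF d(2) X])
  ultimately have "{u. u \<Colon> C \<rightarrow> X \<and> u \<cdot> b = \<zero>\<^bsub>H B X\<^esub>} = {\<zero>\<^bsub>H C X\<^esub>}"
    using mor_zero[OF ob(2) X] by blast
  then show "euler B X = euler C X" using card_Hom_kernel(2)[OF t X] euler_zero[OF Z X] by simp
qed

lemma hall_number_iso:
  assumes "isomorphic \<C> X X'" "isomorphic \<C> Y Y'" "isomorphic \<C> L L'"
  shows "hall_number K \<C> X Y L = hall_number K \<C> X' Y' L'"
proof -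
  have ob: "Y \<in> Ob \<C>" "Y' \<in> Ob \<C>" "L \<in> Ob \<C>" "L' \<in> Ob \<C>" using assms by (auto simp: isomorphic_def)
  show ?thesis unfolding hall_number_eq
    using card_deflations_iso[OF assms(1,3,2)] card_Aut_iso[OF assms(2)]
      euler_iso(1)[OF assms(2) ob(1)] euler_iso(2)[OF assms(2) ob(2)]
      euler_iso(1)[OF assms(2) ob(3)] euler_iso(2)[OF assms(3) ob(2)] by simp
qed

text \<open>Deflations with zero cocone are isomorphisms, and for isomorphic \<open>L\<close> and
  \<open>Y\<close> there are as many of them as automorphisms of \<open>Y\<close>.\<close>

lemma hall_number_left_unit:
  assumes Z: "zero_object \<C> Z" and ob: "Y \<in> Ob \<C>" "L \<in> Ob \<C>"
  shows "hall_number K \<C> Z Y L = (if isomorphic \<C> L Y then 1 else 0)"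
proof (cases "isomorphic \<C> L Y")
  case True
  have "(of_nat (card (Aut \<C> Y)) :: rat) \<noteq> 0" using card_Aut_pos[OF ob(1)] by simp
  then show ?thesis unfolding hall_number_eq deflations_zero[OF Z ob(2,1)]
    using card_isos[OF True] euler_iso(2)[OF True ob(1)] euler_nonzero[OF ob(1,1)] True by simp
next
  case False
  then have "isos \<C> L Y = {}" using ob by (auto simp: isomorphic_def)
  then show ?thesis unfolding hall_number_eq deflations_zero[OF Z ob(2,1)] using False by simp
qed

lemma hall_number_right_unit:
  assumes Z: "zero_object \<C> Z" and ob: "X \<in> Ob \<C>" "L \<in> Ob \<C>"
  shows "hall_number K \<C> X Z L = (if isomorphic \<C> X L then 1 else 0)"
proof (cases "isomorphic \<C> X L")
  case True
  have "(of_nat (card (Aut \<C> X)) :: rat) \<noteq> 0" using card_Aut_pos[OF ob(1)] by simp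
  then show ?thesis
    unfolding hall_numbers_agree[OF ob(1) zero_objectD(1)[OF Z] ob(2)] hall_number_inflations_eq
      inflations_zero[OF Z ob]
    using card_isos[OF True] card_Aut_iso[OF True] euler_iso(1)[OF True ob(1)] euler_nonzero[OF ob(1,1)] True
      by simp
next
  case False
  then have "isos \<C> X L = {}" using ob by (auto simp: isomorphic_def)
  then show ?thesis
    unfolding hall_numbers_agree[OF ob(1) zero_objectD(1)[OF Z] ob(2)] hall_number_inflations_eq
      inflations_zero[OF Z ob]
    using False by simp
qed

text \<open>The sums run over finite systems of representatives that cover the nonzero terms, so
  that the argument deals with objects and triangles instead of isomorphism classes.\<close>

theorem hall_number_assoc:
  assumes ob: "X \<in> Ob \<C>" "Y \<in> Ob \<C>" "Z \<in> Ob \<C>" "M \<in> Ob \<C>"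
    and L: "finite \<L>" "\<L> \<subseteq> Ob \<C>" "\<And>L L'. \<lbrakk>L \<in> \<L>; L' \<in> \<L>; isomorphic \<C> L L'\<rbrakk> \<Longrightarrow> L = L'"
    and L_cov: "\<And>L. \<lbrakk>L \<in> Ob \<C>; hall_number K \<C> X Y L \<noteq> 0\<rbrakk> \<Longrightarrow> \<exists>L'\<in>\<L>. isomorphic \<C> L L'"
    and M: "finite \<M>" "\<M> \<subseteq> Ob \<C>" "\<And>L L'. \<lbrakk>L \<in> \<M>; L' \<in> \<M>; isomorphic \<C> L L'\<rbrakk> \<Longrightarrow> L = L'"
    and M_cov: "\<And>L. \<lbrakk>L \<in> Ob \<C>; hall_number K \<C> Y Z L \<noteq> 0\<rbrakk> \<Longrightarrow> \<exists>L'\<in>\<M>. isomorphic \<C> L L'"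
  shows "(\<Sum>L\<in>\<L>. hall_number K \<C> X Y L * hall_number K \<C> L Z M)
    = (\<Sum>L\<in>\<M>. hall_number K \<C> X L M * hall_number K \<C> Y Z L)"
proof -
  \<comment> \<open>\<open>c\<close> collects the factors of both sides that do not involve the
    middle object \<open>L\<close>; it is the same for both sides.\<close>
  define c where "c = euler X X * euler Z Z * euler X Z /
    (of_nat (card (Aut \<C> X)) * of_nat (card (Aut \<C> Z)) * euler X M * euler M Z)"
  \<comment> \<open>For a triangle \<open>L \<rightarrow> M \<rightarrow> Z\<close> this is the
    order of the kernel of \<open>Hom(X,L) \<rightarrow> Hom(X,M)\<close>. Likewise
    \<open>\<kappa>'\<close> is, for \<open>X \<rightarrow> M \<rightarrow> L\<close>, the order of
    the kernel of \<open>Hom(L,Z) \<rightarrow> Hom(M,Z)\<close>. These are the ghost groups of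
    \<open>card_octahedra\<close>.\<close>
  define \<kappa> where "\<kappa> L = euler X L * euler X Z / euler X M" for L
  define \<kappa>' where "\<kappa>' L = euler L Z * euler X Z / euler M Z" for L
  note nz = euler_nonzero[OF ob(1,3)] euler_nonzero[OF ob(1,4)] euler_nonzero[OF ob(4,3)]
  have nonzero: "hall_number K \<C> X' Y' L \<noteq> 0" if dn: "deflations \<C> X' L Y' \<noteq> {}"
    and o: "X' \<in> Ob \<C>" "Y' \<in> Ob \<C>" "L \<in> Ob \<C>" for X' Y' L
  proof -
    have "card (deflations \<C> X' L Y') \<noteq> 0" using dn finite_deflations[OF o(1)] by simp
    then show ?thesis unfolding hall_number_eq
      using card_Aut_pos[OF o(2)] euler_nonzero[OF o(2,2)] euler_nonzero[OF o(3,2)] by simp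
  qed
  define choice where "choice g = (SOME (L, l, \<delta>). triangle \<C> L l M g Z \<delta>)" for g
  have choice: "triangle \<C> (fst (choice g)) (fst (snd (choice g))) M g Z (snd (snd (choice g)))"
    if g: "g \<in> deflations_from M Z" for g
  proof -
    obtain L0 l0 \<delta>0 where "triangle \<C> L0 l0 M g Z \<delta>0" using g by (auto simp: deflations_from_def)
    then have "case choice g of (L, l, \<delta>) \<Rightarrow> triangle \<C> L l M g Z \<delta>"
      unfolding choice_def by (intro someI[of "\<lambda>(L, l, \<delta>). triangle \<C> L l M g Z \<delta>" "(L0, l0, \<delta>0)"]) simp
    then show ?thesis by (simp add: case_prod_unfold)
  qed
  define choice' where "choice' h = (SOME (L, h', \<delta>). triangle \<C> X h M h' L \<delta>)" for h
  have choice': "triangle \<C> X h M (fst (snd (choice' h))) (fst (choice' h)) (snd (snd (choice' h)))"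
    if h: "h \<in> inflations_to X M" for h
  proof -
    obtain L0 l0 \<delta>0 where "triangle \<C> X h M l0 L0 \<delta>0" using h by (auto simp: inflations_to_def)
    then have "case choice' h of (L, h', \<delta>) \<Rightarrow> triangle \<C> X h M h' L \<delta>"
      unfolding choice'_def by (intro someI[of "\<lambda>(L, h', \<delta>). triangle \<C> X h M h' L \<delta>" "(L0, l0, \<delta>0)"]) simp
    then show ?thesis by (simp add: case_prod_unfold)
  qed
  \<comment> \<open>The first factor is expressed by inflations and the second by deflations, so
    that of all automorphism groups only those of \<open>X\<close> and \<open>Z\<close>
    occur.\<close>
  have "(\<Sum>L\<in>\<L>. hall_number K \<C> X Y L * hall_number K \<C> L Z M)
    = (\<Sum>L\<in>\<L>. c * (of_nat (card (inflations \<C> X L Y) * card (deflations \<C> L M Z)) / \<kappa> L))"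
  proof (rule sum.cong[OF refl])
    fix L assume "L \<in> \<L>"
    then have Lo: "L \<in> Ob \<C>" using L(2) by blast
    show "hall_number K \<C> X Y L * hall_number K \<C> L Z M
      = c * (of_nat (card (inflations \<C> X L Y) * card (deflations \<C> L M Z)) / \<kappa> L)"
      unfolding hall_numbers_agree[OF ob(1,2) Lo]
        unfolding hall_number_inflations_eq hall_number_eq c_def \<kappa>_def
      using nz euler_nonzero[OF ob(1) Lo] by (simp add: field_simps)
  qed
  also have "\<dots> = c * (\<Sum>L\<in>\<L>. of_nat (card (inflations \<C> X L Y) * card (deflations \<C> L M Z)) / \<kappa> L)"
    by (simp add: sum_distrib_left)
  also have "(\<Sum>L\<in>\<L>. of_nat (card (inflations \<C> X L Y) * card (deflations \<C> L M Z)) / \<kappa> L)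
    = (\<Sum>g\<in>deflations_from M Z. \<Sum>h\<in>inflations_to X M.
        of_nat (card {f \<in> inflations \<C> X (fst (choice g)) Y. fst (snd (choice g)) \<cdot> f = h}) / \<kappa>
          (fst (choice g)))"
  proof (rule sum_over_middle[OF ob(1-3) L _ _ choice])
    fix L assume l: "L \<in> Ob \<C>" "inflations \<C> X L Y \<noteq> {}"
    then have "deflations \<C> X L Y \<noteq> {}" using inflations_iff[OF ob(2)] deflations_iff[OF ob(1)] by blast
    then show "\<exists>L'\<in>\<L>. isomorphic \<C> L L'" using L_cov[OF l(1)] nonzero ob l(1) by blast
  next
    fix L L' assume "isomorphic \<C> L L'"
    then show "\<kappa> L = \<kappa> L'" using euler_iso(1)[OF _ ob(1)] by (simp add: \<kappa>_def)
  qed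
  also have "\<dots> = (\<Sum>g\<in>deflations_from M Z. \<Sum>h\<in>inflations_to X M.
        of_nat (card {e \<in> deflations \<C> Y (fst (choice' h)) Z. e \<cdot> fst (snd (choice' h)) = g}) / \<kappa>'
          (fst (choice' h)))"
  proof (intro sum.cong refl)
    fix g h assume g: "g \<in> deflations_from M Z" and h: "h \<in> inflations_to X M"
    note t = choice[OF g] note t' = choice'[OF h]
    note oc = triangleD(4)[OF t] triangleD(6)[OF t']
    have k: "\<kappa> (fst (choice g))
      = of_nat (card {u. u \<Colon> X \<rightarrow> fst (choice g) \<and> fst (snd (choice g)) \<cdot> u = \<zero>\<^bsub>H X M\<^esub>})"
      using card_Hom_kernel(1)[OF t ob(1)] nz by (simp add: \<kappa>_def field_simps)
    have k': "\<kappa>' (fst (choice' h))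
      = of_nat (card {v. v \<Colon> fst (choice' h) \<rightarrow> Z \<and> v \<cdot> fst (snd (choice' h)) = \<zero>\<^bsub>H M Z\<^esub>})"
      using card_Hom_kernel(2)[OF t' ob(3)] nz by (simp add: \<kappa>'_def field_simps)
    have kn: "\<kappa> (fst (choice g)) \<noteq> 0" "\<kappa>' (fst (choice' h)) \<noteq> 0"
      using nz euler_nonzero[OF ob(1) oc(1)] euler_nonzero[OF oc(2) ob(3)] by (simp_all add: \<kappa>_def \<kappa>'_def)
    \<comment> \<open>The octahedral count in the form of a cross-multiplied equality of the two
      fractions.\<close>
    have "of_nat (card {f \<in> inflations \<C> X (fst (choice g)) Y. fst (snd (choice g)) \<cdot> f = h}) *
      \<kappa>' (fst (choice' h))
      = of_nat (card {e \<in> deflations \<C> Y (fst (choice' h)) Z. e \<cdot> fst (snd (choice' h)) = g}) * \<kappa>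
        (fst (choice g))"
      unfolding k k' of_nat_mult[symmetric] card_octahedra[OF t t' ob(2)] ..
    then show "of_nat (card {f \<in> inflations \<C> X (fst (choice g)) Y. fst (snd (choice g)) \<cdot> f = h}) /
      \<kappa> (fst (choice g))
      = of_nat (card {e \<in> deflations \<C> Y (fst (choice' h)) Z. e \<cdot> fst (snd (choice' h)) = g}) / \<kappa>'
        (fst (choice' h))"
      using kn by (simp add: frac_eq_eq)
  qed
  also have "\<dots> = (\<Sum>h\<in>inflations_to X M. \<Sum>g\<in>deflations_from M Z.
        of_nat (card {e \<in> deflations \<C> Y (fst (choice' h)) Z. e \<cdot> fst (snd (choice' h)) = g}) / \<kappa>'
          (fst (choice' h)))"
    by (rule sum.swap)
  also have "\<dots> = (\<Sum>L\<in>\<M>. of_nat (card (inflations \<C> X M L) * card (deflations \<C> Y L Z)) / \<kappa>' L)"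
  proof (rule sum_over_middle_op[OF ob(1-3) M _ _ choice', symmetric])
    fix L assume "L \<in> Ob \<C>" "deflations \<C> Y L Z \<noteq> {}"
    then show "\<exists>L'\<in>\<M>. isomorphic \<C> L L'" using M_cov nonzero ob by blast
  next
    fix L L' assume "isomorphic \<C> L L'"
    then show "\<kappa>' L = \<kappa>' L'" using euler_iso(2)[OF _ ob(3)] by (simp add: \<kappa>'_def)
  qed
  also have "c * \<dots> = (\<Sum>L\<in>\<M>. c * (of_nat (card (inflations \<C> X M L) * card (deflations \<C> Y L Z)) / \<kappa>' L))"
    by (simp add: sum_distrib_left)
  also have "\<dots> = (\<Sum>L\<in>\<M>. hall_number K \<C> X L M * hall_number K \<C> Y Z L)"
  proof (rule sum.cong[OF refl])
    fix L assume "L \<in> \<M>"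
    then have Lo: "L \<in> Ob \<C>" using M(2) by blast
    show "c * (of_nat (card (inflations \<C> X M L) * card (deflations \<C> Y L Z)) / \<kappa>' L)
      = hall_number K \<C> X L M * hall_number K \<C> Y Z L"
      unfolding hall_numbers_agree[OF ob(1) Lo ob(4)]
        unfolding hall_number_inflations_eq hall_number_eq c_def \<kappa>'_def
      using nz euler_nonzero[OF Lo ob(3)] by (simp add: field_simps)
  qed
  finally show ?thesis .
qed

end

section \<open>Algebras given by structure constants\<close>

lemma cring_rat_ring: "cring rat_ring"
proof (rule cringI)
  show "abelian_group rat_ring"
  proof (rule abelian_groupI)
    fix x :: rat
    show "\<exists>y\<in>carrier rat_ring. y \<oplus>\<^bsub>rat_ring\<^esub> x = \<zero>\<^bsub>rat_ring\<^esub>"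
      by (rule bexI[of _ "- x"]) (simp_all add: rat_ring_def)
  qed (simp_all add: rat_ring_def)
  show "comm_monoid rat_ring" by (rule comm_monoidI) (simp_all add: rat_ring_def)
qed (simp add: rat_ring_def distrib_right)

text \<open>There may be infinitely many classes, so each sum in \<open>coeff_assoc\<close> runs
  over the finite support of its inner product.\<close>

locale structure_constants =
  fixes I :: "'a set" and h :: "'a \<Rightarrow> 'a \<Rightarrow> 'a \<Rightarrow> rat" and e :: 'a
  assumes finite_products: "\<lbrakk>a \<in> I; b \<in> I\<rbrakk> \<Longrightarrow> finite {c \<in> I. h a b c \<noteq> 0}"
    and coeff_assoc: "\<lbrakk>a \<in> I; b \<in> I; c \<in> I; m \<in> I\<rbrakk> \<Longrightarrow>
      (\<Sum>l | l \<in> I \<and> h a b l \<noteq> 0. h a b l * h l c m) = (\<Sum>l | l \<in> I \<and> h b c l \<noteq> 0. h a l m * h b c l)"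
    and unit_closed: "e \<in> I"
    and unit_left: "\<lbrakk>b \<in> I; c \<in> I\<rbrakk> \<Longrightarrow> h e b c = (if b = c then 1 else 0)"
    and unit_right: "\<lbrakk>a \<in> I; c \<in> I\<rbrakk> \<Longrightarrow> h a e c = (if a = c then 1 else 0)"
begin

definition finsupp :: "('a \<Rightarrow> rat) set"
  where "finsupp = {\<phi>. finite {c. \<phi> c \<noteq> 0} \<and> {c. \<phi> c \<noteq> 0} \<subseteq> I}"

definition prod :: "('a \<Rightarrow> rat) \<Rightarrow> ('a \<Rightarrow> rat) \<Rightarrow> 'a \<Rightarrow> rat"
  where "prod \<phi> \<psi> c = (if c \<in> I then \<Sum>a | \<phi> a \<noteq> 0. \<Sum>b | \<psi> b \<noteq> 0. \<phi> a * \<psi> b * h a b c else 0)"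

definition convolution_algebra :: "(rat, 'a \<Rightarrow> rat) module"
  where "convolution_algebra =
    \<lparr>carrier = finsupp, mult = prod, one = (\<lambda>c. if c = e then 1 else 0), zero = (\<lambda>c. 0),
     add = (\<lambda>\<phi> \<psi> c. \<phi> c + \<psi> c), smult = (\<lambda>r \<phi> c. r * \<phi> c)\<rparr>"

lemma finsupp_zero: "(\<lambda>c. 0) \<in> finsupp"
  by (simp add: finsupp_def)

lemma finsupp_one: "(\<lambda>c. if c = e then 1 else 0) \<in> finsupp"
  using unit_closed by (simp add: finsupp_def)

lemma finsupp_add: "\<lbrakk>\<phi> \<in> finsupp; \<psi> \<in> finsupp\<rbrakk> \<Longrightarrow> (\<lambda>c. \<phi> c + \<psi> c) \<in> finsupp"
  unfolding finsupp_def
  by (auto intro: finite_subset[of _ "{c. \<phi> c \<noteq> 0} \<union> {c. \<psi> c \<noteq> 0}"])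
    (metis (mono_tags) add_0 mem_Collect_eq subsetD)

lemma finsupp_smult: "\<phi> \<in> finsupp \<Longrightarrow> (\<lambda>c. r * \<phi> c) \<in> finsupp"
  unfolding finsupp_def by (auto intro: finite_subset[of _ "{c. \<phi> c \<noteq> 0}"])

lemma prod_eq:
  assumes "finite S" "{a. \<phi> a \<noteq> 0} \<subseteq> S" "finite T" "{b. \<psi> b \<noteq> 0} \<subseteq> T" "c \<in> I"
  shows "prod \<phi> \<psi> c = (\<Sum>a\<in>S. \<Sum>b\<in>T. \<phi> a * \<psi> b * h a b c)"
proof -
  have "(\<Sum>b | \<psi> b \<noteq> 0. \<phi> a * \<psi> b * h a b c) = (\<Sum>b\<in>T. \<phi> a * \<psi> b * h a b c)" for a
    by (rule sum.mono_neutral_left) (use assms in auto)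
  moreover have "(\<Sum>a | \<phi> a \<noteq> 0. \<Sum>b\<in>T. \<phi> a * \<psi> b * h a b c) = (\<Sum>a\<in>S. \<Sum>b\<in>T. \<phi> a * \<psi> b * h a b c)"
    by (rule sum.mono_neutral_left) (use assms in auto)
  ultimately show ?thesis using assms(5) by (simp add: prod_def)
qed

lemma prod_outside: "c \<notin> I \<Longrightarrow> prod \<phi> \<psi> c = 0"
  by (simp add: prod_def)

lemma prod_support:
  assumes "\<phi> \<in> finsupp" "\<psi> \<in> finsupp"
  defines "S \<equiv> \<Union>a\<in>{a. \<phi> a \<noteq> 0}. \<Union>b\<in>{b. \<psi> b \<noteq> 0}. {c \<in> I. h a b c \<noteq> 0}"
  shows "finite S" "{c. prod \<phi> \<psi> c \<noteq> 0} \<subseteq> S"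
proof -
  show "finite S" unfolding S_def using assms(1,2)
    by (intro finite_UN_I finite_products) (auto simp: finsupp_def)
  show "{c. prod \<phi> \<psi> c \<noteq> 0} \<subseteq> S"
  proof
    fix c assume c: "c \<in> {c. prod \<phi> \<psi> c \<noteq> 0}"
    then have "c \<in> I" using prod_outside by auto
    moreover have "\<exists>a b. \<phi> a \<noteq> 0 \<and> \<psi> b \<noteq> 0 \<and> h a b c \<noteq> 0"
    proof (rule ccontr)
      assume "\<nexists>a b. \<phi> a \<noteq> 0 \<and> \<psi> b \<noteq> 0 \<and> h a b c \<noteq> 0"
      then have "\<phi> a * \<psi> b * h a b c = 0" for a b by auto
      then have "prod \<phi> \<psi> c = 0" unfolding prod_def by (simp only: sum.neutral_const if_cancel)
      then show False using c by simp
    qed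
    ultimately show "c \<in> S" unfolding S_def by auto
  qed
qed

lemma prod_closed: "\<lbrakk>\<phi> \<in> finsupp; \<psi> \<in> finsupp\<rbrakk> \<Longrightarrow> prod \<phi> \<psi> \<in> finsupp"
  using prod_support[of \<phi> \<psi>] prod_outside[of _ \<phi> \<psi>] unfolding finsupp_def
  by (auto intro: finite_subset)

lemma prod_assoc:
  assumes f: "\<phi> \<in> finsupp" "\<psi> \<in> finsupp" "\<chi> \<in> finsupp"
  shows "prod (prod \<phi> \<psi>) \<chi> = prod \<phi> (prod \<psi> \<chi>)"
proof
  fix m
  show "prod (prod \<phi> \<psi>) \<chi> m = prod \<phi> (prod \<psi> \<chi>) m"
  proof (cases "m \<in> I")
    case m: True
    let ?A = "{a. \<phi> a \<noteq> 0}" and ?B = "{b. \<psi> b \<noteq> 0}" and ?C = "{c. \<chi> c \<noteq> 0}"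
    have fin: "finite ?A" "finite ?B" "finite ?C" and sub: "?A \<subseteq> I" "?B \<subseteq> I" "?C \<subseteq> I"
      using f by (auto simp: finsupp_def)
    define S where "S = (\<Union>a\<in>?A. \<Union>b\<in>?B. {l \<in> I. h a b l \<noteq> 0})"
    define T where "T = (\<Union>b\<in>?B. \<Union>c\<in>?C. {l \<in> I. h b c l \<noteq> 0})"
    note S = prod_support[OF f(1,2), folded S_def]
    note T = prod_support[OF f(2,3), folded T_def]
    have SI: "S \<subseteq> I" and TI: "T \<subseteq> I" by (auto simp: S_def T_def)
    have "prod (prod \<phi> \<psi>) \<chi> m = (\<Sum>l\<in>S. \<Sum>c\<in>?C. prod \<phi> \<psi> l * \<chi> c * h l c m)"
      by (rule prod_eq[OF S fin(3) order_refl m])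
    also have "\<dots> = (\<Sum>l\<in>S. \<Sum>c\<in>?C. \<Sum>a\<in>?A. \<Sum>b\<in>?B. \<phi> a * \<psi> b * \<chi> c * (h a b l * h l c m))"
    proof (intro sum.cong refl)
      fix l c assume "l \<in> S"
      then have "prod \<phi> \<psi> l = (\<Sum>a\<in>?A. \<Sum>b\<in>?B. \<phi> a * \<psi> b * h a b l)"
        using prod_eq[OF fin(1) order_refl fin(2) order_refl] SI by blast
      then show "prod \<phi> \<psi> l * \<chi> c * h l c m = (\<Sum>a\<in>?A. \<Sum>b\<in>?B. \<phi> a * \<psi> b * \<chi> c * (h a b l * h l c m))"
        by (simp add: sum_distrib_left sum_distrib_right mult_ac)
    qed
    \<comment> \<open>The sum over \<open>l\<close> is moved innermost, where associativity of the
      structure constants applies for fixed \<open>a\<close>, \<open>b\<close>,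
      \<open>c\<close>.\<close>
    also have "\<dots> = (\<Sum>c\<in>?C. \<Sum>l\<in>S. \<Sum>a\<in>?A. \<Sum>b\<in>?B. \<phi> a * \<psi> b * \<chi> c * (h a b l * h l c m))"
      by (rule sum.swap)
    also have "\<dots> = (\<Sum>c\<in>?C. \<Sum>a\<in>?A. \<Sum>l\<in>S. \<Sum>b\<in>?B. \<phi> a * \<psi> b * \<chi> c * (h a b l * h l c m))"
      by (rule sum.cong[OF refl], rule sum.swap)
    also have "\<dots> = (\<Sum>c\<in>?C. \<Sum>a\<in>?A. \<Sum>b\<in>?B. \<Sum>l\<in>S. \<phi> a * \<psi> b * \<chi> c * (h a b l * h l c m))"
      by (rule sum.cong[OF refl], rule sum.cong[OF refl], rule sum.swap)
    also have "\<dots> = (\<Sum>c\<in>?C. \<Sum>a\<in>?A. \<Sum>b\<in>?B. \<Sum>l\<in>T. \<phi> a * \<psi> b * \<chi> c * (h a l m * h b c l))"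
    proof ((rule sum.cong[OF refl])+)
      fix a b c assume abc: "c \<in> ?C" "a \<in> ?A" "b \<in> ?B"
      \<comment> \<open>\<open>S\<close> and \<open>T\<close> serve all \<open>a\<close>,
        \<open>b\<close>, \<open>c\<close> at once; for fixed indices the additional terms
        vanish.\<close>
      have "(\<Sum>l\<in>S. h a b l * h l c m) = (\<Sum>l | l \<in> I \<and> h a b l \<noteq> 0. h a b l * h l c m)"
        by (rule sum.mono_neutral_right[OF S(1)]) (use abc SI in \<open>auto simp: S_def\<close>)
      also have "\<dots> = (\<Sum>l | l \<in> I \<and> h b c l \<noteq> 0. h a l m * h b c l)"
        by (rule coeff_assoc) (use abc sub m in auto)
      also have "\<dots> = (\<Sum>l\<in>T. h a l m * h b c l)"
        by (rule sum.mono_neutral_left[OF T(1)]) (use abc TI in \<open>auto simp: T_def\<close>)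
      finally show "(\<Sum>l\<in>S. \<phi> a * \<psi> b * \<chi> c * (h a b l * h l c m))
        = (\<Sum>l\<in>T. \<phi> a * \<psi> b * \<chi> c * (h a l m * h b c l))"
        by (simp add: sum_distrib_left[symmetric])
    qed
    also have "\<dots> = (\<Sum>a\<in>?A. \<Sum>c\<in>?C. \<Sum>b\<in>?B. \<Sum>l\<in>T. \<phi> a * \<psi> b * \<chi> c * (h a l m * h b c l))"
      by (rule sum.swap)
    also have "\<dots> = (\<Sum>a\<in>?A. \<Sum>b\<in>?B. \<Sum>c\<in>?C. \<Sum>l\<in>T. \<phi> a * \<psi> b * \<chi> c * (h a l m * h b c l))"
      by (rule sum.cong[OF refl], rule sum.swap)
    also have "\<dots> = (\<Sum>a\<in>?A. \<Sum>b\<in>?B. \<Sum>l\<in>T. \<Sum>c\<in>?C. \<phi> a * \<psi> b * \<chi> c * (h a l m * h b c l))"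
      by (rule sum.cong[OF refl], rule sum.cong[OF refl], rule sum.swap)
    also have "\<dots> = (\<Sum>a\<in>?A. \<Sum>l\<in>T. \<Sum>b\<in>?B. \<Sum>c\<in>?C. \<phi> a * \<psi> b * \<chi> c * (h a l m * h b c l))"
      by (rule sum.cong[OF refl], rule sum.swap)
    also have "\<dots> = (\<Sum>a\<in>?A. \<Sum>l\<in>T. \<phi> a * prod \<psi> \<chi> l * h a l m)"
    proof (intro sum.cong refl)
      fix a l assume "l \<in> T"
      then have "prod \<psi> \<chi> l = (\<Sum>b\<in>?B. \<Sum>c\<in>?C. \<psi> b * \<chi> c * h b c l)"
        using prod_eq[OF fin(2) order_refl fin(3) order_refl] TI by blast
      then show "(\<Sum>b\<in>?B. \<Sum>c\<in>?C. \<phi> a * \<psi> b * \<chi> c * (h a l m * h b c l)) = \<phi> a * prod \<psi> \<chi> l * h a l m"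
        by (simp add: sum_distrib_left sum_distrib_right mult_ac)
    qed
    also have "\<dots> = prod \<phi> (prod \<psi> \<chi>) m"
      by (rule prod_eq[OF fin(1) order_refl T m, symmetric])
    finally show ?thesis .
  qed (simp add: prod_outside)
qed

lemma prod_unit_left:
  assumes "\<phi> \<in> finsupp"
  shows "prod (\<lambda>c. if c = e then 1 else 0) \<phi> = \<phi>"
proof
  fix c
  have fin: "finite {b. \<phi> b \<noteq> 0}" and sub: "{b. \<phi> b \<noteq> 0} \<subseteq> I" using assms by (auto simp: finsupp_def)
  show "prod (\<lambda>c. if c = e then 1 else 0) \<phi> c = \<phi> c"
  proof (cases "c \<in> I")
    case True
    have "prod (\<lambda>c. if c = e then 1 else 0) \<phi> c
      = (\<Sum>a\<in>{e}. \<Sum>b | \<phi> b \<noteq> 0. (if a = e then 1 else 0) * \<phi> b * h a b c)"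
      by (rule prod_eq[OF _ _ fin order_refl True]) auto
    also have "\<dots> = (\<Sum>b | \<phi> b \<noteq> 0. if b = c then \<phi> b else 0)"
      using True sub unit_left by (auto intro!: sum.cong)
    also have "\<dots> = \<phi> c" using fin by (simp add: sum.delta)
    finally show ?thesis .
  qed (use sub in \<open>auto simp: prod_outside\<close>)
qed

lemma prod_unit_right:
  assumes "\<phi> \<in> finsupp"
  shows "prod \<phi> (\<lambda>c. if c = e then 1 else 0) = \<phi>"
proof
  fix c
  have fin: "finite {b. \<phi> b \<noteq> 0}" and sub: "{b. \<phi> b \<noteq> 0} \<subseteq> I" using assms by (auto simp: finsupp_def)
  show "prod \<phi> (\<lambda>c. if c = e then 1 else 0) c = \<phi> c"
  proof (cases "c \<in> I")
    case True
    have "prod \<phi> (\<lambda>c. if c = e then 1 else 0) c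
      = (\<Sum>a | \<phi> a \<noteq> 0. \<Sum>b\<in>{e}. \<phi> a * (if b = e then 1 else 0) * h a b c)"
      by (rule prod_eq[OF fin order_refl _ _ True]) auto
    also have "\<dots> = (\<Sum>a | \<phi> a \<noteq> 0. if a = c then \<phi> a else 0)"
      using True sub unit_right by (auto intro!: sum.cong)
    also have "\<dots> = \<phi> c" using fin by (simp add: sum.delta)
    finally show ?thesis .
  qed (use sub in \<open>auto simp: prod_outside\<close>)
qed

lemma prod_add_left:
  assumes f: "\<phi> \<in> finsupp" "\<phi>' \<in> finsupp" "\<psi> \<in> finsupp"
  shows "prod (\<lambda>c. \<phi> c + \<phi>' c) \<psi> = (\<lambda>c. prod \<phi> \<psi> c + prod \<phi>' \<psi> c)"
proof
  fix c
  let ?S = "{a. \<phi> a \<noteq> 0} \<union> {a. \<phi>' a \<noteq> 0}" and ?T = "{b. \<psi> b \<noteq> 0}"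
  have fin: "finite ?S" "finite ?T" using f by (auto simp: finsupp_def)
  have "{a. \<phi> a + \<phi>' a \<noteq> 0} \<subseteq> ?S" by auto
  then show "prod (\<lambda>c. \<phi> c + \<phi>' c) \<psi> c = prod \<phi> \<psi> c + prod \<phi>' \<psi> c"
    using prod_eq[OF fin(1) _ fin(2) order_refl, of _ c]
    by (cases "c \<in> I") (simp_all add: prod_outside sum.distrib distrib_right)
qed

lemma prod_add_right:
  assumes f: "\<phi> \<in> finsupp" "\<phi>' \<in> finsupp" "\<psi> \<in> finsupp"
  shows "prod \<psi> (\<lambda>c. \<phi> c + \<phi>' c) = (\<lambda>c. prod \<psi> \<phi> c + prod \<psi> \<phi>' c)"
proof
  fix c
  let ?S = "{a. \<phi> a \<noteq> 0} \<union> {a. \<phi>' a \<noteq> 0}" and ?T = "{b. \<psi> b \<noteq> 0}"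
  have fin: "finite ?S" "finite ?T" using f by (auto simp: finsupp_def)
  have "{a. \<phi> a + \<phi>' a \<noteq> 0} \<subseteq> ?S" by auto
  then show "prod \<psi> (\<lambda>c. \<phi> c + \<phi>' c) c = prod \<psi> \<phi> c + prod \<psi> \<phi>' c"
    using prod_eq[OF fin(2) order_refl fin(1), of _ c]
    by (cases "c \<in> I") (simp_all add: prod_outside sum.distrib distrib_right distrib_left)
qed

lemma prod_smult_left:
  assumes f: "\<phi> \<in> finsupp" "\<psi> \<in> finsupp"
  shows "prod (\<lambda>c. r * \<phi> c) \<psi> = (\<lambda>c. r * prod \<phi> \<psi> c)"
proof
  fix c
  let ?S = "{a. \<phi> a \<noteq> 0}" and ?T = "{b. \<psi> b \<noteq> 0}"
  have fin: "finite ?S" "finite ?T" using f by (auto simp: finsupp_def)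
  have "{a. r * \<phi> a \<noteq> 0} \<subseteq> ?S" by auto
  then show "prod (\<lambda>c. r * \<phi> c) \<psi> c = r * prod \<phi> \<psi> c"
    using prod_eq[OF fin(1) _ fin(2) order_refl, of _ c]
    by (cases "c \<in> I") (simp_all add: prod_outside sum_distrib_left mult.assoc)
qed

lemma prod_smult_right:
  assumes f: "\<phi> \<in> finsupp" "\<psi> \<in> finsupp"
  shows "prod \<phi> (\<lambda>c. r * \<psi> c) = (\<lambda>c. r * prod \<phi> \<psi> c)"
proof
  fix c
  let ?S = "{a. \<phi> a \<noteq> 0}" and ?T = "{b. \<psi> b \<noteq> 0}"
  have fin: "finite ?S" "finite ?T" using f by (auto simp: finsupp_def)
  have "{a. r * \<psi> a \<noteq> 0} \<subseteq> ?T" by auto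
  then show "prod \<phi> (\<lambda>c. r * \<psi> c) c = r * prod \<phi> \<psi> c"
    using prod_eq[OF fin(1) order_refl fin(2), of _ c]
    by (cases "c \<in> I") (simp_all add: prod_outside sum_distrib_left mult_ac)
qed

theorem assoc_algebra: "assoc_algebra rat_ring convolution_algebra"
proof -
  have ab: "abelian_group convolution_algebra"
  proof (rule abelian_groupI)
    fix \<phi> assume "\<phi> \<in> carrier convolution_algebra"
    then show "\<exists>\<psi>\<in>carrier convolution_algebra. \<psi> \<oplus>\<^bsub>convolution_algebra\<^esub> \<phi> = \<zero>\<^bsub>convolution_algebra\<^esub>"
      using finsupp_smult[of \<phi> "-1"]
        by (intro bexI[of _ "\<lambda>c. -1 * \<phi> c"]) (simp_all add: convolution_algebra_def)
  qed (simp_all add: convolution_algebra_def finsupp_zero finsupp_add add_ac)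
  have r: "ring convolution_algebra"
  proof (rule ringI[OF ab])
    show "monoid convolution_algebra"
      by (rule monoidI) (simp_all add: convolution_algebra_def finsupp_one prod_closed prod_assoc
        prod_unit_left prod_unit_right)
  qed (simp_all add: convolution_algebra_def prod_add_left prod_add_right)
  have m: "module rat_ring convolution_algebra"
    by (rule moduleI[OF cring_rat_ring ab])
      (simp_all add: convolution_algebra_def rat_ring_def finsupp_smult distrib_left distrib_right mult.assoc)
  show ?thesis
    by (intro assoc_algebra.intro assoc_algebra_axioms.intro m r)
      (simp_all add: convolution_algebra_def prod_smult_left prod_smult_right)
qed

end

context ext_finite_extriangulated
begin
section \<open>The Hall algebra\<close>

lemma some_in_class:
  assumes "X \<in> Ob \<C>"
  shows "isomorphic \<C> X (SOME Y. Y \<in> iso_class \<C> X)"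
proof -
  have "X \<in> iso_class \<C> X" using isomorphic_refl[OF assms] by (simp add: iso_class_def)
  then have "(SOME Y. Y \<in> iso_class \<C> X) \<in> iso_class \<C> X" by (rule someI)
  then show ?thesis by (simp add: iso_class_def)
qed

text \<open>Hall numbers are invariant under isomorphism, so the representatives chosen in
  \<open>hall_coeff\<close> do not matter.\<close>

lemma hall_coeff_eq:
  assumes "X \<in> Ob \<C>" "Y \<in> Ob \<C>" "L \<in> Ob \<C>"
  shows "hall_coeff K \<C> (iso_class \<C> X) (iso_class \<C> Y) (iso_class \<C> L) = hall_number K \<C> X Y L"
  unfolding hall_coeff_def
  by (rule hall_number_iso[symmetric]) (rule some_in_class, rule assms)+

text \<open>The unit of \<open>hall_algebra\<close> is indexed by the set of all zero objects; this
  set has to be one isomorphism class for the unit to be a basis vector.\<close>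

lemma zero_objects_class:
  assumes "zero_object \<C> Z"
  shows "{Z'. zero_object \<C> Z'} = iso_class \<C> Z"
proof (intro equalityI subsetI)
  note z = zero_objectD[OF assms]
  fix Z'
  {
    assume "Z' \<in> {Z'. zero_object \<C> Z'}"
    then have Z': "zero_object \<C> Z'" by simp
    note z' = zero_objectD[OF Z']
    have o: "\<zero>\<^bsub>H Z Z'\<^esub> \<Colon> Z \<rightarrow> Z'" "\<zero>\<^bsub>H Z' Z\<^esub> \<Colon> Z' \<rightarrow> Z" using mor_zero z(1) z'(1) by auto
    have "\<zero>\<^bsub>H Z Z'\<^esub> \<in> isos \<C> Z Z'"
      by (rule isoI[OF o z(2)[OF mor_cmp[OF o] mor_id[OF z(1)]]
        z'(2)[OF mor_cmp[OF o(2,1)] mor_id[OF z'(1)]]])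
    then show "Z' \<in> iso_class \<C> Z" using z(1) z'(1) by (auto simp: iso_class_def isomorphic_def)
  }
  assume "Z' \<in> iso_class \<C> Z"
  then have "isomorphic \<C> Z Z'" by (simp add: iso_class_def)
  then obtain f g where fg: "f \<Colon> Z \<rightarrow> Z'" "g \<Colon> Z' \<rightarrow> Z" "f \<cdot> g = Id \<C> Z'" and Z': "Z' \<in> Ob \<C>"
    using isomorphicE by metis
  have "\<exists>!h. h \<in> Homset \<C> Z' X" "\<exists>!h. h \<in> Homset \<C> X Z'" if X: "X \<in> Ob \<C>" for X
  proof -
    have "h = h'" if h: "h \<Colon> Z' \<rightarrow> X" "h' \<Colon> Z' \<rightarrow> X" for h h'
    proof -
      have "h = (h \<cdot> f) \<cdot> g" using assoc[OF fg(2,1) h(1)] fg(3) cmp_id[OF h(1)] by simp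
      also have "h \<cdot> f = h' \<cdot> f" by (rule z(3)[OF mor_cmp[OF fg(1) h(1)] mor_cmp[OF fg(1) h(2)]])
      also have "(h' \<cdot> f) \<cdot> g = h'" using assoc[OF fg(2,1) h(2)] fg(3) cmp_id[OF h(2)] by simp
      finally show ?thesis .
    qed
    then show "\<exists>!h. h \<in> Homset \<C> Z' X" using mor_zero[OF Z' X] X Z' by (auto simp: mor_def)
    have "h = h'" if h: "h \<Colon> X \<rightarrow> Z'" "h' \<Colon> X \<rightarrow> Z'" for h h'
    proof -
      have "h = f \<cdot> (g \<cdot> h)" using assoc[OF h(1) fg(2,1)] fg(3) id_cmp[OF h(1)] by simp
      also have "g \<cdot> h = g \<cdot> h'" by (rule z(2)[OF mor_cmp[OF h(1) fg(2)] mor_cmp[OF h(2) fg(2)]])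
      also have "f \<cdot> (g \<cdot> h') = h'" using assoc[OF h(2) fg(2,1)] fg(3) id_cmp[OF h(2)] by simp
      finally show ?thesis .
    qed
    then show "\<exists>!h. h \<in> Homset \<C> X Z'" using mor_zero[OF X Z'] X Z' by (auto simp: mor_def)
  qed
  then show "Z' \<in> {Z'. zero_object \<C> Z'}" using Z' by (simp add: zero_object_def)
qed

lemma hall_structure_constants:
  "structure_constants (iso_class \<C> ` Ob \<C>) (hall_coeff K \<C>) {Z. zero_object \<C> Z}"
proof -
  let ?I = "iso_class \<C> ` Ob \<C>" and ?h = "hall_coeff K \<C>"
  obtain Z where Z: "zero_object \<C> Z" using zero_object_exists by blast
  note e = zero_objects_class[OF Z] and z = zero_objectD(1)[OF Z]
  have fin: "finite {c \<in> ?I. ?h (iso_class \<C> X) (iso_class \<C> Y) c \<noteq> 0}" if o: "X \<in> Ob \<C>" "Y \<in> Ob \<C>" for X Y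
  proof (rule finite_subset[OF _ finite_middle_classes[OF o]], rule subsetI)
    fix c assume "c \<in> {c \<in> ?I. ?h (iso_class \<C> X) (iso_class \<C> Y) c \<noteq> 0}"
    then obtain L where L: "L \<in> Ob \<C>" "c = iso_class \<C> L" "?h (iso_class \<C> X) (iso_class \<C> Y) (iso_class \<C> L)
      \<noteq> 0" by blast
    from L(3) have "deflations \<C> X L Y \<noteq> {}" unfolding hall_coeff_eq[OF o L(1)] hall_number_eq by force
    then show "c \<in> {c. \<exists>L. c = iso_class \<C> L \<and> deflations \<C> X L Y \<noteq> {}}" using L(2) by blast
  qed
  define rep where "rep = inv_into (Ob \<C>) (iso_class \<C>)"
  have rep: "rep c \<in> Ob \<C>" "iso_class \<C> (rep c) = c" if "c \<in> ?I" for c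
    using that by (auto simp: rep_def inv_into_into f_inv_into_f)
  \<comment> \<open>One object for each class that occurs in the product of the basis vectors of
    \<open>X\<close> and \<open>Y\<close>: a system of representatives as required by
    \<open>hall_number_assoc\<close>.\<close>
  define R where "R X Y = rep ` {c \<in> ?I. ?h (iso_class \<C> X) (iso_class \<C> Y) c \<noteq> 0}" for X Y
  have R: "finite (R X Y)" "R X Y \<subseteq> Ob \<C>" if "X \<in> Ob \<C>" "Y \<in> Ob \<C>" for X Y
    using fin[OF that] rep(1) by (auto simp: R_def)
  have R_sep: "L = L'" if "L \<in> R X Y" "L' \<in> R X Y" "isomorphic \<C> L L'" for L L' X Y
  proof -
    from that(1,2) obtain c c' where c: "c \<in> ?I" "L = rep c" "c' \<in> ?I" "L' = rep c'" unfolding R_def by blast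
    then have "L \<in> Ob \<C>" using rep(1) by simp
    then have "iso_class \<C> L = iso_class \<C> L'" using that(3) iso_class_eq_iff by simp
    then show ?thesis using c rep(2) by simp
  qed
  have R_cov: "\<exists>L'\<in>R X Y. isomorphic \<C> L L'" if o: "X \<in> Ob \<C>" "Y \<in> Ob \<C>" "L \<in> Ob \<C>"
    and n: "hall_number K \<C> X Y L \<noteq> 0" for X Y L
  proof
    have i: "iso_class \<C> L \<in> ?I" using o(3) by simp
    show "rep (iso_class \<C> L) \<in> R X Y" unfolding R_def using i n hall_coeff_eq[OF o] by simp
    show "isomorphic \<C> L (rep (iso_class \<C> L))" using rep(2)[OF i] iso_class_eq_iff[OF o(3)] by metis
  qed
  have reindex: "(\<Sum>l | l \<in> ?I \<and> ?h (iso_class \<C> X) (iso_class \<C> Y) l \<noteq> 0. w l)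
    = (\<Sum>L\<in>R X Y. w (iso_class \<C> L))" for X Y and w :: "'o set \<Rightarrow> rat"
    unfolding R_def
  proof (subst sum.reindex)
    show "inj_on rep {c \<in> ?I. ?h (iso_class \<C> X) (iso_class \<C> Y) c \<noteq> 0}"
      by (rule inj_on_inverseI[where g = "iso_class \<C>"]) (use rep(2) in blast)
  qed (auto intro!: sum.cong simp: rep(2))
  show ?thesis
  proof (unfold_locales, goal_cases)
    case (1 a b)
    then show ?case using fin by blast
  next
    case (2 a b c m)
    then obtain X Y W M where o: "X \<in> Ob \<C>" "Y \<in> Ob \<C>" "W \<in> Ob \<C>" "M \<in> Ob \<C>"
      and abc: "a = iso_class \<C> X" "b = iso_class \<C> Y" "c = iso_class \<C> W" "m = iso_class \<C> M" by blast
    have "(\<Sum>L\<in>R X Y. ?h a b (iso_class \<C> L) * ?h (iso_class \<C> L) c m)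
      = (\<Sum>L\<in>R X Y. hall_number K \<C> X Y L * hall_number K \<C> L W M)"
    proof (rule sum.cong[OF refl])
      fix L assume "L \<in> R X Y"
      then have "L \<in> Ob \<C>" using R(2)[OF o(1,2)] by blast
      then show "?h a b (iso_class \<C> L) * ?h (iso_class \<C> L) c m
        = hall_number K \<C> X Y L * hall_number K \<C> L W M"
        by (simp add: abc hall_coeff_eq o)
    qed
    also have "\<dots> = (\<Sum>L\<in>R Y W. hall_number K \<C> X L M * hall_number K \<C> Y W L)"
      by (rule hall_number_assoc[OF o R(1)[OF o(1,2)] R(2)[OF o(1,2)] R_sep R_cov[OF o(1,2)] R(1)[OF o(2,3)]
        R(2)[OF o(2,3)] R_sep R_cov[OF o(2,3)]])
    also have "\<dots> = (\<Sum>L\<in>R Y W. ?h a (iso_class \<C> L) m * ?h b c (iso_class \<C> L))"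
    proof (rule sum.cong[OF refl])
      fix L assume "L \<in> R Y W"
      then have "L \<in> Ob \<C>" using R(2)[OF o(2,3)] by blast
      then show "hall_number K \<C> X L M * hall_number K \<C> Y W L
        = ?h a (iso_class \<C> L) m * ?h b c (iso_class \<C> L)"
        by (simp add: abc hall_coeff_eq o)
    qed
    finally show ?case
      unfolding abc reindex .
  next
    case 3
    show ?case unfolding e using z by blast
  next
    case (4 b c)
    then obtain Y L where o: "Y \<in> Ob \<C>" "L \<in> Ob \<C>" "b = iso_class \<C> Y" "c = iso_class \<C> L" by blast
    then have "b = c \<longleftrightarrow> isomorphic \<C> L Y" using iso_class_eq_iff by metis
    then show ?case unfolding e o(3,4) hall_coeff_eq[OF z o(1,2)] hall_number_left_unit[OF Z o(1,2)]
      by (simp add: o(3,4))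
  next
    case (5 a c)
    then obtain X L where o: "X \<in> Ob \<C>" "L \<in> Ob \<C>" "a = iso_class \<C> X" "c = iso_class \<C> L" by blast
    then have "a = c \<longleftrightarrow> isomorphic \<C> X L" using iso_class_eq_iff by metis
    then show ?case unfolding e o(3,4) hall_coeff_eq[OF o(1) z o(2)] hall_number_right_unit[OF Z o(1,2)]
      by (simp add: o(3,4))
  qed
qed

lemma assoc_algebra_hall_algebra: "assoc_algebra rat_ring (hall_algebra K \<C>)"
proof -
  interpret S: structure_constants "iso_class \<C> ` Ob \<C>" "hall_coeff K \<C>" "{Z. zero_object \<C> Z}"
    by (rule hall_structure_constants)
  have "hall_algebra K \<C> = S.convolution_algebra"
    unfolding hall_algebra_def S.convolution_algebra_def S.finsupp_def S.prod_def by (simp add: fun_eq_iff)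
  then show ?thesis using S.assoc_algebra by simp
qed

lemma hall_basis_mult:
  assumes "X \<in> Ob \<C>" "Y \<in> Ob \<C>" "L \<in> Ob \<C>"
  shows "(hall_basis \<C> X \<otimes>\<^bsub>hall_algebra K \<C>\<^esub> hall_basis \<C> Y) (iso_class \<C> L) = hall_number K \<C> X Y L"
proof -
  have "{a. hall_basis \<C> Z a \<noteq> 0} = {iso_class \<C> Z}" for Z by (auto simp: hall_basis_def)
  then show ?thesis using assms by (simp add: hall_algebra_def hall_coeff_eq) (simp add: hall_basis_def)
qed

end

theorem theorem4p2:
  fixes K :: "'k ring" and \<C> :: "('k, 'o, 'm, 'e) extri_cat"
  assumes "field K" and "finite (carrier K)"
    and "extriangulated K \<C>"
    and "krull_schmidt \<C>"
    and "ext_finite K \<C>"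
  shows "(\<forall>X \<in> Ob \<C>. \<forall>Y \<in> Ob \<C>. \<forall>L \<in> Ob \<C>.
            hall_number K \<C> X Y L = hall_number_inflations K \<C> X Y L)
       \<and> (\<forall>X \<in> Ob \<C>. \<forall>Y \<in> Ob \<C>. \<forall>L \<in> Ob \<C>.
            (hall_basis \<C> X \<otimes>\<^bsub>hall_algebra K \<C>\<^esub> hall_basis \<C> Y) (iso_class \<C> L) = hall_number K \<C> X Y L)
       \<and> assoc_algebra rat_ring (hall_algebra K \<C>)"
proof -
  interpret ext_finite_extriangulated K \<C>
    using assms by (intro ext_finite_extriangulated.intro ext_finite_extriangulated_axioms.intro)
  show ?thesis using hall_numbers_agree hall_basis_mult assoc_algebra_hall_algebra by blast
qed

end
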